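(* Let $(\mathcal M,g_0)$ be a compact Riemannian manifold of dimension $n-1$, and let $\Box_0:=\partial_{tt}-\Delta_{g_0}$ be the natural wave operator on $\mathbb{R}\times\mathcal M$. Let $\alpha>0$ be a real number that is not an integer, and write $\alpha=m+\alpha_0$ with $m=\lfloor\alpha\rfloor$ and $\alpha_0\in(0,1)$. Consider the $(n+1)$-dimensional Lorentzian spacetime $\mathbb{R}\times\mathcal M\times\mathbb{R}_+$ with metric $$g^+:=\frac{dt^2-dy^2-g_0}{y^2}.$$ Let $\phi$ solve the Klein--Gordon equation with parameter $\mu=\alpha^2-\frac{n^2}{4}$ for this metric, $$\partial_{tt}\phi-\Delta_{g_0}\phi-\partial_{yy}\phi-\frac{1-n}{y}\,\partial_y\phi+\frac{4\alpha^2-n^2}{4y^2}\,\phi=0,$$ so that $u:=y^{\alpha-\frac n2}\phi$ satisfies $$\partial_{tt}u=\Delta_{g_0}u+\frac{1-2\alpha}{y}\,\partial_yu+\partial_{yy}u,$$ with trivial initial data at time $-\infty$ and boundary condition $u|_{y=0}=f$, where $f\in C^\infty_0(\mathbb{R}\times\mathcal M)$. Let $u_j(t,y)$ and $f_j(t)$ denote the coefficients of $u$ and $f$ in an orthonormal basis $\{Y_j\}_{j\in\mathbb{N}}$ of $L^2(\mathcal M)$ consisting of eigenfunctions, $-\Delta_{g_0}Y_j=\lambda_j^2Y_j$ with $\lambda_j\ge0$. Define the generalized Dirichlet-to-Neumann map $\Lambda_\alpha$ through its coefficients $$(\Lambda_\alpha f)_j:=c_\alpha\lim_{y\to0^+}y^{2(1-\alpha_0)}\Big(\frac1y\,\partial_y\Big)^{m+1}u_j,\qquad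 c_\alpha:=(-1)^{m+1}2^{\alpha+\alpha_0-1}\frac{\Gamma(\alpha)}{\Gamma(1-\alpha_0)}.$$ Then $\widehat{(\Lambda_\alpha f)_j}(\tau)=\sigma_\alpha(\tau,\lambda_j)\,\widehat{f_j}(\tau)$ for all $j$, that is, $$\Lambda_\alpha f=\Box_0^\alpha f.$$
   Context: **The fractional wave operator on $\mathbb{R}\times\mathcal M$.** With the Fourier transform in time $\widehat h(\tau)=\int_{\mathbb{R}}e^{-i\tau t}h(t)\,dt$, the operator $\Box_0^\alpha$ is defined by $\widehat{(\Box_0^\alpha f)_j}(\tau):=\sigma_\alpha(\tau,\lambda_j)\widehat{f_j}(\tau)$, where $$\sigma_\alpha(\tau,\lambda):=\lim_{\epsilon\to0^+}\big(\lambda^2-(\tau-i\epsilon)^2\big)^\alpha\quad\text{(principal branch)}.$$ Equivalently, $\sigma_\alpha=(\lambda^2-\tau^2)^\alpha$ if $|\tau|<\lambda$, and $\sigma_\alpha=e^{i\pi\alpha\,\mathrm{sgn}(\tau)}(\tau^2-\lambda^2)^\alpha$ if $|\tau|>\lambda$. **Meaning of "the solution".** Trivial initial data at $-\infty$ means $u(t_0,\cdot)=u_t(t_0,\cdot)=0$ for any $t_0$ such that $f(t,\cdot)=0$ for all $t<t_0$. Let $k$ be the lowest integer with $k>\frac{1+\alpha}{2}$, and let $\chi$ be a fixed smooth cutoff equal to $1$ for $y<1$ and $0$ for $y>2$. The solution is the unique one of the form $$u=\sum_{j=0}^{k-1}c_j\,y^{2j}\chi(y)\,\Box_0^jf+v$$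 with real constants $c_j$ and with $v\in L^\infty(\mathbb{R},\dot H^1_{\alpha,0})\cap H^1_{\rm loc}(\mathbb{R},L^2_\alpha)$. Here $L^2_\alpha=L^2(\mathcal M\times\mathbb{R}_+,y^{1-2\alpha}dV_{g_0}dy)$, and $\dot H^1_{\alpha,0}$ is the closure of $C^\infty_0(\mathcal M\times\mathbb{R}_+)$ in the norm given by $\|w\|^2=\int_{\mathcal M\times\mathbb{R}_+}(|\nabla_{g_0}w|^2+(\partial_yw)^2)\,y^{1-2\alpha}\,dV_{g_0}\,dy$. *)

theory Defs
  imports "HOL-Analysis.Analysis"
begin

section \<open>Smooth functions\<close>

primrec Ck_on :: "nat \<Rightarrow> ('a::real_normed_vector \<Rightarrow> 'b::real_normed_vector) \<Rightarrow> 'a set \<Rightarrow> bool" where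
  "Ck_on 0 f S \<longleftrightarrow> continuous_on S f"
| "Ck_on (Suc k) f S \<longleftrightarrow>
     (\<forall>x\<in>S. f differentiable (at x)) \<and> (\<forall>v. Ck_on k (\<lambda>x. frechet_derivative f (at x) v) S)"

text \<open>Only used for open \<open>S\<close> in finite-dimensional spaces.\<close>

definition smooth_on :: "('a::real_normed_vector \<Rightarrow> 'b::real_normed_vector) \<Rightarrow> 'a set \<Rightarrow> bool" where
  "smooth_on f S \<longleftrightarrow> (\<forall>k. Ck_on k f S)"

abbreviation ddt :: "(real \<Rightarrow> 'b::real_normed_vector) \<Rightarrow> real \<Rightarrow> 'b" where
  "ddt h \<equiv> \<lambda>s. vector_derivative h (at s)"

definition pd :: "'d \<Rightarrow> (real^'d::finite \<Rightarrow> 'b::real_normed_vector) \<Rightarrow> real^'d \<Rightarrow> 'b" where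
  "pd a H p = frechet_derivative H (at p) (axis a 1)"

section \<open>Compact Riemannian manifolds\<close>

text \<open>
  The manifold is the whole type \<open>'m\<close>; \<open>param\<close> matters only on \<open>coord ` cdom\<close>, where it inverts
  \<open>coord\<close>. A Riemannian metric is given by its matrix of components \<open>g k p\<close> in each chart \<open>k\<close> of
  the atlas, as a function of the coordinates \<open>p\<close>.
\<close>

record ('m, 'd) chart =
  cdom :: "'m set"
  coord :: "'m \<Rightarrow> real^'d"
  param :: "real^'d \<Rightarrow> 'm"

type_synonym ('m, 'd) metric = "('m, 'd) chart \<Rightarrow> real^'d \<Rightarrow> real^'d^'d"

definition smooth_atlas :: "('m::{t2_space, second_countable_topology}, 'd::finite) chart set \<Rightarrow> bool" where
  "smooth_atlas A \<longleftrightarrow>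
     (\<forall>k\<in>A. open (cdom k) \<and> open (coord k ` cdom k) \<and>
            homeomorphism (cdom k) (coord k ` cdom k) (coord k) (param k)) \<and>
     (\<Union>k\<in>A. cdom k) = UNIV \<and>
     (\<forall>k\<in>A. \<forall>l\<in>A. smooth_on (coord l \<circ> param k) (coord k ` (cdom k \<inter> cdom l)))"

definition riemannian_metric ::
    "('m::{t2_space, second_countable_topology}, 'd::finite) chart set \<Rightarrow> ('m, 'd) metric \<Rightarrow> bool" where
  "riemannian_metric A g \<longleftrightarrow>
     (\<forall>k\<in>A. (\<forall>a b. smooth_on (\<lambda>p. g k p $ a $ b) (coord k ` cdom k)) \<and>
            (\<forall>p\<in>coord k ` cdom k. transpose (g k p) = g k p \<and>
                                  (\<forall>\<xi>. \<xi> \<noteq> 0 \<longrightarrow> 0 < \<xi> \<bullet> (g k p *v \<xi>)))) \<and>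
     (\<forall>k\<in>A. \<forall>l\<in>A. \<forall>x\<in>cdom k \<inter> cdom l.
        (let J = matrix (frechet_derivative (coord l \<circ> param k) (at (coord k x)))
         in g k (coord k x) = transpose J ** g l (coord l x) ** J))"

definition compact_riemannian_manifold ::
    "('m::{t2_space, second_countable_topology}, 'd::finite) chart set \<Rightarrow> ('m, 'd) metric \<Rightarrow> bool" where
  "compact_riemannian_manifold A g \<longleftrightarrow>
     compact (UNIV :: 'm set) \<and> smooth_atlas A \<and> riemannian_metric A g"

text \<open>The Riemannian volume is the unique Borel measure with the usual density in each chart.\<close>

definition riemannian_volume ::
    "('m::{t2_space, second_countable_topology}, 'd::finite) chart set \<Rightarrow> ('m, 'd) metric \<Rightarrow> 'm measure \<Rightarrow> bool" where
  "riemannian_volume A g V \<longleftrightarrow>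
     sets V = sets borel \<and>
     (\<forall>k\<in>A. \<forall>B\<in>sets borel. B \<subseteq> cdom k \<longrightarrow>
        emeasure V B = (\<integral>\<^sup>+p. ennreal (sqrt (det (g k p))) * indicator (coord k ` B) p \<partial>lborel))"

text \<open>
  The local expressions of the Laplace--Beltrami operator and of \<open>\<bar>\<nabla>h\<bar>\<^sup>2\<close> agree in all charts
  around a point, so the choice of the chart is immaterial.
\<close>

definition chart_at :: "('m, 'd::finite) chart set \<Rightarrow> 'm \<Rightarrow> ('m, 'd) chart" where
  "chart_at A x = (SOME k. k \<in> A \<and> x \<in> cdom k)"

definition laplace_coord :: "(real^'d \<Rightarrow> real^'d^'d) \<Rightarrow> (real^'d::finite \<Rightarrow> complex) \<Rightarrow> real^'d \<Rightarrow> complex" where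
  "laplace_coord G H p =
     (1 / sqrt (det (G p))) *\<^sub>R
       (\<Sum>a\<in>UNIV. pd a (\<lambda>q. \<Sum>b\<in>UNIV. (sqrt (det (G q)) * matrix_inv (G q) $ a $ b) *\<^sub>R pd b H q) p)"

definition laplace ::
    "('m, 'd::finite) chart set \<Rightarrow> ('m, 'd) metric \<Rightarrow> ('m \<Rightarrow> complex) \<Rightarrow> 'm \<Rightarrow> complex" where
  "laplace A g h x =
     (let k = chart_at A x in laplace_coord (g k) (h \<circ> param k) (coord k x))"

definition grad_sq ::
    "('m, 'd::finite) chart set \<Rightarrow> ('m, 'd) metric \<Rightarrow> ('m \<Rightarrow> complex) \<Rightarrow> 'm \<Rightarrow> real" where
  "grad_sq A g h x =
     (let k = chart_at A x; p = coord k x; H = h \<circ> param k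
      in Re (\<Sum>a\<in>UNIV. \<Sum>b\<in>UNIV. (matrix_inv (g k p) $ a $ b) *\<^sub>R (pd a H p * cnj (pd b H p))))"

text \<open>
  Functions on \<open>S \<times> M\<close> with \<open>S\<close> an open set of a normed space: smoothness, and membership in
  \<open>C\<^sub>0\<^sup>\<infinity>(S \<times> M)\<close> (extended by \<open>0\<close> outside \<open>S\<close>). Throughout, the point of \<open>M\<close> is the last argument.
\<close>

definition smooth_mfd ::
    "('m, 'd::finite) chart set \<Rightarrow> 'p::real_normed_vector set \<Rightarrow> ('p \<Rightarrow> 'm \<Rightarrow> complex) \<Rightarrow> bool" where
  "smooth_mfd A S F \<longleftrightarrow>
     (\<forall>k\<in>A. smooth_on (\<lambda>(p, q). F p (param k q)) (S \<times> coord k ` cdom k))"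

definition test_mfd ::
    "('m::topological_space, 'd::finite) chart set \<Rightarrow> 'p::real_normed_vector set \<Rightarrow> ('p \<Rightarrow> 'm \<Rightarrow> complex) \<Rightarrow> bool" where
  "test_mfd A S F \<longleftrightarrow>
     smooth_mfd A S F \<and>
     (\<exists>K. compact K \<and> K \<subseteq> S \<times> UNIV \<and> (\<forall>p x. (p, x) \<notin> K \<longrightarrow> F p x = 0))"

section \<open>Eigenfunction expansions\<close>

definition mode_coeff :: "'m measure \<Rightarrow> (nat \<Rightarrow> 'm \<Rightarrow> complex) \<Rightarrow> nat \<Rightarrow> ('m \<Rightarrow> complex) \<Rightarrow> complex" where
  "mode_coeff V Y j h = (\<integral>x. h x * cnj (Y j x) \<partial>V)"

definition orthonormal_basis_L2 :: "'m measure \<Rightarrow> (nat \<Rightarrow> 'm \<Rightarrow> complex) \<Rightarrow> bool" where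
  "orthonormal_basis_L2 V Y \<longleftrightarrow>
     (\<forall>j. Y j \<in> borel_measurable V \<and> (\<integral>\<^sup>+x. ennreal ((cmod (Y j x))\<^sup>2) \<partial>V) < \<infinity>) \<and>
     (\<forall>i j. mode_coeff V Y j (Y i) = (if i = j then 1 else 0)) \<and>
     (\<forall>h. h \<in> borel_measurable V \<and> (\<integral>\<^sup>+x. ennreal ((cmod (h x))\<^sup>2) \<partial>V) < \<infinity> \<longrightarrow>
        (\<lambda>N. \<integral>\<^sup>+x. ennreal ((cmod (h x - (\<Sum>j<N. mode_coeff V Y j h * Y j x)))\<^sup>2) \<partial>V) \<longlonglongrightarrow> 0)"

definition laplace_eigenbasis ::
    "('m, 'd::finite) chart set \<Rightarrow> ('m, 'd) metric \<Rightarrow> 'm measure \<Rightarrow> (nat \<Rightarrow> 'm \<Rightarrow> complex) \<Rightarrow> (nat \<Rightarrow> real) \<Rightarrow> bool" where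
  "laplace_eigenbasis A g V Y lam \<longleftrightarrow>
     orthonormal_basis_L2 V Y \<and>
     (\<forall>j. (\<forall>k\<in>A. smooth_on (Y j \<circ> param k) (coord k ` cdom k)) \<and> 0 \<le> lam j \<and>
          (\<forall>x. - laplace A g (Y j) x = of_real ((lam j)\<^sup>2) * Y j x))"

section \<open>Wave operators\<close>

definition wave_op ::
    "('m, 'd::finite) chart set \<Rightarrow> ('m, 'd) metric \<Rightarrow> (real \<Rightarrow> 'm \<Rightarrow> complex) \<Rightarrow> real \<Rightarrow> 'm \<Rightarrow> complex" where
  "wave_op A g f t x = ddt (ddt (\<lambda>s. f s x)) t - laplace A g (f t) x"

definition fourier :: "(real \<Rightarrow> complex) \<Rightarrow> real \<Rightarrow> complex" where
  "fourier h \<tau> = (\<integral>t. exp (- \<i> * of_real (\<tau> * t)) * h t \<partial>lborel)"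

definition wave_symbol :: "real \<Rightarrow> real \<Rightarrow> real \<Rightarrow> complex" where
  "wave_symbol \<alpha> \<tau> lm =
     Lim (at_right 0)
       (\<lambda>\<epsilon>::real. ((of_real lm)\<^sup>2 - (of_real \<tau> - \<i> * of_real \<epsilon>)\<^sup>2) powr (of_real \<alpha> :: complex))"

text \<open>
  \<open>F j\<close> and \<open>G j\<close> are the coefficients of functions on \<open>\<real> \<times> M\<close>; the predicate says that the
  second function is the \<open>\<alpha>\<close>-th power of the wave operator applied to the first.
\<close>

definition is_wave_power ::
    "real \<Rightarrow> (nat \<Rightarrow> real) \<Rightarrow> (nat \<Rightarrow> real \<Rightarrow> complex) \<Rightarrow> (nat \<Rightarrow> real \<Rightarrow> complex) \<Rightarrow> bool" where
  "is_wave_power \<alpha> lam F G \<longleftrightarrow>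
     (\<forall>j. integrable lborel (F j) \<and> integrable lborel (G j) \<and>
          (\<forall>\<tau>. fourier (G j) \<tau> = wave_symbol \<alpha> \<tau> (lam j) * fourier (F j) \<tau>))"

section \<open>Klein--Gordon equation\<close>

text \<open>Functions on \<open>\<real> \<times> \<real>\<^sub>+ \<times> M\<close> have arguments in the order \<open>t, y, x\<close>; values at \<open>y \<le> 0\<close> are irrelevant.\<close>

definition KG_op ::
    "('m, 'd::finite) chart set \<Rightarrow> ('m, 'd) metric \<Rightarrow> nat \<Rightarrow> real \<Rightarrow>
     (real \<Rightarrow> real \<Rightarrow> 'm \<Rightarrow> complex) \<Rightarrow> real \<Rightarrow> real \<Rightarrow> 'm \<Rightarrow> complex" where
  "KG_op A g n \<alpha> \<phi> t y x =
     ddt (ddt (\<lambda>s. \<phi> s y x)) t - laplace A g (\<phi> t y) x - ddt (ddt (\<lambda>z. \<phi> t z x)) y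
     - ((1 - real n) / y) *\<^sub>R ddt (\<lambda>z. \<phi> t z x) y
     + ((4 * \<alpha>\<^sup>2 - (real n)\<^sup>2) / (4 * y\<^sup>2)) *\<^sub>R \<phi> t y x"

text \<open>
  Solutions in the sense of distributions: \<open>KG_op\<close> is formally symmetric with respect to the
  measure \<open>y\<^bsup>1-n\<^esup> dt dy dV\<close>, so it appears on the test function unchanged.
\<close>

definition KG_solution ::
    "('m::topological_space, 'd::finite) chart set \<Rightarrow> ('m, 'd) metric \<Rightarrow> 'm measure \<Rightarrow> nat \<Rightarrow> real \<Rightarrow>
     (real \<Rightarrow> real \<Rightarrow> 'm \<Rightarrow> complex) \<Rightarrow> bool" where
  "KG_solution A g V n \<alpha> \<phi> \<longleftrightarrow>
     (\<forall>T a b. 0 < a \<longrightarrow>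
        set_integrable (lborel \<Otimes>\<^sub>M (lborel \<Otimes>\<^sub>M V)) ({-T..T} \<times> {a..b} \<times> UNIV) (\<lambda>(t, y, x). \<phi> t y x)) \<and>
     (\<forall>\<psi>. test_mfd A (UNIV \<times> {0<..}) (\<lambda>(t, y). \<psi> t y) \<longrightarrow>
        (LINT (t, y, x) : UNIV \<times> {0<..} \<times> UNIV | lborel \<Otimes>\<^sub>M (lborel \<Otimes>\<^sub>M V).
           (y powr (1 - real n)) *\<^sub>R (\<phi> t y x * KG_op A g n \<alpha> \<psi> t y x)) = 0)"

subsection \<open>The solution class\<close>

text \<open>The measure \<open>y\<^bsup>1-2\<alpha>\<^esup> dV dy\<close> on \<open>\<real>\<^sub>+ \<times> M\<close>, whose square integrable functions form \<open>L\<^sup>2\<^sub>\<alpha>\<close>.\<close>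

definition cyl_measure :: "real \<Rightarrow> 'm measure \<Rightarrow> (real \<times> 'm) measure" where
  "cyl_measure \<alpha> V =
     density (lborel \<Otimes>\<^sub>M V) (\<lambda>(y, x). ennreal (y powr (1 - 2 * \<alpha>)) * indicator {0<..} y)"

definition energy ::
    "('m, 'd::finite) chart set \<Rightarrow> ('m, 'd) metric \<Rightarrow> 'm measure \<Rightarrow> real \<Rightarrow> (real \<Rightarrow> 'm \<Rightarrow> complex) \<Rightarrow> ennreal" where
  "energy A g V \<alpha> w =
     (\<integral>\<^sup>+(y, x). ennreal (grad_sq A g (w y) x + (cmod (ddt (\<lambda>z. w z x) y))\<^sup>2) \<partial>cyl_measure \<alpha> V)"

text \<open>
  By Hardy's inequality a sequence in \<open>C\<^sub>0\<^sup>\<infinity>\<close> that is Cauchy in the energy norm converges in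
  \<open>L\<^sup>2\<^sub>l\<^sub>o\<^sub>c\<close>, which realises the completion as a space of functions; its members are the \<open>w\<close>
  possessing an approximating sequence.
\<close>

definition Hdot_approx ::
    "('m::topological_space, 'd::finite) chart set \<Rightarrow> ('m, 'd) metric \<Rightarrow> 'm measure \<Rightarrow> real \<Rightarrow>
     (nat \<Rightarrow> real \<Rightarrow> 'm \<Rightarrow> complex) \<Rightarrow> (real \<Rightarrow> 'm \<Rightarrow> complex) \<Rightarrow> bool" where
  "Hdot_approx A g V \<alpha> ws w \<longleftrightarrow>
     (\<forall>i. test_mfd A {0<..} (ws i)) \<and>
     (\<forall>i. energy A g V \<alpha> (ws i) < \<infinity>) \<and>
     (\<forall>e>0. \<exists>N. \<forall>i\<ge>N. \<forall>l\<ge>N. energy A g V \<alpha> (\<lambda>y x. ws i y x - ws l y x) < e) \<and>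
     (\<forall>a b. 0 < a \<longrightarrow>
        (\<lambda>i. \<integral>\<^sup>+(y, x). ennreal ((cmod (ws i y x - w y x))\<^sup>2) * indicator {a..b} y \<partial>(lborel \<Otimes>\<^sub>M V))
          \<longlonglongrightarrow> 0)"

definition Linf_Hdot ::
    "('m::topological_space, 'd::finite) chart set \<Rightarrow> ('m, 'd) metric \<Rightarrow> 'm measure \<Rightarrow> real \<Rightarrow>
     (real \<Rightarrow> real \<Rightarrow> 'm \<Rightarrow> complex) \<Rightarrow> bool" where
  "Linf_Hdot A g V \<alpha> v \<longleftrightarrow>
     set_borel_measurable (lborel \<Otimes>\<^sub>M (lborel \<Otimes>\<^sub>M V)) (UNIV \<times> {0<..} \<times> UNIV) (\<lambda>(t, y, x). v t y x) \<and>
     (\<exists>C::real. AE t in lborel. \<exists>ws. Hdot_approx A g V \<alpha> ws (v t) \<and>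
                                     (\<forall>i. energy A g V \<alpha> (ws i) \<le> ennreal C))"

definition L2loc :: "'m measure \<Rightarrow> real \<Rightarrow> (real \<Rightarrow> real \<Rightarrow> 'm \<Rightarrow> complex) \<Rightarrow> bool" where
  "L2loc V \<alpha> v \<longleftrightarrow>
     set_borel_measurable (lborel \<Otimes>\<^sub>M (lborel \<Otimes>\<^sub>M V)) (UNIV \<times> {0<..} \<times> UNIV) (\<lambda>(t, y, x). v t y x) \<and>
     (\<forall>T. (\<integral>\<^sup>+(t, y, x). ennreal ((cmod (v t y x))\<^sup>2) * indicator {-T..T} t
             \<partial>(lborel \<Otimes>\<^sub>M cyl_measure \<alpha> V)) < \<infinity>)"

definition weak_dt :: "'m measure \<Rightarrow> (real \<Rightarrow> real \<Rightarrow> 'm \<Rightarrow> complex) \<Rightarrow> (real \<Rightarrow> real \<Rightarrow> 'm \<Rightarrow> complex) \<Rightarrow> bool" where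
  "weak_dt V v v' \<longleftrightarrow>
     (\<forall>T. AE (y, x) in lborel \<Otimes>\<^sub>M V. 0 < y \<longrightarrow>
        set_integrable lborel {-T..T} (\<lambda>t. v t y x) \<and> set_integrable lborel {-T..T} (\<lambda>t. v' t y x)) \<and>
     (\<forall>\<eta>::real \<Rightarrow> real. smooth_on \<eta> UNIV \<and> (\<exists>T. \<forall>t. t \<notin> {-T..T} \<longrightarrow> \<eta> t = 0) \<longrightarrow>
        (AE (y, x) in lborel \<Otimes>\<^sub>M V. 0 < y \<longrightarrow>
           (\<integral>t. deriv \<eta> t *\<^sub>R v t y x \<partial>lborel) = - (\<integral>t. \<eta> t *\<^sub>R v' t y x \<partial>lborel)))"

definition H1loc_L2 :: "'m measure \<Rightarrow> real \<Rightarrow> (real \<Rightarrow> real \<Rightarrow> 'm \<Rightarrow> complex) \<Rightarrow> bool" where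
  "H1loc_L2 V \<alpha> v \<longleftrightarrow> L2loc V \<alpha> v \<and> (\<exists>v'. L2loc V \<alpha> v' \<and> weak_dt V v v')"

text \<open>The cutoff \<open>chi\<close> is a parameter of the solution class.\<close>

definition smooth_cutoff :: "(real \<Rightarrow> real) \<Rightarrow> bool" where
  "smooth_cutoff chi \<longleftrightarrow> smooth_on chi UNIV \<and> (\<forall>y<1. chi y = 1) \<and> (\<forall>y>2. chi y = 0)"

definition solution_form ::
    "('m::topological_space, 'd::finite) chart set \<Rightarrow> ('m, 'd) metric \<Rightarrow> 'm measure \<Rightarrow> real \<Rightarrow> (real \<Rightarrow> real) \<Rightarrow>
     (real \<Rightarrow> 'm \<Rightarrow> complex) \<Rightarrow> (real \<Rightarrow> real \<Rightarrow> 'm \<Rightarrow> complex) \<Rightarrow> bool" where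
  "solution_form A g V \<alpha> chi f u \<longleftrightarrow>
     (\<exists>(c :: nat \<Rightarrow> real) v.
        Linf_Hdot A g V \<alpha> v \<and> H1loc_L2 V \<alpha> v \<and>
        (\<forall>t x. \<forall>y>0. u t y x =
           (\<Sum>j < (LEAST k::nat. (1 + \<alpha>) / 2 < real k).
               (c j * y ^ (2 * j) * chi y) *\<^sub>R (wave_op A g ^^ j) f t x) + v t y x))"

text \<open>
  Members of the class are only determined almost everywhere, so the data at a time \<open>t\<^sub>0\<close> are
  imposed for almost every \<open>t\<^sub>0\<close> as in the classical condition, and the boundary values are
  taken as an averaged \<open>L\<^sup>2\<close> trace.
\<close>

definition trivial_initial_data ::
    "'m measure \<Rightarrow> (real \<Rightarrow> 'm \<Rightarrow> complex) \<Rightarrow> (real \<Rightarrow> real \<Rightarrow> 'm \<Rightarrow> complex) \<Rightarrow> bool" where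
  "trivial_initial_data V f u \<longleftrightarrow>
     (\<exists>u'. weak_dt V u u' \<and>
        (AE t\<^sub>0 in lborel. (\<forall>t<t\<^sub>0. \<forall>x. f t x = 0) \<longrightarrow>
           (AE (y, x) in lborel \<Otimes>\<^sub>M V. 0 < y \<longrightarrow> u t\<^sub>0 y x = 0 \<and> u' t\<^sub>0 y x = 0)))"

definition boundary_value ::
    "'m measure \<Rightarrow> (real \<Rightarrow> 'm \<Rightarrow> complex) \<Rightarrow> (real \<Rightarrow> real \<Rightarrow> 'm \<Rightarrow> complex) \<Rightarrow> bool" where
  "boundary_value V f u \<longleftrightarrow>
     (AE t in lborel.
        ((\<lambda>\<delta>. ennreal (1 / \<delta>) *
            (\<integral>\<^sup>+(y, x). ennreal ((cmod (u t y x - f t x))\<^sup>2) * indicator {0<..<\<delta>} y \<partial>(lborel \<Otimes>\<^sub>M V)))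
          \<longlongrightarrow> 0) (at_right 0))"

section \<open>The generalized Dirichlet-to-Neumann map\<close>

text \<open>
  The coefficients of \<open>u\<close> are a priori given for almost every \<open>(t, y)\<close>; they are identified with
  their continuous version, which is unique for \<open>y > 0\<close>.
\<close>

definition continuous_version :: "(real \<Rightarrow> real \<Rightarrow> complex) \<Rightarrow> (real \<Rightarrow> real \<Rightarrow> complex) \<Rightarrow> bool" where
  "continuous_version H h \<longleftrightarrow>
     continuous_on (UNIV \<times> {0<..}) (\<lambda>(t, y). H t y) \<and>
     (AE (t, y) in lborel \<Otimes>\<^sub>M lborel. 0 < y \<longrightarrow> H t y = h t y)"

definition DN_quotient :: "real \<Rightarrow> (real \<Rightarrow> complex) \<Rightarrow> real \<Rightarrow> complex" where
  "DN_quotient \<alpha> h y =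
     (y powr (2 * (1 - frac \<alpha>))) *\<^sub>R
       (((\<lambda>w z. (1 / z) *\<^sub>R ddt w z) ^^ (nat \<lfloor>\<alpha>\<rfloor> + 1)) h) y"

definition DN_const :: "real \<Rightarrow> real" where
  "DN_const \<alpha> =
     (-1) ^ (nat \<lfloor>\<alpha>\<rfloor> + 1) * 2 powr (\<alpha> + frac \<alpha> - 1) * Gamma \<alpha> / Gamma (1 - frac \<alpha>)"

definition DN_map :: "real \<Rightarrow> (nat \<Rightarrow> real \<Rightarrow> real \<Rightarrow> complex) \<Rightarrow> nat \<Rightarrow> real \<Rightarrow> complex" where
  "DN_map \<alpha> U j t = DN_const \<alpha> *\<^sub>R Lim (at_right 0) (DN_quotient \<alpha> (U j t))"

end

theory Submission
  imports Defs "HOL-Probability.Probability"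
begin

text \<open>
  Projecting on an eigenfunction turns the equation for \<open>u\<close> into a wave equation in \<open>(t, y)\<close> for one
  mode, in a weak sense. Its Laplace transform in \<open>t\<close> at \<open>w = e + i \<xi>\<close> solves the Bessel equation with
  parameter \<open>z\<close>, where \<open>z\<^sup>2 = \<lambda>\<^sup>2 + w\<^sup>2\<close> and \<open>Re z > 0\<close>. The solution class forces this transform to grow
  at most like \<open>y\<^sup>\<alpha>\<close> and to attain the boundary value, so that it is a multiple of \<open>y\<^sup>\<alpha> K\<^sub>\<alpha>(z y)\<close>. This makes the
  mode smooth in \<open>y > 0\<close>; since \<open>(1/y) d/dy\<close> lowers the order of the kernel, the limit defining \<open>\<Lambda>\<^sub>\<alpha>\<close>
  multiplies the transform by \<open>z\<^sup>2\<^sup>\<alpha> = (\<lambda>\<^sup>2 + w\<^sup>2)\<^sup>\<alpha>\<close>, and letting \<open>e\<close> tend to \<open>0\<close> gives the symbol of the wave operator.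

  The bound by \<open>y\<^sup>\<alpha>\<close> comes from the energy of \<open>v\<close>: a function with finite energy vanishing at \<open>y = 0\<close>
  is at most a multiple of \<open>y\<^sup>\<alpha>\<close>, by the Cauchy-Schwarz inequality with weight \<open>y\<^sup>1\<^sup>-\<^sup>2\<^sup>\<alpha>\<close>.
\<close>

text \<open>Three obstacles shape the argument. A mode satisfies its equation only weakly and is
  known only almost everywhere, so no ODE theory applies to its transform \<open>W\<close>. It is
  divided by the kernel \<open>A\<close>, which first has to be shown free of zeros for complex
  \<open>z\<close>; testing with \<open>A\<close> times a multiplier that stays constant near
  infinity then shows directly that \<open>W / A\<close> is constant, because the growth bound on
  \<open>W\<close> and the decay of \<open>A\<close> remove the contribution from infinity.

  The symbol has branch points at \<open>w = i lam\<close> and \<open>w = - i lam\<close>, on the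
  boundary of the half-plane. No fixed line \<open>Re w = e\<close> shows that the limit is
  integrable in time, so all lines with \<open>0 < e \<le> 1\<close> are used. That they represent
  the same function follows from uniqueness: each of them represents the mode.

  The solution class speaks of iterated wave operators on \<open>f\<close> without any bound on
  them. Integrability of their coefficients is recovered from the dependence of \<open>u - v\<close>
  on \<open>y\<close>.

  The two Gamma values in \<open>DN_const\<close> are the boundary values of kernels of order
  \<open>\<alpha>\<close> and of order \<open>1 - frac \<alpha>\<close>.\<close>

abbreviation eix :: "real \<Rightarrow> complex" where "eix x \<equiv> exp (\<i> * of_real x)"

abbreviation lborel2 :: "(real \<times> real) measure" where "lborel2 \<equiv> lborel \<Otimes>\<^sub>M lborel"

section \<open>Calculus of smooth functions\<close>

lemma Ck_on_cong:
 assumes "open S" "\<And>x. x \<in> S ==> f x = g x" "Ck_on k f S"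
 shows "Ck_on k g S"
 using assms(2,3)
proof (induction k arbitrary: f g)
 case 0
 then show ?case by (auto cong: continuous_on_cong)
next
 case (Suc k)
 have fd: "(f has_derivative frechet_derivative f (at x)) (at x)" if "x \<in> S" for x
  using Suc.prems(2) that by (simp add: frechet_derivative_works)
 have gd: "(g has_derivative frechet_derivative f (at x)) (at x)" if "x \<in> S" for x
  using has_derivative_transform_within_open[OF fd[OF that] assms(1) that] Suc.prems(1) by auto
 have eq: "frechet_derivative f (at x) = frechet_derivative g (at x)" if "x \<in> S" for x
  using frechet_derivative_at[OF gd[OF that]] .
 have "Ck_on k (\<lambda>x. frechet_derivative g (at x) v) S" for v
 proof (rule Suc.IH)
  show "Ck_on k (\<lambda>x. frechet_derivative f (at x) v) S" using Suc.prems(2) by simp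
 qed (simp add: eq)
 then show ?case using gd by (auto simp: differentiable_def)
qed

lemma Ck_on_SucI:
 assumes "open S" "\<And>x. x \<in> S ==> (f has_derivative f' x) (at x)" "\<And>v. Ck_on k (\<lambda>x. f' x v) S"
 shows "Ck_on (Suc k) f S"
proof -
 have eq: "f' x = frechet_derivative f (at x)" if "x \<in> S" for x
  using frechet_derivative_at[OF assms(2)[OF that]] .
 show ?thesis
  using assms(2) Ck_on_cong[OF assms(1) _ assms(3)] eq by (auto simp: differentiable_def)
qed

lemma Ck_on_SucD:
 assumes "Ck_on (Suc k) f S" "x \<in> S"
 shows "(f has_derivative frechet_derivative f (at x)) (at x)"
 using assms by (simp add: frechet_derivative_works)

lemma Ck_on_continuous: "Ck_on k f S ==> continuous_on S f"
 by (cases k) (auto intro!: continuous_at_imp_continuous_on simp: differentiable_imp_continuous_within)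

lemma Ck_on_Suc_imp: "Ck_on (Suc k) f S ==> Ck_on k f S"
proof (induction k arbitrary: f)
 case 0
 then show ?case using Ck_on_continuous[of "Suc 0" f S] by simp
next
 case (Suc k)
 have "Ck_on (Suc k) (\<lambda>x. frechet_derivative f (at x) v) S" for v
  using Suc.prems by (subst (asm) Ck_on.simps(2)) blast
 then have "Ck_on k (\<lambda>x. frechet_derivative f (at x) v) S" for v using Suc.IH by blast
 moreover have "\<forall>x\<in>S. f differentiable (at x)" using Suc.prems by simp
 ultimately show ?case by simp
qed

lemma Ck_on_subset: "Ck_on k f S ==> T \<subseteq> S ==> Ck_on k f T"
 proof (induction k arbitrary: f)
 case 0
 then show ?case using continuous_on_subset by auto
next
 case (Suc k)
 then show ?case by auto
qed

lemma Ck_on_const [simp, intro]: "Ck_on k (\<lambda>x. c) S"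
 by (induction k arbitrary: c) auto

lemma Ck_on_bounded_linear:
 assumes "open S" "bounded_linear L"
 shows "Ck_on k L S"
proof (cases k)
 case 0
 then show ?thesis using assms(2) by (simp add: bounded_linear.linear linear_continuous_on)
next
 case (Suc m)
 then show ?thesis
  using Ck_on_SucI[OF assms(1), of L "\<lambda>x. L" m] assms(2) bounded_linear_imp_has_derivative by auto
qed

lemma Ck_on_add:
 assumes "open S" "Ck_on k f S" "Ck_on k g S"
 shows "Ck_on k (\<lambda>x. f x + g x) S"
 using assms(2,3)
proof (induction k arbitrary: f g)
 case 0
 then show ?case by (auto intro: continuous_on_add)
next
 case (Suc k)
 show ?case
  by (rule Ck_on_SucI[OF assms(1) has_derivative_add[OF Ck_on_SucD Ck_on_SucD]])
    (use Suc in auto)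
qed

lemma Ck_on_linear_outer:
 assumes "open S" "bounded_linear B" "Ck_on k f S"
 shows "Ck_on k (\<lambda>x. B (f x)) S"
 using assms(3)
proof (induction k arbitrary: f)
 case 0
 then show ?case using bounded_linear.continuous_on[OF assms(2)] by auto
next
 case (Suc k)
 show ?case
  by (rule Ck_on_SucI[OF assms(1) bounded_linear.has_derivative[OF assms(2) Ck_on_SucD]])
    (use Suc in auto)
qed

lemma Ck_on_bilinear:
 assumes "open S" "bounded_bilinear B" "Ck_on k f S" "Ck_on k g S"
 shows "Ck_on k (\<lambda>x. B (f x) (g x)) S"
 using assms(3,4)
proof (induction k arbitrary: f g)
 case 0
 then show ?case using bounded_bilinear.continuous_on[OF assms(2)] by auto
next
 case (Suc k)
 have fg: "Ck_on k f S" "Ck_on k g S" using Suc.prems Ck_on_Suc_imp by blast+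
 show ?case
  by (rule Ck_on_SucI[OF assms(1) bounded_bilinear.FDERIV[OF assms(2) Ck_on_SucD Ck_on_SucD]])
    (use Suc fg in \<open>auto intro!: Ck_on_add[OF assms(1)]\<close>)
qed

lemma Ck_on_affine_inner:
 assumes "open S" "bounded_linear L" "\<And>x. x \<in> S ==> L x + c \<in> T" "Ck_on k f T"
 shows "Ck_on k (\<lambda>x. f (L x + c)) S"
 using assms(4)
proof (induction k arbitrary: f)
 case 0
 have "continuous_on S (\<lambda>x. L x + c)"
  using assms(2) by (intro continuous_intros) (simp add: bounded_linear.linear linear_continuous_on)
 then show ?case using 0 assms(3) by (auto intro!: continuous_on_compose2[of T f])
next
 case (Suc k)
 have d: "((\<lambda>x. L x + c) has_derivative L) (at x)" for x
  using has_derivative_add[OF bounded_linear_imp_has_derivative[OF assms(2), of "at x"]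
    has_derivative_const[of c "at x"]] by simp
 have "((\<lambda>x. f (L x + c)) has_derivative (\<lambda>v. frechet_derivative f (at (L x + c)) (L v))) (at x)"
  if "x \<in> S" for x
  using diff_chain_at[OF d Ck_on_SucD[OF Suc.prems assms(3)[OF that]]] by (simp add: o_def)
 then show ?case
  by (rule Ck_on_SucI[OF assms(1)]) (use Suc in auto)
qed

lemma Ck_on_vector_derivative:
 fixes f :: "real => 'b::real_normed_vector"
 assumes "open S" "\<And>x. x \<in> S ==> (f has_vector_derivative f' x) (at x)" "Ck_on k f' S"
 shows "Ck_on (Suc k) f S"
 by (rule Ck_on_SucI[OF assms(1) assms(2)[unfolded has_vector_derivative_def]])
   (simp_all add: Ck_on_linear_outer[OF assms(1) bounded_linear_scaleR_right assms(3)])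

lemma Ck_on_vector_derivativeD:
 fixes f :: "real => 'b::real_normed_vector"
 assumes "open S" "Ck_on (Suc k) f S"
 shows "Ck_on k (\<lambda>x. vector_derivative f (at x)) S"
  "\<And>x. x \<in> S ==> (f has_vector_derivative vector_derivative f (at x)) (at x)"
proof -
 have d: "f differentiable (at x)" if "x \<in> S" for x using assms(2) that by simp
 then show "\<And>x. x \<in> S ==> (f has_vector_derivative vector_derivative f (at x)) (at x)"
  by (simp add: vector_derivative_works)
 have "Ck_on k (\<lambda>x. frechet_derivative f (at x) 1) S" using assms(2) by simp
 then show "Ck_on k (\<lambda>x. vector_derivative f (at x)) S"
  by (rule Ck_on_cong[OF assms(1), rotated]) (simp add: frechet_derivative_eq_vector_derivative d)
qed

lemma Ck_on_inverse:
 fixes f :: "'a::real_normed_vector => 'b::real_normed_field"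
 assumes "open S" "\<And>x. x \<in> S ==> f x \<noteq> 0" "Ck_on k f S"
 shows "Ck_on k (\<lambda>x. inverse (f x)) S"
 using assms(3)
proof (induction k)
 case 0
 then show ?case using assms(2) by (auto intro: continuous_on_inverse)
next
 case (Suc k)
 have f: "Ck_on k (\<lambda>x. inverse (f x)) S" using Suc Ck_on_Suc_imp by blast
 show ?case
 proof (rule Ck_on_SucI[OF assms(1)])
  show "((\<lambda>x. inverse (f x)) has_derivative
    (\<lambda>h. - (inverse (f x) * frechet_derivative f (at x) h * inverse (f x)))) (at x)" if "x \<in> S" for x
   using Deriv.has_derivative_inverse[OF assms(2)[OF that] Ck_on_SucD[OF Suc.prems that]] .
  have "Ck_on k (\<lambda>x. inverse (f x) * frechet_derivative f (at x) v * inverse (f x)) S" for v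
   using f Suc.prems by (intro Ck_on_bilinear[OF assms(1) bounded_bilinear_mult]) auto
  from Ck_on_linear_outer[OF assms(1) bounded_linear_minus[OF bounded_linear_ident] this]
  show "Ck_on k (\<lambda>x. - (inverse (f x) * frechet_derivative f (at x) v * inverse (f x))) S" for v .
 qed
qed

text \<open>Gluing along the open cover by \<open>{0<..}\<close> and \<open>{..<a}\<close>: on the
  second set the function is zero, so each derivative continues by zero.\<close>

lemma Ck_on_zero_outside:
 fixes f :: "real => complex"
 assumes "Ck_on k f {0<..}" "0 < a" "\<And>y. y \<notin> {a..b} ==> f y = 0"
 shows "Ck_on k f UNIV"
 using assms(1,3)
proof (induction k arbitrary: f)
 case 0
 have "continuous_on ({0<..} \<union> {..<a}) f"
 proof (rule continuous_on_open_Un)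
  show "continuous_on {..<a} f"
   using 0 by (subst continuous_on_cong[OF refl, of _ _ "\<lambda>_. 0"]) auto
 qed (use 0 in auto)
 moreover have "{0<..} \<union> {..<a} = UNIV" using \<open>0 < a\<close> by auto
 ultimately show ?case by simp
next
 case (Suc k)
 have zero: "(f has_vector_derivative 0) (at y)" if "y < a \<or> b < y" for y
  by (rule has_vector_derivative_transform_within_open[where f = "\<lambda>_. 0" and S = "{..<a} \<union> {b<..}"])
    (use that Suc.prems in \<open>auto simp: open_Un\<close>)
 have vd: "vector_derivative f (at y) = 0" if "y \<notin> {a..b}" for y
  using zero[of y] that by (auto intro!: vector_derivative_at)
 note D = Ck_on_vector_derivativeD[OF open_greaterThan Suc.prems(1)]
 have hd: "(f has_vector_derivative vector_derivative f (at y)) (at y)" for y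
 proof (cases "y \<in> {0<..}")
  case False
  then have "y < a" using \<open>0 < a\<close> by auto
  then show ?thesis using zero[of y] vd[of y] by auto
 qed (use D in auto)
 show ?case
  by (rule Ck_on_vector_derivative[OF open_UNIV hd]) (rule Suc.IH, use D vd in auto)
qed

lemma smooth_on_mult:
 fixes f g :: "'a::real_normed_vector => complex"
 shows "open S ==> smooth_on f S ==> smooth_on g S ==> smooth_on (\<lambda>x. f x * g x) S"
 by (simp add: smooth_on_def Ck_on_bilinear[OF _ bounded_bilinear_mult])

lemma smooth_on_add:
 "open S ==> smooth_on f S ==> smooth_on g S ==> smooth_on (\<lambda>x. f x + g x) S"
 by (simp add: smooth_on_def Ck_on_add)

lemma smooth_on_const [simp, intro]: "smooth_on (\<lambda>x. c) S"
 by (auto simp: smooth_on_def)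

lemma smooth_on_linear_outer:
 "open S ==> bounded_linear B ==> smooth_on f S ==> smooth_on (\<lambda>x. B (f x)) S"
 by (simp add: smooth_on_def Ck_on_linear_outer)

lemma smooth_on_affine_inner:
 "open S ==> bounded_linear L ==> (\<And>x. x \<in> S ==> L x + c \<in> T) ==> smooth_on f T
  ==> smooth_on (\<lambda>x. f (L x + c)) S"
 unfolding smooth_on_def using Ck_on_affine_inner[of S L c T] by blast

lemma smooth_on_inverse:
 fixes f :: "'a::real_normed_vector => complex"
 shows "open S ==> (\<And>x. x \<in> S ==> f x \<noteq> 0) ==> smooth_on f S ==> smooth_on (\<lambda>x. inverse (f x)) S"
 by (simp add: smooth_on_def Ck_on_inverse)

lemma smooth_on_continuous: "smooth_on f S ==> continuous_on S f"
 unfolding smooth_on_def using Ck_on_continuous by blast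

lemma smooth_on_subset: "smooth_on f S ==> T \<subseteq> S ==> smooth_on f T"
 unfolding smooth_on_def using Ck_on_subset by blast

lemma smooth_on_cong: "open S ==> (\<And>x. x \<in> S ==> f x = g x) ==> smooth_on f S ==> smooth_on g S"
 unfolding smooth_on_def using Ck_on_cong by blast

lemma smooth_on_vector_derivativeI:
 fixes f :: "real => 'b::real_normed_vector"
 assumes "open S" "\<And>x. x \<in> S ==> (f has_vector_derivative f' x) (at x)" "smooth_on f' S"
 shows "smooth_on f S"
 unfolding smooth_on_def
proof
 fix k
 have "Ck_on (Suc k) f S"
  using Ck_on_vector_derivative[OF assms(1,2)] assms(3) by (auto simp: smooth_on_def)
 then show "Ck_on k f S" by (rule Ck_on_Suc_imp)
qed

lemma smooth_on_vector_derivativeD: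
 fixes f :: "real => 'b::real_normed_vector"
 assumes "open S" "smooth_on f S"
 shows "smooth_on (\<lambda>x. vector_derivative f (at x)) S"
  "\<And>x. x \<in> S ==> (f has_vector_derivative vector_derivative f (at x)) (at x)"
 using Ck_on_vector_derivativeD[OF assms(1)] assms(2) unfolding smooth_on_def by blast+

text \<open>Coinduction: a family of functions closed under differentiation up to smooth factors.\<close>

lemma smooth_on_family:
 fixes f :: "'i => real => complex"
 assumes "open S" "\<And>i x. x \<in> S ==> (f i has_vector_derivative c i x * f (d i) x) (at x)"
  "\<And>i. smooth_on (c i) S"
 shows "smooth_on (f i) S"
proof -
 have "Ck_on k (f i) S" for k i
 proof (induction k arbitrary: i)
  case 0
  show ?case using assms(2)
   by (auto intro!: continuous_at_imp_continuous_on has_vector_derivative_continuous)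
 next
  case (Suc k)
  show ?case
   by (rule Ck_on_vector_derivative[OF assms(1,2)])
     (use Suc assms in \<open>simp_all add: smooth_on_def Ck_on_bilinear[OF _ bounded_bilinear_mult]\<close>)
 qed
 then show ?thesis by (simp add: smooth_on_def)
qed

lemma smooth_on_exp_of_real: "smooth_on (\<lambda>t. exp (c * of_real t) :: complex) UNIV"
proof -
 have "((\<lambda>t. exp (c * of_real t) :: complex) has_vector_derivative c * exp (c * of_real t)) (at t)" for t
  by (rule has_vector_derivative_real_field) (auto intro!: derivative_eq_intros)
 from smooth_on_family[of UNIV "\<lambda>_::unit. \<lambda>t. exp (c * of_real t)" "\<lambda>_ _. c" "\<lambda>i. i", OF _ this]
 show ?thesis by auto
qed

lemma smooth_on_powr: "smooth_on (\<lambda>y. complex_of_real (y powr a)) {0<..}"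
proof -
 have "((\<lambda>y. complex_of_real (y powr b)) has_vector_derivative of_real b * of_real (y powr (b - 1))) (at y)"
  if "y \<in> {0<..}" for b y
  using that has_vector_derivative_of_real[of "\<lambda>y. y powr b" "b * y powr (b - 1)" "at y"]
   has_real_derivative_powr[of y b]
  by (auto simp: has_real_derivative_iff_has_vector_derivative)
 from smooth_on_family[of "{0<..}" "\<lambda>b y. complex_of_real (y powr b)" "\<lambda>b _. of_real b" "\<lambda>b. b - 1", OF _ this]
 show ?thesis by auto
qed

section \<open>Parameter integrals\<close>

lemma continuous_on_integral_dominated:
 fixes f :: "'a::metric_space => 'b => 'c::{banach, second_countable_topology}"
 assumes "\<And>x. x \<in> S ==> f x \<in> borel_measurable M"
  and "\<And>t. t \<in> space M ==> continuous_on S (\<lambda>x. f x t)"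
  and "\<And>x t. x \<in> S ==> t \<in> space M ==> norm (f x t) \<le> g t"
  and "integrable M g"
 shows "continuous_on S (\<lambda>x. \<integral>t. f x t \<partial>M)"
 unfolding continuous_on_sequentially comp_def
proof safe
 fix x a assume x: "\<forall>n. x n \<in> S" "x \<longlonglongrightarrow> a" and a: "a \<in> S"
 show "(\<lambda>n. \<integral>t. f (x n) t \<partial>M) \<longlonglongrightarrow> (\<integral>t. f a t \<partial>M)"
 proof (rule integral_dominated_convergence[where w = g])
  have "(\<lambda>n. f (x n) t) \<longlonglongrightarrow> f a t" if "t \<in> space M" for t
   using assms(2)[OF that] x a unfolding continuous_on_sequentially comp_def by blast
  then show "AE t in M. (\<lambda>n. f (x n) t) \<longlonglongrightarrow> f a t" by auto
 qed (use assms x a in auto)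
qed

text \<open>Dominated convergence for difference quotients. The bound \<open>g\<close> on the
  derivative carries over to the quotients by the mean value inequality, which is where convexity of
  \<open>S\<close> enters.\<close>

lemma has_vector_derivative_integral:
 fixes f :: "real => 'b => 'c::{banach, second_countable_topology}"
 assumes S: "open S" "convex S" "x \<in> S"
  and int: "\<And>x. x \<in> S ==> integrable M (f x)"
  and der: "\<And>x t. x \<in> S ==> t \<in> space M ==> ((\<lambda>x. f x t) has_vector_derivative f' x t) (at x)"
  and meas: "f' x \<in> borel_measurable M"
  and bnd: "\<And>x t. x \<in> S ==> t \<in> space M ==> norm (f' x t) \<le> g t"
  and g: "integrable M g"
 shows "((\<lambda>x. \<integral>t. f x t \<partial>M) has_vector_derivative (\<integral>t. f' x t \<partial>M)) (at x)"
proof -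
 let ?q = "\<lambda>y t. inverse (y - x) *\<^sub>R (f y t - f x t)"
 have "((\<lambda>y. \<integral>t. ?q y t \<partial>M) \<longlongrightarrow> (\<integral>t. f' x t \<partial>M)) (at x within S)"
  unfolding tendsto_at_iff_sequentially comp_def
 proof safe
  fix X assume X: "\<forall>i. X i \<in> S - {x}" "X \<longlonglongrightarrow> x"
  show "(\<lambda>n. \<integral>t. ?q (X n) t \<partial>M) \<longlonglongrightarrow> (\<integral>t. f' x t \<partial>M)"
  proof (rule integral_dominated_convergence[where w = g])
   show "AE t in M. (\<lambda>n. ?q (X n) t) \<longlonglongrightarrow> f' x t"
   proof (rule AE_I2)
    fix t assume t: "t \<in> space M"
    have *: "((\<lambda>y. ?q y t) \<longlongrightarrow> f' x t) (at x)"
     using der[OF S(3) t] unfolding has_vector_derivative_def has_derivative_iff_norm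
    proof -
     assume "bounded_linear (\<lambda>v. v *\<^sub>R f' x t) \<and>
      ((\<lambda>y. norm (f y t - f x t - (y - x) *\<^sub>R f' x t) / norm (y - x)) \<longlongrightarrow> 0) (at x)"
     then have "((\<lambda>y. norm (f y t - f x t - (y - x) *\<^sub>R f' x t) / norm (y - x)) \<longlongrightarrow> 0) (at x)" ..
     moreover have "\<forall>\<^sub>F y in at x. norm (f y t - f x t - (y - x) *\<^sub>R f' x t) / norm (y - x) = norm (?q y t - f' x t)"
      unfolding eventually_at_filter
     proof (rule always_eventually, intro allI impI)
      fix y assume "y \<noteq> x"
      have "norm (?q y t - f' x t) = norm (inverse (y - x) *\<^sub>R (f y t - f x t - (y - x) *\<^sub>R f' x t))"
       using \<open>y \<noteq> x\<close> scaleR_diff_right[of "inverse (y - x)" "f y t - f x t" "(y - x) *\<^sub>R f' x t"] by simp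
      then show "norm (f y t - f x t - (y - x) *\<^sub>R f' x t) / norm (y - x) = norm (?q y t - f' x t)"
       by (simp add: divide_inverse mult.commute)
     qed
     ultimately have "((\<lambda>y. norm (?q y t - f' x t)) \<longlongrightarrow> 0) (at x)"
      by (rule Lim_transform_eventually)
     then have "((\<lambda>y. ?q y t - f' x t) \<longlongrightarrow> 0) (at x)" by (rule tendsto_norm_zero_cancel)
     then show ?thesis by (rule LIM_zero_cancel)
    qed
    then show "(\<lambda>n. ?q (X n) t) \<longlonglongrightarrow> f' x t"
     using X unfolding tendsto_at_iff_sequentially comp_def by auto
   qed
   show "AE t in M. norm (?q (X n) t) \<le> g t" for n
   proof (rule AE_I2)
    fix t assume t: "t \<in> space M"
    have "norm (f (X n) t - f x t) \<le> g t * norm (X n - x)"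
    proof (rule differentiable_bound[OF S(2), where f = "\<lambda>x. f x t" and f' = "\<lambda>x v. v *\<^sub>R f' x t"])
     fix y assume y: "y \<in> S"
     show "((\<lambda>x. f x t) has_derivative (\<lambda>v. v *\<^sub>R f' y t)) (at y within S)"
      using der[OF y t] unfolding has_vector_derivative_def by (rule has_derivative_at_withinI)
     show "onorm (\<lambda>v. v *\<^sub>R f' y t) \<le> g t"
      using bnd[OF y t] norm_ge_zero[of "f' y t"] by (intro onorm_le) (auto simp: mult.commute mult_left_mono)
    qed (use X S in auto)
    moreover have "norm (?q (X n) t) = norm (f (X n) t - f x t) / norm (X n - x)"
     by (simp add: divide_inverse mult.commute)
    ultimately show "norm (?q (X n) t) \<le> g t"
     using X(1)[rule_format, of n] by (simp add: pos_divide_le_eq)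
   qed
   show "?q (X n) \<in> borel_measurable M" for n
   proof -
    have [measurable]: "f (X n) \<in> borel_measurable M" "f x \<in> borel_measurable M"
     using int X S by auto
    show ?thesis by measurable
   qed
  qed (fact meas g)+
 qed
 then have lim: "((\<lambda>y. \<integral>t. ?q y t \<partial>M) \<longlongrightarrow> (\<integral>t. f' x t \<partial>M)) (at x)"
  unfolding at_within_open[OF S(3,1)] .
 have ev: "\<forall>\<^sub>F y in at x. (\<integral>t. ?q y t \<partial>M) = inverse (y - x) *\<^sub>R ((\<integral>t. f y t \<partial>M) - (\<integral>t. f x t \<partial>M))"
 proof -
  have "\<forall>\<^sub>F y in at x. y \<in> S" using S by (simp add: eventually_at_in_open')
  then show ?thesis by eventually_elim (use int S in simp)
 qed
 have lim2: "((\<lambda>y. inverse (y - x) *\<^sub>R ((\<integral>t. f y t \<partial>M) - (\<integral>t. f x t \<partial>M))) \<longlongrightarrow> (\<integral>t. f' x t \<partial>M)) (at x)"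
  by (rule Lim_transform_eventually[OF lim ev])
 show ?thesis
  unfolding has_vector_derivative_def has_derivative_iff_norm
 proof (intro conjI bounded_linear_scaleR_left)
  have "((\<lambda>y. norm (inverse (y - x) *\<^sub>R ((\<integral>t. f y t \<partial>M) - (\<integral>t. f x t \<partial>M)) - (\<integral>t. f' x t \<partial>M))) \<longlongrightarrow> 0) (at x)"
   using tendsto_norm_zero[OF LIM_zero[OF lim2]] .
  moreover have "\<forall>\<^sub>F y in at x. norm (inverse (y - x) *\<^sub>R ((\<integral>t. f y t \<partial>M) - (\<integral>t. f x t \<partial>M)) - (\<integral>t. f' x t \<partial>M))
    = norm ((\<integral>t. f y t \<partial>M) - (\<integral>t. f x t \<partial>M) - (y - x) *\<^sub>R (\<integral>t. f' x t \<partial>M)) / norm (y - x)"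
   unfolding eventually_at_filter
  proof (rule always_eventually, intro allI impI)
   fix y assume "y \<noteq> x"
   let ?d = "(\<integral>t. f y t \<partial>M) - (\<integral>t. f x t \<partial>M)" and ?e = "\<integral>t. f' x t \<partial>M"
   have "inverse (y - x) *\<^sub>R ?d - ?e = inverse (y - x) *\<^sub>R (?d - (y - x) *\<^sub>R ?e)"
    using \<open>y \<noteq> x\<close> scaleR_diff_right[of "inverse (y - x)" ?d "(y - x) *\<^sub>R ?e"] by simp
   then show "norm (inverse (y - x) *\<^sub>R ?d - ?e) = norm (?d - (y - x) *\<^sub>R ?e) / norm (y - x)"
    by (simp add: divide_inverse mult.commute)
  qed
  ultimately show "((\<lambda>y. norm ((\<integral>t. f y t \<partial>M) - (\<integral>t. f x t \<partial>M) - (y - x) *\<^sub>R (\<integral>t. f' x t \<partial>M)) / norm (y - x)) \<longlongrightarrow> 0) (at x)"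
   by (rule Lim_transform_eventually)
 qed
qed

text \<open>The set where \<open>f\<close> is nonzero is open and would be null, but a nonempty open
  set is not negligible. This upgrades almost everywhere identities between continuous functions,
  both on a line of the transform variable and in the half-plane of \<open>(t, y)\<close>.\<close>

lemma AE_zero_imp_zero:
 fixes f :: "'a::euclidean_space => 'b::real_normed_vector"
 assumes "open S" "continuous_on S f" "AE x in lborel. x \<in> S --> f x = 0" "x \<in> S"
 shows "f x = 0"
proof (rule ccontr)
 assume "f x \<noteq> 0"
 define N where "N = {y \<in> S. f y \<noteq> 0}"
 have "N = S \<inter> f -` (- {0})" by (auto simp: N_def)
 then have "open N" using continuous_open_preimage[OF assms(2,1), of "- {0}"] by (auto simp: Int_def)
 moreover have "N \<noteq> {}" using \<open>f x \<noteq> 0\<close> assms(4) by (auto simp: N_def)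
 moreover have "AE y in lborel. y \<notin> N" using assms(3) by (auto simp: N_def)
 then have "N \<in> null_sets lborel"
  using \<open>open N\<close> by (subst (asm) AE_iff_null_sets[symmetric]) (auto simp: borel_open)
 then have "negligible N" by (simp add: negligible_iff_null_sets null_sets_completionI)
 ultimately show False using open_not_negligible by blast
qed

section \<open>The modified Bessel kernel\<close>

text \<open>The common core of all integrations by parts and of the kernel recurrences below: each
  is the vanishing integral of a total derivative.\<close>

lemma integral_derivative_zero:
 fixes F f :: "real => complex"
 assumes "\<And>x. (F has_vector_derivative f x) (at x)" "continuous_on UNIV f" "integrable lborel f"
  "(F \<longlongrightarrow> 0) at_top" "(F \<longlongrightarrow> 0) at_bot"
 shows "(\<integral>x. f x \<partial>lborel) = 0"
proof -
 have "(LBINT x=-\<infinity>..\<infinity>. f x) = 0 - 0"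
 proof (rule interval_integral_FTC_integrable)
  show "((F \<circ> real_of_ereal) \<longlongrightarrow> 0) (at_right (- \<infinity>))" "((F \<circ> real_of_ereal) \<longlongrightarrow> 0) (at_left \<infinity>)"
   using assms(4,5) by (simp_all add: ereal_tendsto_simps)
 qed (use assms in \<open>auto simp: continuous_on_eq_continuous_at set_integrable_def\<close>)
 then show ?thesis by (simp add: interval_lebesgue_integral_def set_lebesgue_integral_def)
qed

lemma integrable_gaussian: "0 < c ==> integrable lborel (\<lambda>t::real. exp (- (c * t\<^sup>2)))"
proof -
 assume c: "0 < c"
 define s where "s = sqrt (1 / (2 * c))"
 have s: "0 < s" "s\<^sup>2 = 1 / (2 * c)" using c by (simp_all add: s_def)
 have "integrable lborel (\<lambda>t. sqrt (2 * pi * s\<^sup>2) * normal_density 0 s t)"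
  using integrable_normal_density[OF s(1)] by simp
 moreover have "sqrt (2 * pi * s\<^sup>2) * normal_density 0 s t = exp (- (c * t\<^sup>2))" for t
  unfolding normal_density_def s(2) using c by (simp add: field_simps)
 ultimately show ?thesis by simp
qed

lemma integrable_exp_abs: "0 < u ==> integrable lborel (\<lambda>x::real. exp (- (u * \<bar>x\<bar>)))"
proof -
 assume u: "0 < u"
 let ?g = "\<lambda>x::real. indicator {0<..} x *\<^sub>R exp (- (x * u))"
 have g: "integrable lborel ?g" using integrable_I0i_exp_mscale[OF u] by (simp add: set_integrable_def)
 have g': "integrable lborel (\<lambda>x. ?g (- x))"
  using lborel_integrable_real_affine[OF g, of "-1" 0] by simp
 have "integrable lborel (\<lambda>x. ?g x + ?g (- x))" using g g' by simp
 then show ?thesis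
 proof (rule integrable_cong_AE_imp)
  have "AE x in lborel. x \<noteq> (0::real)" by (rule AE_lborel_singleton)
  then show "AE x in lborel. ?g x + ?g (- x) = exp (- (u * \<bar>x\<bar>))"
   by eventually_elim (auto simp: indicator_def mult.commute split: if_splits)
 qed simp
qed

lemma exp_gt_quadratic: "0 \<le> t ==> t\<^sup>2 / 2 \<le> exp (t::real)"
 using exp_lower_Taylor_quadratic[of t] by auto

text \<open>Gives the exponent of the kernel quadratic growth in both directions, hence Gaussian
  domination. The second derivative of the difference of the two sides is
  \<open>(exp (y/2) - exp (- y/2))^2\<close>, and evenness reduces everything to the
  half-line.\<close>

lemma exp_sum_ge: "2 + t\<^sup>2 \<le> exp t + exp (- t::real)"
proof -
 have *: "2 + s\<^sup>2 \<le> exp s + exp (- s)" if "0 \<le> s" for s :: real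
 proof -
  define h where "h = (\<lambda>s::real. exp s + exp (- s) - s\<^sup>2 - 2)"
  define h' where "h' = (\<lambda>s::real. exp s - exp (- s) - 2 * s)"
  have m': "0 \<le> h' x" if "0 \<le> x" for x
  proof -
   have "h' 0 \<le> h' x"
   proof (rule DERIV_nonneg_imp_nondecreasing[OF that], intro exI conjI)
    fix y :: real
    show "(h' has_real_derivative (exp y + exp (- y) - 2)) (at y)"
     unfolding h'_def by (auto intro!: derivative_eq_intros)
    have "0 \<le> (exp (y/2) - exp (- y/2))\<^sup>2" by simp
    also have "\<dots> = exp y + exp (- y) - 2"
     by (simp add: power2_eq_square algebra_simps exp_add[symmetric])
    finally show "0 \<le> exp y + exp (- y) - 2" .
   qed
   then show ?thesis by (simp add: h'_def)
  qed
  have "h 0 \<le> h s"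
  proof (rule DERIV_nonneg_imp_nondecreasing[OF that], intro exI conjI)
   fix y :: real assume "0 \<le> y" "y \<le> s"
   show "(h has_real_derivative h' y) (at y)"
    unfolding h_def h'_def by (auto intro!: derivative_eq_intros)
   show "0 \<le> h' y" using m' \<open>0 \<le> y\<close> by simp
  qed
  then show ?thesis by (simp add: h_def)
 qed
 show ?thesis using *[of t] *[of "- t"] by (cases "0 \<le> t") auto
qed

text \<open>With \<open>y e\<^sup>t\<close> in place of \<open>e\<^sup>t\<close>, \<open>bint mu z y\<close> is \<open>2 y\<^sup>mu K\<^sub>mu(z y)\<close>.\<close>

definition bker :: "real => complex => real => real => complex" where
 "bker mu z y t = exp (- z * of_real ((exp t + y\<^sup>2 * exp (- t)) / 2) + of_real (mu * t))"

definition bint :: "real => complex => real => complex" where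
 "bint mu z y = (\<integral>t. bker mu z y t \<partial>lborel)"

lemma norm_bker: "norm (bker mu z y t) = exp (- Re z * ((exp t + y\<^sup>2 * exp (- t)) / 2) + mu * t)"
 by (simp add: bker_def)

lemma continuous_bker_fst: "continuous_on S (\<lambda>(z, y). bker mu z y t)"
 unfolding bker_def split_beta by (intro continuous_intros) auto

text \<open>Differentiation in \<open>y\<close> or \<open>t\<close> produces only factors
  \<open>exp t\<close>, \<open>exp (- t)\<close> and constants in \<open>t\<close>. By these shifts
  it never leaves the family \<open>bker\<close>.\<close>

lemma bker_shift:
 "bker (mu - 1) z y t = of_real (exp (- t)) * bker mu z y t"
 "bker (mu + 1) z y t = of_real (exp t) * bker mu z y t"
 unfolding bker_def exp_of_real[symmetric] exp_add[symmetric]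
 by (rule arg_cong[where f = exp], simp add: algebra_simps)+

lemma exp_has_vector_derivative:
 fixes h :: "real => complex"
 assumes "(h has_vector_derivative h') (at x)"
 shows "((\<lambda>x. exp (h x)) has_vector_derivative h' * exp (h x)) (at x)"
 using field_vector_diff_chain_at[OF assms DERIV_exp] by (simp add: o_def)

lemma exp_real_has_vector_derivative:
 assumes "(r has_real_derivative r') (at x)" "(s has_real_derivative s') (at x)"
 shows "((\<lambda>x. exp (z * of_real (r x) + of_real (s x)) :: complex) has_vector_derivative
  (z * of_real r' + of_real s') * exp (z * of_real (r x) + of_real (s x))) (at x)"
proof (rule exp_has_vector_derivative)
 have "((\<lambda>x. of_real (r x) :: complex) has_vector_derivative of_real r') (at x)"
  "((\<lambda>x. of_real (s x) :: complex) has_vector_derivative of_real s') (at x)"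
  using assms by (auto intro: has_vector_derivative_of_real simp: has_real_derivative_iff_has_vector_derivative)
 then show "((\<lambda>x. z * of_real (r x) + of_real (s x)) has_vector_derivative z * of_real r' + of_real s') (at x)"
  by (intro has_vector_derivative_add has_vector_derivative_mult_right) auto
qed

lemma bker_measurable [measurable]: "bker mu z y \<in> borel_measurable borel"
 unfolding bker_def by measurable

text \<open>It depends on \<open>z\<close> and \<open>y\<close> only through the lower bounds
  \<open>e\<close> and \<open>y0\<close>, so it dominates the kernel locally uniformly. Its
  constants come from completing the square in \<open>bker_le_gdom\<close>.\<close>

definition gdom :: "real => real => real => real => real" where
 "gdom mu e y0 t = exp (mu\<^sup>2 / (e * min 1 (y0\<^sup>2))) * exp (- (e * min 1 (y0\<^sup>2) / 4 * t\<^sup>2))"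

lemma integrable_gdom: "0 < e ==> 0 < y0 ==> integrable lborel (gdom mu e y0)"
 unfolding gdom_def by (intro integrable_mult_right integrable_gaussian) auto

lemma bker_le_gdom:
 assumes "0 < e" "e \<le> Re z" "0 < y0" "y0 \<le> y"
 shows "norm (bker mu z y t) \<le> gdom mu e y0 t"
proof -
 define c where "c = e * min 1 (y0\<^sup>2)"
 have c: "0 < c" using assms by (simp add: c_def)
 have y2: "y0\<^sup>2 \<le> y\<^sup>2" using assms by (intro power_mono) auto
 have "min 1 (y0\<^sup>2) * t\<^sup>2 \<le> min 1 (y0\<^sup>2) * (exp t + exp (- t))"
  using exp_sum_ge[of t] by (intro mult_left_mono) auto
 also have "\<dots> = min 1 (y0\<^sup>2) * exp t + min 1 (y0\<^sup>2) * exp (- t)" by (simp add: algebra_simps)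
 also have "\<dots> \<le> 1 * exp t + y\<^sup>2 * exp (- t)"
  using y2 by (intro add_mono mult_right_mono) auto
 finally have "e * (min 1 (y0\<^sup>2) * t\<^sup>2) \<le> Re z * (exp t + y\<^sup>2 * exp (- t))"
  using assms by (intro mult_mono) auto
 then have 1: "c * t\<^sup>2 / 2 \<le> Re z * ((exp t + y\<^sup>2 * exp (- t)) / 2)" by (simp add: c_def mult.assoc)
 \<comment> \<open>Half of the decay \<open>c t^2 / 2\<close> is spent on absorbing the linear term
   \<open>mu t\<close>, at the price of the constant \<open>mu^2 / c\<close>.\<close>
 have "0 \<le> (c * t / 2 - mu)\<^sup>2 / c" using c by simp
 also have "\<dots> = c * t\<^sup>2 / 4 - mu * t + mu\<^sup>2 / c"
  using c by (simp add: power2_eq_square field_simps)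
 finally have 2: "mu * t \<le> c * t\<^sup>2 / 4 + mu\<^sup>2 / c" by simp
 have "- Re z * ((exp t + y\<^sup>2 * exp (- t)) / 2) + mu * t \<le> mu\<^sup>2 / c + - (c / 4 * t\<^sup>2)"
  using 1 2 by linarith
 then show ?thesis unfolding norm_bker gdom_def c_def[symmetric] by (simp flip: exp_add)
qed

lemma integrable_bker: "0 < Re z ==> 0 < y ==> integrable lborel (bker mu z y)"
 by (rule Bochner_Integration.integrable_bound[OF integrable_gdom[of "Re z" y mu]])
   (auto intro!: AE_I2 order_trans[OF bker_le_gdom abs_ge_self])

lemma continuous_on_bint:
 assumes "0 < e" "0 < y0"
 shows "continuous_on ({z. e \<le> Re z} \<times> {y0..}) (\<lambda>(z, y). bint mu z y)"
 unfolding bint_def split_beta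
 by (rule continuous_on_integral_dominated[OF _ _ _ integrable_gdom[OF assms]])
   (use continuous_bker_fst assms in \<open>auto simp: split_beta intro!: bker_le_gdom\<close>)

lemma norm_bint_le:
 assumes "0 < e" "e \<le> Re z" "0 < y0" "y0 \<le> y"
 shows "norm (bint mu z y) \<le> (\<integral>t. gdom mu e y0 t \<partial>lborel)"
 unfolding bint_def
 by (rule Bochner_Integration.integral_norm_bound_integral) (use assms in \<open>auto intro!: integrable_bker integrable_gdom bker_le_gdom\<close>)

text \<open>In Bessel terms, \<open>(y^mu K_mu(z y))' = - z y^mu K_(mu-1)(z y)\<close>. The interval
  \<open>{y/2<..<2*y}\<close> keeps away from zero, where the dominating Gaussian
  degenerates.\<close>

lemma bint_deriv:
 assumes "0 < Re z" "0 < y"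
 shows "((\<lambda>y. bint mu z y) has_vector_derivative - z * of_real y * bint (mu - 1) z y) (at y)"
proof -
 have "((\<lambda>y. \<integral>t. bker mu z y t \<partial>lborel) has_vector_derivative (\<integral>t. - z * of_real y * bker (mu - 1) z y t \<partial>lborel)) (at y)"
 proof (rule has_vector_derivative_integral[where S = "{y/2<..<2*y}" and g = "\<lambda>t. norm z * (2 * y) * gdom (mu - 1) (Re z) (y / 2) t"])
  fix x t assume x: "x \<in> {y/2<..<2*y}"
  show "((\<lambda>x. bker mu z x t) has_vector_derivative - z * of_real x * bker (mu - 1) z x t) (at x)"
  proof -
   have "((\<lambda>x. (exp t + x\<^sup>2 * exp (- t)) / 2) has_real_derivative x * exp (- t)) (at x)"
    by (auto intro!: derivative_eq_intros)
   from exp_real_has_vector_derivative[OF this DERIV_const[of "mu * t"], of "- z"]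
   show ?thesis unfolding bker_shift bker_def[symmetric] by (simp add: mult_ac)
  qed
  show "norm (- z * of_real x * bker (mu - 1) z x t) \<le> norm z * (2 * y) * gdom (mu - 1) (Re z) (y / 2) t"
   unfolding norm_mult using x assms
   by (intro mult_mono bker_le_gdom) auto
 qed (use assms in \<open>auto intro!: integrable_bker integrable_gdom\<close>)
 then show ?thesis by (simp add: bint_def)
qed

lemma bker_tendsto_0:
 assumes "0 < Re z" "0 < y"
 shows "(bker mu z y \<longlongrightarrow> 0) at_top" "(bker mu z y \<longlongrightarrow> 0) at_bot"
proof -
 define c where "c = Re z * min 1 (y\<^sup>2) / 4"
 have c: "0 < c" using assms by (simp add: c_def)
 have le: "norm (bker mu z y t) \<le> exp (mu\<^sup>2 / (Re z * min 1 (y\<^sup>2))) * exp (- (c * t\<^sup>2))" for t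
  using bker_le_gdom[of "Re z" z y y mu t] assms by (simp add: gdom_def c_def)
 have sq: "filterlim (\<lambda>t::real. c * t\<^sup>2) at_top at_top" "filterlim (\<lambda>t::real. c * t\<^sup>2) at_top at_bot"
  using filterlim_tendsto_pos_mult_at_top[OF tendsto_const c filterlim_pow_at_top[OF _ filterlim_ident]]
   filterlim_tendsto_pos_mult_at_top[OF tendsto_const c filterlim_pow_at_bot_even[OF _ filterlim_ident]]
  by auto
 have ex: "((\<lambda>t. exp (- (c * t\<^sup>2))) \<longlongrightarrow> 0) at_top" "((\<lambda>t. exp (- (c * t\<^sup>2))) \<longlongrightarrow> 0) at_bot"
  using sq by (auto intro!: filterlim_compose[OF exp_at_bot] simp: filterlim_uminus_at_bot)
 show "(bker mu z y \<longlongrightarrow> 0) at_top" "(bker mu z y \<longlongrightarrow> 0) at_bot"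
  by (rule Lim_null_comparison[OF always_eventually[OF allI[OF le]] tendsto_mult_right_zero[OF ex(1)]],
    rule Lim_null_comparison[OF always_eventually[OF allI[OF le]] tendsto_mult_right_zero[OF ex(2)]])
qed

lemma bker_deriv_t:
 "((\<lambda>t. bker mu z y t) has_vector_derivative
   - (z / 2) * bker (mu + 1) z y t + (z / 2) * of_real (y\<^sup>2) * bker (mu - 1) z y t + of_real mu * bker mu z y t) (at t)"
proof -
 have "((\<lambda>t. (exp t + y\<^sup>2 * exp (- t)) / 2) has_real_derivative (exp t - y\<^sup>2 * exp (- t)) / 2) (at t)"
  "((\<lambda>t. mu * t) has_real_derivative mu) (at t)"
  by (auto intro!: derivative_eq_intros)
 from exp_real_has_vector_derivative[OF this, of "- z"]
 show ?thesis unfolding bker_shift bker_def[symmetric] by (simp add: algebra_simps diff_divide_distrib)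
qed

text \<open>The integral of the \<open>t\<close>-derivative of \<open>bker\<close> vanishes, and
  this derivative combines the orders \<open>mu + 1\<close>, \<open>mu - 1\<close> and
  \<open>mu\<close>. It is the three-term recurrence of the Macdonald functions.\<close>

lemma bint_recurrence:
 assumes "0 < Re z" "0 < y"
 shows "z / 2 * (bint (mu + 1) z y - of_real (y\<^sup>2) * bint (mu - 1) z y) = of_real mu * bint mu z y"
proof -
 note [intro, simp] = integrable_bker[OF assms]
 let ?f = "\<lambda>t. - (z / 2) * bker (mu + 1) z y t + (z / 2) * of_real (y\<^sup>2) * bker (mu - 1) z y t + of_real mu * bker mu z y t"
 have "(\<integral>t. ?f t \<partial>lborel) = 0"
 proof (rule integral_derivative_zero[OF bker_deriv_t])
  show "continuous_on UNIV ?f" unfolding bker_def by (intro continuous_intros) auto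
  show "integrable lborel ?f" by (intro Bochner_Integration.integrable_add integrable_mult_right) auto
 qed (use bker_tendsto_0[OF assms] in auto)
 then have "- (z / 2) * bint (mu + 1) z y + (z / 2) * of_real (y\<^sup>2) * bint (mu - 1) z y + of_real mu * bint mu z y = 0"
  unfolding bint_def by (subst (asm) Bochner_Integration.integral_add, auto)+
 then show ?thesis by (simp add: algebra_simps)
qed

text \<open>The substitution of \<open>2 ln y - t\<close> for \<open>t\<close> exchanges
  \<open>exp t\<close> with \<open>y^2 exp (- t)\<close>. This is the symmetry
  \<open>K_(-mu) = K_mu\<close>; later it turns the weight in \<open>DN_quotient\<close> into a
  kernel of positive order.\<close>

lemma bint_reflect:
 assumes "0 < y"
 shows "of_real (y powr (2 * mu)) * bint (- mu) z y = bint mu z y"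
proof -
 have "bint (- mu) z y = (\<integral>t. bker (- mu) z y (2 * ln y + (-1) * t) \<partial>lborel)"
  unfolding bint_def by (subst lborel_integral_real_affine[of "-1" _ "2 * ln y"]) auto
 also have "\<dots> = (\<integral>t. of_real (y powr (- (2 * mu))) * bker mu z y t \<partial>lborel)"
 proof (rule Bochner_Integration.integral_cong[OF refl])
  fix t
  have y2: "exp (2 * ln y) = y\<^sup>2" using assms by (metis exp_double exp_ln)
  then have y2': "exp (ln y * 2) = y\<^sup>2" by (simp add: mult.commute)
  have 1: "exp (2 * ln y + (-1) * t) = y\<^sup>2 * exp (- t)" by (simp add: exp_diff exp_minus y2 y2' field_simps)
  have 2: "y\<^sup>2 * exp (- (2 * ln y + (-1) * t)) = exp t"
   using assms by (simp add: exp_diff exp_minus y2 y2' field_simps)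
  have 3: "of_real (y powr (- (2 * mu))) = exp (complex_of_real (- (2 * mu) * ln y))"
   using assms by (simp add: powr_def flip: exp_of_real)
  show "bker (- mu) z y (2 * ln y + (-1) * t) = of_real (y powr (- (2 * mu))) * bker mu z y t"
   unfolding bker_def 1 2 3 exp_add[symmetric] by (rule arg_cong[where f = exp]) (simp add: algebra_simps)
 qed
 also have "\<dots> = of_real (y powr (- (2 * mu))) * bint mu z y" by (simp add: bint_def)
 finally show ?thesis using assms by (simp add: mult.assoc[symmetric] powr_add[symmetric] flip: of_real_mult)
qed

text \<open>A second differentiation gives order \<open>mu - 2\<close>, which the recurrence at
  \<open>mu - 1\<close> removes. The outcome is the equation
  \<open>A'' + ((1 - 2 mu) / y) A' = z^2 A\<close>, the transformed equation of a single
  mode.\<close>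

lemma bint_second_deriv:
 assumes "0 < Re z" "0 < y"
 shows "((\<lambda>y. - z * of_real y * bint (mu - 1) z y) has_vector_derivative
   z\<^sup>2 * bint mu z y - of_real ((1 - 2 * mu) / y) * (- z * of_real y * bint (mu - 1) z y)) (at y)"
proof -
 have d: "((\<lambda>y. - z * of_real y * bint (mu - 1) z y) has_vector_derivative
   (- z * of_real y) * (- z * of_real y * bint (mu - 1 - 1) z y) + (- z) * bint (mu - 1) z y) (at y)"
  by (rule has_vector_derivative_mult[OF _ bint_deriv[OF assms]])
    (auto intro!: derivative_eq_intros has_vector_derivative_real_field)
 have r: "z / 2 * (bint mu z y - of_real (y\<^sup>2) * bint (mu - 1 - 1) z y) = (of_real mu - 1) * bint (mu - 1) z y"
  using bint_recurrence[OF assms, of "mu - 1"] by simp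
 have z: "of_real (y\<^sup>2) = (of_real y :: complex)\<^sup>2" by simp
 have "z * (bint mu z y - (of_real y)\<^sup>2 * bint (mu - 1 - 1) z y) = 2 * ((of_real mu - 1) * bint (mu - 1) z y)"
  unfolding r[symmetric] z by simp
 then have "z * (z * (bint mu z y - (of_real y)\<^sup>2 * bint (mu - 1 - 1) z y)) = z * (2 * ((of_real mu - 1) * bint (mu - 1) z y))"
  by simp
 moreover have c: "of_real ((1 - 2 * mu) / y) * (- z * of_real y * b) = - (1 - 2 * of_real mu) * (z * b)" for b
  using assms(2) by (simp add: field_simps)
 ultimately have "(- z * of_real y) * (- z * of_real y * bint (mu - 1 - 1) z y) + (- z) * bint (mu - 1) z y
   = z\<^sup>2 * bint mu z y - of_real ((1 - 2 * mu) / y) * (- z * of_real y * bint (mu - 1) z y)"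
  unfolding c by (simp add: power2_eq_square algebra_simps)
 then show ?thesis using d by simp
qed

lemma norm_bint_decay:
 assumes "0 < Re z" "1 \<le> y"
 shows "norm (bint mu z y) \<le> exp (- (Re z * y / 2)) * (\<integral>t. gdom mu (Re z / 2) 1 t \<partial>lborel)"
proof -
 have "norm (bint mu z y) \<le> (\<integral>t. exp (- (Re z * y / 2)) * gdom mu (Re z / 2) 1 t \<partial>lborel)"
  unfolding bint_def
 proof (rule Bochner_Integration.integral_norm_bound_integral)
  fix t
  \<comment> \<open>The exponent is used at half strength twice: through
    \<open>exp t + y^2 exp (- t) \<ge> 2 y\<close> for the decay in \<open>y\<close>, and with
    \<open>y\<close> lowered to \<open>1\<close> for convergence of the integral.\<close>
  have "0 \<le> (exp (t/2) - y * exp (- t/2))\<^sup>2" by simp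
  also have "\<dots> = exp t + y\<^sup>2 * exp (- t) - 2 * y"
   by (simp add: power2_eq_square algebra_simps exp_add[symmetric])
  finally have a: "2 * y \<le> exp t + y\<^sup>2 * exp (- t)" by simp
  have "1\<^sup>2 * exp (- t) \<le> y\<^sup>2 * exp (- t)"
   using assms by (intro mult_right_mono power_mono) auto
  then have b: "2 * y + (exp t + 1\<^sup>2 * exp (- t)) \<le> 2 * (exp t + y\<^sup>2 * exp (- t))"
   using a unfolding distrib_left[of 2] mult_2 by linarith
  have "Re z * (2 * y + (exp t + 1\<^sup>2 * exp (- t))) \<le> Re z * (2 * (exp t + y\<^sup>2 * exp (- t)))"
   using b assms by (intro mult_left_mono) auto
  then have "- Re z * ((exp t + y\<^sup>2 * exp (- t)) / 2) + mu * t \<le> - (Re z * y / 2) + (- (Re z / 2) * ((exp t + 1\<^sup>2 * exp (- t)) / 2) + mu * t)"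
   by (simp add: field_simps)
  then have "norm (bker mu z y t) \<le> exp (- (Re z * y / 2)) * norm (bker mu (of_real (Re z / 2)) 1 t)"
   unfolding norm_bker exp_add[symmetric] by simp
  also have "\<dots> \<le> exp (- (Re z * y / 2)) * gdom mu (Re z / 2) 1 t"
   using assms by (intro mult_left_mono bker_le_gdom) auto
  finally show "norm (bker mu z y t) \<le> exp (- (Re z * y / 2)) * gdom mu (Re z / 2) 1 t" .
 qed (use assms in \<open>auto intro!: integrable_bker integrable_gdom integrable_mult_right\<close>)
 then show ?thesis by simp
qed

subsection \<open>The boundary limit and the Gamma function\<close>

text \<open>At \<open>y = 0\<close> the term \<open>y^2 exp (- t)\<close> is gone, and decay towards
  negative \<open>t\<close> comes only from \<open>exp (mu t)\<close> with \<open>mu > 0\<close>.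
  The resulting bound is uniform in \<open>y\<close> down to the boundary.\<close>

definition edom :: "real => real => real => real" where
 "edom mu a t = exp (2 * mu\<^sup>2 / a) * exp (- (mu * \<bar>t\<bar>))"

lemma integrable_edom: "0 < mu ==> integrable lborel (edom mu a)"
 unfolding edom_def by (intro integrable_mult_right integrable_exp_abs)

lemma exp_le_edom:
 assumes "0 < mu" "0 < a" "a \<le> b"
 shows "exp (- (b * exp t) + mu * t) \<le> edom mu a t"
proof (cases "0 \<le> t")
 case True
 \<comment> \<open>For \<open>t \<ge> 0\<close> the quadratic lower bound of \<open>exp t\<close>
   has to pay for \<open>2 mu t\<close>: once for the growth \<open>mu t\<close> that is present,
   once for the decay \<open>- mu t\<close> that is wanted.\<close>
 have "0 \<le> (a * t - 2 * mu)\<^sup>2 / (2 * a)" using assms by simp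
 also have "\<dots> = a * t\<^sup>2 / 2 - 2 * mu * t + 2 * mu\<^sup>2 / a"
  using assms by (simp add: power2_eq_square field_simps)
 finally have 1: "2 * mu * t \<le> a * (t\<^sup>2 / 2) + 2 * mu\<^sup>2 / a" by simp
 have "a * (t\<^sup>2 / 2) \<le> b * exp t" using exp_gt_quadratic[OF True] assms by (intro mult_mono) auto
 then have "- (b * exp t) + mu * t \<le> 2 * mu\<^sup>2 / a + - (mu * \<bar>t\<bar>)" using 1 True by simp
 then show ?thesis unfolding edom_def exp_add[symmetric] by simp
next
 case False
 have "0 \<le> b * exp t" "0 \<le> 2 * mu\<^sup>2 / a" using assms by auto
 then have "- (b * exp t) + mu * t \<le> 2 * mu\<^sup>2 / a + - (mu * \<bar>t\<bar>)" using False by simp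
 then show ?thesis unfolding edom_def exp_add[symmetric] by simp
qed

lemma bker_le_edom:
 assumes "0 < mu" "0 < a" "2 * a \<le> Re z"
 shows "norm (bker mu z y t) \<le> edom mu a t"
proof -
 have "- Re z * ((exp t + y\<^sup>2 * exp (- t)) / 2) + mu * t \<le> - (Re z / 2 * exp t) + mu * t"
  using assms by (simp add: field_simps)
 then have "norm (bker mu z y t) \<le> exp (- (Re z / 2 * exp t) + mu * t)" unfolding norm_bker by simp
 also have "\<dots> \<le> edom mu a t" using assms by (intro exp_le_edom) auto
 finally show ?thesis .
qed

lemma integrable_bker_0: "0 < mu ==> 0 < Re z ==> integrable lborel (bker mu z y)"
 by (rule Bochner_Integration.integrable_bound[OF integrable_edom[of mu "Re z / 2"]])
   (auto intro!: AE_I2 order_trans[OF bker_le_edom abs_ge_self])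

lemma bint_tendsto_0:
 assumes "0 < mu" "0 < Re z"
 shows "((\<lambda>y. bint mu z y) \<longlongrightarrow> bint mu z 0) (at_right 0)"
proof -
 have "continuous_on UNIV (\<lambda>y. bint mu z y)"
  unfolding bint_def
 proof (rule continuous_on_integral_dominated[OF _ _ _ integrable_edom[OF assms(1), of "Re z / 2"]])
  show "continuous_on UNIV (\<lambda>y. bker mu z y t)" for t
   unfolding bker_def by (intro continuous_intros) auto
 qed (use assms in \<open>auto intro!: bker_le_edom\<close>)
 then show ?thesis
  by (simp add: continuous_on_eq_continuous_at isCont_def tendsto_within_subset[of _ _ "0::real" UNIV])
qed

text \<open>Euler's integral after substituting \<open>w = exp t\<close>, the variable in which the
  kernel is written.\<close>

lemma Gamma_exp_integral:
 fixes mu :: real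
 assumes "0 < mu"
 shows "(\<integral>t. exp (- exp t + mu * t) \<partial>lborel) = Gamma mu"
proof -
 let ?f = "\<lambda>w::real. exp (- w) * w powr (mu - 1)"
 have fg: "?f (exp t) * exp t = exp (- exp t + mu * t)" for t
  by (simp add: powr_def exp_add[symmetric] algebra_simps)
 have int: "integrable lborel (\<lambda>t. exp (- exp t + mu * t))"
  by (rule Bochner_Integration.integrable_bound[OF integrable_edom[OF assms, of 1]])
    (use exp_le_edom[OF assms, of 1 1] in \<open>auto intro!: AE_I2 order_trans[OF _ abs_ge_self]\<close>)
 have "((ereal \<circ> exp \<circ> real_of_ereal) \<longlongrightarrow> 0) (at_right (- \<infinity>))"
  using exp_at_bot by (simp add: ereal_tendsto_simps zero_ereal_def tendsto_ereal)
 moreover have "((ereal \<circ> exp \<circ> real_of_ereal) \<longlongrightarrow> \<infinity>) (at_left \<infinity>)"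
  using exp_at_top by (simp add: ereal_tendsto_simps)
 ultimately have *: "(LBINT x=0..\<infinity>. ?f x) = (LBINT x=-\<infinity>..\<infinity>. ?f (exp x) * exp x)"
  by (intro interval_integral_substitution_nonneg(2)[where g = exp and g' = exp and a = "-\<infinity>" and b = \<infinity>])
    (use int in \<open>auto simp: set_integrable_def fg intro!: derivative_eq_intros continuous_intros\<close>)
 have "(\<integral>t. exp (- exp t + mu * t) \<partial>lborel) = (\<integral>w. indicator {0<..} w *\<^sub>R ?f w \<partial>lborel)"
  using * by (simp add: fg interval_lebesgue_integral_def set_lebesgue_integral_def zero_ereal_def)
 also have "\<dots> = enn2real (\<integral>\<^sup>+ w. ennreal (indicator {0<..} w *\<^sub>R ?f w) \<partial>lborel)"
  by (rule integral_eq_nn_integral) (auto intro!: AE_I2 simp: indicator_def)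
 also have "(\<integral>\<^sup>+ w. ennreal (indicator {0<..} w *\<^sub>R ?f w) \<partial>lborel) =
   (\<integral>\<^sup>+ w. ennreal (indicator {0..} w * w powr (mu - 1) / exp w) \<partial>lborel)"
 proof (rule nn_integral_cong_AE)
  have "AE x in lborel. x \<noteq> (0::real)" by (rule AE_lborel_singleton)
  then show "AE w in lborel. ennreal (indicator {0<..} w *\<^sub>R ?f w) = ennreal (indicator {0..} w * w powr (mu - 1) / exp w)"
   by eventually_elim (auto simp: indicator_def exp_minus field_simps)
 qed
 also have "\<dots> = ennreal (Gamma mu)" using Gamma_conv_nn_integral_real[OF assms] by simp
 finally show ?thesis using Gamma_real_pos[OF assms] by simp
qed

lemma bint_0_real:
 assumes "0 < mu" "0 < x"
 shows "bint mu (of_real x) 0 = of_real ((x / 2) powr (- mu) * Gamma mu)"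
proof -
 define s where "s = ln (x / 2)"
 have s: "exp s = x / 2" using assms by (simp add: s_def)
 have "bint mu (of_real x) 0 = (\<integral>t. of_real (exp (- (exp s * exp t) + mu * t)) \<partial>lborel)"
  unfolding bint_def bker_def s by (simp flip: exp_of_real)
 also have "\<dots> = of_real (\<integral>t. exp (- (exp s * exp t) + mu * t) \<partial>lborel)" by simp
 \<comment> \<open>Translating \<open>t\<close> by \<open>s = ln (x / 2)\<close> reduces to Euler's
   integral and releases the power of \<open>x / 2\<close>.\<close>
 also have "(\<integral>t. exp (- (exp s * exp t) + mu * t) \<partial>lborel) = (\<integral>t. exp (- (exp s * exp (- s + 1 * t)) + mu * (- s + 1 * t)) \<partial>lborel)"
  by (subst lborel_integral_real_affine[of 1 _ "- s"]) auto
 also have "\<dots> = (\<integral>t. exp (- mu * s) * exp (- exp t + mu * t) \<partial>lborel)"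
  by (rule Bochner_Integration.integral_cong) (auto simp: exp_add[symmetric] algebra_simps)
 also have "\<dots> = exp (- mu * s) * Gamma mu" using Gamma_exp_integral[OF assms(1)] by simp
 also have "exp (- mu * s) = (x / 2) powr (- mu)" using assms by (simp add: powr_def s_def)
 finally show ?thesis .
qed

lemma bint_0_recurrence:
 assumes "0 < mu" "0 < Re z"
 shows "z / 2 * bint (mu + 1) z 0 = of_real mu * bint mu z 0"
proof -
 note [intro, simp] = integrable_bker_0[OF _ assms(2)]
 let ?f = "\<lambda>t. - (z / 2) * bker (mu + 1) z 0 t + of_real mu * bker mu z 0 t"
 have le: "norm (bker mu z 0 t) \<le> exp (2 * mu\<^sup>2 / (Re z / 2)) * exp (- (mu * \<bar>t\<bar>))" for t
  using bker_le_edom[of mu "Re z / 2" z 0 t] assms by (simp add: edom_def)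
 have ab: "filterlim (\<lambda>t::real. mu * \<bar>t\<bar>) at_top at_top" "filterlim (\<lambda>t::real. mu * \<bar>t\<bar>) at_top at_bot"
  using assms(1) filterlim_at_infinity_imp_norm_at_top[OF filterlim_at_top_imp_at_infinity[OF filterlim_ident]]
   filterlim_at_infinity_imp_norm_at_top[OF filterlim_at_bot_imp_at_infinity[OF filterlim_ident]]
  by (auto intro!: filterlim_tendsto_pos_mult_at_top[OF tendsto_const])
 have ex: "((\<lambda>t. exp (- (mu * \<bar>t\<bar>))) \<longlongrightarrow> 0) at_top" "((\<lambda>t. exp (- (mu * \<bar>t\<bar>))) \<longlongrightarrow> 0) at_bot"
  using ab by (auto intro!: filterlim_compose[OF exp_at_bot] simp: filterlim_uminus_at_bot)
 have "(\<integral>t. ?f t \<partial>lborel) = 0"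
 proof (rule integral_derivative_zero[where F = "bker mu z 0"])
  show "(bker mu z 0 has_vector_derivative ?f t) (at t)" for t
   using bker_deriv_t[of mu z 0 t] by simp
  show "continuous_on UNIV ?f" unfolding bker_def by (intro continuous_intros) auto
  show "integrable lborel ?f" using assms by (intro Bochner_Integration.integrable_add integrable_mult_right) auto
  show "(bker mu z 0 \<longlongrightarrow> 0) at_top"
   by (rule Lim_null_comparison[OF always_eventually[OF allI[OF le]] tendsto_mult_right_zero[OF ex(1)]])
  show "(bker mu z 0 \<longlongrightarrow> 0) at_bot"
   by (rule Lim_null_comparison[OF always_eventually[OF allI[OF le]] tendsto_mult_right_zero[OF ex(2)]])
 qed
 then have "- (z / 2) * bint (mu + 1) z 0 + of_real mu * bint mu z 0 = 0"
  unfolding bint_def using assms by (subst (asm) Bochner_Integration.integral_add) auto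
 then show ?thesis by (simp add: algebra_simps)
qed

text \<open>For non-real \<open>z\<close> the translation in \<open>bint_0_real\<close> would leave
  the real line. Instead \<open>(z / 2)^mu * bint mu z 0\<close> is constant along the vertical line
  through \<open>z\<close>, because \<open>bint_0_recurrence\<close> makes its derivative vanish;
  its value is read off at the real point of that line.\<close>

lemma bint_0:
 assumes "0 < mu" "0 < Re z"
 shows "bint mu z 0 = (z / 2) powr (- of_real mu) * of_real (Gamma mu)"
proof -
 define a where "a = Re z"
 have a: "0 < a" using assms by (simp add: a_def)
 define w where "w = (\<lambda>x. Complex a x)"
 have Rw: "Re (w x) = a" for x by (simp add: w_def)
 have wd: "(w has_vector_derivative \<i>) (at x)" for x
 proof -
  have "((\<lambda>x. of_real a + \<i> * of_real x) has_vector_derivative \<i>) (at x)"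
   by (auto intro!: derivative_eq_intros has_vector_derivative_real_field)
  then show ?thesis by (simp add: w_def complex_eq_iff Complex_eq)
 qed
 have w0: "w x \<noteq> 0" for x using Rw[of x] a by auto
 have dJ: "((\<lambda>x. bint mu (w x) 0) has_vector_derivative - (\<i> / 2) * bint (mu + 1) (w x) 0) (at x)" for x
 proof -
  have "((\<lambda>x. \<integral>t. bker mu (w x) 0 t \<partial>lborel) has_vector_derivative (\<integral>t. - (\<i> / 2) * bker (mu + 1) (w x) 0 t \<partial>lborel)) (at x)"
  proof (rule has_vector_derivative_integral[where S = UNIV and g = "\<lambda>t. edom (mu + 1) (a / 2) t"])
   fix x t
   show "((\<lambda>x. bker mu (w x) 0 t) has_vector_derivative - (\<i> / 2) * bker (mu + 1) (w x) 0 t) (at x)"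
   proof -
    have "((\<lambda>x. - w x * of_real (exp t / 2) + of_real (mu * t)) has_vector_derivative - \<i> * of_real (exp t / 2) + 0) (at x)"
     by (intro has_vector_derivative_add has_vector_derivative_mult_left has_vector_derivative_minus wd
       has_vector_derivative_const)
    from exp_has_vector_derivative[OF this] show ?thesis
     unfolding bker_shift by (simp add: bker_def mult.assoc)
   qed
   have "norm (bker (mu + 1) (w x) 0 t) \<le> edom (mu + 1) (a / 2) t"
    using assms a Rw by (intro bker_le_edom) auto
   then show "norm (- (\<i> / 2) * bker (mu + 1) (w x) 0 t) \<le> edom (mu + 1) (a / 2) t"
    by (simp add: norm_mult) (smt (verit) norm_ge_zero)
  qed (use assms a Rw in \<open>auto intro!: integrable_bker_0 integrable_edom\<close>)
  then show ?thesis by (simp add: bint_def)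
 qed
 have dJ': "((\<lambda>x. bint mu (w x) 0) has_vector_derivative - \<i> * of_real mu / w x * bint mu (w x) 0) (at x)" for x
 proof -
  have "bint (mu + 1) (w x) 0 = 2 / w x * (of_real mu * bint mu (w x) 0)"
   using bint_0_recurrence[OF assms(1), of "w x"] a Rw w0[of x] by (simp add: field_simps)
  then have "- (\<i> / 2) * bint (mu + 1) (w x) 0 = - \<i> * of_real mu / w x * bint mu (w x) 0"
   by (simp add: field_simps)
  then show ?thesis using dJ[of x] by simp
 qed
 have dP: "((\<lambda>x. (w x / 2) powr of_real mu) has_vector_derivative \<i> * of_real mu / w x * (w x / 2) powr of_real mu) (at x)" for x
 proof -
  have "((\<lambda>v. (v / 2) powr of_real mu) has_field_derivative of_real mu / w x * (w x / 2) powr of_real mu) (at (w x))"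
   using Rw[of x] a w0[of x]
   by (auto intro!: derivative_eq_intros simp: complex_nonpos_Reals_iff powr_diff field_simps)
  from field_vector_diff_chain_at[OF wd this] show ?thesis by (simp add: o_def mult_ac)
 qed
 have "\<exists>c. \<forall>x. (w x / 2) powr of_real mu * bint mu (w x) 0 = c"
 proof -
  have "((\<lambda>x. (w x / 2) powr of_real mu * bint mu (w x) 0) has_vector_derivative 0) (at x)" for x
   using has_vector_derivative_mult[OF dP dJ', of x] by (simp add: field_simps)
  then obtain c where "\<And>x. x \<in> UNIV ==> (w x / 2) powr of_real mu * bint mu (w x) 0 = c"
   using has_vector_derivative_zero_constant[of UNIV "\<lambda>x. (w x / 2) powr of_real mu * bint mu (w x) 0"] by auto
  then show ?thesis by blast
 qed
 then have eq: "(w (Im z) / 2) powr of_real mu * bint mu (w (Im z)) 0 = (w 0 / 2) powr of_real mu * bint mu (w 0) 0"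
  by metis
 have "w 0 = of_real a" by (simp add: w_def complex_eq_iff)
 then have "(w 0 / 2) powr of_real mu * bint mu (w 0) 0 = of_real ((a / 2) powr mu) * of_real ((a / 2) powr (- mu) * Gamma mu)"
  using bint_0_real[OF assms(1) a] powr_of_real[of "a / 2" mu] a by simp
 also have "\<dots> = of_real (Gamma mu)"
  using a by (simp add: powr_minus flip: of_real_mult)
 finally have "(z / 2) powr of_real mu * bint mu z 0 = of_real (Gamma mu)"
  using eq by (simp add: w_def a_def)
 moreover have "z \<noteq> 0" using assms by auto
 ultimately show ?thesis by (simp add: powr_minus field_simps)
qed

text \<open>Absolute values replace \<open>z\<close> by \<open>Re z\<close> and allow
  \<open>y\<close> to be dropped, after which the real formula applies. Being independent of
  \<open>y\<close>, the bound dominates the passage to the boundary.\<close>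

lemma norm_bint_le_Gamma:
 assumes "0 < mu" "0 < Re z"
 shows "norm (bint mu z y) \<le> (Re z / 2) powr (- mu) * Gamma mu"
proof -
 have "norm (bint mu z y) \<le> (\<integral>t. norm (bker mu (of_real (Re z)) 0 t) \<partial>lborel)"
  unfolding bint_def
 proof (rule Bochner_Integration.integral_norm_bound_integral)
  show "norm (bker mu z y t) \<le> norm (bker mu (of_real (Re z)) 0 t)" for t
   using assms unfolding norm_bker by (simp add: mult_left_mono field_simps)
 qed (use assms in \<open>auto intro!: integrable_bker_0 integrable_norm\<close>)
 also have "\<dots> = (\<integral>t. Re (bker mu (of_real (Re z)) 0 t) \<partial>lborel)"
 proof (rule Bochner_Integration.integral_cong[OF refl])
  fix t
  have "bker mu (of_real (Re z)) 0 t = of_real (exp (- Re z * ((exp t + 0\<^sup>2 * exp (- t)) / 2) + mu * t))"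
   unfolding bker_def by (simp only: exp_of_real[symmetric] of_real_add of_real_mult of_real_minus)
  then show "norm (bker mu (of_real (Re z)) 0 t) = Re (bker mu (of_real (Re z)) 0 t)" by simp
 qed
 also have "\<dots> = Re (bint mu (of_real (Re z)) 0)"
  using assms unfolding bint_def by (intro integral_Re) (auto intro!: integrable_bker_0)
 also have "\<dots> = (Re z / 2) powr (- mu) * Gamma mu" using bint_0_real[of mu "Re z"] assms by simp
 finally show ?thesis .
qed

section \<open>Fourier inversion\<close>

lemma integrable_pair_bound:
 fixes h :: "'a \<times> 'b => 'c::{banach, second_countable_topology}" and f :: "'a => real" and g :: "'b => real"
 assumes "sigma_finite_measure M1" "sigma_finite_measure M2"
  and [measurable]: "h \<in> borel_measurable (M1 \<Otimes>\<^sub>M M2)"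
  and "integrable M1 f" "integrable M2 g"
  and le: "AE p in M1 \<Otimes>\<^sub>M M2. norm (h p) \<le> f (fst p) * g (snd p)"
 shows "integrable (M1 \<Otimes>\<^sub>M M2) h"
proof -
 interpret A: sigma_finite_measure M1 by fact
 interpret B: sigma_finite_measure M2 by fact
 interpret pair_sigma_finite M1 M2 ..
 have [measurable]: "f \<in> borel_measurable M1" "g \<in> borel_measurable M2" using assms by auto
 have "integrable (M1 \<Otimes>\<^sub>M M2) (\<lambda>p. f (fst p) * g (snd p))"
 proof (rule Fubini_integrable)
  have "integrable M1 (\<lambda>x. norm (f x) * (\<integral>y. norm (g y) \<partial>M2))"
   using assms by (intro integrable_mult_left integrable_norm)
  then show "integrable M1 (\<lambda>x. \<integral>y. norm (f (fst (x, y)) * g (snd (x, y))) \<partial>M2)"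
   by (simp add: abs_mult)
 qed (use assms in auto)
 then show ?thesis
  by (rule Bochner_Integration.integrable_bound) (use le in \<open>auto elim!: eventually_mono\<close>)
qed

text \<open>The positive and the negative part have the same mass \<open>c\<close> and the same
  transform. Divided by \<open>c\<close> they are probability densities with equal characteristic
  functions, so Levy's uniqueness theorem identifies them; for \<open>c = 0\<close> both parts
  vanish outright.\<close>

lemma fourier_zero_real:
 fixes g :: "real => real"
 assumes g: "integrable lborel g" and 0: "\<And>xi. (\<integral>t. eix (xi * t) * of_real (g t) \<partial>lborel) = 0"
 shows "AE t in lborel. g t = 0"
proof -
 define p where "p = (\<lambda>t. max 0 (g t))"
 define n where "n = (\<lambda>t. max 0 (- g t))"
 have pint: "integrable lborel p" and nint: "integrable lborel n"
  unfolding p_def n_def using g by (auto intro!: integrable_max)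
 have [measurable]: "p \<in> borel_measurable borel" "n \<in> borel_measurable borel"
  using pint nint by auto
 have pn: "g t = p t - n t" "0 \<le> p t" "0 \<le> n t" for t by (auto simp: p_def n_def)
 have eqF: "(\<integral>t. eix (xi * t) * of_real (p t) \<partial>lborel) = (\<integral>t. eix (xi * t) * of_real (n t) \<partial>lborel)" for xi
 proof -
  have i: "integrable lborel (\<lambda>t. eix (xi * t) * complex_of_real (h t))" if "integrable lborel h" for h
   by (rule Bochner_Integration.integrable_bound[OF that]) (use that in \<open>auto simp: norm_mult\<close>)
  show ?thesis using 0[of xi] unfolding pn(1) of_real_diff right_diff_distrib
   by (subst (asm) Bochner_Integration.integral_diff) (use i[OF pint] i[OF nint] in auto)
 qed
 define c where "c = (\<integral>t. p t \<partial>lborel)"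
 have "complex_of_real (\<integral>t. p t \<partial>lborel) = complex_of_real (\<integral>t. n t \<partial>lborel)"
  using eqF[of 0] by simp
 then have cn: "(\<integral>t. n t \<partial>lborel) = c" by (simp add: c_def)
 show ?thesis
 proof (cases "c = 0")
  case True
  then have "AE t in lborel. p t = 0" "AE t in lborel. n t = 0"
   using integral_nonneg_eq_0_iff_AE[OF pint] integral_nonneg_eq_0_iff_AE[OF nint] pn cn
   by (auto simp: c_def)
  then show ?thesis by eventually_elim (simp add: pn(1))
 next
  case False
  have "0 \<le> c" unfolding c_def using pn by (intro Bochner_Integration.integral_nonneg) auto
  then have c: "0 < c" using False by simp
  define D where "D = (\<lambda>h::real=>real. density lborel (\<lambda>t. ennreal (h t / c)))"
  have rd: "real_distribution (D h)"
   if h: "integrable lborel h" "\<And>t. 0 \<le> h t" "(\<integral>t. h t \<partial>lborel) = c" for h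
  proof -
   have [measurable]: "h \<in> borel_measurable borel" using h by auto
   have "(\<integral>\<^sup>+t. ennreal (h t / c) \<partial>lborel) = ennreal (\<integral>t. h t / c \<partial>lborel)"
    using h c by (intro nn_integral_eq_integral) auto
   also have "(\<integral>t. h t / c \<partial>lborel) = 1" using h(3) c by simp
   finally have "prob_space (D h)"
    by (intro prob_spaceI) (simp add: D_def emeasure_density)
   then show ?thesis by (auto simp: real_distribution_def real_distribution_axioms_def D_def)
  qed
  have ch: "char (D h) = (\<lambda>xi. (\<integral>t. eix (xi * t) * of_real (h t) \<partial>lborel) / of_real c)"
   if h: "integrable lborel h" "\<And>t. 0 \<le> h t" for h
  proof
   fix xi
   have [measurable]: "h \<in> borel_measurable borel" using h by auto
   have "char (D h) xi = (\<integral>t. (h t / c) *\<^sub>R eix (xi * t) \<partial>lborel)"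
    unfolding char_def D_def using h c by (subst integral_density) auto
   also have "\<dots> = (\<integral>t. eix (xi * t) * of_real (h t) / of_real c \<partial>lborel)"
    by (rule Bochner_Integration.integral_cong) (auto simp: scaleR_conv_of_real)
   finally show "char (D h) xi = (\<integral>t. eix (xi * t) * of_real (h t) \<partial>lborel) / of_real c" by simp
  qed
  have "D p = D n"
   by (rule Levy_uniqueness) (use rd ch pint nint pn cn c_def eqF in auto)
  then have "AE t in lborel. ennreal (p t / c) = ennreal (n t / c)"
   unfolding D_def by (subst (asm) sigma_finite_measure.density_unique_iff[OF sigma_finite_lborel]) auto
  then show ?thesis
   by eventually_elim (use pn c in \<open>simp add: ennreal_inj\<close>)
 qed
qed

lemma measurable_cnj [measurable]: "cnj \<in> borel_measurable borel"
 by (intro borel_measurable_continuous_onI continuous_intros)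

text \<open>Conjugation turns the transform at \<open>- xi\<close> into that of \<open>cnj g\<close>
  at \<open>xi\<close>. Hence the real and imaginary parts of \<open>g\<close> have vanishing
  transforms too.\<close>

lemma fourier_zero:
 fixes g :: "real => complex"
 assumes g: "integrable lborel g" and 0: "\<And>xi. (\<integral>t. eix (xi * t) * g t \<partial>lborel) = 0"
 shows "AE t in lborel. g t = 0"
proof -
 have [measurable]: "g \<in> borel_measurable borel" using g by auto
 have i: "integrable lborel (\<lambda>t. eix (xi * t) * g t)" "integrable lborel (\<lambda>t. eix (xi * t) * cnj (g t))" for xi
  by (rule Bochner_Integration.integrable_bound[OF g], use g in \<open>auto simp: norm_mult\<close>)+
 have 1: "(\<integral>t. eix (xi * t) * cnj (g t) \<partial>lborel) = 0" for xi
 proof -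
  have "(\<integral>t. eix (xi * t) * cnj (g t) \<partial>lborel) = (\<integral>t. cnj (eix ((- xi) * t) * g t) \<partial>lborel)"
   by (simp add: exp_cnj)
  also have "\<dots> = cnj (\<integral>t. eix ((- xi) * t) * g t \<partial>lborel)" 
   by (rule integral_bounded_linear[OF bounded_linear_cnj i(1)])
  finally show ?thesis using 0[of "- xi"] by simp
 qed
 have "AE t in lborel. Re (g t) = 0"
 proof (rule fourier_zero_real)
  fix xi
  have eq: "eix (xi * t) * of_real (Re (g t)) = (eix (xi * t) * g t + eix (xi * t) * cnj (g t)) / 2" for t
   by (simp add: distrib_left[symmetric] complex_add_cnj)
  show "(\<integral>t. eix (xi * t) * of_real (Re (g t)) \<partial>lborel) = 0"
   unfolding eq using 0[of xi] 1[of xi] i[of xi] by simp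
 qed (use g in auto)
 moreover have "AE t in lborel. Im (g t) = 0"
 proof (rule fourier_zero_real)
  fix xi
  have eq: "eix (xi * t) * of_real (Im (g t)) = (eix (xi * t) * g t - eix (xi * t) * cnj (g t)) / (2 * \<i>)" for t
  proof -
   have "eix (xi * t) * g t - eix (xi * t) * cnj (g t) = eix (xi * t) * (of_real (2 * Im (g t)) * \<i>)"
    unfolding right_diff_distrib[symmetric] complex_diff_cnj ..
   then show ?thesis by (simp add: field_simps)
  qed
  show "(\<integral>t. eix (xi * t) * of_real (Im (g t)) \<partial>lborel) = 0"
   unfolding eq using 0[of xi] 1[of xi] i[of xi] by simp
 qed (use g in auto)
 ultimately show ?thesis by eventually_elim (simp add: complex_eq_iff)
qed

lemma gaussian_fourier:
 "(\<integral>\<xi>. of_real (std_normal_density \<xi>) * eix (t * \<xi>) \<partial>lborel) = (of_real (exp (- t\<^sup>2 / 2)) :: complex)"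
proof -
 have "of_real (exp (- t\<^sup>2 / 2)) = char std_normal_distribution t" by (simp add: char_std_normal_distribution)
 also have "\<dots> = (\<integral>\<xi>. std_normal_density \<xi> *\<^sub>R eix (t * \<xi>) \<partial>lborel)"
  unfolding char_def by (subst integral_density) auto
 finally show ?thesis by (simp add: scaleR_conv_of_real)
qed

text \<open>Both sides of the inversion formula have the same Fourier transform after multiplication
 with a Gaussian, by the multiplication formula.\<close>

lemma fourier_inversion:
 fixes g gh :: "real => complex"
 assumes g: "integrable lborel g" and gh: "integrable lborel gh"
  and gh_def: "\<And>xi. gh xi = (\<integral>t. exp (- (\<i> * of_real (xi * t))) * g t \<partial>lborel)"
 shows "AE t in lborel. g t = (\<integral>xi. eix (xi * t) * gh xi \<partial>lborel) / of_real (2 * pi)"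
proof -
 have [measurable]: "g \<in> borel_measurable borel" "gh \<in> borel_measurable borel" using g gh by auto
 define G where "G = (\<lambda>t. (\<integral>xi. eix (xi * t) * gh xi \<partial>lborel) / of_real (2 * pi))"
 \<comment> \<open>The candidate \<open>G\<close> is only known to be bounded. The weight
   \<open>E\<close> makes the difference integrable, so that \<open>fourier_zero\<close> applies,
   and it has no zeros, so it can be divided out afterwards.\<close>
 define E where "E = (\<lambda>t::real. complex_of_real (exp (- t\<^sup>2 / 2)))"
 let ?n = "\<lambda>x. complex_of_real (std_normal_density x)"
 have [measurable]: "G \<in> borel_measurable borel" unfolding G_def by measurable
 have [measurable]: "E \<in> borel_measurable borel" unfolding E_def by measurable
 have ndens: "E x = of_real (sqrt (2 * pi)) * ?n x" for x
  by (simp add: E_def std_normal_density_def)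
 have sq: "of_real (sqrt (2 * pi)) * of_real (sqrt (2 * pi)) = complex_of_real (2 * pi)"
  by (simp flip: of_real_mult)
 have nint: "integrable lborel (\<lambda>x. std_normal_density x)" by (rule integrable_normal_density) simp
 have Eint: "integrable lborel (\<lambda>x. norm (E x))"
  unfolding ndens norm_mult using nint by (intro integrable_mult_right integrable_norm) (simp add: integrable_of_real)
 define C where "C = (\<integral>xi. norm (gh xi) \<partial>lborel) / (2 * pi)"
 have Gb: "norm (G t) \<le> C" for t
  unfolding G_def C_def norm_divide
  by (rule order_trans[OF divide_right_mono[OF integral_norm_bound]]) (auto simp: norm_mult)
 have EG: "integrable lborel (\<lambda>t. E t * G t)"
 proof (rule Bochner_Integration.integrable_bound[OF integrable_mult_left[OF Eint, of C]])
  have "norm (E t * G t) \<le> norm (norm (E t) * C)" for t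
   using mult_left_mono[OF Gb, of "norm (E t)" t] order_trans[OF norm_ge_zero Gb]
   by (simp add: norm_mult)
  then show "AE t in lborel. norm (E t * G t) \<le> norm (norm (E t) * C)" by blast
 qed auto
 have Eg: "integrable lborel (\<lambda>t. E t * g t)"
  by (rule Bochner_Integration.integrable_bound[OF g])
    (auto simp: norm_mult E_def intro!: AE_I2 mult_left_le_one_le)
 have "AE t in lborel. E t * g t - E t * G t = 0"
 proof (rule fourier_zero)
  fix s
  have iE: "integrable lborel (\<lambda>t. eix (s * t) * (E t * g t))"
   "integrable lborel (\<lambda>t. eix (s * t) * (E t * G t))"
   by (rule Bochner_Integration.integrable_bound[OF Eg], auto simp: norm_mult)
     (rule Bochner_Integration.integrable_bound[OF EG], auto simp: norm_mult)
  have A: "(\<integral>t. eix (s * t) * (E t * g t) \<partial>lborel) = (\<integral>\<xi>. ?n \<xi> * gh (\<xi> - s) \<partial>lborel)"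
  proof -
   let ?h = "\<lambda>t \<xi>. eix (s * t) * g t * (?n \<xi> * eix ((- t) * \<xi>))"
   have "integrable (lborel2) (case_prod ?h)"
    by (rule integrable_pair_bound[OF sigma_finite_lborel sigma_finite_lborel _ integrable_norm[OF g] integrable_norm[OF nint]])
      (auto simp: norm_mult)
   then have "(\<integral>\<xi>. \<integral>t. ?h t \<xi> \<partial>lborel \<partial>lborel) = (\<integral>t. \<integral>\<xi>. ?h t \<xi> \<partial>lborel \<partial>lborel)"
    by (rule lborel_pair.Fubini_integral)
   also have "(\<lambda>t. \<integral>\<xi>. ?h t \<xi> \<partial>lborel) = (\<lambda>t. eix (s * t) * (E t * g t))"
    by (intro ext, simp only: integral_mult_right_zero gaussian_fourier) (simp add: E_def mult_ac)
   finally have "(\<integral>t. eix (s * t) * (E t * g t) \<partial>lborel) = (\<integral>\<xi>. \<integral>t. ?h t \<xi> \<partial>lborel \<partial>lborel)" ..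
   also have "(\<lambda>\<xi>. \<integral>t. ?h t \<xi> \<partial>lborel) = (\<lambda>\<xi>. ?n \<xi> * gh (\<xi> - s))"
   proof
    fix \<xi>
    have eq: "?h t \<xi> = ?n \<xi> * (exp (- (\<i> * of_real ((\<xi> - s) * t))) * g t)" for t
    proof -
     have e: "eix (s * t) * eix ((- t) * \<xi>) = exp (- (\<i> * of_real ((\<xi> - s) * t)))"
      unfolding exp_add[symmetric] by (rule arg_cong[where f = exp]) (simp add: algebra_simps)
     show ?thesis unfolding e[symmetric] by (simp only: mult_ac)
    qed
    show "(\<integral>t. ?h t \<xi> \<partial>lborel) = ?n \<xi> * gh (\<xi> - s)" unfolding eq gh_def by simp
   qed
   finally show ?thesis .
  qed
  have B: "(\<integral>t. eix (s * t) * (E t * G t) \<partial>lborel) = (\<integral>xi. ?n (s + xi) * gh xi \<partial>lborel)"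
  proof -
   let ?h = "\<lambda>t xi. eix (s * t) * E t * (eix (xi * t) * gh xi)"
   have "integrable (lborel2) (case_prod ?h)"
    by (rule integrable_pair_bound[OF sigma_finite_lborel sigma_finite_lborel _ Eint integrable_norm[OF gh]])
      (auto simp: norm_mult)
   then have "(\<integral>xi. \<integral>t. ?h t xi \<partial>lborel \<partial>lborel) = (\<integral>t. \<integral>xi. ?h t xi \<partial>lborel \<partial>lborel)"
    by (rule lborel_pair.Fubini_integral)
   also have "(\<lambda>t. \<integral>xi. ?h t xi \<partial>lborel) = (\<lambda>t. of_real (2 * pi) * (eix (s * t) * (E t * G t)))"
   proof
    fix t
    have "(\<integral>xi. eix (xi * t) * gh xi \<partial>lborel) = of_real (2 * pi) * G t" by (simp add: G_def)
    then show "(\<integral>xi. ?h t xi \<partial>lborel) = of_real (2 * pi) * (eix (s * t) * (E t * G t))"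
     unfolding integral_mult_right_zero by (simp only: mult_ac)
   qed
   finally have "of_real (2 * pi) * (\<integral>t. eix (s * t) * (E t * G t) \<partial>lborel) = (\<integral>xi. \<integral>t. ?h t xi \<partial>lborel \<partial>lborel)"
    by simp
   also have "(\<lambda>xi. \<integral>t. ?h t xi \<partial>lborel) = (\<lambda>xi. of_real (2 * pi) * (?n (s + xi) * gh xi))"
   proof
    fix xi
    have eq: "?h t xi = gh xi * (of_real (sqrt (2 * pi)) * (?n t * eix ((s + xi) * t)))" for t
    proof -
     have e: "eix (s * t) * eix (xi * t) = eix ((s + xi) * t)"
      unfolding exp_add[symmetric] by (rule arg_cong[where f = exp]) (simp add: algebra_simps)
     show ?thesis unfolding ndens e[symmetric] by (simp only: mult_ac)
    qed
    have "(\<integral>t. ?h t xi \<partial>lborel) = gh xi * (of_real (sqrt (2 * pi)) * E (s + xi))"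
     unfolding eq integral_mult_right_zero
     using gaussian_fourier[of "s + xi"] by (simp add: E_def mult.commute)
    then show "(\<integral>t. ?h t xi \<partial>lborel) = of_real (2 * pi) * (?n (s + xi) * gh xi)"
     unfolding ndens sq[symmetric] by (simp only: mult_ac)
   qed
   finally show ?thesis by simp
  qed
  have "(\<integral>\<xi>. ?n \<xi> * gh (\<xi> - s) \<partial>lborel) = (\<integral>xi. ?n (s + xi) * gh xi \<partial>lborel)"
   by (subst lborel_integral_real_affine[of 1 _ s]) auto
  then show "(\<integral>t. eix (s * t) * (E t * g t - E t * G t) \<partial>lborel) = 0"
   unfolding right_diff_distrib Bochner_Integration.integral_diff[OF iE] A B by simp
 qed (use EG Eg in auto)
 then have "AE t in lborel. g t = G t"
  by eventually_elim (simp add: E_def)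
 then show ?thesis by (simp add: G_def)
qed

section \<open>Laplace transforms of test functions\<close>

text \<open>A test function is carried together with all its derivatives, so that decay of its
  transform to any order is a matter of choosing an index. One \<open>T\<close> bounds the supports
  of all members.\<close>

definition test_seq :: "(nat => real => complex) => real => bool" where
 "test_seq F T \<longleftrightarrow> 0 < T \<and> (\<forall>k t. (F k has_vector_derivative F (Suc k) t) (at t)) \<and>
   (\<forall>k t. T < \<bar>t\<bar> --> F k t = 0)"

definition lap :: "(real => complex) => complex => complex" where
 "lap f w = (\<integral>t. exp (- (w * of_real t)) * f t \<partial>lborel)"

lemma test_seq_continuous: "test_seq F T ==> continuous_on S (F k)"
 unfolding test_seq_def
 by (meson continuous_at_imp_continuous_on has_vector_derivative_continuous)

lemma test_seq_measurable: "test_seq F T ==> F k \<in> borel_measurable borel"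
 using test_seq_continuous borel_measurable_continuous_onI by blast

lemma test_seq_integrable: "test_seq F T ==> integrable lborel (F k)"
proof -
 assume F: "test_seq F T"
 have "set_integrable lborel {-T..T} (F k)"
  unfolding set_integrable_def by (rule borel_integrable_compact) (auto intro!: test_seq_continuous[OF F])
 moreover have "indicator {-T..T} t *\<^sub>R F k t = F k t" for t
  using F by (auto simp: test_seq_def indicator_def)
 ultimately show ?thesis by (simp add: set_integrable_def)
qed

lemma test_seq_exp_bound:
 assumes "test_seq F T" "0 \<le> Re w" "Re w \<le> 1"
 shows "norm (exp (- (w * of_real t)) * F k t) \<le> exp T * norm (F k t)"
proof (cases "T < \<bar>t\<bar>")
 case False
 have "- (Re w * t) \<le> Re w * T" using False assms mult_left_mono[of "- t" T "Re w"] by auto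
 also have "\<dots> \<le> 1 * T" using assms by (intro mult_right_mono) (auto simp: test_seq_def)
 finally show ?thesis by (simp add: norm_mult mult_right_mono)
qed (use assms in \<open>auto simp: test_seq_def\<close>)

lemma lap_integrable:
 assumes "test_seq F T"
 shows "integrable lborel (\<lambda>t. exp (- (w * of_real t)) * F k t)"
proof -
 have "continuous_on UNIV (\<lambda>t. exp (- (w * of_real t)) * F k t)"
  by (intro continuous_intros test_seq_continuous[OF assms])
 then have "set_integrable lborel {-T..T} (\<lambda>t. exp (- (w * of_real t)) * F k t)"
  unfolding set_integrable_def by (intro borel_integrable_compact) (auto intro: continuous_on_subset)
 moreover have "indicator {-T..T} t *\<^sub>R (exp (- (w * of_real t)) * F k t) = exp (- (w * of_real t)) * F k t" for t
  using assms by (auto simp: test_seq_def indicator_def)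
 ultimately show ?thesis by (simp add: set_integrable_def)
qed

lemma norm_lap_le:
 assumes "test_seq F T" "0 \<le> Re w" "Re w \<le> 1"
 shows "norm (lap (F k) w) \<le> exp T * (\<integral>t. norm (F k t) \<partial>lborel)"
proof -
 have "norm (lap (F k) w) \<le> (\<integral>t. exp T * norm (F k t) \<partial>lborel)"
  unfolding lap_def
  by (rule Bochner_Integration.integral_norm_bound_integral)
    (use assms lap_integrable[OF assms(1)] test_seq_integrable[OF assms(1)] test_seq_exp_bound[OF assms] in auto)
 then show ?thesis by simp
qed

lemma lap_deriv:
 assumes F: "test_seq F T"
 shows "lap (F (Suc k)) w = w * lap (F k) w"
proof -
 let ?f = "\<lambda>t. exp (- (w * of_real t)) * F (Suc k) t + (- w * exp (- (w * of_real t))) * F k t"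
 have "(\<integral>t. ?f t \<partial>lborel) = 0"
 proof (rule integral_derivative_zero[where F = "\<lambda>t. exp (- (w * of_real t)) * F k t"])
  show "((\<lambda>t. exp (- (w * of_real t)) * F k t) has_vector_derivative ?f t) (at t)" for t
  proof (rule has_vector_derivative_mult)
   show "((\<lambda>t. exp (- (w * of_real t))) has_vector_derivative - w * exp (- (w * of_real t))) (at t)"
    by (rule has_vector_derivative_real_field) (auto intro!: derivative_eq_intros)
  qed (use F in \<open>simp add: test_seq_def\<close>)
  show "continuous_on UNIV ?f" by (intro continuous_intros test_seq_continuous[OF F])
  show "integrable lborel ?f"
   using lap_integrable[OF F, of w] by (auto simp: mult.assoc)
  have "\<forall>\<^sub>F t in at_top. 0 = exp (- (w * of_real t)) * F k t"
   using eventually_gt_at_top[of T] by eventually_elim (use F in \<open>auto simp: test_seq_def\<close>)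
  then show "((\<lambda>t. exp (- (w * of_real t)) * F k t) \<longlongrightarrow> 0) at_top"
   by (rule Lim_transform_eventually[OF tendsto_const])
  have "\<forall>\<^sub>F t in at_bot. 0 = exp (- (w * of_real t)) * F k t"
   using eventually_gt_at_bot[of "- T"] by eventually_elim (use F in \<open>auto simp: test_seq_def\<close>)
  then show "((\<lambda>t. exp (- (w * of_real t)) * F k t) \<longlongrightarrow> 0) at_bot"
   by (rule Lim_transform_eventually[OF tendsto_const])
 qed
 moreover have "(\<integral>t. ?f t \<partial>lborel) = lap (F (Suc k)) w + (- w) * lap (F k) w"
  unfolding lap_def mult.assoc using lap_integrable[OF F, of w]
  by (subst Bochner_Integration.integral_add) auto
 ultimately show ?thesis by simp
qed

lemma lap_power: "test_seq F T ==> lap (F N) w = w ^ N * lap (F 0) w"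
 by (induction N) (auto simp: lap_deriv)

lemma one_plus_power_le: "0 \<le> x ==> (1 + x) ^ N \<le> 2 ^ N * (1 + x ^ N)" for x :: real
proof -
 assume x: "0 \<le> x"
 have "(1 + x) ^ N \<le> (2 * max 1 x) ^ N" using x by (intro power_mono) auto
 also have "\<dots> = 2 ^ N * max 1 x ^ N" by (simp add: power_mult_distrib)
 also have "max 1 x ^ N \<le> 1 + x ^ N" using x by (auto simp: max_def)
 finally show ?thesis by simp
qed

text \<open>By \<open>lap_power\<close> the factor \<open>w^N\<close> is exchanged for the transform
  of the derivative \<open>F N\<close>, which is bounded on the strip because the support is
  compact. Uniformity over the strip matters later, when \<open>Re w\<close> is tied to the time
  \<open>t\<close>.\<close>

lemma lap_rapid:
 assumes F: "test_seq F T"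
 obtains C where "\<And>w. 0 \<le> Re w ==> Re w \<le> 1 ==> (1 + \<bar>Im w\<bar>) ^ N * norm (lap (F 0) w) \<le> C"
proof
 fix w assume w: "0 \<le> Re w" "Re w \<le> 1"
 have "(1 + \<bar>Im w\<bar>) ^ N \<le> 2 ^ N * (1 + \<bar>Im w\<bar> ^ N)" by (rule one_plus_power_le) simp
 also have "\<dots> \<le> 2 ^ N * (1 + norm w ^ N)"
  by (intro mult_left_mono add_left_mono power_mono abs_Im_le_cmod) auto
 finally have "(1 + \<bar>Im w\<bar>) ^ N * norm (lap (F 0) w) \<le> 2 ^ N * (1 + norm w ^ N) * norm (lap (F 0) w)"
  by (rule mult_right_mono) simp
 also have "\<dots> = 2 ^ N * (norm (lap (F 0) w) + norm (lap (F N) w))"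
  by (simp add: lap_power[OF F, of N w] norm_mult norm_power algebra_simps)
 also have "\<dots> \<le> 2 ^ N * (exp T * (\<integral>t. norm (F 0 t) \<partial>lborel) + exp T * (\<integral>t. norm (F N t) \<partial>lborel))"
  using norm_lap_le[OF F w] by (intro mult_left_mono add_mono) auto
 finally show "(1 + \<bar>Im w\<bar>) ^ N * norm (lap (F 0) w) \<le> 2 ^ N * (exp T * (\<integral>t. norm (F 0 t) \<partial>lborel) + exp T * (\<integral>t. norm (F N t) \<partial>lborel))" .
qed

lemma continuous_on_lap:
 assumes F: "test_seq F T"
 shows "continuous_on {w. 0 \<le> Re w \<and> Re w \<le> 1} (lap (F k))"
 unfolding lap_def
 by (rule continuous_on_integral_dominated[where g = "\<lambda>t. exp T * norm (F k t)"])
   (use test_seq_measurable[OF F, of k] F test_seq_integrable[OF F, of k] test_seq_exp_bound[OF F, of _ _ k] in \<open>auto intro!: continuous_intros\<close>)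

text \<open>Leibniz rule for the derivatives of \<open>t F 0 t\<close>. At \<open>k = 0\<close> the
  truncated index \<open>k - 1\<close> is harmless, since its factor is zero.\<close>

definition times_t :: "(nat => real => complex) => nat => real => complex" where
 "times_t F k t = of_real t * F k t + of_nat k * F (k - 1) t"

lemma times_t_0: "times_t F 0 t = of_real t * F 0 t"
 by (simp add: times_t_def)

lemma test_seq_times_t:
 assumes F: "test_seq F T"
 shows "test_seq (times_t F) T"
proof -
 have d: "(F k has_vector_derivative F (Suc k) t) (at t)" for k t using F by (simp add: test_seq_def)
 have "(times_t F k has_vector_derivative times_t F (Suc k) t) (at t)" for k t
 proof -
  have 1: "((\<lambda>t. of_real t * F k t) has_vector_derivative of_real t * F (Suc k) t + of_real 1 * F k t) (at t)"
   by (intro has_vector_derivative_mult d has_vector_derivative_of_real) (auto intro!: derivative_eq_intros)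
  have 2: "((\<lambda>t. of_nat k * F (k - 1) t) has_vector_derivative of_nat k * F k t) (at t)"
   using has_vector_derivative_mult_right[OF d[of "k - 1" t], of "of_nat k"] by (cases k) auto
  show ?thesis using has_vector_derivative_add[OF 1 2] by (simp add: times_t_def[abs_def] algebra_simps)
 qed
 then show ?thesis using F by (auto simp: test_seq_def times_t_def)
qed

lemma lap_has_vector_derivative:
 assumes F: "test_seq F T"
 shows "((\<lambda>xi. lap (F 0) (Complex e xi)) has_vector_derivative - \<i> * lap (times_t F 0) (Complex e xi)) (at xi)"
proof -
 have "((\<lambda>xi. \<integral>t. exp (- (Complex e xi * of_real t)) * F 0 t \<partial>lborel) has_vector_derivative
   (\<integral>t. - \<i> * (exp (- (Complex e xi * of_real t)) * times_t F 0 t) \<partial>lborel)) (at xi)"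
 proof (rule has_vector_derivative_integral[where S = UNIV and g = "\<lambda>t. norm (exp (- (of_real e * of_real t)) * times_t F 0 t)"])
  fix x t
  have "((\<lambda>x. exp (- ((of_real e + \<i> * of_real x) * of_real t))) has_vector_derivative
    - \<i> * of_real t * exp (- ((of_real e + \<i> * of_real x) * of_real t))) (at x)"
   by (rule has_vector_derivative_real_field) (auto intro!: derivative_eq_intros)
  from has_vector_derivative_mult_left[OF this, of "F 0 t"]
  show "((\<lambda>xi. exp (- (Complex e xi * of_real t)) * F 0 t) has_vector_derivative
    - \<i> * (exp (- (Complex e x * of_real t)) * times_t F 0 t)) (at x)"
   by (simp add: times_t_0 Complex_eq mult_ac)
  show "norm (- \<i> * (exp (- (Complex e x * of_real t)) * times_t F 0 t)) \<le> norm (exp (- (of_real e * of_real t)) * times_t F 0 t)"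
   by (simp add: norm_mult)
 qed (use lap_integrable[OF F] lap_integrable[OF test_seq_times_t[OF F]] in \<open>auto intro!: integrable_norm borel_measurable_integrable\<close>)
 then show ?thesis by (simp add: lap_def)
qed

section \<open>The wave symbol\<close>

text \<open>Near \<open>a\<close> the exponent above \<open>-1\<close> suffices; at distance more
  than one the power is at most one and \<open>1 / (1 + xi^2)\<close> takes over.\<close>

lemma integrable_powr_near:
 assumes "0 \<le> \<kappa>" "\<kappa> < 1"
 shows "integrable lborel (\<lambda>xi::real. \<bar>xi - a\<bar> powr (- \<kappa>) / (1 + xi\<^sup>2))"
proof -
 have c: "integrable lborel (\<lambda>xi::real. inverse (1 + xi\<^sup>2))"
  using integrable_inverse_1_plus_square by (simp add: set_integrable_def)
 have "(\<lambda>x::real. x powr (- \<kappa>)) integrable_on {0..1}"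
  by (rule integrable_on_powr_from_0) (use assms in auto)
 then have "(\<lambda>x::real. x powr (- \<kappa>)) absolutely_integrable_on {0..1}"
  by (intro nonnegative_absolutely_integrable_1) auto
 then have p: "integrable lborel (\<lambda>x::real. indicator {0..1} x *\<^sub>R x powr (- \<kappa>))"
  unfolding set_integrable_def by (subst (asm) integrable_completion) auto
 let ?g = "\<lambda>x::real. indicator {0..1} x *\<^sub>R x powr (- \<kappa>)"
 have i1: "integrable lborel (\<lambda>xi. ?g (- a + 1 * xi))" by (rule lborel_integrable_real_affine[OF p]) simp
 have i2: "integrable lborel (\<lambda>xi. ?g (a + (-1) * xi))" by (rule lborel_integrable_real_affine[OF p]) simp
 have "integrable lborel (\<lambda>xi. inverse (1 + xi\<^sup>2) + (?g (- a + 1 * xi) + ?g (a + (-1) * xi)))"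
  by (intro Bochner_Integration.integrable_add c i1 i2)
 then show ?thesis
 proof (rule Bochner_Integration.integrable_bound)
  have "norm (\<bar>xi - a\<bar> powr (- \<kappa>) / (1 + xi\<^sup>2)) \<le> norm (inverse (1 + xi\<^sup>2) + (?g (- a + 1 * xi) + ?g (a + (-1) * xi)))" for xi
  proof (cases "\<bar>xi - a\<bar> \<le> 1")
   case True
   have "\<bar>xi - a\<bar> powr (- \<kappa>) / (1 + xi\<^sup>2) \<le> \<bar>xi - a\<bar> powr (- \<kappa>) / 1"
    by (intro divide_left_mono) (auto simp: add_pos_nonneg)
   also have "\<dots> \<le> ?g (- a + 1 * xi) + ?g (a + (-1) * xi)"
    using True by (cases "a \<le> xi") (auto simp: indicator_def abs_if)
   finally have "\<bar>xi - a\<bar> powr (- \<kappa>) / (1 + xi\<^sup>2) \<le> inverse (1 + xi\<^sup>2) + (?g (- a + 1 * xi) + ?g (a + (-1) * xi))"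
    by (simp add: add_increasing)
   then show ?thesis by simp
  next
   case False
   have "\<bar>xi - a\<bar> powr (- \<kappa>) \<le> \<bar>xi - a\<bar> powr 0" using False assms by (intro powr_mono) auto
   then have "\<bar>xi - a\<bar> powr (- \<kappa>) / (1 + xi\<^sup>2) \<le> 1 / (1 + xi\<^sup>2)"
    using False by (intro divide_right_mono) (auto split: if_splits)
   also have "\<dots> \<le> inverse (1 + xi\<^sup>2) + (?g (- a + 1 * xi) + ?g (a + (-1) * xi))"
    by (simp add: divide_inverse)
   finally show ?thesis by simp
  qed
  then show "AE xi in lborel. norm (\<bar>xi - a\<bar> powr (- \<kappa>) / (1 + xi\<^sup>2)) \<le> norm (inverse (1 + xi\<^sup>2) + (?g (- a + 1 * xi) + ?g (a + (-1) * xi)))"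
   by blast
 qed measurable
qed

lemma integrable_powr_tail:
 assumes "p < -1"
 shows "integrable lborel (\<lambda>t::real. indicator {1..} t * t powr p)"
proof -
 have "((\<lambda>x::real. x powr p) has_integral - (1 powr (p + 1)) / (p + 1)) {1..}"
  by (rule has_integral_powr_to_inf) (use assms in auto)
 then have "(\<lambda>x::real. x powr p) absolutely_integrable_on {1..}"
  by (intro nonnegative_absolutely_integrable_1) auto
 then show ?thesis
  unfolding set_integrable_def by (subst (asm) integrable_completion) auto
qed

definition zsq :: "real => complex => complex" where
 "zsq lam w = (of_real lam)\<^sup>2 + w\<^sup>2"

text \<open>The imaginary part is \<open>2 Re w Im w\<close>, so a real value forces
  \<open>Im w = 0\<close>, and then the real part is positive. Thus principal powers of
  \<open>zsq\<close> are differentiable in the open right half-plane.\<close>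

lemma zsq_notin_nonpos:
 assumes "0 < Re w"
 shows "zsq lam w \<notin> \<real>\<^sub>\<le>\<^sub>0"
proof
 assume *: "zsq lam w \<in> \<real>\<^sub>\<le>\<^sub>0"
 have im: "Im (zsq lam w) = 2 * Re w * Im w" and re: "Re (zsq lam w) = lam\<^sup>2 + (Re w)\<^sup>2 - (Im w)\<^sup>2"
  by (simp_all add: zsq_def power2_eq_square)
 have "Im w = 0" using * im assms by (auto simp: complex_nonpos_Reals_iff)
 then have "0 < Re (zsq lam w)" using assms re by (simp add: add_nonneg_pos)
 then show False using * by (simp add: complex_nonpos_Reals_iff)
qed

lemma zsq_factor: "zsq lam w = (w - \<i> * of_real lam) * (w + \<i> * of_real lam)"
 by (simp add: zsq_def power2_eq_square algebra_simps)

text \<open>Distance to the nearer of the two branch points of the symbol, which lie on the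
  imaginary axis.\<close>

definition sdist :: "real => complex => real" where
 "sdist lam w = min (norm (w - \<i> * of_real lam)) (norm (w + \<i> * of_real lam))"

text \<open>\<open>m\<close> and \<open>M\<close> stand for the smaller and the larger distance to
  the branch points. Positive powers are charged to the upper bound \<open>B\<close>; only
  \<open>m\<close> may keep a negative power, at worst \<open>- \<gamma>\<close>.\<close>

lemma powr_product_bound:
 fixes m :: real
 assumes "0 < m" "m \<le> M" "M \<le> B" "1 \<le> B" "0 \<le> p" "- \<gamma> \<le> q" "p + q + \<gamma> \<le> P"
 shows "M powr p * m powr q \<le> B powr P * m powr (- \<gamma>)"
proof -
 have "m powr q = m powr (q + \<gamma>) * m powr (- \<gamma>)" by (simp flip: powr_add)
 then have "M powr p * m powr q = (M powr p * m powr (q + \<gamma>)) * m powr (- \<gamma>)" by simp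
 also have "\<dots> \<le> (B powr p * B powr (q + \<gamma>)) * m powr (- \<gamma>)"
  using assms by (intro mult_right_mono mult_mono powr_mono2) auto
 also have "\<dots> \<le> B powr P * m powr (- \<gamma>)"
  using assms by (intro mult_right_mono) (auto simp flip: powr_add intro!: powr_mono)
 finally show ?thesis .
qed

text \<open>Two derivatives of \<open>zsq^\<alpha>\<close> leave the power
  \<open>\<alpha> - 2\<close> of the distance to a branch point; the value
  \<open>max (2 - \<alpha>) 1\<close> covers this and the milder terms. It stays strictly below
  \<open>2\<close>, on which the integrability in time depends.\<close>

definition gam :: "real => real" where "gam \<alpha> = 2 - min \<alpha> 1"

definition bd :: "real => complex => real" where "bd lam w = (1 + lam) * (1 + \<bar>Im w\<bar>)"

text \<open>Since \<open>zsq\<close> is the product of two linear factors, each quantity is a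
  product of powers of the two distances \<open>m \<le> M\<close> to the branch points, with factors
  \<open>w\<close> charged to \<open>M\<close>.\<close>

lemma symbol_bounds:
 assumes \<alpha>: "0 < \<alpha>" and lam: "0 \<le> lam" and w: "0 < Re w" "Re w \<le> 1"
 defines "R \<equiv> bd lam w powr (2 * \<alpha> + 2) * sdist lam w powr (- gam \<alpha>)"
 shows "norm (zsq lam w powr of_real \<alpha>) \<le> R"
  "norm (w * zsq lam w powr of_real (\<alpha> - 1)) \<le> R"
  "norm (zsq lam w powr of_real (\<alpha> - 1)) \<le> R"
  "norm (w\<^sup>2 * zsq lam w powr of_real (\<alpha> - 2)) \<le> R"
proof -
 define a where "a = norm (w - \<i> * of_real lam)"
 define b where "b = norm (w + \<i> * of_real lam)"
 define m where "m = min a b"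
 define M where "M = max a b"
 define B where "B = bd lam w"
 have ab: "Re w \<le> a" "Re w \<le> b"
  using abs_Re_le_cmod[of "w - \<i> * of_real lam"] abs_Re_le_cmod[of "w + \<i> * of_real lam"]
  by (auto simp: a_def b_def)
 have m: "0 < m" using ab w by (simp add: m_def)
 have mM: "m \<le> M" by (simp add: m_def M_def)
 have nw: "norm w \<le> 1 + \<bar>Im w\<bar>" using cmod_le[of w] w by simp
 have "a \<le> norm w + lam" "b \<le> norm w + lam"
  unfolding a_def b_def using lam by (auto intro: order_trans[OF norm_triangle_ineq4] order_trans[OF norm_triangle_ineq] simp: norm_mult)
 then have "M \<le> 1 + \<bar>Im w\<bar> + lam" using nw by (simp add: M_def)
 also have "\<dots> \<le> B" using lam by (simp add: B_def bd_def algebra_simps)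
 finally have MB: "M \<le> B" .
 have B1: "1 \<le> B" using lam by (simp add: B_def bd_def algebra_simps add_increasing)
 \<comment> \<open>\<open>w\<close> is the midpoint of \<open>w - i lam\<close> and
   \<open>w + i lam\<close>.\<close>
 have wM: "norm w \<le> M"
 proof -
  have "2 * norm w = norm ((w - \<i> * of_real lam) + (w + \<i> * of_real lam))" by (simp flip: norm_mult_numeral1)
  also have "\<dots> \<le> a + b" unfolding a_def b_def by (rule norm_triangle_ineq)
  also have "\<dots> \<le> 2 * M" by (simp add: M_def)
  finally show ?thesis by simp
 qed
 have M: "0 < M" using m mM by simp
 have nz: "norm (zsq lam w powr of_real p) = M powr p * m powr p" for p
 proof -
  have "norm (zsq lam w) = M * m" unfolding zsq_factor norm_mult a_def[symmetric] b_def[symmetric]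
   by (auto simp: M_def m_def min_def max_def)
  then show ?thesis using M m by (simp add: norm_powr_real_powr' powr_mult)
 qed
 have R: "R = B powr (2 * \<alpha> + 2) * m powr (- gam \<alpha>)"
  by (simp add: R_def B_def sdist_def m_def a_def b_def)
 note pb = powr_product_bound[OF m mM MB B1, of _ "gam \<alpha>" _ "2 * \<alpha> + 2", folded R]
 show "norm (zsq lam w powr of_real \<alpha>) \<le> R"
  unfolding nz by (rule pb) (use \<alpha> in \<open>auto simp: gam_def\<close>)
 have "norm (w * zsq lam w powr of_real (\<alpha> - 1)) \<le> M * (M powr (\<alpha> - 1) * m powr (\<alpha> - 1))"
  unfolding norm_mult nz using wM by (intro mult_right_mono) auto
 also have "\<dots> = M powr \<alpha> * m powr (\<alpha> - 1)" using M by (simp add: powr_mult_base)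
 also have "\<dots> \<le> R" by (rule pb) (use \<alpha> in \<open>auto simp: gam_def\<close>)
 finally show "norm (w * zsq lam w powr of_real (\<alpha> - 1)) \<le> R" .
 have 3: "M powr \<alpha> * m powr (\<alpha> - 2) \<le> R" by (rule pb) (use \<alpha> in \<open>auto simp: gam_def\<close>)
 \<comment> \<open>The exponent \<open>\<alpha> - 1\<close> of \<open>M\<close> may be negative.
   Trading one factor \<open>m\<close> for \<open>M\<close> reduces the claim to the exponents
   \<open>\<alpha>\<close> and \<open>\<alpha> - 2\<close>, already bounded.\<close>
 have "m * M powr (\<alpha> - 1) \<le> M * M powr (\<alpha> - 1)" using mM by (intro mult_right_mono) auto
 then have "m * M powr (\<alpha> - 1) \<le> M powr \<alpha>" using M by (simp add: powr_mult_base)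
 then have "(m * M powr (\<alpha> - 1)) * m powr (\<alpha> - 2) \<le> M powr \<alpha> * m powr (\<alpha> - 2)" by (rule mult_right_mono) simp
 moreover have m1: "m * m powr (\<alpha> - 2) = m powr (\<alpha> - 1)" using m by (simp add: powr_mult_base)
 have "(m * M powr (\<alpha> - 1)) * m powr (\<alpha> - 2) = M powr (\<alpha> - 1) * m powr (\<alpha> - 1)"
  unfolding m1[symmetric] by (simp only: mult_ac)
 ultimately show "norm (zsq lam w powr of_real (\<alpha> - 1)) \<le> R"
  unfolding nz using 3 by linarith
 have "norm (w\<^sup>2 * zsq lam w powr of_real (\<alpha> - 2)) \<le> M\<^sup>2 * (M powr (\<alpha> - 2) * m powr (\<alpha> - 2))"
  unfolding norm_mult nz norm_power using wM by (intro mult_right_mono power_mono) auto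
 also have "\<dots> = M powr \<alpha> * m powr (\<alpha> - 2)" using M powr_add[of M 2 "\<alpha> - 2"] by simp
 finally show "norm (w\<^sup>2 * zsq lam w powr of_real (\<alpha> - 2)) \<le> R" using 3 by simp
qed

lemma sdist_ge: "0 < Re w ==> Re w \<le> sdist lam w"
 using abs_Re_le_cmod[of "w - \<i> * of_real lam"] abs_Re_le_cmod[of "w + \<i> * of_real lam"]
 by (auto simp: sdist_def)

text \<open>The transform that the Dirichlet-to-Neumann data must have. \<open>hsym1\<close> and
  \<open>hsym2\<close> are its first two derivatives in \<open>xi\<close> along
  \<open>Complex e xi\<close>, written as sums of a transform of a test function times a factor
  estimated in \<open>symbol_bounds\<close>.\<close>

definition hsym0 :: "real => real => (nat => real => complex) => complex => complex" where
 "hsym0 \<alpha> lam F w = lap (F 0) w * zsq lam w powr of_real \<alpha>"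

definition hsym1 :: "real => real => (nat => real => complex) => complex => complex" where
 "hsym1 \<alpha> lam F w = - \<i> * lap (times_t F 0) w * zsq lam w powr of_real \<alpha> +
   2 * \<i> * of_real \<alpha> * lap (F 0) w * (w * zsq lam w powr of_real (\<alpha> - 1))"

definition hsym2 :: "real => real => (nat => real => complex) => complex => complex" where
 "hsym2 \<alpha> lam F w = - lap (times_t (times_t F) 0) w * zsq lam w powr of_real \<alpha> +
   4 * of_real \<alpha> * lap (times_t F 0) w * (w * zsq lam w powr of_real (\<alpha> - 1)) -
   2 * of_real \<alpha> * lap (F 0) w * zsq lam w powr of_real (\<alpha> - 1) -
   4 * of_real (\<alpha> * (\<alpha> - 1)) * lap (F 0) w * (w\<^sup>2 * zsq lam w powr of_real (\<alpha> - 2))"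

lemma Complex_vd: "((\<lambda>xi. Complex e xi) has_vector_derivative \<i>) (at xi)"
proof -
 have "((\<lambda>x. of_real e + \<i> * of_real x) has_vector_derivative \<i>) (at xi)"
  by (auto intro!: derivative_eq_intros has_vector_derivative_real_field)
 then show ?thesis by (simp add: Complex_eq)
qed

lemma zsq_powr_vd:
 assumes "0 < e"
 shows "((\<lambda>xi. zsq lam (Complex e xi) powr of_real p) has_vector_derivative
  2 * \<i> * of_real p * (Complex e xi * zsq lam (Complex e xi) powr of_real (p - 1))) (at xi)"
proof -
 have "((\<lambda>w. zsq lam w powr of_real p) has_field_derivative
   of_real p * zsq lam (Complex e xi) powr (of_real p - 1) * (2 * Complex e xi)) (at (Complex e xi))"
 proof (rule DERIV_chain2[OF has_field_derivative_powr])
  show "zsq lam (Complex e xi) \<notin> \<real>\<^sub>\<le>\<^sub>0" using assms by (intro zsq_notin_nonpos) simp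
  show "(zsq lam has_field_derivative 2 * Complex e xi) (at (Complex e xi))"
   unfolding zsq_def[abs_def] by (auto intro!: derivative_eq_intros)
 qed
 from field_vector_diff_chain_at[OF Complex_vd this] show ?thesis by (simp add: o_def mult_ac)
qed

lemma hsym0_vd:
 assumes "test_seq F T" "0 < e"
 shows "((\<lambda>xi. hsym0 \<alpha> lam F (Complex e xi)) has_vector_derivative hsym1 \<alpha> lam F (Complex e xi)) (at xi)"
 unfolding hsym0_def hsym1_def
 by (rule has_vector_derivative_eq_rhs[OF has_vector_derivative_mult[OF lap_has_vector_derivative[OF assms(1)] zsq_powr_vd[OF assms(2)]]])
   (simp add: algebra_simps)

lemma hsym1_vd:
 assumes F: "test_seq F T" and e: "0 < e"
 shows "((\<lambda>xi. hsym1 \<alpha> lam F (Complex e xi)) has_vector_derivative hsym2 \<alpha> lam F (Complex e xi)) (at xi)"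
proof -
 note l0 = lap_has_vector_derivative[OF F, of e xi] and l1 = lap_has_vector_derivative[OF test_seq_times_t[OF F], of e xi]
 note z0 = zsq_powr_vd[OF e, of lam \<alpha> xi] and z1 = has_vector_derivative_mult[OF Complex_vd zsq_powr_vd[OF e, of lam "\<alpha> - 1" xi]]
 have sq: "Complex e xi * (2 * \<i> * of_real (\<alpha> - 1) * (Complex e xi * zsq lam (Complex e xi) powr of_real (\<alpha> - 1 - 1)))
   = 2 * \<i> * of_real (\<alpha> - 1) * ((Complex e xi)\<^sup>2 * zsq lam (Complex e xi) powr of_real (\<alpha> - 2))"
  by (simp add: power2_eq_square)
 note d = has_vector_derivative_add[OF has_vector_derivative_mult[OF has_vector_derivative_mult_right[OF l1, of "- \<i>"] z0]
   has_vector_derivative_mult[OF has_vector_derivative_mult_right[OF l0, of "2 * \<i> * of_real \<alpha>"] z1[unfolded sq]]]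
 show ?thesis
  unfolding hsym1_def hsym2_def
  by (rule has_vector_derivative_eq_rhs[OF d]) (simp add: algebra_simps power2_eq_square)
qed

lemma hsym_bound:
 assumes F: "test_seq F T" and \<alpha>: "0 < \<alpha>" and lam: "0 \<le> lam"
 obtains K where "0 \<le> K"
  "\<And>w. 0 < Re w ==> Re w \<le> 1 ==> norm (hsym0 \<alpha> lam F w) \<le> K / (1 + (Im w)\<^sup>2) * sdist lam w powr (- gam \<alpha>)"
  "\<And>w. 0 < Re w ==> Re w \<le> 1 ==> norm (hsym1 \<alpha> lam F w) \<le> K / (1 + (Im w)\<^sup>2) * sdist lam w powr (- gam \<alpha>)"
  "\<And>w. 0 < Re w ==> Re w \<le> 1 ==> norm (hsym2 \<alpha> lam F w) \<le> K / (1 + (Im w)\<^sup>2) * sdist lam w powr (- gam \<alpha>)"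
proof -
 \<comment> \<open>\<open>N\<close> powers of \<open>1 + |Im w|\<close> compensate the growth of
   \<open>bd\<close> to the power \<open>2 \<alpha> + 2\<close>; the two extra ones in
   \<open>N + 2\<close> leave the integrable factor \<open>1 / (1 + (Im w)^2)\<close>.\<close>
 define N where "N = nat \<lceil>2 * \<alpha> + 2\<rceil>"
 have F1: "test_seq (times_t F) T" and F2: "test_seq (times_t (times_t F)) T"
  using F test_seq_times_t by blast+
 obtain C0 where C0: "\<And>w. 0 \<le> Re w ==> Re w \<le> 1 ==> (1 + \<bar>Im w\<bar>) ^ (N + 2) * norm (lap (F 0) w) \<le> C0"
  using lap_rapid[OF F] by blast
 obtain C1 where C1: "\<And>w. 0 \<le> Re w ==> Re w \<le> 1 ==> (1 + \<bar>Im w\<bar>) ^ (N + 2) * norm (lap (times_t F 0) w) \<le> C1"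
  using lap_rapid[OF F1] by blast
 obtain C2 where C2: "\<And>w. 0 \<le> Re w ==> Re w \<le> 1 ==> (1 + \<bar>Im w\<bar>) ^ (N + 2) * norm (lap (times_t (times_t F) 0) w) \<le> C2"
  using lap_rapid[OF F2] by blast
 define C where "C = max 0 (max C0 (max C1 C2))"
 define D where "D = C * (1 + lam) ^ N"
 have D: "0 \<le> D" using lam by (simp add: D_def C_def)
 have key: "norm (L * s) \<le> D / (1 + (Im w)\<^sup>2) * sdist lam w powr (- gam \<alpha>)"
  if "0 < Re w" "(1 + \<bar>Im w\<bar>) ^ (N + 2) * norm L \<le> C"
   "norm s \<le> bd lam w powr (2 * \<alpha> + 2) * sdist lam w powr (- gam \<alpha>)" for L s :: complex and w
 proof -
  have b1: "1 \<le> bd lam w" using lam by (simp add: bd_def algebra_simps add_increasing)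
  have "bd lam w powr (2 * \<alpha> + 2) \<le> bd lam w powr real N"
   using b1 \<alpha> by (intro powr_mono) (auto simp: N_def)
  also have "\<dots> = (1 + lam) ^ N * (1 + \<bar>Im w\<bar>) ^ N"
   using b1 by (subst powr_realpow) (auto simp: bd_def power_mult_distrib)
  finally have b: "bd lam w powr (2 * \<alpha> + 2) \<le> (1 + lam) ^ N * (1 + \<bar>Im w\<bar>) ^ N" .
  have i: "1 + (Im w)\<^sup>2 \<le> (1 + \<bar>Im w\<bar>)\<^sup>2" by (simp add: power2_eq_square algebra_simps)
  have p: "0 < 1 + (Im w)\<^sup>2" by (simp add: add_pos_nonneg)
  have "norm L * (1 + \<bar>Im w\<bar>) ^ N * (1 + (Im w)\<^sup>2) \<le> norm L * (1 + \<bar>Im w\<bar>) ^ N * (1 + \<bar>Im w\<bar>)\<^sup>2"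
   using i by (intro mult_left_mono) auto
  also have "\<dots> = (1 + \<bar>Im w\<bar>) ^ (N + 2) * norm L" by (simp only: power_add mult_ac)
  also have "\<dots> \<le> C" by fact
  finally have L: "norm L * (1 + \<bar>Im w\<bar>) ^ N \<le> C / (1 + (Im w)\<^sup>2)" using p by (simp add: pos_le_divide_eq)
  have "norm (L * s) \<le> norm L * (((1 + lam) ^ N * (1 + \<bar>Im w\<bar>) ^ N) * sdist lam w powr (- gam \<alpha>))"
   unfolding norm_mult
   by (intro mult_left_mono order_trans[OF that(3)] mult_right_mono b) auto
  also have "\<dots> = (norm L * (1 + \<bar>Im w\<bar>) ^ N) * ((1 + lam) ^ N * sdist lam w powr (- gam \<alpha>))" by (simp only: mult_ac)
  also have "\<dots> \<le> C / (1 + (Im w)\<^sup>2) * ((1 + lam) ^ N * sdist lam w powr (- gam \<alpha>))"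
   using L lam by (intro mult_right_mono) auto
  also have "\<dots> = D / (1 + (Im w)\<^sup>2) * sdist lam w powr (- gam \<alpha>)" by (simp add: D_def)
  finally show ?thesis .
 qed
 define K where "K = D * (1 + (2 * \<alpha> + 1) + (1 + 4 * \<alpha> + 2 * \<alpha> + 4 * \<bar>\<alpha> * (\<alpha> - 1)\<bar>))"
 have C: "0 \<le> C" "C0 \<le> C" "C1 \<le> C" "C2 \<le> C" by (auto simp: C_def)
 show ?thesis
 proof (rule that[of K])
  show "0 \<le> K" using D \<alpha> by (simp add: K_def)
  fix w assume w: "0 < Re w" "Re w \<le> 1"
  define Q where "Q = D / (1 + (Im w)\<^sup>2) * sdist lam w powr (- gam \<alpha>)"
  have Q: "0 \<le> Q" using D by (simp add: Q_def)
  have KQ: "K / (1 + (Im w)\<^sup>2) * sdist lam w powr (- gam \<alpha>) = (1 + (2 * \<alpha> + 1) + (1 + 4 * \<alpha> + 2 * \<alpha> + 4 * \<bar>\<alpha> * (\<alpha> - 1)\<bar>)) * Q"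
   by (simp add: K_def Q_def)
  have l: "(1 + \<bar>Im w\<bar>) ^ (N + 2) * norm (lap (F 0) w) \<le> C"
    "(1 + \<bar>Im w\<bar>) ^ (N + 2) * norm (lap (times_t F 0) w) \<le> C"
    "(1 + \<bar>Im w\<bar>) ^ (N + 2) * norm (lap (times_t (times_t F) 0) w) \<le> C"
   using C0[of w] C1[of w] C2[of w] C w by linarith+
  note sb = symbol_bounds[OF \<alpha> lam w]
  have k: "norm (lap (F 0) w * zsq lam w powr of_real \<alpha>) \<le> Q"
   "norm (lap (times_t F 0) w * zsq lam w powr of_real \<alpha>) \<le> Q"
   "norm (lap (times_t (times_t F) 0) w * zsq lam w powr of_real \<alpha>) \<le> Q"
   "norm (lap (F 0) w * (w * zsq lam w powr of_real (\<alpha> - 1))) \<le> Q"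
   "norm (lap (times_t F 0) w * (w * zsq lam w powr of_real (\<alpha> - 1))) \<le> Q"
   "norm (lap (F 0) w * zsq lam w powr of_real (\<alpha> - 1)) \<le> Q"
   "norm (lap (F 0) w * (w\<^sup>2 * zsq lam w powr of_real (\<alpha> - 2))) \<le> Q"
   unfolding Q_def by (rule key[OF w(1)]; use l sb in blast)+
  have sc: "norm (c * a * b) \<le> norm c * Q" if "norm (a * b) \<le> Q" for a b c :: complex
   using mult_left_mono[OF that, of "norm c"] by (simp add: norm_mult mult.assoc)
  show "norm (hsym0 \<alpha> lam F w) \<le> K / (1 + (Im w)\<^sup>2) * sdist lam w powr (- gam \<alpha>)"
  proof -
   have "norm (hsym0 \<alpha> lam F w) \<le> 1 * Q" using k(1) by (simp add: hsym0_def)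
   also have "\<dots> \<le> (1 + (2 * \<alpha> + 1) + (1 + 4 * \<alpha> + 2 * \<alpha> + 4 * \<bar>\<alpha> * (\<alpha> - 1)\<bar>)) * Q"
    using Q \<alpha> by (intro mult_right_mono) auto
   finally show ?thesis unfolding KQ .
  qed
  show "norm (hsym1 \<alpha> lam F w) \<le> K / (1 + (Im w)\<^sup>2) * sdist lam w powr (- gam \<alpha>)"
  proof -
   have "norm (hsym1 \<alpha> lam F w) \<le> norm (- \<i>) * Q + norm (2 * \<i> * of_real \<alpha> :: complex) * Q"
    unfolding hsym1_def
    by (rule norm_triangle_le[OF add_mono[OF sc[OF k(2)] sc[OF k(4)]]])
   also have "\<dots> = (2 * \<alpha> + 1) * Q" using \<alpha> by (simp add: norm_mult algebra_simps)
   also have "\<dots> \<le> (1 + (2 * \<alpha> + 1) + (1 + 4 * \<alpha> + 2 * \<alpha> + 4 * \<bar>\<alpha> * (\<alpha> - 1)\<bar>)) * Q"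
    using Q \<alpha> by (intro mult_right_mono) auto
   finally show ?thesis unfolding KQ .
  qed
  show "norm (hsym2 \<alpha> lam F w) \<le> K / (1 + (Im w)\<^sup>2) * sdist lam w powr (- gam \<alpha>)"
  proof -
   have "norm (hsym2 \<alpha> lam F w) \<le> (norm (-1::complex) * Q + norm (4 * of_real \<alpha> :: complex) * Q +
     norm (2 * of_real \<alpha> :: complex) * Q) + norm (4 * of_real (\<alpha> * (\<alpha> - 1)) :: complex) * Q"
    using norm_triangle_le_diff[OF add_mono[OF norm_triangle_le_diff[OF add_mono[OF norm_triangle_le[OF add_mono[OF sc[OF k(3), of "-1"] sc[OF k(5), of "4 * of_real \<alpha>"]]]
      sc[OF k(6), of "2 * of_real \<alpha>"]]] sc[OF k(7), of "4 * of_real (\<alpha> * (\<alpha> - 1))"]]]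
    unfolding hsym2_def by simp
   also have "\<dots> = (1 + 4 * \<alpha> + 2 * \<alpha> + 4 * \<bar>\<alpha> * (\<alpha> - 1)\<bar>) * Q"
   proof -
    have n: "norm (4 * of_real x :: complex) = 4 * \<bar>x\<bar>" "norm (2 * of_real x :: complex) = 2 * \<bar>x\<bar>" for x
     by (simp_all add: norm_mult)
    show ?thesis unfolding n using \<alpha> by (simp only: distrib_right abs_of_pos norm_minus_cancel norm_one)
   qed
   also have "\<dots> \<le> (1 + (2 * \<alpha> + 1) + (1 + 4 * \<alpha> + 2 * \<alpha> + 4 * \<bar>\<alpha> * (\<alpha> - 1)\<bar>)) * Q"
    using Q \<alpha> by (intro mult_right_mono) auto
   finally show ?thesis unfolding KQ .
  qed
 qed
qed

lemma integrable_inverse_square: "integrable lborel (\<lambda>xi::real. K / (1 + xi\<^sup>2))"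
proof -
 have c: "integrable lborel (\<lambda>xi::real. inverse (1 + xi\<^sup>2))"
  using integrable_inverse_1_plus_square by (simp add: set_integrable_def)
 show ?thesis using integrable_mult_right[OF c, of K] by (simp add: divide_inverse)
qed

lemma tendsto_inverse_square: "((\<lambda>xi::real. K / (1 + xi\<^sup>2)) \<longlongrightarrow> 0) at_top" "((\<lambda>xi::real. K / (1 + xi\<^sup>2)) \<longlongrightarrow> 0) at_bot"
 by (rule tendsto_divide_0[OF tendsto_const], rule filterlim_at_top_imp_at_infinity,
   rule filterlim_tendsto_add_at_top[OF tendsto_const], rule filterlim_pow_at_top, simp, rule filterlim_ident)
   (rule tendsto_divide_0[OF tendsto_const], rule filterlim_at_top_imp_at_infinity,
   rule filterlim_tendsto_add_at_top[OF tendsto_const], rule filterlim_pow_at_bot_even, simp, rule filterlim_ident, simp)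

lemma fourier_by_parts:
 fixes H H' :: "real => complex"
 assumes d: "\<And>xi. (H has_vector_derivative H' xi) (at xi)" and c: "continuous_on UNIV H'"
  and b: "\<And>xi. norm (H xi) \<le> K / (1 + xi\<^sup>2)" "\<And>xi. norm (H' xi) \<le> K / (1 + xi\<^sup>2)"
 shows "(\<integral>xi. eix (xi * t) * H' xi \<partial>lborel) = - (\<i> * of_real t) * (\<integral>xi. eix (xi * t) * H xi \<partial>lborel)"
proof -
 have cH: "continuous_on UNIV H"
  using d by (intro continuous_at_imp_continuous_on) (auto intro: has_vector_derivative_continuous)
 have [measurable]: "H \<in> borel_measurable borel" "H' \<in> borel_measurable borel"
  using cH c by (auto intro: borel_measurable_continuous_onI)
 have i: "integrable lborel (\<lambda>xi. eix (xi * t) * h xi)"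
  if "\<And>xi. norm (h xi) \<le> K / (1 + xi\<^sup>2)" "h \<in> borel_measurable borel" for h :: "real => complex"
 proof (rule Bochner_Integration.integrable_bound[OF integrable_inverse_square[of K]])
  have "norm (eix (xi * t) * h xi) \<le> norm (K / (1 + xi\<^sup>2))" for xi
   using order_trans[OF that(1) abs_ge_self] by (simp add: norm_mult)
  then show "AE xi in lborel. norm (eix (xi * t) * h xi) \<le> norm (K / (1 + xi\<^sup>2))" by blast
 qed (use that(2) in measurable)
 let ?f = "\<lambda>xi. eix (xi * t) * H' xi + (\<i> * of_real t) * (eix (xi * t) * H xi)"
 have "(\<integral>xi. ?f xi \<partial>lborel) = 0"
 proof (rule integral_derivative_zero[where F = "\<lambda>xi. eix (xi * t) * H xi"])
  fix xi
  have "((\<lambda>xi. eix (xi * t)) has_vector_derivative \<i> * of_real t * eix (xi * t)) (at xi)"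
   unfolding of_real_mult by (rule has_vector_derivative_real_field) (auto intro!: derivative_eq_intros)
  from has_vector_derivative_mult[OF this d]
  show "((\<lambda>xi. eix (xi * t) * H xi) has_vector_derivative ?f xi) (at xi)" by (simp add: mult.assoc)
 next
  show "continuous_on UNIV ?f" by (intro continuous_intros c cH)
  show "integrable lborel ?f"
   using b by (intro Bochner_Integration.integrable_add integrable_mult_right i) auto
  have le: "norm (eix (xi * t) * H xi) \<le> K / (1 + xi\<^sup>2)" for xi using b by (simp add: norm_mult)
  show "((\<lambda>xi. eix (xi * t) * H xi) \<longlongrightarrow> 0) at_top"
   by (rule Lim_null_comparison[OF always_eventually[OF allI[OF le]] tendsto_inverse_square(1)])
  show "((\<lambda>xi. eix (xi * t) * H xi) \<longlongrightarrow> 0) at_bot"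
   by (rule Lim_null_comparison[OF always_eventually[OF allI[OF le]] tendsto_inverse_square(2)])
 qed
 moreover have "(\<integral>xi. ?f xi \<partial>lborel) = (\<integral>xi. eix (xi * t) * H' xi \<partial>lborel) + (\<i> * of_real t) * (\<integral>xi. eix (xi * t) * H xi \<partial>lborel)"
  unfolding integral_mult_right_zero[symmetric]
  by (rule Bochner_Integration.integral_add) (use i[OF b(1)] i[OF b(2)] in auto)
 ultimately show ?thesis by (simp add: add_eq_0_iff)
qed

lemma continuous_on_lap_line:
 assumes "test_seq F T"
 shows "continuous_on UNIV (\<lambda>xi. lap (F 0) (Complex e xi))"
 using lap_has_vector_derivative[OF assms]
 by (intro continuous_at_imp_continuous_on) (auto intro: has_vector_derivative_continuous)

lemma continuous_on_zsq_powr_line: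
 assumes "0 < e"
 shows "continuous_on UNIV (\<lambda>xi. zsq lam (Complex e xi) powr of_real p)"
 using zsq_powr_vd[OF assms]
 by (intro continuous_at_imp_continuous_on) (auto intro: has_vector_derivative_continuous)

lemma continuous_on_Complex_line: "continuous_on S (\<lambda>xi. Complex e xi)"
 using Complex_vd by (intro continuous_at_imp_continuous_on) (auto intro: has_vector_derivative_continuous)

lemma continuous_on_hsym:
 assumes F: "test_seq F T" and e: "0 < e"
 shows "continuous_on UNIV (\<lambda>xi. hsym0 \<alpha> lam F (Complex e xi))"
  "continuous_on UNIV (\<lambda>xi. hsym1 \<alpha> lam F (Complex e xi))"
  "continuous_on UNIV (\<lambda>xi. hsym2 \<alpha> lam F (Complex e xi))"
 unfolding hsym0_def hsym1_def hsym2_def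
 by (intro continuous_on_add continuous_on_diff continuous_on_mult continuous_on_const continuous_on_minus
   continuous_on_power continuous_on_lap_line[OF F] continuous_on_zsq_powr_line[OF e] continuous_on_Complex_line
   continuous_on_lap_line[OF test_seq_times_t[OF F]] continuous_on_lap_line[OF test_seq_times_t[OF test_seq_times_t[OF F]]])+

lemma sdist_powr_le:
 assumes "0 < Re w" "0 \<le> g"
 shows "sdist lam w powr (- g) \<le> Re w powr (- g)"
 using assms sdist_ge[of w lam] by (intro powr_mono2') auto

lemma gam_bounds: "0 < \<alpha> ==> 1 \<le> gam \<alpha>" "0 < \<alpha> ==> gam \<alpha> < 2"
 by (auto simp: gam_def)

text \<open>The exponent is split evenly: one half is estimated by the real part \<open>e\<close>,
  the other by the distance along the line, whose power \<open>- \<kappa>\<close> is locally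
  integrable for \<open>\<kappa> < 1\<close>. Estimating by \<open>e\<close> alone would cost
  \<open>e^(-2 \<kappa>)\<close>, too much for integrability in time.\<close>

lemma sdist_powr_le2:
 assumes "0 < e" "0 \<le> \<kappa>" "xi \<noteq> lam" "xi \<noteq> - lam"
 shows "sdist lam (Complex e xi) powr (- (2 * \<kappa>)) \<le> e powr (- \<kappa>) * (\<bar>xi - lam\<bar> powr (- \<kappa>) + \<bar>xi - (- lam)\<bar> powr (- \<kappa>))"
proof -
 have *: "norm v powr (- (2 * \<kappa>)) \<le> e powr (- \<kappa>) * \<bar>s\<bar> powr (- \<kappa>)"
  if "Re v = e" "Im v = s" "s \<noteq> 0" for v s
 proof -
  have "e \<le> norm v" "\<bar>s\<bar> \<le> norm v" using that assms abs_Re_le_cmod[of v] abs_Im_le_cmod[of v] by auto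
  then have "norm v powr (- \<kappa>) * norm v powr (- \<kappa>) \<le> e powr (- \<kappa>) * \<bar>s\<bar> powr (- \<kappa>)"
   using assms that by (intro mult_mono powr_mono2') auto
  then show ?thesis by (simp flip: powr_add)
 qed
 let ?v = "Complex e xi"
 have 1: "norm (?v - \<i> * of_real lam) powr (- (2 * \<kappa>)) \<le> e powr (- \<kappa>) * \<bar>xi - lam\<bar> powr (- \<kappa>)"
  by (rule *) (use assms in auto)
 have 2: "norm (?v + \<i> * of_real lam) powr (- (2 * \<kappa>)) \<le> e powr (- \<kappa>) * \<bar>xi + lam\<bar> powr (- \<kappa>)"
  by (rule *) (use assms in auto)
 have "sdist lam ?v powr (- (2 * \<kappa>)) \<le> norm (?v - \<i> * of_real lam) powr (- (2 * \<kappa>)) + norm (?v + \<i> * of_real lam) powr (- (2 * \<kappa>))"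
  unfolding sdist_def min_def by (simp add: add_increasing add_increasing2)
 also have "\<dots> \<le> e powr (- \<kappa>) * \<bar>xi - lam\<bar> powr (- \<kappa>) + e powr (- \<kappa>) * \<bar>xi + lam\<bar> powr (- \<kappa>)"
  by (rule add_mono[OF 1 2])
 finally show ?thesis by (simp add: algebra_simps)
qed

lemma integral_norm_bound_AE:
 fixes f :: "'a => 'b::{banach, second_countable_topology}" and g :: "'a => real"
 assumes "integrable M g" "AE x in M. norm (f x) \<le> g x"
 shows "norm (\<integral>x. f x \<partial>M) \<le> (\<integral>x. g x \<partial>M)"
proof (cases "integrable M f")
 case True
 then show ?thesis
  using assms by (intro order_trans[OF integral_norm_bound] integral_mono_AE) auto
next
 case False
 have "0 \<le> (\<integral>x. g x \<partial>M)"
  by (rule integral_nonneg_AE) (use assms(2) in \<open>auto elim!: eventually_mono intro: order_trans[OF norm_ge_zero]\<close>)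
 then show ?thesis using False by (simp add: not_integrable_integral_eq)
qed

locale symbol_setup =
 fixes F :: "nat => real => complex" and T \<alpha> lam :: real
 assumes F: "test_seq F T" and \<alpha>: "0 < \<alpha>" and lam: "0 \<le> lam"
begin

lemma hsym_line_bound:
 assumes "0 < e" "e \<le> 1"
 shows "\<exists>K. \<forall>xi. norm (hsym0 \<alpha> lam F (Complex e xi)) \<le> K / (1 + xi\<^sup>2) \<and>
  norm (hsym1 \<alpha> lam F (Complex e xi)) \<le> K / (1 + xi\<^sup>2) \<and>
  norm (hsym2 \<alpha> lam F (Complex e xi)) \<le> K / (1 + xi\<^sup>2)"
proof -
 obtain K where K: "0 \<le> K"
  "\<And>w. 0 < Re w ==> Re w \<le> 1 ==> norm (hsym0 \<alpha> lam F w) \<le> K / (1 + (Im w)\<^sup>2) * sdist lam w powr (- gam \<alpha>)"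
  "\<And>w. 0 < Re w ==> Re w \<le> 1 ==> norm (hsym1 \<alpha> lam F w) \<le> K / (1 + (Im w)\<^sup>2) * sdist lam w powr (- gam \<alpha>)"
  "\<And>w. 0 < Re w ==> Re w \<le> 1 ==> norm (hsym2 \<alpha> lam F w) \<le> K / (1 + (Im w)\<^sup>2) * sdist lam w powr (- gam \<alpha>)"
  using hsym_bound[OF F \<alpha> lam] by blast
 have s: "K / (1 + xi\<^sup>2) * sdist lam (Complex e xi) powr (- gam \<alpha>) \<le> K * e powr (- gam \<alpha>) / (1 + xi\<^sup>2)" for xi
  using sdist_powr_le[of "Complex e xi" "gam \<alpha>" lam] assms gam_bounds[OF \<alpha>] K(1)
   mult_left_mono[of "sdist lam (Complex e xi) powr (- gam \<alpha>)" "e powr (- gam \<alpha>)" "K / (1 + xi\<^sup>2)"]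
  by (simp add: add_nonneg_nonneg)
 note K' = K(2-4)[of "Complex e _", unfolded complex.sel, OF assms]
 show ?thesis
  by (intro exI[of _ "K * e powr (- gam \<alpha>)"] allI conjI)
    (rule order_trans[OF K'(1) s] order_trans[OF K'(2) s] order_trans[OF K'(3) s])+
qed

lemma integrable_hsym0:
 assumes "0 < e" "e \<le> 1"
 shows "integrable lborel (\<lambda>xi. hsym0 \<alpha> lam F (Complex e xi))"
proof -
 obtain K where K: "\<forall>xi. norm (hsym0 \<alpha> lam F (Complex e xi)) \<le> K / (1 + xi\<^sup>2) \<and>
  norm (hsym1 \<alpha> lam F (Complex e xi)) \<le> K / (1 + xi\<^sup>2) \<and>
  norm (hsym2 \<alpha> lam F (Complex e xi)) \<le> K / (1 + xi\<^sup>2)"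
  using hsym_line_bound[OF assms] ..
 note K = K[rule_format, THEN conjunct1] K[rule_format, THEN conjunct2, THEN conjunct1]
  K[rule_format, THEN conjunct2, THEN conjunct2]
 have [measurable]: "(\<lambda>xi. hsym0 \<alpha> lam F (Complex e xi)) \<in> borel_measurable borel"
  using continuous_on_hsym(1)[OF F assms(1)] by (rule borel_measurable_continuous_onI)
 show ?thesis
 proof (rule Bochner_Integration.integrable_bound[OF integrable_inverse_square[of K]])
  show "AE xi in lborel. norm (hsym0 \<alpha> lam F (Complex e xi)) \<le> norm (K / (1 + xi\<^sup>2))"
   using order_trans[OF K(1) abs_ge_self] by (auto simp only: real_norm_def intro!: AE_I2)
 qed measurable
qed

definition Et :: "real => real => complex" where
 "Et e t = (\<integral>xi. eix (xi * t) * hsym0 \<alpha> lam F (Complex e xi) \<partial>lborel)"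

lemma Et_by_parts:
 assumes "0 < e" "e \<le> 1"
 shows "- (of_real t)\<^sup>2 * Et e t = (\<integral>xi. eix (xi * t) * hsym2 \<alpha> lam F (Complex e xi) \<partial>lborel)"
proof -
 obtain K where K: "\<forall>xi. norm (hsym0 \<alpha> lam F (Complex e xi)) \<le> K / (1 + xi\<^sup>2) \<and>
  norm (hsym1 \<alpha> lam F (Complex e xi)) \<le> K / (1 + xi\<^sup>2) \<and>
  norm (hsym2 \<alpha> lam F (Complex e xi)) \<le> K / (1 + xi\<^sup>2)"
  using hsym_line_bound[OF assms] ..
 note K = K[rule_format, THEN conjunct1] K[rule_format, THEN conjunct2, THEN conjunct1]
  K[rule_format, THEN conjunct2, THEN conjunct2]
 have 1: "(\<integral>xi. eix (xi * t) * hsym1 \<alpha> lam F (Complex e xi) \<partial>lborel) = - (\<i> * of_real t) * Et e t"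
  unfolding Et_def
  by (rule fourier_by_parts[OF hsym0_vd[OF F assms(1)] continuous_on_hsym(2)[OF F assms(1)] K(1,2)])
 have 2: "(\<integral>xi. eix (xi * t) * hsym2 \<alpha> lam F (Complex e xi) \<partial>lborel)
   = - (\<i> * of_real t) * (\<integral>xi. eix (xi * t) * hsym1 \<alpha> lam F (Complex e xi) \<partial>lborel)"
  by (rule fourier_by_parts[OF hsym1_vd[OF F assms(1)] continuous_on_hsym(3)[OF F assms(1)] K(2,3)])
 show ?thesis unfolding 2 1 by (simp add: power2_eq_square mult_ac)
qed

text \<open>Two integrations by parts gain \<open>t^2\<close>, while the singularity of the second
  derivative costs \<open>e^(- \<kappa>) = t^\<kappa>\<close> on the line \<open>e = 1 / t\<close>,
  with \<open>\<kappa> = gam \<alpha> / 2\<close>. Because \<open>\<kappa> < 1\<close>, the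
  resulting exponent is below \<open>-1\<close>.\<close>

lemma Et_decay:
 obtains C where "\<And>t. 1 \<le> t ==> norm (Et (1 / t) t) \<le> C * t powr (gam \<alpha> / 2 - 2)"
proof -
 obtain K where K0: "0 \<le> K"
  "\<And>w. 0 < Re w ==> Re w \<le> 1 ==> norm (hsym0 \<alpha> lam F w) \<le> K / (1 + (Im w)\<^sup>2) * sdist lam w powr (- gam \<alpha>)"
  "\<And>w. 0 < Re w ==> Re w \<le> 1 ==> norm (hsym1 \<alpha> lam F w) \<le> K / (1 + (Im w)\<^sup>2) * sdist lam w powr (- gam \<alpha>)"
  and K: "\<And>w. 0 < Re w ==> Re w \<le> 1 ==> norm (hsym2 \<alpha> lam F w) \<le> K / (1 + (Im w)\<^sup>2) * sdist lam w powr (- gam \<alpha>)"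
  using hsym_bound[OF F \<alpha> lam] by blast
 define \<kappa> where "\<kappa> = gam \<alpha> / 2"
 have \<kappa>: "0 \<le> \<kappa>" "\<kappa> < 1" using gam_bounds[OF \<alpha>] by (auto simp: \<kappa>_def)
 let ?S = "\<lambda>xi. \<bar>xi - lam\<bar> powr (- \<kappa>) / (1 + xi\<^sup>2) + \<bar>xi - (- lam)\<bar> powr (- \<kappa>) / (1 + xi\<^sup>2)"
 have Sint: "integrable lborel ?S"
  by (intro Bochner_Integration.integrable_add integrable_powr_near \<kappa>)
 show ?thesis
 proof (rule that)
  fix t :: real assume t: "1 \<le> t"
  define e where "e = 1 / t"
  have e: "0 < e" "e \<le> 1" using t by (auto simp: e_def)
  have hb: "AE xi in lborel. norm (eix (xi * t) * hsym2 \<alpha> lam F (Complex e xi)) \<le> K * e powr (- \<kappa>) * ?S xi"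
  proof -
   have "AE xi in lborel. xi \<noteq> lam" "AE xi in lborel. xi \<noteq> - lam" by (rule AE_lborel_singleton)+
   then show ?thesis
   proof eventually_elim
    fix xi assume "xi \<noteq> lam" "xi \<noteq> - lam"
    then have "sdist lam (Complex e xi) powr (- gam \<alpha>) \<le> e powr (- \<kappa>) * (\<bar>xi - lam\<bar> powr (- \<kappa>) + \<bar>xi - (- lam)\<bar> powr (- \<kappa>))"
     using sdist_powr_le2[OF e(1) \<kappa>(1), of xi lam] by (simp add: \<kappa>_def)
    then have "K / (1 + xi\<^sup>2) * sdist lam (Complex e xi) powr (- gam \<alpha>) \<le> K / (1 + xi\<^sup>2) * (e powr (- \<kappa>) * (\<bar>xi - lam\<bar> powr (- \<kappa>) + \<bar>xi - (- lam)\<bar> powr (- \<kappa>)))"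
     using K0(1) by (intro mult_left_mono) (auto simp: add_nonneg_nonneg)
    also have "\<dots> = K * e powr (- \<kappa>) * ?S xi"
     by (simp add: add_divide_distrib[symmetric])
    finally show "norm (eix (xi * t) * hsym2 \<alpha> lam F (Complex e xi)) \<le> K * e powr (- \<kappa>) * ?S xi"
     using K[of "Complex e xi"] e by (simp add: norm_mult)
   qed
  qed
  have i2: "integrable lborel (\<lambda>xi. K * e powr (- \<kappa>) * ?S xi)" by (rule integrable_mult_right[OF Sint])
  have "norm (\<integral>xi. eix (xi * t) * hsym2 \<alpha> lam F (Complex e xi) \<partial>lborel) \<le> (\<integral>xi. K * e powr (- \<kappa>) * ?S xi \<partial>lborel)"
   by (rule integral_norm_bound_AE[OF i2 hb])
  also have "\<dots> = K * (\<integral>xi. ?S xi \<partial>lborel) * t powr \<kappa>"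
  proof -
   have "e powr (- \<kappa>) = t powr \<kappa>" using t by (simp add: e_def powr_minus powr_divide)
   then show ?thesis by simp
  qed
  finally have "t\<^sup>2 * norm (Et e t) \<le> K * (\<integral>xi. ?S xi \<partial>lborel) * t powr \<kappa>"
   unfolding Et_by_parts[OF e, symmetric] by (simp add: norm_mult norm_power)
  then have "norm (Et e t) \<le> K * (\<integral>xi. ?S xi \<partial>lborel) * t powr \<kappa> / t\<^sup>2"
   using t by (simp add: pos_le_divide_eq mult.commute)
  also have "\<dots> = K * (\<integral>xi. ?S xi \<partial>lborel) * t powr (\<kappa> - 2)"
   using t by (simp add: powr_diff powr_numeral)
  finally show "norm (Et (1 / t) t) \<le> K * (\<integral>xi. ?S xi \<partial>lborel) * t powr (gam \<alpha> / 2 - 2)"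
   by (simp add: e_def \<kappa>_def)
 qed
qed

text \<open>The decay at time \<open>t\<close> is read off the line \<open>Re w = 1 / t\<close>, where the factor
 \<open>exp (w t)\<close> stays bounded.\<close>

lemma symbol_inverse:
 fixes G :: "real => complex"
 assumes G: "\<And>e t. 0 < e ==> e \<le> 1 ==> G t = (\<integral>xi. exp (Complex e xi * of_real t) * hsym0 \<alpha> lam F (Complex e xi) \<partial>lborel) / of_real (2 * pi)"
  and G0: "\<And>t. t < - T ==> G t = 0"
 shows "integrable lborel G" "fourier G xi0 = wave_symbol \<alpha> xi0 lam * fourier (F 0) xi0"
proof -
 have T: "0 < T" using F by (simp add: test_seq_def)
 have GE: "G t = of_real (exp (e * t)) * Et e t / of_real (2 * pi)" if "0 < e" "e \<le> 1" for e t
 proof -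
  have eq: "exp (Complex e xi * of_real t) * hsym0 \<alpha> lam F (Complex e xi)
    = of_real (exp (e * t)) * (eix (xi * t) * hsym0 \<alpha> lam F (Complex e xi))" for xi
   by (simp add: Complex_eq distrib_right exp_add mult.assoc flip: exp_of_real)
  show ?thesis unfolding G[OF that] Et_def eq by simp
 qed
 have [measurable]: "(\<lambda>xi. hsym0 \<alpha> lam F (Complex e xi)) \<in> borel_measurable borel" if "0 < e" for e
  using continuous_on_hsym(1)[OF F that] by (rule borel_measurable_continuous_onI)
 have [measurable]: "Et 1 \<in> borel_measurable borel"
  unfolding Et_def[abs_def] by measurable
 have G1: "G = (\<lambda>t. of_real (exp t) * Et 1 t / of_real (2 * pi))" using GE[of 1] by auto
 have [measurable]: "G \<in> borel_measurable borel" unfolding G1 by measurable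
 obtain C where C: "\<And>t. 1 \<le> t ==> norm (Et (1 / t) t) \<le> C * t powr (gam \<alpha> / 2 - 2)" using Et_decay by blast
 define B where "B = (\<integral>xi. norm (hsym0 \<alpha> lam F (Complex 1 xi)) \<partial>lborel)"
 have Eb: "norm (Et 1 t) \<le> B" for t
  unfolding Et_def B_def by (rule order_trans[OF integral_norm_bound]) (simp add: norm_mult)
 have B0: "0 \<le> B" unfolding B_def by simp
 have C0: "0 \<le> C" using order_trans[OF norm_ge_zero C[of 1]] by simp
 \<comment> \<open>Nothing before \<open>- T\<close>, a constant from the line \<open>e = 1\<close>
   up to time one, and the power from the line \<open>e = 1 / t\<close> afterwards.\<close>
 let ?dom = "\<lambda>t. exp 1 * B * indicator {-T..1} t + exp 1 * C * (indicator {1..} t * t powr (gam \<alpha> / 2 - 2))"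
 have pi1: "norm x / (2 * pi) \<le> norm x" for x :: complex
 proof -
  have "norm x / (2 * pi) \<le> norm x / 1" using pi_gt3 by (intro divide_left_mono) auto
  then show ?thesis by simp
 qed
 have dom: "norm (G t) \<le> ?dom t" for t
 proof (cases "t < - T")
  case False
  show ?thesis
  proof (cases "t \<le> 1")
   case True
   have "norm (G t) \<le> exp t * norm (Et 1 t)"
    using pi1[of "of_real (exp t) * Et 1 t"] by (simp add: G1 norm_divide norm_mult)
   also have "\<dots> \<le> exp 1 * B" using True Eb B0 by (intro mult_mono) auto
   also have "\<dots> \<le> ?dom t" using False True C0 by (simp add: indicator_def)
   finally show ?thesis .
  next
   case f: False
   then have t: "1 \<le> t" by simp
   have "norm (G t) \<le> exp (1 / t * t) * norm (Et (1 / t) t)"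
    using pi1[of "of_real (exp (1 / t * t)) * Et (1 / t) t"] GE[of "1 / t" t] t by (simp add: norm_divide norm_mult)
   also have "\<dots> \<le> exp 1 * (C * t powr (gam \<alpha> / 2 - 2))" using C[OF t] t by (intro mult_mono) auto
   also have "\<dots> \<le> ?dom t" using f B0 by (simp add: indicator_def)
   finally show ?thesis .
  qed
 qed (use G0 B0 C0 in \<open>auto simp: indicator_def\<close>)
 have "integrable lborel ?dom"
  using gam_bounds[OF \<alpha>] by (intro Bochner_Integration.integrable_add integrable_mult_right integrable_powr_tail)
    (auto simp: integrable_indicator_iff emeasure_lborel_Icc_eq)
 then show Gint: "integrable lborel G"
  by (rule Bochner_Integration.integrable_bound) (use order_trans[OF dom abs_ge_self] in \<open>auto intro!: AE_I2\<close>)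
 have expG: "norm (exp (- (w * of_real t)) * G t) \<le> exp T * norm (G t)" if "0 \<le> Re w" "Re w \<le> 1" for w t
 proof (cases "t < - T")
  case False
  have "- (Re w * t) \<le> Re w * T" using False that mult_left_mono[of "- t" T "Re w"] by auto
  also have "\<dots> \<le> 1 * T" using that T by (intro mult_right_mono) auto
  finally show ?thesis by (simp add: norm_mult mult_right_mono)
 qed (simp add: G0)
 have lint: "integrable lborel (\<lambda>t. exp (- (w * of_real t)) * G t)" if "0 \<le> Re w" "Re w \<le> 1" for w
  by (rule Bochner_Integration.integrable_bound[OF integrable_mult_right[OF integrable_norm[OF Gint], of "exp T"]])
    (use expG[OF that] in auto)
 have lcont: "continuous_on {w. 0 \<le> Re w \<and> Re w \<le> 1} (lap G)"
  unfolding lap_def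
  by (rule continuous_on_integral_dominated[OF _ _ _ integrable_mult_right[OF integrable_norm[OF Gint], of "exp T"]])
    (use expG in \<open>auto intro!: continuous_intros\<close>)
 \<comment> \<open>\<open>G\<close> is given by inverse transforms, so Fourier inversion returns
   \<open>hsym0\<close> almost everywhere on each line; continuity of both sides removes the
   exceptional set.\<close>
 have Gh: "lap G (Complex e xi) = hsym0 \<alpha> lam F (Complex e xi)" if e: "0 < e" "e \<le> 1" for e xi
 proof -
  let ?h = "\<lambda>xi. hsym0 \<alpha> lam F (Complex e xi)"
  let ?E = "\<lambda>t. exp (- (of_real e * of_real t)) * G t"
  have E: "Et e t = of_real (2 * pi) * ?E t" for t
  proof -
   have "?E t = exp (- (of_real e * of_real t)) * exp (of_real e * of_real t) * Et e t / of_real (2 * pi)"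
    unfolding GE[OF e] by (simp flip: exp_of_real)
   then show ?thesis by (simp flip: exp_add)
  qed
  have Eint: "integrable lborel (Et e)" unfolding E using lint[of "of_real e"] e by auto
  have "AE xi in lborel. ?h xi = (\<integral>s. eix (s * xi) * Et e (- s) \<partial>lborel) / of_real (2 * pi)"
  proof (rule fourier_inversion[OF integrable_hsym0[OF e]])
   show "integrable lborel (\<lambda>s. Et e (- s))" using lborel_integrable_real_affine[OF Eint, of "-1" 0] by simp
   show "Et e (- s) = (\<integral>t. exp (- (\<i> * of_real (s * t))) * ?h t \<partial>lborel)" for s
    unfolding Et_def by (simp add: mult.commute)
  qed
  moreover have "(\<integral>s. eix (s * xi) * Et e (- s) \<partial>lborel) / of_real (2 * pi) = lap G (Complex e xi)" for xi
  proof -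
   have "(\<integral>s. eix (s * xi) * Et e (- s) \<partial>lborel) = (\<integral>s. eix ((- s) * xi) * Et e s \<partial>lborel)"
    by (subst lborel_integral_real_affine[of "-1" _ 0]) auto
   also have "\<dots> = (\<integral>s. of_real (2 * pi) * (exp (- (Complex e xi * of_real s)) * G s) \<partial>lborel)"
   proof (rule Bochner_Integration.integral_cong[OF refl])
    fix s
    have "eix ((- s) * xi) * exp (- (of_real e * of_real s)) = exp (- (Complex e xi * of_real s))"
     unfolding exp_add[symmetric] by (rule arg_cong[where f = exp]) (simp add: Complex_eq algebra_simps)
    then show "eix ((- s) * xi) * Et e s = of_real (2 * pi) * (exp (- (Complex e xi * of_real s)) * G s)"
     unfolding E by (simp add: mult.assoc[symmetric] mult.commute[of _ "of_real pi"])
   qed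
   finally show ?thesis by (simp add: lap_def)
  qed
  ultimately have ae: "AE xi in lborel. xi \<in> UNIV --> ?h xi - lap G (Complex e xi) = 0" by simp
  have "continuous_on UNIV (\<lambda>xi. ?h xi - lap G (Complex e xi))"
   by (intro continuous_intros continuous_on_hsym(1)[OF F e(1)] continuous_on_compose2[OF lcont continuous_on_Complex_line])
     (use e in auto)
  from AE_zero_imp_zero[OF open_UNIV this ae, of xi] show ?thesis by simp
 qed
 have at01: "at 0 within {0..1} = at_right (0::real)" by (rule at_within_Icc_at_right) simp
 have Clim: "((\<lambda>e. Complex e xi0) \<longlongrightarrow> Complex 0 xi0) (at 0 within {0..1})"
  by (intro tendsto_Complex tendsto_intros)
 have limg: "((\<lambda>e. lap g (Complex e xi0)) \<longlongrightarrow> fourier g xi0) (at_right 0)"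
  if "continuous_on {w. 0 \<le> Re w \<and> Re w \<le> 1} (lap g)" for g
 proof -
  have "((\<lambda>e. lap g (Complex e xi0)) \<longlongrightarrow> lap g (Complex 0 xi0)) (at 0 within {0..1})"
   by (rule continuous_on_tendsto_compose[OF that Clim]) (auto simp: eventually_at_filter)
  moreover have "lap g (Complex 0 xi0) = fourier g xi0"
   unfolding lap_def fourier_def Complex_eq by (simp add: mult.assoc)
  ultimately show ?thesis unfolding at01 by simp
 qed
 note limG = limg[OF lcont] and limF = limg[OF continuous_on_lap[OF F, of 0]]
 let ?p = "\<lambda>e. zsq lam (Complex e xi0) powr of_real \<alpha>"
 have ev: "\<forall>\<^sub>F e in at_right 0. 0 < e \<and> e < (1::real)"
  using eventually_at_right_real[of 0 "1::real"] by simp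
 have ps: "wave_symbol \<alpha> xi0 lam = Lim (at_right 0) ?p"
 proof -
  have "(of_real xi0 - \<i> * of_real e)\<^sup>2 = - (Complex e xi0)\<^sup>2" for e
   by (simp add: Complex_eq power2_eq_square algebra_simps)
  then show ?thesis by (simp add: wave_symbol_def zsq_def)
 qed
 \<comment> \<open>\<open>wave_symbol\<close> is a \<open>Lim\<close>, whose existence is not known
   at this point. Where the transform of \<open>F 0\<close> is nonzero, division by it proves
   convergence and gives the value. Where it is zero, the local bound \<open>P\<close> on the symbol
   makes \<open>lap G\<close> tend to zero, so both sides vanish.\<close>
 show "fourier G xi0 = wave_symbol \<alpha> xi0 lam * fourier (F 0) xi0"
 proof (cases "fourier (F 0) xi0 = 0")
  case False
  have "((\<lambda>e. lap G (Complex e xi0) / lap (F 0) (Complex e xi0)) \<longlongrightarrow> fourier G xi0 / fourier (F 0) xi0) (at_right 0)"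
   by (rule tendsto_divide[OF limG limF False])
  moreover have "\<forall>\<^sub>F e in at_right 0. lap G (Complex e xi0) / lap (F 0) (Complex e xi0) = ?p e"
   using ev tendsto_imp_eventually_ne[OF limF False]
   by eventually_elim (simp add: Gh hsym0_def)
  ultimately have "(?p \<longlongrightarrow> fourier G xi0 / fourier (F 0) xi0) (at_right 0)" by (rule Lim_transform_eventually)
  then have "wave_symbol \<alpha> xi0 lam = fourier G xi0 / fourier (F 0) xi0"
   unfolding ps by (intro tendsto_Lim) auto
  then show ?thesis using False by simp
 next
  case True
  define P where "P = (lam\<^sup>2 + (1 + \<bar>xi0\<bar>)\<^sup>2) powr \<alpha>"
  have le: "norm (lap G (Complex e xi0)) \<le> norm (lap (F 0) (Complex e xi0)) * P" if "0 < e" "e < 1" for e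
  proof -
   have "norm (Complex e xi0) \<le> 1 + \<bar>xi0\<bar>" using cmod_le[of "Complex e xi0"] that by simp
   then have "norm ((Complex e xi0)\<^sup>2) \<le> (1 + \<bar>xi0\<bar>)\<^sup>2" unfolding norm_power by (intro power_mono) auto
   then have "norm (zsq lam (Complex e xi0)) \<le> lam\<^sup>2 + (1 + \<bar>xi0\<bar>)\<^sup>2"
    unfolding zsq_def by (intro norm_triangle_le) (auto simp: norm_power)
   then have "norm (?p e) \<le> P"
    unfolding P_def using \<alpha> by (simp add: norm_powr_real_powr' powr_mono2)
   then show ?thesis using Gh[of e xi0] that by (simp add: hsym0_def norm_mult mult_left_mono)
  qed
  have "((\<lambda>e. norm (lap (F 0) (Complex e xi0)) * P) \<longlongrightarrow> 0) (at_right 0)"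
   using tendsto_mult_left_zero[OF tendsto_norm_zero[OF limF[unfolded True]], of P] .
  then have "((\<lambda>e. lap G (Complex e xi0)) \<longlongrightarrow> 0) (at_right 0)"
   by (rule Lim_null_comparison[rotated]) (use ev le in \<open>auto elim: eventually_mono\<close>)
  then have "fourier G xi0 = 0" using limG tendsto_unique[OF trivial_limit_at_right_real] by blast
  then show ?thesis using True by simp
 qed
qed

end

section \<open>The square root of the symbol\<close>

text \<open>The principal root, which lies in the right half-plane for \<open>Re w > 0\<close> and
  is the parameter of the kernel at the transform variable \<open>w\<close>.\<close>

definition zroot :: "real => complex => complex" where
 "zroot lam w = zsq lam w powr of_real (1 / 2)"

lemma zsq_nonzero: "0 < Re w ==> zsq lam w \<noteq> 0"
 using zsq_notin_nonpos[of w lam] by (auto simp: complex_nonpos_Reals_iff)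

lemma zroot_square: "0 < Re w ==> (zroot lam w)\<^sup>2 = zsq lam w"
 using zsq_nonzero[of w lam] by (simp add: zroot_def powr_def exp_double[symmetric])

text \<open>Halving the logarithm keeps its imaginary part in the principal strip, so the principal
  powers compose without crossing a branch.\<close>

lemma zroot_powr:
 assumes "0 < Re w"
 shows "zroot lam w powr of_real p = zsq lam w powr of_real (p / 2)"
proof -
 have z: "zsq lam w \<noteq> 0" using zsq_nonzero[OF assms] .
 have zr: "zroot lam w = exp (Ln (zsq lam w) / 2)" using z by (simp add: zroot_def powr_def)
 have "Im (Ln (zsq lam w) / 2) = Im (Ln (zsq lam w)) / 2" by simp
 then have L: "Ln (zroot lam w) = Ln (zsq lam w) / 2"
  unfolding zr using mpi_less_Im_Ln[OF z] Im_Ln_le_pi[OF z] pi_gt_zero by (intro Ln_exp) linarith+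
 have "zroot lam w \<noteq> 0" by (simp add: zr)
 then show ?thesis using z by (simp add: powr_def L)
qed

text \<open>The root \<open>r\<close> of \<open>zeta\<close> satisfies
  \<open>2 (Re r)^2 = |zeta| + Re zeta\<close>, and \<open>|zeta| \<ge> |w|^2 - lam^2\<close> makes
  the right side at least \<open>2 (Re w)^2\<close>. Hence on a line \<open>Re w = e\<close> the
  kernel parameter stays in \<open>Re z \<ge> e\<close>, where the kernel bounds are
  uniform.\<close>

lemma Re_zroot_ge:
 assumes "0 < Re w"
 shows "Re w \<le> Re (zroot lam w)"
proof -
 have z: "zsq lam w \<noteq> 0" using zsq_nonzero[OF assms] .
 let ?r = "zroot lam w"
 have "- pi / 2 < Im (Ln (zsq lam w)) / 2" "Im (Ln (zsq lam w)) / 2 \<le> pi / 2"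
  using mpi_less_Im_Ln[OF z] Im_Ln_le_pi[OF z] by linarith+
 then have "0 \<le> cos (Im (Ln (zsq lam w)) / 2)" by (intro cos_ge_zero) auto
 then have r0: "0 \<le> Re ?r" using z by (simp add: zroot_def powr_def Re_exp)
 have n: "norm (zsq lam w) = (Re ?r)\<^sup>2 + (Im ?r)\<^sup>2"
  unfolding zroot_square[OF assms, symmetric] norm_power cmod_power2 ..
 have r: "Re (zsq lam w) = (Re ?r)\<^sup>2 - (Im ?r)\<^sup>2"
  unfolding zroot_square[OF assms, symmetric] by (simp add: power2_eq_square)
 have "norm (w\<^sup>2) = norm (zsq lam w - (of_real lam)\<^sup>2)" by (simp add: zsq_def)
 also have "\<dots> \<le> norm (zsq lam w) + lam\<^sup>2"
  by (rule order_trans[OF norm_triangle_ineq4]) (simp add: norm_power)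
 finally have 1: "(Re w)\<^sup>2 + (Im w)\<^sup>2 \<le> norm (zsq lam w) + lam\<^sup>2" by (simp add: norm_power cmod_power2)
 have 2: "Re (zsq lam w) = lam\<^sup>2 + (Re w)\<^sup>2 - (Im w)\<^sup>2" by (simp add: zsq_def power2_eq_square)
 have "(Re w)\<^sup>2 \<le> (Re ?r)\<^sup>2" using 1 2 n r by linarith
 then show ?thesis using r0 by (rule power2_le_imp_le)
qed

section \<open>The kernel has no zeros\<close>

lemma powr_le_exp:
 assumes "0 < (d::real)"
 obtains K where "0 \<le> K" "\<And>y. 1 \<le> y ==> y powr q \<le> K * exp (d * y)"
proof -
 define n where "n = nat \<lceil>max q 0\<rceil> + 1"
 have n: "q \<le> real n" "0 < n" by (auto simp: n_def) linarith
 show ?thesis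
 proof (rule that[of "(real n / d) ^ n"])
  fix y :: real assume y: "1 \<le> y"
  have "y powr q \<le> y powr real n" using y n by (intro powr_mono) auto
  also have "\<dots> = y ^ n" using y by (simp add: powr_realpow)
  also have "\<dots> = (real n / d) ^ n * (d * y / real n) ^ n"
   using assms n by (simp flip: power_mult_distrib)
  also have "(d * y / real n) ^ n \<le> exp (d * y / real n) ^ n"
   using assms y n order_trans[OF _ exp_ge_add_one_self[of "d * y / real n"], of "d * y / real n"]
   by (intro power_mono) auto
  also have "exp (d * y / real n) ^ n = exp (d * y)" using n by (simp flip: exp_of_nat_mult)
  finally show "y powr q \<le> (real n / d) ^ n * exp (d * y)" using assms by (simp add: mult_left_mono)
 qed (use assms in auto)
qed

definition bint1 :: "real => complex => real => complex" where
 "bint1 mu z y = - z * of_real y * bint (mu - 1) z y"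

lemma bint_vd: "0 < Re z ==> 0 < y ==> ((\<lambda>y. bint mu z y) has_vector_derivative bint1 mu z y) (at y)"
 unfolding bint1_def by (rule bint_deriv)

lemma bint1_vd:
 "0 < Re z ==> 0 < y ==> ((\<lambda>y. bint1 mu z y) has_vector_derivative
   z\<^sup>2 * bint mu z y - of_real ((1 - 2 * mu) / y) * bint1 mu z y) (at y)"
 unfolding bint1_def by (rule bint_second_deriv)

text \<open>The rate drops from \<open>Re z / 2\<close> to \<open>Re z / 4\<close> because the
  derivative carries an extra factor \<open>y\<close>, absorbed by half of the exponential.\<close>

lemma bint_exp_decay:
 assumes "0 < Re z"
 obtains K where "0 \<le> K" "\<And>y. 1 \<le> y ==> norm (bint mu z y) \<le> K * exp (- (Re z / 4 * y))"
  "\<And>y. 1 \<le> y ==> norm (bint1 mu z y) \<le> K * exp (- (Re z / 4 * y))"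
proof -
 define c where "c = Re z / 4"
 have c: "0 < c" using assms by (simp add: c_def)
 obtain L where L: "0 \<le> L" "\<And>y. 1 \<le> y ==> y powr 1 \<le> L * exp (c * y)" using powr_le_exp[OF c] by blast
 define I0 where "I0 = (\<integral>t. gdom mu (Re z / 2) 1 t \<partial>lborel)"
 define I1 where "I1 = (\<integral>t. gdom (mu - 1) (Re z / 2) 1 t \<partial>lborel)"
 have I: "0 \<le> I0" "0 \<le> I1" by (auto simp: I0_def I1_def gdom_def)
 show ?thesis
 proof (rule that[of "I0 + norm z * L * I1"])
  show "0 \<le> I0 + norm z * L * I1" using I L by simp
  fix y :: real assume y: "1 \<le> y"
  have "norm (bint mu z y) \<le> exp (- (Re z * y / 2)) * I0"
   unfolding I0_def by (rule norm_bint_decay[OF assms y])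
  also have "\<dots> \<le> exp (- (c * y)) * (I0 + norm z * L * I1)"
   using I L y assms by (intro mult_mono) (auto simp: c_def)
  finally show "norm (bint mu z y) \<le> (I0 + norm z * L * I1) * exp (- (Re z / 4 * y))" by (simp add: c_def mult.commute)
  have "norm (bint1 mu z y) = norm z * y * norm (bint (mu - 1) z y)" using y by (simp add: bint1_def norm_mult)
  also have "\<dots> \<le> norm z * (L * exp (c * y)) * (exp (- (Re z * y / 2)) * I1)"
   using L(2)[OF y] y norm_bint_decay[OF assms y, of "mu - 1"] I L(1)
   unfolding I1_def by (intro mult_mono) auto
  also have "\<dots> = norm z * L * I1 * (exp (c * y) * exp (- (Re z * y / 2)))" by simp
  also have "exp (c * y) * exp (- (Re z * y / 2)) = exp (- (c * y))" by (simp add: c_def flip: exp_add)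
  also have "norm z * L * I1 * exp (- (c * y)) \<le> (I0 + norm z * L * I1) * exp (- (c * y))"
   using I by (intro mult_right_mono) auto
  finally show "norm (bint1 mu z y) \<le> (I0 + norm z * L * I1) * exp (- (Re z / 4 * y))" by (simp add: c_def)
 qed
qed

lemma bint_0_nonzero: "0 < \<alpha> ==> 0 < Re z ==> bint \<alpha> z 0 \<noteq> 0"
 by (subst bint_0) (auto simp: Gamma_real_pos less_imp_neq[symmetric])

text \<open>Uniqueness for the initial value problem of the Bessel equation, with Gronwall's inequality.\<close>

lemma bint_zero_backwards:
 assumes z: "0 < Re z" and y1: "0 < y1" "bint \<alpha> z y1 = 0" "bint1 \<alpha> z y1 = 0" and a: "0 < a" "a \<le> y1"
 shows "bint \<alpha> z a = 0"
proof -
 define b where "b = norm (z\<^sup>2)"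
 define d where "d = 2 * \<bar>1 - 2 * \<alpha>\<bar> / a"
 \<comment> \<open>\<open>d\<close> bounds the coefficient \<open>2 |1 - 2 \<alpha>| / y\<close>
   from \<open>a\<close> on. With this \<open>K\<close> the function \<open>N\<close> satisfies
   \<open>|N'| \<le> K N\<close> there, which controls it backwards from \<open>y1\<close>.\<close>
 define K where "K = 1 + b + d"
 have bd: "0 \<le> b" "0 \<le> d" using a by (auto simp: b_def d_def)
 define N where "N = (\<lambda>y. (norm (bint \<alpha> z y))\<^sup>2 + (norm (bint1 \<alpha> z y))\<^sup>2)"
 define N' where "N' = (\<lambda>y. 2 * (bint \<alpha> z y \<bullet> bint1 \<alpha> z y) +
   2 * (bint1 \<alpha> z y \<bullet> (z\<^sup>2 * bint \<alpha> z y - of_real ((1 - 2 * \<alpha>) / y) * bint1 \<alpha> z y)))"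
 have dN: "(N has_real_derivative N' y) (at y)" if "0 < y" for y
 proof -
  have *: "((\<lambda>y. (norm (f y))\<^sup>2) has_real_derivative 2 * (f y \<bullet> f')) (at y)"
   if "(f has_vector_derivative f') (at y)" for f :: "real => complex" and f'
  proof -
   have "((\<lambda>y. f y \<bullet> f y) has_derivative (\<lambda>h. f y \<bullet> (h *\<^sub>R f') + (h *\<^sub>R f') \<bullet> f y)) (at y)"
    using has_derivative_inner[OF that[unfolded has_vector_derivative_def] that[unfolded has_vector_derivative_def]] .
   then show ?thesis
    unfolding has_field_derivative_def power2_norm_eq_inner
    by (rule has_derivative_eq_rhs) (auto simp: fun_eq_iff inner_commute)
  qed
  show ?thesis unfolding N_def N'_def
   by (intro DERIV_add * bint_vd bint1_vd z that)
 qed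
 have N'b: "- K * N y \<le> N' y" if y: "a \<le> y" for y
 proof -
  define A where "A = norm (bint \<alpha> z y)"
  define B where "B = norm (bint1 \<alpha> z y)"
  have y0: "0 < y" using a y by simp
  have AB: "2 * A * B \<le> A\<^sup>2 + B\<^sup>2" using sum_squares_bound[of A B] by simp
  have nn: "0 \<le> A" "0 \<le> B" by (auto simp: A_def B_def)
  have 1: "\<bar>2 * (bint \<alpha> z y \<bullet> bint1 \<alpha> z y)\<bar> \<le> A\<^sup>2 + B\<^sup>2"
   using Cauchy_Schwarz_ineq2[of "bint \<alpha> z y" "bint1 \<alpha> z y"] AB by (simp add: A_def B_def)
  have "norm (z\<^sup>2 * bint \<alpha> z y - of_real ((1 - 2 * \<alpha>) / y) * bint1 \<alpha> z y) \<le> b * A + \<bar>1 - 2 * \<alpha>\<bar> / y * B"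
   using y0 by (intro norm_triangle_le_diff add_mono) (auto simp: b_def A_def B_def norm_mult norm_divide simp flip: of_real_diff of_real_divide)
  also have "\<bar>1 - 2 * \<alpha>\<bar> / y * B \<le> d / 2 * B"
   using nn y a unfolding d_def by (intro mult_right_mono) (auto intro!: divide_left_mono)
  finally have "norm (z\<^sup>2 * bint \<alpha> z y - of_real ((1 - 2 * \<alpha>) / y) * bint1 \<alpha> z y) \<le> b * A + d / 2 * B" by simp
  then have "2 * (B * norm (z\<^sup>2 * bint \<alpha> z y - of_real ((1 - 2 * \<alpha>) / y) * bint1 \<alpha> z y)) \<le> 2 * (B * (b * A + d / 2 * B))"
   using nn by (intro mult_left_mono) auto
  also have "\<dots> = b * (2 * A * B) + d * B\<^sup>2" by (simp add: power2_eq_square algebra_simps)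
  also have "\<dots> \<le> b * (A\<^sup>2 + B\<^sup>2) + d * (A\<^sup>2 + B\<^sup>2)"
   using AB bd by (intro add_mono mult_left_mono) auto
  finally have 2: "\<bar>2 * (bint1 \<alpha> z y \<bullet> (z\<^sup>2 * bint \<alpha> z y - of_real ((1 - 2 * \<alpha>) / y) * bint1 \<alpha> z y))\<bar> \<le> b * (A\<^sup>2 + B\<^sup>2) + d * (A\<^sup>2 + B\<^sup>2)"
   using Cauchy_Schwarz_ineq2[of "bint1 \<alpha> z y" "z\<^sup>2 * bint \<alpha> z y - of_real ((1 - 2 * \<alpha>) / y) * bint1 \<alpha> z y"] by (simp add: B_def)
  have "\<bar>N' y\<bar> \<le> K * N y"
   using abs_triangle_ineq[THEN order_trans, OF add_mono[OF 1 2]]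
   unfolding N'_def N_def K_def A_def B_def by (simp add: algebra_simps)
  then show ?thesis by simp
 qed
 have "N a * exp (K * a) \<le> N y1 * exp (K * y1)"
 proof (rule DERIV_nonneg_imp_nondecreasing[OF a(2)], intro exI conjI)
  fix y assume y: "a \<le> y" "y \<le> y1"
  show "((\<lambda>y. N y * exp (K * y)) has_real_derivative (N' y + K * N y) * exp (K * y)) (at y)"
   using a y by (auto intro!: derivative_eq_intros dN simp: algebra_simps)
  show "0 \<le> (N' y + K * N y) * exp (K * y)" using N'b[OF y(1)] by simp
 qed
 then have "N a * exp (K * a) \<le> 0" using y1 by (simp add: N_def)
 then have "N a \<le> 0" by (simp add: mult_le_0_iff)
 then have "(norm (bint \<alpha> z a))\<^sup>2 \<le> 0" unfolding N_def using zero_le_power2[of "norm (bint1 \<alpha> z a)"] by linarith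
 then show ?thesis by simp
qed

text \<open>\<open>Re (cnj z \<cdot> y\<^sup>1\<^sup>-\<^sup>2\<^sup>\<alpha> A' cnj A)\<close> is nondecreasing and tends to \<open>0\<close> at infinity, so it
 vanishes beyond any zero of \<open>A\<close>.\<close>

lemma bint_nonzero:
 assumes \<alpha>: "0 < \<alpha>" and z: "0 < Re z" and y0: "0 < y0"
 shows "bint \<alpha> z y0 \<noteq> 0"
proof
 assume zero: "bint \<alpha> z y0 = 0"
 define A where "A = bint \<alpha> z"
 define B where "B = bint1 \<alpha> z"
 define p where "p = (\<lambda>y::real. y powr (1 - 2 * \<alpha>))"
 define phi where "phi = (\<lambda>y. p y * (A y \<bullet> (cnj z * B y)))"
 define phi' where "phi' = (\<lambda>y. p y * Re z * ((norm z)\<^sup>2 * (norm (A y))\<^sup>2 + (norm (B y))\<^sup>2))"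
 have dphi: "(phi has_real_derivative phi' y) (at y)" if "0 < y" for y
 proof -
  have dp: "(p has_real_derivative (1 - 2 * \<alpha>) / y * p y) (at y)"
   unfolding p_def by (rule DERIV_cong[OF has_real_derivative_powr[OF that]]) (use that in \<open>simp add: powr_diff powr_minus divide_inverse\<close>)
  have "((\<lambda>y. A y \<bullet> (cnj z * B y)) has_derivative
    (\<lambda>h. A y \<bullet> (h *\<^sub>R (cnj z * (z\<^sup>2 * A y - of_real ((1 - 2 * \<alpha>) / y) * B y))) + (h *\<^sub>R B y) \<bullet> (cnj z * B y))) (at y)"
   using bint_vd[OF z that, of \<alpha>] has_vector_derivative_mult_right[OF bint1_vd[OF z that, of \<alpha>], of "cnj z"]
   unfolding has_vector_derivative_def A_def B_def by (rule has_derivative_inner)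
  then have dAB: "((\<lambda>y. A y \<bullet> (cnj z * B y)) has_real_derivative
    (A y \<bullet> (cnj z * (z\<^sup>2 * A y - of_real ((1 - 2 * \<alpha>) / y) * B y)) + B y \<bullet> (cnj z * B y))) (at y)"
   unfolding has_field_derivative_def by (rule has_derivative_eq_rhs) (auto simp: fun_eq_iff algebra_simps)
  have "(1 - 2 * \<alpha>) / y * p y * (A y \<bullet> (cnj z * B y)) + (A y \<bullet> (cnj z * (z\<^sup>2 * A y - of_real ((1 - 2 * \<alpha>) / y) * B y)) + B y \<bullet> (cnj z * B y)) * p y = phi' y"
  proof -
   have 1: "cnj z * (z\<^sup>2 * A y - of_real ((1 - 2 * \<alpha>) / y) * B y) = of_real ((norm z)\<^sup>2) * (z * A y) - ((1 - 2 * \<alpha>) / y) *\<^sub>R (cnj z * B y)"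
   proof -
    have "cnj z * z = of_real ((norm z)\<^sup>2)" unfolding complex_norm_square by (simp add: mult.commute)
    then have "cnj z * (z * (z * A y)) = of_real ((norm z)\<^sup>2) * (z * A y)" by (metis mult.assoc)
    then show ?thesis by (simp add: scaleR_conv_of_real power2_eq_square algebra_simps)
   qed
   have 2: "A y \<bullet> (z * A y) = Re z * (norm (A y))\<^sup>2" "B y \<bullet> (cnj z * B y) = Re z * (norm (B y))\<^sup>2"
    unfolding cmod_power2 by (simp_all add: inner_complex_def power2_eq_square algebra_simps)
   have 3: "A y \<bullet> (of_real ((norm z)\<^sup>2) * (z * A y)) = (norm z)\<^sup>2 * (A y \<bullet> (z * A y))"
    unfolding scaleR_conv_of_real[symmetric] by (rule inner_scaleR_right)
   show ?thesis unfolding 1 inner_diff_right inner_scaleR_right 3 2 phi'_def by (simp add: algebra_simps)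
  qed
  then show ?thesis unfolding phi_def by (intro DERIV_cong[OF DERIV_mult[OF dp dAB]])
 qed
 have phi'0: "0 \<le> phi' y" for y using z by (simp add: phi'_def p_def)
 have mono: "phi a \<le> phi b" if "0 < a" "a \<le> b" for a b
 proof (rule DERIV_nonneg_imp_nondecreasing[OF that(2)])
  show "\<exists>d. (phi has_real_derivative d) (at x) \<and> 0 \<le> d" if "a \<le> x" for x
   using dphi[of x] phi'0[of x] that \<open>0 < a\<close> by (intro exI[of _ "phi' x"]) simp
 qed
 have lim: "(phi \<longlongrightarrow> 0) at_top"
 proof -
  obtain K where K: "0 \<le> K" "\<And>y. 1 \<le> y ==> norm (A y) \<le> K * exp (- (Re z / 4 * y))"
   "\<And>y. 1 \<le> y ==> norm (B y) \<le> K * exp (- (Re z / 4 * y))"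
   using bint_exp_decay[OF z, of \<alpha>] unfolding A_def B_def by blast
  have c: "0 < Re z / 4" using z by simp
  obtain L where L: "0 \<le> L" "\<And>y. 1 \<le> y ==> y powr (1 - 2 * \<alpha>) \<le> L * exp (Re z / 4 * y)"
   using powr_le_exp[OF c] by blast
  have "norm (phi y) \<le> (L * (norm z * K * K)) * exp (- (Re z / 4 * y))" if y: "1 \<le> y" for y
  proof -
   have "norm (A y \<bullet> (cnj z * B y)) \<le> norm (A y) * (norm z * norm (B y))"
    using Cauchy_Schwarz_ineq2[of "A y" "cnj z * B y"] by (simp add: norm_mult)
   also have "\<dots> \<le> (K * exp (- (Re z / 4 * y))) * (norm z * (K * exp (- (Re z / 4 * y))))"
    using K(1) K(2,3)[OF y] by (intro mult_mono) auto
   finally have "norm (phi y) \<le> (L * exp (Re z / 4 * y)) * ((K * exp (- (Re z / 4 * y))) * (norm z * (K * exp (- (Re z / 4 * y)))))"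
    unfolding phi_def real_norm_def abs_mult p_def using L(1) L(2)[OF y] by (intro mult_mono) auto
   also have "\<dots> = (L * (norm z * K * K)) * (exp (Re z / 4 * y) * exp (- (Re z / 4 * y)) * exp (- (Re z / 4 * y)))"
    by (simp only: mult_ac)
   also have "exp (Re z / 4 * y) * exp (- (Re z / 4 * y)) = 1" by (simp flip: exp_add)
   finally show ?thesis by simp
  qed
  then have "\<forall>\<^sub>F y in at_top. norm (phi y) \<le> (L * (norm z * K * K)) * exp (- (Re z / 4 * y))"
   by (intro eventually_mono[OF eventually_ge_at_top[of 1]])
  moreover have "((\<lambda>y. exp (- (Re z / 4 * y))) \<longlongrightarrow> 0) at_top"
   by (intro filterlim_compose[OF exp_at_bot])
     (use filterlim_tendsto_pos_mult_at_top[OF tendsto_const c filterlim_ident] in \<open>simp add: filterlim_uminus_at_bot\<close>)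
  ultimately show ?thesis using Lim_null_comparison tendsto_mult_right_zero by fast
 qed
 have le0: "phi y \<le> 0" if "0 < y" for y
 proof (rule tendsto_lowerbound[OF lim])
  show "\<forall>\<^sub>F x in at_top. phi y \<le> phi x" using eventually_ge_at_top[of y] by eventually_elim (use mono that in auto)
 qed simp
 \<comment> \<open>Beyond \<open>y0\<close>, monotonicity gives \<open>phi \<ge> phi y0 = 0\<close>,
   and the limit at infinity gives \<open>phi \<le> 0\<close>.\<close>
 have ph0: "phi y = 0" if "y0 \<le> y" for y
  using mono[OF y0 that] le0[of y] that y0 zero by (simp add: phi_def A_def)
 have "(phi has_real_derivative 0) (at (y0 + 1))"
  by (rule has_field_derivative_transform_within_open[OF DERIV_const open_greaterThan[of y0]]) (use ph0 in auto)
 then have "phi' (y0 + 1) = 0" using dphi[of "y0 + 1"] y0 DERIV_unique by fastforce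
 then have "(norm z)\<^sup>2 * (norm (A (y0 + 1)))\<^sup>2 + (norm (B (y0 + 1)))\<^sup>2 = 0"
  using y0 z by (simp add: phi'_def p_def)
 then have "A (y0 + 1) = 0 \<and> B (y0 + 1) = 0"
  using z by (subst (asm) add_nonneg_eq_0_iff) auto
 \<comment> \<open>Vanishing value and derivative at \<open>y0 + 1\<close> propagate down towards
   the boundary, where the limit is a nonzero multiple of a Gamma value.\<close>
 then have "bint \<alpha> z a = 0" if "0 < a" "a \<le> y0 + 1" for a
  using bint_zero_backwards[OF z, of "y0 + 1" \<alpha> a] that y0 by (simp add: A_def B_def)
 then have "\<forall>\<^sub>F a in at_right 0. bint \<alpha> z a = 0"
  using eventually_at_right_real[of 0 "y0 + 1"] y0 by (auto elim!: eventually_mono)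
 then have "((\<lambda>a. bint \<alpha> z a) \<longlongrightarrow> 0) (at_right 0)" by (rule tendsto_eventually)
 then have "bint \<alpha> z 0 = 0" using bint_tendsto_0[OF \<alpha> z] tendsto_unique[OF trivial_limit_at_right_real] by blast
 then show False using bint_0_nonzero[OF \<alpha> z] by simp
qed

section \<open>Weak solutions of the Bessel equation\<close>

lemma AE_pos_exhaust:
 assumes "\<And>a b. 0 < a ==> AE y in lborel. y \<in> {a..b::real} --> Q y"
 shows "AE y in lborel. 0 < y --> Q y"
proof -
 have "AE y in lborel. \<forall>n. y \<in> {1 / real (Suc n)..real n} --> Q y"
  unfolding AE_all_countable by (intro allI assms) simp
 then show ?thesis
 proof (elim eventually_mono, intro impI)
  fix y :: real
  assume y: "\<forall>n. y \<in> {1 / real (Suc n)..real n} --> Q y" and "0 < y"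
  obtain N where N: "1 / real (Suc N) < y" using nat_approx_posE[OF \<open>0 < y\<close>] by auto
  obtain M where M: "y < real M" using reals_Archimedean2 by blast
  have "1 / real (Suc (max N M)) \<le> 1 / real (Suc N)" by (simp add: frac_le)
  then have "y \<in> {1 / real (Suc (max N M))..real (max N M)}" using N M by auto
  with y show "Q y" by blast
 qed
qed

text \<open>The cutoff of the solution class does double duty: besides its role in the expansion of
  \<open>u\<close> it supplies, after affine changes of variable, all auxiliary bump functions
  below.\<close>

locale cutoff =
 fixes chi :: "real => real"
 assumes chi: "smooth_cutoff chi"
begin

definition cx :: "real => complex" where "cx y = of_real (chi y)"
definition cx1 :: "real => complex" where "cx1 y = vector_derivative cx (at y)"
definition cx2 :: "real => complex" where "cx2 y = vector_derivative cx1 (at y)"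

lemma cx_smooth: "smooth_on cx UNIV"
 unfolding cx_def[abs_def] using chi
 by (intro smooth_on_linear_outer[OF open_UNIV bounded_linear_of_real]) (simp add: smooth_cutoff_def)

lemma cx1_smooth: "smooth_on cx1 UNIV"
 using smooth_on_vector_derivativeD(1)[OF open_UNIV cx_smooth] by (simp add: cx1_def[abs_def])

lemma cx2_smooth: "smooth_on cx2 UNIV"
 using smooth_on_vector_derivativeD(1)[OF open_UNIV cx1_smooth] by (simp add: cx2_def[abs_def])

lemma cx_vd: "(cx has_vector_derivative cx1 y) (at y)"
 using smooth_on_vector_derivativeD(2)[OF open_UNIV cx_smooth] by (simp add: cx1_def[abs_def])

lemma cx1_vd: "(cx1 has_vector_derivative cx2 y) (at y)"
 using smooth_on_vector_derivativeD(2)[OF open_UNIV cx1_smooth] by (simp add: cx2_def[abs_def])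

lemma cx_1: "y < 1 ==> cx y = 1" and cx_0: "2 < y ==> cx y = 0"
 using chi by (auto simp: cx_def smooth_cutoff_def)

lemma cx1_0: "y < 1 \<or> 2 < y ==> cx1 y = 0"
proof -
 assume "y < 1 \<or> 2 < y"
 moreover have "(cx has_vector_derivative 0) (at y)" if "y < 1"
  by (rule has_vector_derivative_transform_within_open[where f = "\<lambda>_. 1" and S = "{..<1}"]) (use that cx_1 in auto)
 moreover have "(cx has_vector_derivative 0) (at y)" if "2 < y"
  by (rule has_vector_derivative_transform_within_open[where f = "\<lambda>_. 0" and S = "{2<..}"]) (use that cx_0 in auto)
 ultimately show ?thesis unfolding cx1_def using vector_derivative_at by blast
qed

lemma cx2_0: "y < 1 \<or> 2 < y ==> cx2 y = 0"
proof -
 assume "y < 1 \<or> 2 < y"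
 moreover have "(cx1 has_vector_derivative 0) (at y)" if "y < 1"
  by (rule has_vector_derivative_transform_within_open[where f = "\<lambda>_. 0" and S = "{..<1}"]) (use that cx1_0 in auto)
 moreover have "(cx1 has_vector_derivative 0) (at y)" if "2 < y"
  by (rule has_vector_derivative_transform_within_open[where f = "\<lambda>_. 0" and S = "{2<..}"]) (use that cx1_0 in auto)
 ultimately show ?thesis unfolding cx2_def using vector_derivative_at by blast
qed

lemma cx_cont: "continuous_on UNIV cx" and cx1_cont: "continuous_on UNIV cx1" and cx2_cont: "continuous_on UNIV cx2"
 using cx_smooth cx1_smooth cx2_smooth smooth_on_continuous by blast+

lemma cx_measurable [measurable]: "cx \<in> borel_measurable borel"
 and cx1_measurable [measurable]: "cx1 \<in> borel_measurable borel"
 and cx2_measurable [measurable]: "cx2 \<in> borel_measurable borel"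
 using cx_cont cx1_cont cx2_cont borel_measurable_continuous_onI by blast+

lemma cx_bound: "\<exists>X\<ge>1. \<forall>y. norm (cx y) \<le> X \<and> norm (cx1 y) \<le> X \<and> norm (cx2 y) \<le> X"
proof -
 have *: "\<exists>B. \<forall>y\<in>{1..2}. norm (g y) \<le> B" if "continuous_on UNIV g" for g :: "real => complex"
 proof -
  have "continuous_on {1..2} g" using that continuous_on_subset by blast
  then have "compact (g ` {1..2})" using compact_continuous_image by blast
  then have "bounded (g ` {1..2})" by (rule compact_imp_bounded)
  then show ?thesis by (auto simp: bounded_iff)
 qed
 obtain B0 where B0: "\<forall>y\<in>{1..2}. norm (cx y) \<le> B0" using *[OF cx_cont] by blast
 obtain B1 where B1: "\<forall>y\<in>{1..2}. norm (cx1 y) \<le> B1" using *[OF cx1_cont] by blast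
 obtain B2 where B2: "\<forall>y\<in>{1..2}. norm (cx2 y) \<le> B2" using *[OF cx2_cont] by blast
 define X where "X = max 1 (max B0 (max B1 B2))"
 have "norm (cx y) \<le> X \<and> norm (cx1 y) \<le> X \<and> norm (cx2 y) \<le> X" for y
 proof -
  consider "y < 1" | "y \<in> {1..2}" | "2 < y" by fastforce
  then show ?thesis
  proof cases
   case 1
   then show ?thesis by (simp add: cx_1 cx1_0 cx2_0 X_def)
  next
   case 2
   then show ?thesis using B0 B1 B2 by (fastforce simp: X_def)
  next
   case 3
   then show ?thesis by (simp add: cx_0 cx1_0 cx2_0 X_def)
  qed
 qed
 then show ?thesis by (intro exI[of _ X]) (simp add: X_def)
qed

lemma cx_affine_smooth:
 assumes "r \<noteq> 0"
 shows "smooth_on (\<lambda>y. cx (y / r + s)) UNIV" "smooth_on (\<lambda>y. cx1 (y / r + s)) UNIV" "smooth_on (\<lambda>y. cx2 (y / r + s)) UNIV"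
 by (rule smooth_on_affine_inner[OF open_UNIV, where T = UNIV]; use cx_smooth cx1_smooth cx2_smooth in \<open>auto intro: bounded_linear_divide\<close>)+

lemma cx_affine_vd:
 assumes "r \<noteq> 0"
 shows "((\<lambda>y. cx (y / r + s)) has_vector_derivative cx1 (y / r + s) / of_real r) (at y)"
  "((\<lambda>y. cx1 (y / r + s)) has_vector_derivative cx2 (y / r + s) / of_real r) (at y)"
proof -
 have d: "((\<lambda>y. y / r + s) has_vector_derivative 1 / r) (at y)"
  using assms by (auto intro!: derivative_eq_intros simp flip: has_real_derivative_iff_has_vector_derivative)
 show "((\<lambda>y. cx (y / r + s)) has_vector_derivative cx1 (y / r + s) / of_real r) (at y)"
  using vector_diff_chain_at[OF d cx_vd] by (simp add: o_def scaleR_conv_of_real)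
 show "((\<lambda>y. cx1 (y / r + s)) has_vector_derivative cx2 (y / r + s) / of_real r) (at y)"
  using vector_diff_chain_at[OF d cx1_vd] by (simp add: o_def scaleR_conv_of_real)
qed

text \<open>For small \<open>h\<close> it passes from zero to one on \<open>[a, a + h]\<close> and
  back to zero on \<open>[b - h, b]\<close>, approximating an indicator by smooth functions.\<close>

definition plateau :: "real => real => real => real => complex" where
 "plateau a b h y = (1 - cx (y / h + (1 - a / h))) * cx (y / h + (2 - b / h))"

lemma plateau_smooth: "0 < h ==> smooth_on (plateau a b h) UNIV"
proof -
 assume h: "0 < h"
 have "smooth_on (\<lambda>y. 1 + - cx (y / h + (1 - a / h))) UNIV"
  by (intro smooth_on_add open_UNIV smooth_on_const smooth_on_linear_outer[OF open_UNIV bounded_linear_minus[OF bounded_linear_ident]]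
    cx_affine_smooth) (use h in auto)
 then show ?thesis unfolding plateau_def[abs_def]
  using h by (intro smooth_on_mult open_UNIV cx_affine_smooth) auto
qed

lemma plateau_outside:
 assumes "0 < h" "y \<notin> {a..b}"
 shows "plateau a b h y = 0"
proof (cases "y < a")
 case True
 then have "y / h + (1 - a / h) < 1" using assms by (simp add: divide_strict_right_mono)
 then show ?thesis by (simp add: plateau_def cx_1)
next
 case False
 then have "2 < y / h + (2 - b / h)" using assms by (simp add: divide_strict_right_mono)
 then show ?thesis by (simp add: plateau_def cx_0)
qed

lemma plateau_tendsto:
 assumes "y \<noteq> a" "y \<noteq> b"
 shows "(\<lambda>n. plateau a b (1 / real (Suc n)) y) \<longlonglongrightarrow> indicator {a<..<b} y"
proof (cases "y \<in> {a<..<b}")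
 case True
 then obtain N where N: "1 / real (Suc N) < min (y - a) (b - y)"
  using nat_approx_posE[of "min (y - a) (b - y)"] by auto
 have "plateau a b (1 / real (Suc n)) y = 1" if "N \<le> n" for n
 proof -
  define h where "h = 1 / real (Suc n)"
  have h: "0 < h" "h \<le> 1 / real (Suc N)" using that by (auto simp: h_def field_simps)
  then have "h < y - a" "h < b - y" using N by auto
  then have "2 < y / h + (1 - a / h)" "y / h + (2 - b / h) < 1"
   using h(1) by (auto simp: field_simps)
  then show ?thesis unfolding h_def[symmetric] by (simp add: plateau_def cx_0 cx_1)
 qed
 then have "\<forall>\<^sub>F n in sequentially. plateau a b (1 / real (Suc n)) y = 1"
  by (auto simp: eventually_sequentially)
 then show ?thesis using True by (simp add: tendsto_eventually)
next
 case False
 then have "y \<notin> {a..b}" using assms by auto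
 then have "plateau a b h y = 0" if "0 < h" for h by (rule plateau_outside[OF that])
 then show ?thesis using False by simp
qed

lemma plateau_bound: "\<exists>X. \<forall>a b h y. norm (plateau a b h y) \<le> X"
proof -
 obtain X where X: "1 \<le> X" "\<And>y. norm (cx y) \<le> X" using cx_bound by blast
 have "norm (plateau a b h y) \<le> (1 + X) * X" for a b h y
  unfolding plateau_def norm_mult
  by (intro mult_mono order_trans[OF norm_triangle_ineq4]) (use X in auto)
 then show ?thesis by blast
qed

text \<open>Testing with \<open>exp (i xi y)\<close> times a plateau function and letting the
  plateau sharpen shows that \<open>H\<close>, restricted to an interval, has vanishing Fourier
  transform. Thus \<open>fourier_zero\<close> takes the place of mollification.\<close>

lemma zero_if_orthogonal:
 fixes H :: "real => complex"
 assumes H: "\<And>a b. 0 < a ==> set_integrable lborel {a..b} H"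
  and orth: "\<And>\<psi> a b. smooth_on \<psi> {0<..} ==> 0 < a ==> (\<And>y. y \<notin> {a..b} ==> \<psi> y = 0) ==>
   (\<integral>y. indicator {a..b} y *\<^sub>R H y * \<psi> y \<partial>lborel) = 0"
 shows "AE y in lborel. 0 < y --> H y = 0"
proof -
 have *: "AE y in lborel. indicator {a<..<b} y *\<^sub>R H y = 0" if a: "0 < a" for a b
 proof (rule fourier_zero)
  have Hab: "integrable lborel (\<lambda>y. indicator {a..b} y *\<^sub>R H y)" using H[OF a] by (simp add: set_integrable_def)
  have [measurable]: "(\<lambda>y. indicator {a..b} y *\<^sub>R H y) \<in> borel_measurable borel" using Hab by auto
  have i: "indicator {a<..<b} y *\<^sub>R H y = indicator {a<..<b} y *\<^sub>R (indicator {a..b} y *\<^sub>R H y)" for y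
   by (auto simp: indicator_def)
  show "integrable lborel (\<lambda>y. indicator {a<..<b} y *\<^sub>R H y)"
   unfolding i by (rule integrable_mult_indicator[OF _ Hab]) simp
  fix xi
  obtain X where X: "\<And>a b h y. norm (plateau a b h y) \<le> X" using plateau_bound by blast
  have [measurable]: "plateau a b (1 / real (Suc n)) \<in> borel_measurable borel" for n
   unfolding plateau_def[abs_def] by measurable
  let ?s = "\<lambda>n y. indicator {a..b} y *\<^sub>R H y * (exp (\<i> * of_real xi * of_real y) * plateau a b (1 / real (Suc n)) y)"
  have "(\<lambda>n. \<integral>y. ?s n y \<partial>lborel) \<longlonglongrightarrow> (\<integral>y. eix (xi * y) * (indicator {a<..<b} y *\<^sub>R H y) \<partial>lborel)"
  proof (rule integral_dominated_convergence[where w = "\<lambda>y. norm (indicator {a..b} y *\<^sub>R H y) * X"])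
   have "AE y in lborel. y \<noteq> a" "AE y in lborel. y \<noteq> b" by (rule AE_lborel_singleton)+
   then show "AE y in lborel. (\<lambda>n. ?s n y) \<longlonglongrightarrow> eix (xi * y) * (indicator {a<..<b} y *\<^sub>R H y)"
   proof eventually_elim
    fix y assume y: "y \<noteq> a" "y \<noteq> b"
    have "(\<lambda>n. ?s n y) \<longlonglongrightarrow> indicator {a..b} y *\<^sub>R H y * (exp (\<i> * of_real xi * of_real y) * indicator {a<..<b} y)"
     by (intro tendsto_intros plateau_tendsto y)
    then show "(\<lambda>n. ?s n y) \<longlonglongrightarrow> eix (xi * y) * (indicator {a<..<b} y *\<^sub>R H y)"
     by (auto simp: indicator_def mult_ac split: if_splits)
   qed
   show "AE y in lborel. norm (?s n y) \<le> norm (indicator {a..b} y *\<^sub>R H y) * X" for n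
   proof (rule AE_I2)
    fix y
    have "norm (?s n y) = norm (indicator {a..b} y *\<^sub>R H y) * norm (plateau a b (1 / real (Suc n)) y)"
     by (simp add: norm_mult)
    also have "\<dots> \<le> norm (indicator {a..b} y *\<^sub>R H y) * X" by (intro mult_left_mono X) simp
    finally show "norm (?s n y) \<le> norm (indicator {a..b} y *\<^sub>R H y) * X" .
   qed
   show "integrable lborel (\<lambda>y. norm (indicator {a..b} y *\<^sub>R H y) * X)" using Hab by (intro integrable_mult_left integrable_norm)
   show "(\<lambda>y. eix (xi * y) * (indicator {a<..<b} y *\<^sub>R H y)) \<in> borel_measurable lborel" unfolding i by measurable
  qed measurable
  moreover have "(\<integral>y. ?s n y \<partial>lborel) = 0" for n
  proof (rule orth[OF _ a])
   show "smooth_on (\<lambda>y. exp (\<i> * of_real xi * of_real y) * plateau a b (1 / real (Suc n)) y) {0<..}"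
    by (intro smooth_on_mult open_greaterThan smooth_on_subset[OF smooth_on_exp_of_real] smooth_on_subset[OF plateau_smooth]) auto
   show "exp (\<i> * of_real xi * of_real y) * plateau a b (1 / real (Suc n)) y = 0" if "y \<notin> {a..b}" for y
    using plateau_outside[OF _ that, of "1 / real (Suc n)"] by simp
  qed
  ultimately show "(\<integral>y. eix (xi * y) * (indicator {a<..<b} y *\<^sub>R H y) \<partial>lborel) = 0"
   by (simp add: LIMSEQ_const_iff)
 qed
 show ?thesis
 proof (rule AE_pos_exhaust)
  show "AE y in lborel. y \<in> {a..b} --> H y = 0" if "0 < a" for a b
   using *[OF half_gt_zero[OF that], of "b + 1"] by eventually_elim (use that in \<open>auto simp: indicator_def split: if_splits\<close>)
 qed
qed

end

text \<open>The antiderivative starts at zero but ends at the total integral \<open>m\<close>, so it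
  has compact support only if \<open>m = 0\<close>. The constant is recorded because it has to be
  compensated: by a cutoff at infinity in one application, by a bump near zero in the other.\<close>

lemma antiderivative_compact_support:
 fixes \<kappa> :: "real => complex"
 assumes \<kappa>_smooth: "smooth_on \<kappa> {0<..}" and a: "0 < a" and \<kappa>0: "\<And>y. y \<notin> {a..b} ==> \<kappa> y = 0"
 shows "\<exists>\<omega> m \<Omega>. smooth_on \<omega> {0<..} \<and> (\<forall>y>0. (\<omega> has_vector_derivative \<kappa> y) (at y)) \<and>
  (\<forall>y<a. \<omega> y = 0) \<and> (\<forall>y. max a b < y --> \<omega> y = m) \<and> 0 \<le> \<Omega> \<and> (\<forall>y>0. norm (\<omega> y) \<le> \<Omega>)"
proof -
 have \<kappa>_cont: "continuous_on UNIV \<kappa>"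
  using Ck_on_zero_outside[of 0 \<kappa> a b] smooth_on_continuous[OF \<kappa>_smooth] a \<kappa>0 by simp
 define \<omega> where "\<omega> = (\<lambda>y. integral {0..y} \<kappa>)"
 have \<omega>_vd: "(\<omega> has_vector_derivative \<kappa> y) (at y)" if "0 < y" for y
 proof -
  have "(\<omega> has_vector_derivative \<kappa> y) (at y within {0..y + 1})"
   unfolding \<omega>_def using that by (intro integral_has_vector_derivative continuous_on_subset[OF \<kappa>_cont]) auto
  then show ?thesis using that by (simp add: at_within_Icc_at)
 qed
 have \<omega>_smooth: "smooth_on \<omega> {0<..}"
  by (rule smooth_on_vector_derivativeI[OF open_greaterThan _ \<kappa>_smooth]) (simp add: \<omega>_vd)
 have \<omega>0: "\<omega> y = 0" if "y < a" for y
 proof -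
  have "\<omega> y = integral {0..y} (\<lambda>_. 0)" unfolding \<omega>_def by (rule integral_cong) (use \<kappa>0 that in auto)
  then show ?thesis by simp
 qed
 define b' where "b' = max a b + 1"
 have b': "a < b'" "b < b'" by (auto simp: b'_def)
 have "continuous_on {a..b'} \<omega>"
  using a by (intro continuous_at_imp_continuous_on) (auto intro!: has_vector_derivative_continuous[OF \<omega>_vd])
 then have "bounded (\<omega> ` {a..b'})" using compact_continuous_image compact_imp_bounded by blast
 then obtain L where L: "\<forall>y\<in>{a..b'}. norm (\<omega> y) \<le> L" by (auto simp: bounded_iff)
 note L = L[rule_format]
 have "\<exists>k. \<forall>y\<in>{max a b<..}. \<omega> y = k"
 proof -
  have "(\<omega> has_vector_derivative 0) (at y within {max a b<..})" if "y \<in> {max a b<..}" for y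
   using \<omega>_vd[of y] \<kappa>0[of y] that a by (auto intro: has_vector_derivative_at_within)
  then show ?thesis using has_vector_derivative_zero_constant[of "{max a b<..}" \<omega>] by (metis convex_real_interval(3))
 qed
 then have cst: "\<omega> y = \<omega> b'" if "max a b < y" for y using that by (auto simp: b'_def)
 have "norm (\<omega> y) \<le> max L 0" if "0 < y" for y
 proof -
  consider "y < a" | "y \<in> {a..b'}" | "b' \<le> y" by fastforce
  then show ?thesis
  proof cases
   case 3
   then have "\<omega> y = \<omega> b'" by (intro cst) (auto simp: b'_def)
   then show ?thesis using L[of b'] b' by auto
  qed (use L[of y] \<omega>0[of y] in auto)
 qed
 then show ?thesis using \<omega>_vd \<omega>_smooth \<omega>0 cst by (intro exI[of _ \<omega>] exI[of _ "\<omega> b'"] exI[of _ "max L 0"]) auto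
qed

text \<open>With the weight \<open>P = y^(1 - 2 \<alpha>)\<close> the operator on the test function
  is the symmetric expression \<open>z^2 P \<theta> - (P \<theta>')'\<close>. The error in
  \<open>W0\<close> has two sources: \<open>y^\<alpha>\<close> from the part of finite energy and
  \<open>y^2\<close> from the second term of the even expansion of \<open>u\<close>.\<close>

locale weak_bessel = cutoff +
 fixes \<alpha> C D :: real and z c :: complex and W :: "real => complex"
 assumes \<alpha>: "0 < \<alpha>" and z: "0 < Re z" and Wm [measurable]: "W \<in> borel_measurable borel"
  and Wb: "AE y in lborel. 0 < y --> norm (W y) \<le> C * (1 + y powr \<alpha>)"
  and W0: "AE y in lborel. 0 < y \<and> y < 1 --> norm (W y - c) \<le> D * (y powr \<alpha> + y\<^sup>2)"
  and weak: "\<And>\<theta> \<theta>1 \<theta>2 a b. smooth_on \<theta> {0<..} ==> 0 < a ==> (\<And>y. y \<notin> {a..b} ==> \<theta> y = 0) ==>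
    (\<And>y. 0 < y ==> (\<theta> has_vector_derivative \<theta>1 y) (at y)) ==>
    (\<And>y. 0 < y ==> (\<theta>1 has_vector_derivative \<theta>2 y) (at y)) ==>
    (\<integral>y. indicator {0<..} y *\<^sub>R (W y * of_real (y powr (1 - 2 * \<alpha>)) *
     (z\<^sup>2 * \<theta> y - \<theta>2 y - of_real ((1 - 2 * \<alpha>) / y) * \<theta>1 y)) \<partial>lborel) = 0"
begin

abbreviation A :: "real => complex" where "A \<equiv> bint \<alpha> z"
abbreviation B :: "real => complex" where "B \<equiv> bint1 \<alpha> z"
definition P :: "real => complex" where "P y = of_real (y powr (1 - 2 * \<alpha>))"

lemma A_nz: "0 < y ==> A y \<noteq> 0" by (rule bint_nonzero[OF \<alpha> z])

lemma P_nz: "0 < y ==> P y \<noteq> 0" by (simp add: P_def)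

text \<open>Differentiation lowers the order, so smoothness is proved for all orders
  simultaneously.\<close>

lemma A_smooth: "smooth_on A {0<..}"
proof (rule smooth_on_family[where f = "\<lambda>mu. bint mu z" and c = "\<lambda>_ y. - z * of_real y" and d = "\<lambda>mu. mu - 1"])
 show "smooth_on (\<lambda>y. - z * of_real y) {0<..}"
  by (intro smooth_on_mult open_greaterThan smooth_on_const)
    (simp add: smooth_on_def Ck_on_bounded_linear bounded_linear_of_real)
 show "(bint i z has_vector_derivative - z * of_real x * bint (i - 1) z x) (at x)" if "x \<in> {0<..}" for i x
  by (rule bint_deriv[OF z]) (use that in simp)
qed auto

lemma P_vd: "0 < y ==> (P has_vector_derivative of_real ((1 - 2 * \<alpha>) / y) * P y) (at y)"
proof -
 assume y: "0 < y"
 have "((\<lambda>y. y powr (1 - 2 * \<alpha>)) has_real_derivative (1 - 2 * \<alpha>) / y * y powr (1 - 2 * \<alpha>)) (at y)"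
  by (rule DERIV_cong[OF has_real_derivative_powr[OF y]]) (use y in \<open>simp add: powr_diff powr_minus divide_inverse\<close>)
 then show ?thesis
  unfolding P_def[abs_def] of_real_mult[symmetric]
  by (rule has_vector_derivative_of_real)
qed

lemma continuous_on_measurable_pos:
 fixes h :: "real => complex"
 assumes "continuous_on {0<..} h"
 shows "(\<lambda>y. indicator {0<..} y *\<^sub>R h y) \<in> borel_measurable borel"
 by (rule borel_measurable_continuous_on_indicator[OF _ assms]) simp

text \<open>Testing with \<open>A \<cdot> \<omega>\<close>, where \<open>y\<^sup>1\<^sup>-\<^sup>2\<^sup>\<alpha> A\<^sup>2 \<omega>' = \<nu>\<close>; here \<open>\<omega>\<close> is constant near infinity and
 is cut off there, where \<open>A\<close> decays exponentially.\<close>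

lemma weak_quotient:
 assumes nu: "smooth_on \<nu> {0<..}" and a: "0 < a" and supp: "\<And>y. y \<notin> {a..b} ==> \<nu> y = 0"
  and nu1: "\<And>y. 0 < y ==> (\<nu> has_vector_derivative \<nu>1 y) (at y)"
 shows "(\<integral>y. indicator {0<..} y *\<^sub>R (W y * (\<nu>1 y / A y)) \<partial>lborel) = 0"
proof -
 define \<kappa> where "\<kappa> = (\<lambda>y. \<nu> y * inverse (P y * (A y * A y)))"
 have \<kappa>_smooth: "smooth_on \<kappa> {0<..}"
  unfolding \<kappa>_def P_def[abs_def]
  by (intro smooth_on_mult smooth_on_inverse open_greaterThan nu smooth_on_powr A_smooth) (auto simp: A_nz)
 have \<kappa>_nu: "\<kappa> y * (P y * (A y * A y)) = \<nu> y" if "0 < y" for y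
 proof -
  have "P y * (A y * A y) \<noteq> 0" using A_nz[OF that] P_nz[OF that] by simp
  then show ?thesis by (simp only: \<kappa>_def mult.assoc[of "\<nu> y"] left_inverse mult_1_right not_False_eq_True)
 qed
 have \<kappa>0: "\<kappa> y = 0" if "y \<notin> {a..b}" for y using supp[OF that] by (simp add: \<kappa>_def)
 define \<kappa>1 where "\<kappa>1 = (\<lambda>y. vector_derivative \<kappa> (at y))"
 have \<kappa>_vd: "(\<kappa> has_vector_derivative \<kappa>1 y) (at y)" if "0 < y" for y
  using smooth_on_vector_derivativeD(2)[OF open_greaterThan \<kappa>_smooth] that by (simp add: \<kappa>1_def)
 have out: "h1 = 0" if "y \<notin> {a..b}" "0 < y" "\<And>y. y \<notin> {a..b} ==> h y = 0" "(h has_vector_derivative h1) (at y)"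
  for h :: "real => complex" and h1 y
 proof -
  have "(h has_vector_derivative 0) (at y)"
   by (rule has_vector_derivative_transform_within_open[where f = "\<lambda>_. 0" and S = "- {a..b}"]) (use that in auto)
  then show ?thesis using that(4) vector_derivative_at by metis
 qed
 have \<kappa>10: "\<kappa>1 y = 0" if "y \<notin> {a..b}" "0 < y" for y by (rule out[OF that \<kappa>0 \<kappa>_vd[OF that(2)]])
 have nu10: "\<nu>1 y = 0" if "y \<notin> {a..b}" "0 < y" for y by (rule out[OF that supp nu1[OF that(2)]])
 have nu1_eq: "\<nu>1 y / A y = P y * (A y * \<kappa>1 y + (of_real ((1 - 2 * \<alpha>) / y) * A y + 2 * B y) * \<kappa> y)" if y: "0 < y" for y
 proof -
  have "((\<lambda>y. \<kappa> y * (P y * (A y * A y))) has_vector_derivative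
    \<kappa> y * (P y * (A y * B y + B y * A y) + of_real ((1 - 2 * \<alpha>) / y) * P y * (A y * A y)) + \<kappa>1 y * (P y * (A y * A y))) (at y)"
   by (intro has_vector_derivative_mult \<kappa>_vd P_vd bint_vd z y)
  then have "(\<nu> has_vector_derivative
    \<kappa> y * (P y * (A y * B y + B y * A y) + of_real ((1 - 2 * \<alpha>) / y) * P y * (A y * A y)) + \<kappa>1 y * (P y * (A y * A y))) (at y)"
   by (rule has_vector_derivative_transform_within_open[where S = "{0<..}"]) (use y \<kappa>_nu in auto)
  then have "\<nu>1 y = \<kappa> y * (P y * (A y * B y + B y * A y) + of_real ((1 - 2 * \<alpha>) / y) * P y * (A y * A y)) + \<kappa>1 y * (P y * (A y * A y))"
   using nu1[OF y] vector_derivative_at by metis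
  also have "\<dots> = A y * (P y * (A y * \<kappa>1 y + (of_real ((1 - 2 * \<alpha>) / y) * A y + 2 * B y) * \<kappa> y))"
   by (simp add: algebra_simps)
  finally show ?thesis using A_nz[OF y] by simp
 qed
 obtain \<omega> m \<Omega> where \<omega>_smooth: "smooth_on \<omega> {0<..}" and \<omega>_vd: "\<And>y. 0 < y ==> (\<omega> has_vector_derivative \<kappa> y) (at y)"
  and \<omega>0: "\<And>y. y < a ==> \<omega> y = 0" and "\<And>y. max a b < y ==> \<omega> y = m" and \<Omega>: "0 \<le> \<Omega>" "\<And>y. 0 < y ==> norm (\<omega> y) \<le> \<Omega>"
  using antiderivative_compact_support[OF \<kappa>_smooth a \<kappa>0] by metis
 obtain X where X: "1 \<le> X" "\<And>y. norm (cx y) \<le> X" "\<And>y. norm (cx1 y) \<le> X" "\<And>y. norm (cx2 y) \<le> X" using cx_bound by blast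
 define q where "q = (\<lambda>y::real. complex_of_real ((1 - 2 * \<alpha>) / y))"
 \<comment> \<open>The terms in which a derivative falls on the cutoff at scale \<open>n\<close>.
   They live on \<open>[n, 2 n]\<close>, where \<open>A\<close> and \<open>B\<close> are
   exponentially small.\<close>
 define e2 where "e2 = (\<lambda>n::nat. \<lambda>y. P y * (A y * \<omega> y * (cx2 (y / real n + 0) / of_real (real n) / of_real (real n)) +
   2 * B y * \<omega> y * (cx1 (y / real n + 0) / of_real (real n)) + q y * A y * \<omega> y * (cx1 (y / real n + 0) / of_real (real n))))"
 let ?I = "\<lambda>y. indicator {0<..} y *\<^sub>R (W y * (\<nu>1 y / A y))"
 let ?J = "\<lambda>n y. indicator {0<..} y *\<^sub>R (W y * e2 n y)"
 \<comment> \<open>Once \<open>n\<close> exceeds \<open>b\<close>, the cutoff is one on the support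
   of \<open>\<kappa>\<close>; once it exceeds \<open>2\<close>, the transition region lies in
   \<open>y \<ge> 1\<close>, where the decay bounds hold.\<close>
 define n0 where "n0 = nat \<lceil>max 2 b\<rceil> + 1"
 have n0: "max 2 b < real n" if "n0 \<le> n" for n
  using that unfolding n0_def by linarith
 have sum0: "(\<integral>y. ?I y + ?J n y \<partial>lborel) = 0" if n: "n0 \<le> n" for n
 proof -
  define r where "r = real n"
  have r: "r \<noteq> 0" "b < r" using n0[OF n] by (auto simp: r_def)
  define ch0 where "ch0 = (\<lambda>y. cx (y / r + 0))"
  define ch1 where "ch1 = (\<lambda>y. cx1 (y / r + 0) / of_real r)"
  define ch2 where "ch2 = (\<lambda>y. cx2 (y / r + 0) / of_real r / of_real r)"
  have chi_vd: "(ch0 has_vector_derivative ch1 y) (at y)" "(ch1 has_vector_derivative ch2 y) (at y)" for y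
   unfolding ch0_def ch1_def ch2_def
   by (rule cx_affine_vd(1)[OF r(1)], rule has_vector_derivative_divide[OF cx_affine_vd(2)[OF r(1)]])
  \<comment> \<open>Because \<open>A\<close> solves the Bessel equation, the terms with
    undifferentiated multiplier cancel in the weak form. What remains is \<open>- \<nu>1 / A\<close>
    and the error \<open>e2\<close>.\<close>
  define \<theta> where "\<theta> = (\<lambda>y. A y * (\<omega> y * ch0 y))"
  define \<theta>1 where "\<theta>1 = (\<lambda>y. A y * (\<omega> y * ch1 y + \<kappa> y * ch0 y) + B y * (\<omega> y * ch0 y))"
  define \<theta>2 where "\<theta>2 = (\<lambda>y. (A y * ((\<omega> y * ch2 y + \<kappa> y * ch1 y) + (\<kappa> y * ch1 y + \<kappa>1 y * ch0 y)) + B y * (\<omega> y * ch1 y + \<kappa> y * ch0 y)) +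
    (B y * (\<omega> y * ch1 y + \<kappa> y * ch0 y) + (z\<^sup>2 * A y - of_real ((1 - 2 * \<alpha>) / y) * B y) * (\<omega> y * ch0 y)))"
  have "(\<integral>y. indicator {0<..} y *\<^sub>R (W y * of_real (y powr (1 - 2 * \<alpha>)) *
     (z\<^sup>2 * \<theta> y - \<theta>2 y - of_real ((1 - 2 * \<alpha>) / y) * \<theta>1 y)) \<partial>lborel) = 0"
  proof (rule weak[OF _ a])
   show "smooth_on \<theta> {0<..}" unfolding \<theta>_def ch0_def
    by (intro smooth_on_mult open_greaterThan A_smooth \<omega>_smooth smooth_on_subset[OF cx_affine_smooth(1)[OF r(1)]]) auto
   show "\<theta> y = 0" if "y \<notin> {a..2 * r}" for y
   proof (cases "y < a")
    case False
    then have "2 < y / r" using that r n0[OF n] by (simp add: r_def field_simps)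
    then show ?thesis by (simp add: \<theta>_def ch0_def cx_0)
   qed (simp add: \<theta>_def \<omega>0)
   fix y :: real assume y: "0 < y"
   show "(\<theta> has_vector_derivative \<theta>1 y) (at y)" unfolding \<theta>_def \<theta>1_def
    by (intro has_vector_derivative_mult bint_vd \<omega>_vd chi_vd z y)
   show "(\<theta>1 has_vector_derivative \<theta>2 y) (at y)" unfolding \<theta>1_def \<theta>2_def
    by (intro has_vector_derivative_add has_vector_derivative_mult bint_vd bint1_vd \<omega>_vd chi_vd \<kappa>_vd z y)
  qed
  moreover have "indicator {0<..} y *\<^sub>R (W y * of_real (y powr (1 - 2 * \<alpha>)) *
     (z\<^sup>2 * \<theta> y - \<theta>2 y - of_real ((1 - 2 * \<alpha>) / y) * \<theta>1 y)) = - (?I y + ?J n y)" for y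
  proof (cases "0 < y")
   case y: True
   have k: "\<kappa> y * ch0 y = \<kappa> y" "\<kappa> y * ch1 y = 0" "\<kappa>1 y * ch0 y = \<kappa>1 y"
   proof -
    have "\<kappa> y * ch0 y = \<kappa> y \<and> \<kappa> y * ch1 y = 0 \<and> \<kappa>1 y * ch0 y = \<kappa>1 y"
    proof (cases "y \<in> {a..b}")
     case True
     then have "y / r < 1" using r y by (simp add: field_simps)
     then show ?thesis by (simp add: ch0_def ch1_def cx_1 cx1_0)
    qed (use \<kappa>0 \<kappa>10 y in auto)
    then show "\<kappa> y * ch0 y = \<kappa> y" "\<kappa> y * ch1 y = 0" "\<kappa>1 y * ch0 y = \<kappa>1 y" by auto
   qed
   have e2': "e2 n y = P y * (A y * \<omega> y * ch2 y + 2 * B y * \<omega> y * ch1 y + q y * A y * \<omega> y * ch1 y)"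
    unfolding e2_def ch2_def ch1_def r_def ..
   have qy: "of_real ((1 - 2 * \<alpha>) / y) = q y" by (simp add: q_def)
   have "z\<^sup>2 * \<theta> y - \<theta>2 y - q y * \<theta>1 y = - ((A y * \<kappa>1 y + (q y * A y + 2 * B y) * \<kappa> y) + (A y * \<omega> y * ch2 y + 2 * B y * \<omega> y * ch1 y + q y * A y * \<omega> y * ch1 y))"
    unfolding \<theta>_def \<theta>1_def \<theta>2_def k qy by (simp add: algebra_simps)
   then have "P y * (z\<^sup>2 * \<theta> y - \<theta>2 y - q y * \<theta>1 y) = - (\<nu>1 y / A y + e2 n y)"
    unfolding nu1_eq[OF y] e2' q_def by (simp only: distrib_left mult_minus_right)
   then have "W y * (P y * (z\<^sup>2 * \<theta> y - \<theta>2 y - q y * \<theta>1 y)) = - (W y * (\<nu>1 y / A y) + W y * e2 n y)"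
    by (simp only: distrib_left mult_minus_right)
   then show ?thesis using y by (simp add: P_def q_def mult.assoc)
  qed simp
  ultimately show ?thesis by (simp only: Bochner_Integration.integral_minus neg_equal_0_iff_equal)
 qed
 have Iint: "integrable lborel ?I"
 proof -
  have c1: "continuous_on {0<..} (\<lambda>y. \<nu>1 y / A y)"
  proof -
   have "vector_derivative \<nu> (at y) = \<nu>1 y" if "y \<in> {0<..}" for y using nu1 that by (intro vector_derivative_at) simp
   then have "continuous_on {0<..} \<nu>1"
    by (rule continuous_on_eq[OF smooth_on_continuous[OF smooth_on_vector_derivativeD(1)[OF open_greaterThan nu]]])
   then show ?thesis using smooth_on_continuous[OF A_smooth] A_nz by (intro continuous_on_divide) auto
  qed
  have "bounded ((\<lambda>y. \<nu>1 y / A y) ` {a..b})"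
   using a by (intro compact_imp_bounded compact_continuous_image continuous_on_subset[OF c1]) auto
  then obtain L where L: "\<And>y. y \<in> {a..b} ==> norm (\<nu>1 y / A y) \<le> L" unfolding bounded_iff by blast
  have [measurable]: "(\<lambda>y. indicator {0<..} y *\<^sub>R (\<nu>1 y / A y)) \<in> borel_measurable borel" by (rule continuous_on_measurable_pos[OF c1])
  have eq: "?I y = W y * (indicator {0<..} y *\<^sub>R (\<nu>1 y / A y))" for y by simp
  have "integrable lborel (\<lambda>y. (\<bar>C\<bar> * (1 + b powr \<alpha>) * L) * indicator {a..b} y)"
   by (intro integrable_mult_right) (auto simp: integrable_indicator_iff emeasure_lborel_Icc_eq)
  then show ?thesis
  proof (rule Bochner_Integration.integrable_bound)
   show "AE y in lborel. norm (?I y) \<le> norm ((\<bar>C\<bar> * (1 + b powr \<alpha>) * L) * indicator {a..b} y)"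
    using Wb
   proof eventually_elim
    fix y assume W: "0 < y --> norm (W y) \<le> C * (1 + y powr \<alpha>)"
    show "norm (?I y) \<le> norm ((\<bar>C\<bar> * (1 + b powr \<alpha>) * L) * indicator {a..b} y)"
    proof (cases "0 < y \<and> y \<in> {a..b}")
     case True
     have "norm (W y) \<le> C * (1 + y powr \<alpha>)" using W True by simp
     also have "\<dots> \<le> \<bar>C\<bar> * (1 + b powr \<alpha>)"
      using True \<alpha> by (intro mult_mono add_left_mono powr_mono2) auto
     finally have "norm (W y) * norm (\<nu>1 y / A y) \<le> \<bar>C\<bar> * (1 + b powr \<alpha>) * L"
      using L[of y] True by (intro mult_mono) auto
     then show ?thesis using True by (simp add: norm_mult norm_divide)
    next
     case False
     then show ?thesis using nu10[of y] by (auto simp: indicator_def)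
    qed
   qed
   show "?I \<in> borel_measurable lborel" unfolding eq by measurable
  qed
 qed
 obtain K where K: "0 \<le> K" "\<And>y. 1 \<le> y ==> norm (A y) \<le> K * exp (- (Re z / 4 * y))"
   "\<And>y. 1 \<le> y ==> norm (B y) \<le> K * exp (- (Re z / 4 * y))"
  using bint_exp_decay[OF z, of \<alpha>] by blast
 define d where "d = Re z / 8"
 have d: "0 < d" using z by (simp add: d_def)
 obtain L where L: "0 \<le> L" "\<And>y. 1 \<le> y ==> y powr (1 - \<alpha>) \<le> L * exp (d * y)" using powr_le_exp[OF d] by blast
 define M where "M = \<bar>C\<bar> * 2 * (L * (K * \<Omega> * X * (3 + \<bar>1 - 2 * \<alpha>\<bar>)))"
 \<comment> \<open>The growth \<open>y^\<alpha>\<close> of \<open>W\<close> times the weight amounts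
   to \<open>y^(1 - \<alpha>)\<close>. Half of the exponential rate absorbs this power and the other
   half dominates uniformly in \<open>n\<close>.\<close>
 have Jb: "AE y in lborel. \<forall>n. n0 \<le> n --> norm (?J n y) \<le> M * exp (- (d * \<bar>y\<bar>))"
  using Wb
 proof eventually_elim
  fix y assume W: "0 < y --> norm (W y) \<le> C * (1 + y powr \<alpha>)"
  show "\<forall>n. n0 \<le> n --> norm (?J n y) \<le> M * exp (- (d * \<bar>y\<bar>))"
  proof (intro allI impI)
   fix n assume "n0 \<le> n"
   note n = n0[OF this]
   have M0: "0 \<le> M" using L K \<Omega> X by (simp add: M_def)
   show "norm (?J n y) \<le> M * exp (- (d * \<bar>y\<bar>))"
   proof (cases "0 < y \<and> real n \<le> y")
    case False
    have "0 < y ==> e2 n y = 0" using False n unfolding e2_def by (subst cx1_0 cx2_0; simp)+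
    then show ?thesis using M0 by (auto simp: indicator_def)
   next
    case True
    then have y: "1 \<le> y" "0 < y" using n by auto
    have n1: "1 \<le> real n" using n by simp
    let ?E = "exp (- (Re z / 4 * y))"
    have s: "norm (cx1 v / of_real (real n)) \<le> X" "norm (cx2 v / of_real (real n) / of_real (real n)) \<le> X" for v
    proof -
     have *: "norm (w / of_real (real n)) \<le> X" if "norm w \<le> X" for w :: complex
     proof -
      have "norm w / real n \<le> norm w / 1" using n1 by (intro divide_left_mono) auto
      then show ?thesis using that by (simp add: norm_divide)
     qed
     show "norm (cx1 v / of_real (real n)) \<le> X" "norm (cx2 v / of_real (real n) / of_real (real n)) \<le> X" by (intro * X)+
    qed
    have qb: "norm (q y) \<le> \<bar>1 - 2 * \<alpha>\<bar>"
     unfolding q_def norm_of_real abs_divide using y mult_left_mono[OF y(1), of "\<bar>1 - 2 * \<alpha>\<bar>"] by (simp add: divide_le_eq)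
    let ?m = "K * ?E * \<Omega> * X"
    have m0: "0 \<le> K * ?E" using K by simp
    have b1: "norm (A y * \<omega> y * (cx2 (y / real n + 0) / of_real (real n) / of_real (real n))) \<le> ?m"
     unfolding norm_mult using K(2)[OF y(1)] \<Omega>(2)[OF y(2)] s X(1) \<Omega>(1) m0 by (intro mult_mono) auto
    have b2: "norm (2 * B y * \<omega> y * (cx1 (y / real n + 0) / of_real (real n))) \<le> 2 * (K * ?E) * \<Omega> * X"
     unfolding norm_mult using K(3)[OF y(1)] \<Omega>(2)[OF y(2)] s X(1) \<Omega>(1) m0 by (intro mult_mono) auto
    have b3: "norm (q y * A y * \<omega> y * (cx1 (y / real n + 0) / of_real (real n))) \<le> \<bar>1 - 2 * \<alpha>\<bar> * (K * ?E) * \<Omega> * X"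
     unfolding norm_mult using K(2)[OF y(1)] \<Omega>(2)[OF y(2)] s X(1) \<Omega>(1) qb m0 by (intro mult_mono) auto
    have "norm (e2 n y) \<le> y powr (1 - 2 * \<alpha>) * (?m + 2 * (K * ?E) * \<Omega> * X + \<bar>1 - 2 * \<alpha>\<bar> * (K * ?E) * \<Omega> * X)"
     unfolding e2_def norm_mult[of "P y"]
     by (intro mult_mono norm_triangle_mono b1 b2 b3) (auto simp: P_def)
    also have "\<dots> = y powr (1 - 2 * \<alpha>) * (K * \<Omega> * X * (3 + \<bar>1 - 2 * \<alpha>\<bar>)) * ?E" by (simp add: algebra_simps)
    finally have e2b: "norm (e2 n y) \<le> y powr (1 - 2 * \<alpha>) * (K * \<Omega> * X * (3 + \<bar>1 - 2 * \<alpha>\<bar>)) * ?E" .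
    have "1 \<le> y powr \<alpha>" using y \<alpha> by (simp add: ge_one_powr_ge_zero)
    then have "C * (1 + y powr \<alpha>) \<le> \<bar>C\<bar> * (2 * y powr \<alpha>)" by (intro mult_mono) auto
    then have Wy: "norm (W y) \<le> \<bar>C\<bar> * (2 * y powr \<alpha>)" using W y by simp
    let ?k = "K * \<Omega> * X * (3 + \<bar>1 - 2 * \<alpha>\<bar>)"
    have k0: "0 \<le> ?k" using K \<Omega> X by simp
    have "norm (?J n y) = norm (W y) * norm (e2 n y)" using y by (simp add: norm_mult)
    also have "\<dots> \<le> (\<bar>C\<bar> * (2 * y powr \<alpha>)) * (y powr (1 - 2 * \<alpha>) * ?k * ?E)"
     using Wy e2b by (intro mult_mono) auto
    also have "\<dots> = \<bar>C\<bar> * 2 * ((y powr \<alpha> * y powr (1 - 2 * \<alpha>)) * ?k) * ?E" by (simp only: mult_ac)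
    also have "y powr \<alpha> * y powr (1 - 2 * \<alpha>) = y powr (1 - \<alpha>)" by (simp flip: powr_add)
    also have "\<bar>C\<bar> * 2 * (y powr (1 - \<alpha>) * ?k) * ?E \<le> \<bar>C\<bar> * 2 * ((L * exp (d * y)) * ?k) * ?E"
     using L(2)[OF y(1)] k0 by (intro mult_right_mono mult_left_mono) auto
    also have "\<dots> = M * (exp (d * y) * ?E)" unfolding M_def by (simp only: mult_ac)
    also have "exp (d * y) * ?E = exp (- (d * \<bar>y\<bar>))" using y by (simp add: d_def flip: exp_add)
    finally show ?thesis .
   qed
  qed
 qed
 have e2m: "(\<lambda>y. indicator {0<..} y *\<^sub>R e2 n y) \<in> borel_measurable borel" for n
 proof (rule continuous_on_measurable_pos)
  have cA: "continuous_on {0<..} A" using smooth_on_continuous[OF A_smooth] .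
  have cB: "continuous_on {0<..} B" using bint1_vd[OF z]
   by (intro continuous_at_imp_continuous_on) (auto intro: has_vector_derivative_continuous)
  have cP: "continuous_on {0<..} P" using P_vd
   by (intro continuous_at_imp_continuous_on) (auto intro: has_vector_derivative_continuous)
  have co: "continuous_on {0<..} \<omega>" using smooth_on_continuous[OF \<omega>_smooth] .
  have cq: "continuous_on {0<..} q" unfolding q_def by (intro continuous_intros) auto
  have c1: "continuous_on {0<..} (\<lambda>y. cx1 (y / real n + 0) / of_real (real n))" "continuous_on {0<..} (\<lambda>y. cx2 (y / real n + 0) / of_real (real n) / of_real (real n))"
   unfolding divide_inverse
   by (intro continuous_on_mult continuous_on_const continuous_on_compose2[OF cx1_cont] continuous_on_compose2[OF cx2_cont]
     continuous_on_add continuous_on_id subset_UNIV)+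
  show "continuous_on {0<..} (e2 n)" unfolding e2_def
   by (intro continuous_on_mult continuous_on_add continuous_on_const cA cB cP co cq c1)
 qed
 have Jm [measurable]: "?J n \<in> borel_measurable borel" for n
 proof -
  have eq: "?J n y = W y * (indicator {0<..} y *\<^sub>R e2 n y)" for y by simp
  show ?thesis unfolding eq using e2m[of n] by measurable
 qed
 have Mint: "integrable lborel (\<lambda>y. M * exp (- (d * \<bar>y\<bar>)))" by (intro integrable_mult_right integrable_exp_abs d)
 have Jint: "integrable lborel (?J n)" if "n0 \<le> n" for n
  by (rule Bochner_Integration.integrable_bound[OF Mint]) (use Jb that in \<open>auto elim!: eventually_mono intro: order_trans[OF _ abs_ge_self]\<close>)
 have "(\<lambda>n. \<integral>y. ?J (n + n0) y \<partial>lborel) \<longlonglongrightarrow> integral\<^sup>L lborel (\<lambda>y::real. 0)"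
 proof (rule integral_dominated_convergence[where w = "\<lambda>y. M * exp (- (d * \<bar>y\<bar>))"])
  show "AE y in lborel. norm (?J (n + n0) y) \<le> M * exp (- (d * \<bar>y\<bar>))" for n
   using Jb by eventually_elim simp
  show "AE y in lborel. (\<lambda>n. ?J (n + n0) y) \<longlonglongrightarrow> 0"
  proof (intro AE_I2 tendsto_eventually)
   fix y :: real
   have "\<forall>\<^sub>F n in sequentially. nat \<lceil>\<bar>y\<bar>\<rceil> + 1 \<le> n" by (rule eventually_ge_at_top)
   then show "\<forall>\<^sub>F n in sequentially. ?J (n + n0) y = 0"
   proof eventually_elim
    fix n assume "nat \<lceil>\<bar>y\<bar>\<rceil> + 1 \<le> n"
    then have "\<bar>y\<bar> < real (n + n0)" by linarith
    then have "y / real (n + n0) + 0 < 1" by (simp add: field_simps)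
    then have "e2 (n + n0) y = 0" unfolding e2_def using cx1_0 cx2_0 by simp
    then show "?J (n + n0) y = 0" by simp
   qed
  qed
 qed (use Mint in auto)
 moreover have "(\<integral>y. ?J (n + n0) y \<partial>lborel) = - (\<integral>y. ?I y \<partial>lborel)" for n
  using sum0[of "n + n0"] Bochner_Integration.integral_add[OF Iint Jint[of "n + n0"]] by (simp add: eq_neg_iff_add_eq_0 add.commute)
 ultimately show ?thesis by (simp add: LIMSEQ_const_iff)
qed

text \<open>By \<open>weak_quotient\<close> the function \<open>W / A\<close> is orthogonal to all
  derivatives of test functions, hence constant; \<open>H\<close> subtracts the value this constant
  must have at the boundary. A test function \<open>\<psi>\<close> of nonzero mean is made a
  derivative by adding a bump of the opposite mean close to zero, where \<open>H\<close> is
  small.\<close>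

lemma solution_unique:
 "AE y in lborel. 0 < y --> W y = c / A 0 * A y"
proof -
 define h0 where "h0 = c / A 0"
 define H where "H = (\<lambda>y. W y / A y - h0)"
 have cA: "continuous_on {0<..} A" using smooth_on_continuous[OF A_smooth] .
 have Am: "(\<lambda>y. indicator {0<..} y *\<^sub>R inverse (A y)) \<in> borel_measurable borel"
  by (rule continuous_on_measurable_pos) (intro continuous_on_inverse cA, use A_nz in auto)
 have Hm: "(\<lambda>y. indicator {0<..} y *\<^sub>R H y) \<in> borel_measurable borel"
 proof -
  have eq: "indicator {0<..} y *\<^sub>R H y = W y * (indicator {0<..} y *\<^sub>R inverse (A y)) - indicator {0<..} y *\<^sub>R h0" for y
   by (simp add: H_def indicator_def divide_inverse)
  show ?thesis unfolding eq using Am by measurable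
 qed
 have Hint: "set_integrable lborel {a..b} H" if a: "0 < a" for a b
 proof -
  have "bounded ((\<lambda>y. inverse (A y)) ` {a..b})"
   using a A_nz by (intro compact_imp_bounded compact_continuous_image continuous_on_inverse continuous_on_subset[OF cA]) auto
  then obtain L where L: "\<And>y. y \<in> {a..b} ==> norm (inverse (A y)) \<le> L" unfolding bounded_iff by blast
  let ?K = "\<bar>C\<bar> * (1 + b powr \<alpha>) * L + norm h0"
  have "integrable lborel (\<lambda>y. ?K * indicator {a..b} y)"
   by (intro integrable_mult_right) (auto simp: integrable_indicator_iff emeasure_lborel_Icc_eq)
  then show ?thesis unfolding set_integrable_def
  proof (rule Bochner_Integration.integrable_bound)
   have eq: "indicator {a..b} y *\<^sub>R H y = indicator {a..b} y *\<^sub>R (indicator {0<..} y *\<^sub>R H y)" for y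
    using a by (auto simp: indicator_def)
   show "(\<lambda>y. indicator {a..b} y *\<^sub>R H y) \<in> borel_measurable lborel" unfolding eq using Hm by measurable
   show "AE y in lborel. norm (indicator {a..b} y *\<^sub>R H y) \<le> norm (?K * indicator {a..b} y)"
    using Wb
   proof eventually_elim
    fix y assume W: "0 < y --> norm (W y) \<le> C * (1 + y powr \<alpha>)"
    show "norm (indicator {a..b} y *\<^sub>R H y) \<le> norm (?K * indicator {a..b} y)"
    proof (cases "y \<in> {a..b}")
     case True
     have "norm (W y) \<le> C * (1 + y powr \<alpha>)" using W True a by simp
     also have "\<dots> \<le> \<bar>C\<bar> * (1 + b powr \<alpha>)"
      using True \<alpha> a by (intro mult_mono add_left_mono powr_mono2) auto
     finally have "norm (W y) * norm (inverse (A y)) \<le> \<bar>C\<bar> * (1 + b powr \<alpha>) * L"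
      using L[OF True] by (intro mult_mono) auto
     then have "norm (H y) \<le> ?K" unfolding H_def divide_inverse
      by (intro order_trans[OF norm_triangle_ineq4] add_right_mono) (simp add: norm_mult)
     then show ?thesis using True by simp
    qed simp
   qed
  qed
 qed
 have "AE y in lborel. 0 < y --> H y = 0"
 proof (rule zero_if_orthogonal[OF Hint])
  fix \<psi> :: "real => complex" and a b :: real
  assume psi: "smooth_on \<psi> {0<..}" and a: "0 < a" and psi0: "\<And>y. y \<notin> {a..b} ==> \<psi> y = 0"
  obtain \<Psi> m \<Omega> where Psi_smooth: "smooth_on \<Psi> {0<..}" and Psi_vd: "\<And>y. 0 < y ==> (\<Psi> has_vector_derivative \<psi> y) (at y)"
   and Psi0: "\<And>y. y < a ==> \<Psi> y = 0" and Psim: "\<And>y. max a b < y ==> \<Psi> y = m" and "0 \<le> \<Omega>" "\<And>y. 0 < y ==> norm (\<Psi> y) \<le> \<Omega>"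
   using antiderivative_compact_support[OF psi a psi0] by metis
  obtain X where X: "1 \<le> X" "\<And>y. norm (cx y) \<le> X" "\<And>y. norm (cx1 y) \<le> X" using cx_bound by blast
  let ?I = "\<integral>y. indicator {a..b} y *\<^sub>R H y * \<psi> y \<partial>lborel"
  have psi_c: "continuous_on {0<..} \<psi>" using smooth_on_continuous[OF psi] .
  have small: "norm ?I \<le> norm m * X * \<epsilon>" if \<epsilon>: "0 < \<epsilon>" for \<epsilon>
  proof -
   \<comment> \<open>It bounds the norm of \<open>H\<close> almost everywhere on
     \<open>0 < y < 1\<close> and tends to zero at the boundary, because \<open>A\<close> tends to
     the nonzero value \<open>A 0\<close>.\<close>
   define G where "G = (\<lambda>y. D * (y powr \<alpha> + y\<^sup>2) / norm (A y) + norm (c / A y - c / A 0))"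
   have Alim: "(A \<longlongrightarrow> A 0) (at_right 0)" by (rule bint_tendsto_0[OF \<alpha> z])
   have A0: "A 0 \<noteq> 0" by (rule bint_0_nonzero[OF \<alpha> z])
   have "(G \<longlongrightarrow> D * (0 + 0\<^sup>2) / norm (A 0) + norm (c / A 0 - c / A 0)) (at_right 0)"
   proof -
    have "((\<lambda>y::real. y powr \<alpha>) \<longlongrightarrow> 0) (at_right 0)"
     using \<alpha> by (intro tendsto_zero_powrI[OF tendsto_ident_at tendsto_const]) (auto simp: eventually_at_filter)
    then show ?thesis unfolding G_def using A0 Alim by (intro tendsto_intros) auto
   qed
   then have "(G \<longlongrightarrow> 0) (at_right 0)" by simp
   then have "\<forall>\<^sub>F y in at_right 0. G y < \<epsilon>" using \<epsilon> by (rule order_tendstoD(2))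
   then obtain y\<epsilon> where y\<epsilon>: "0 < y\<epsilon>" "\<And>y. 0 < y ==> y < y\<epsilon> ==> G y < \<epsilon>"
    unfolding eventually_at_right_field by auto
   define \<delta> where "\<delta> = min (min a y\<epsilon>) 1 / 4"
   have \<delta>: "0 < \<delta>" "2 * \<delta> < a" "2 * \<delta> < y\<epsilon>" "2 * \<delta> < 1" using a y\<epsilon> by (auto simp: \<delta>_def)
   define b' where "b' = max a b"
   \<comment> \<open>The antiderivative of \<open>\<psi>\<close> ends at \<open>m\<close>;
     subtracting a step of height \<open>m\<close> between \<open>\<delta>\<close> and
     \<open>2 \<delta>\<close> gives compact support. The step changes the derivative only where the
     norm of \<open>H\<close> is at most \<open>\<epsilon>\<close>, and its slope
     \<open>1 / \<delta>\<close> is balanced by the length \<open>\<delta>\<close>.\<close>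
   define \<nu> where "\<nu> = (\<lambda>y. \<Psi> y - m * (1 - cx (y / \<delta> + 0)))"
   define \<nu>1 where "\<nu>1 = (\<lambda>y. \<psi> y + m * (cx1 (y / \<delta> + 0) / of_real \<delta>))"
   have nu_vd: "(\<nu> has_vector_derivative \<nu>1 y) (at y)" if "0 < y" for y
   proof -
    have "(\<nu> has_vector_derivative \<psi> y - m * (0 - cx1 (y / \<delta> + 0) / of_real \<delta>)) (at y)"
     unfolding \<nu>_def using \<delta>(1)
     by (intro has_vector_derivative_diff has_vector_derivative_mult_right has_vector_derivative_const cx_affine_vd Psi_vd that) auto
    then show ?thesis by (simp add: \<nu>1_def)
   qed
   have nu0: "\<nu> y = 0" if "y \<notin> {\<delta>..b'}" for y
   proof (cases "y < \<delta>")
    case True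
    then have "y / \<delta> < 1" "y < a" using \<delta> by (auto simp: field_simps)
    then show ?thesis by (simp add: \<nu>_def Psi0 cx_1)
   next
    case False
    then have "max a b < y" "2 < y / \<delta>" using that \<delta> by (auto simp: b'_def field_simps)
    then show ?thesis by (simp add: \<nu>_def Psim cx_0)
   qed
   have nu_smooth: "smooth_on \<nu> {0<..}"
   proof -
    have e: "\<nu> = (\<lambda>y. \<Psi> y + m * (cx (y / \<delta> + 0) + - 1))" by (auto simp: \<nu>_def algebra_simps)
    show ?thesis unfolding e using \<delta>(1)
     by (intro smooth_on_add smooth_on_mult smooth_on_const open_greaterThan Psi_smooth smooth_on_subset[OF cx_affine_smooth(1)]) auto
   qed
   have nu1_c: "continuous_on {0<..} \<nu>1"
    unfolding \<nu>1_def divide_inverse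
    by (intro continuous_on_add psi_c continuous_on_mult continuous_on_const continuous_on_compose2[OF cx1_cont]
      continuous_on_id subset_UNIV)
   have nu10: "\<nu>1 y = 0" if "y \<notin> {\<delta>..b'}" "0 < y" for y
   proof -
    have "(\<nu> has_vector_derivative 0) (at y)"
     by (rule has_vector_derivative_transform_within_open[where f = "\<lambda>_. 0" and S = "- {\<delta>..b'}"]) (use that nu0 in auto)
    then show ?thesis using nu_vd[OF that(2)] vector_derivative_at by metis
   qed
   have q: "(\<integral>y. indicator {0<..} y *\<^sub>R (W y * (\<nu>1 y / A y)) \<partial>lborel) = 0"
    by (rule weak_quotient[OF nu_smooth \<delta>(1) nu0 nu_vd])
   have nuint: "(\<integral>y. indicator {\<delta> / 2..b' + 1} y *\<^sub>R \<nu>1 y \<partial>lborel) = \<nu> (b' + 1) - \<nu> (\<delta> / 2)"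
    by (rule integral_FTC_Icc)
      (use \<delta> in \<open>auto intro!: has_vector_derivative_at_within nu_vd continuous_on_subset[OF nu1_c] simp: b'_def\<close>)
   have b1: "set_integrable lborel {\<delta> / 2..b' + 1} \<nu>1"
    unfolding set_integrable_def using \<delta> by (intro borel_integrable_compact continuous_on_subset[OF nu1_c]) auto
   let ?S = "{\<delta> / 2..b' + 1}"
   have Hnu: "integrable lborel (\<lambda>y. indicator ?S y *\<^sub>R H y * \<nu>1 y)" "(\<integral>y. indicator ?S y *\<^sub>R H y * \<nu>1 y \<partial>lborel) = 0"
   proof -
    have "bounded (\<nu>1 ` ?S)" using \<delta> by (intro compact_imp_bounded compact_continuous_image continuous_on_subset[OF nu1_c]) auto
    then obtain L where L: "\<And>y. y \<in> ?S ==> norm (\<nu>1 y) \<le> L" unfolding bounded_iff by blast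
    have e1: "indicator {0<..} y *\<^sub>R (W y * (\<nu>1 y / A y)) = indicator ?S y *\<^sub>R H y * \<nu>1 y + h0 * (indicator ?S y *\<^sub>R \<nu>1 y)" for y
     using nu10[of y] \<delta> by (auto simp: indicator_def H_def algebra_simps)
    have HL: "integrable lborel (\<lambda>y. indicator ?S y *\<^sub>R H y * \<nu>1 y)"
    proof (rule Bochner_Integration.integrable_bound)
     have HS: "integrable lborel (\<lambda>y. indicator ?S y *\<^sub>R H y)" using Hint[of "\<delta> / 2"] \<delta> by (simp add: set_integrable_def)
     then show "integrable lborel (\<lambda>y. norm (indicator ?S y *\<^sub>R H y) * L)" by (intro integrable_mult_left integrable_norm)
     from HS have [measurable]: "(\<lambda>y. indicator ?S y *\<^sub>R H y) \<in> borel_measurable borel" by auto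
     have [measurable]: "(\<lambda>y. indicator ?S y *\<^sub>R \<nu>1 y) \<in> borel_measurable borel" using b1 by (auto simp: set_integrable_def)
     have e: "indicator ?S y *\<^sub>R H y * \<nu>1 y = (indicator ?S y *\<^sub>R H y) * (indicator ?S y *\<^sub>R \<nu>1 y)" for y by (auto simp: indicator_def)
     show "(\<lambda>y. indicator ?S y *\<^sub>R H y * \<nu>1 y) \<in> borel_measurable lborel" unfolding e by measurable
     have "norm (indicator ?S y *\<^sub>R H y * \<nu>1 y) \<le> norm (norm (indicator ?S y *\<^sub>R H y) * L)" for y
     proof (cases "y \<in> ?S")
      case True
      then show ?thesis using mult_left_mono[OF L[OF True], of "norm (H y)"] order_trans[OF norm_ge_zero L[OF True]] by (simp add: norm_mult)
     qed simp
     then show "AE y in lborel. norm (indicator ?S y *\<^sub>R H y * \<nu>1 y) \<le> norm (norm (indicator ?S y *\<^sub>R H y) * L)" by blast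
    qed
    have "(\<integral>y. indicator ?S y *\<^sub>R H y * \<nu>1 y \<partial>lborel) + h0 * (\<integral>y. indicator ?S y *\<^sub>R \<nu>1 y \<partial>lborel) = 0"
    proof -
     have i2: "integrable lborel (\<lambda>y. h0 * (indicator ?S y *\<^sub>R \<nu>1 y))"
      using b1 by (intro integrable_mult_right) (simp add: set_integrable_def)
     show ?thesis
      using q unfolding e1 Bochner_Integration.integral_add[OF HL i2] integral_mult_right_zero .
    qed
    then show "(\<integral>y. indicator ?S y *\<^sub>R H y * \<nu>1 y \<partial>lborel) = 0"
     unfolding nuint using nu0[of "b' + 1"] nu0[of "\<delta> / 2"] \<delta> by simp
    show "integrable lborel (\<lambda>y. indicator ?S y *\<^sub>R H y * \<nu>1 y)" by (rule HL)
   qed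
   let ?g = "\<lambda>y. indicator {\<delta>..2 * \<delta>} y *\<^sub>R H y * (m * (cx1 (y / \<delta> + 0) / of_real \<delta>))"
   have Hae: "AE y in lborel. norm (?g y) \<le> \<epsilon> * norm m * X / \<delta> * indicator {\<delta>..2 * \<delta>} y"
    using W0
   proof eventually_elim
    fix y assume W: "0 < y \<and> y < 1 --> norm (W y - c) \<le> D * (y powr \<alpha> + y\<^sup>2)"
    show "norm (?g y) \<le> \<epsilon> * norm m * X / \<delta> * indicator {\<delta>..2 * \<delta>} y"
    proof (cases "y \<in> {\<delta>..2 * \<delta>}")
     case True
     then have y: "0 < y" "y < 1" "y < y\<epsilon>" using \<delta> by auto
     have "H y = (W y - c) / A y + (c / A y - c / A 0)" by (simp add: H_def h0_def diff_divide_distrib)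
     then have "norm (H y) \<le> norm ((W y - c) / A y) + norm (c / A y - c / A 0)" by (simp add: norm_triangle_ineq)
     also have "norm ((W y - c) / A y) \<le> D * (y powr \<alpha> + y\<^sup>2) / norm (A y)"
      unfolding norm_divide using W y by (intro divide_right_mono) auto
     finally have "norm (H y) \<le> \<epsilon>" using y\<epsilon>(2)[OF y(1,3)] by (simp add: G_def)
     then have "norm (H y) * (norm m * (norm (cx1 (y / \<delta> + 0)) / \<delta>)) \<le> \<epsilon> * (norm m * (X / \<delta>))"
      using X \<delta> \<epsilon> by (intro mult_mono divide_right_mono) auto
     then show ?thesis using True \<delta> by (simp add: norm_mult norm_divide)
    qed simp
   qed
   have Si: "integrable lborel (\<lambda>y. \<epsilon> * norm m * X / \<delta> * indicator {\<delta>..2 * \<delta>} y)"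
    by (intro integrable_mult_right) (auto simp: integrable_indicator_iff emeasure_lborel_Icc_eq)
   have gm: "?g \<in> borel_measurable lborel"
   proof -
    have eq: "?g y = indicator {\<delta>..2 * \<delta>} y *\<^sub>R (indicator {0<..} y *\<^sub>R H y) * (m * (cx1 (y / \<delta> + 0) / of_real \<delta>))" for y
     using \<delta> by (auto simp: indicator_def)
    show ?thesis unfolding eq using Hm by measurable
   qed
   have gi: "integrable lborel ?g"
    by (rule Bochner_Integration.integrable_bound[OF Si gm], rule eventually_mono[OF Hae])
      (erule order_trans, simp only: real_norm_def abs_ge_self)
   have gb: "norm (\<integral>y. ?g y \<partial>lborel) \<le> \<epsilon> * norm m * X"
   proof -
    have "norm (\<integral>y. ?g y \<partial>lborel) \<le> (\<integral>y. \<epsilon> * norm m * X / \<delta> * indicator {\<delta>..2 * \<delta>} y \<partial>lborel)"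
     by (rule integral_norm_bound_AE[OF Si Hae])
    also have "\<dots> = \<epsilon> * norm m * X / \<delta> * \<delta>" using \<delta> by simp
    finally show ?thesis using \<delta> by simp
   qed
   have eq: "indicator {a..b} y *\<^sub>R H y * \<psi> y = indicator ?S y *\<^sub>R H y * \<nu>1 y - ?g y" for y
    proof -
     have out: "cx1 (y / \<delta> + 0) = 0" if "y \<notin> {\<delta>..2 * \<delta>}"
      by (rule cx1_0) (use that \<delta> in \<open>auto simp: field_simps\<close>)
     have S: "{a..b} \<subseteq> ?S" "{\<delta>..2 * \<delta>} \<subseteq> ?S" using \<delta> by (auto simp: b'_def)
     show ?thesis
      using out psi0[of y] S by (cases "y \<in> {a..b}"; cases "y \<in> {\<delta>..2 * \<delta>}"; cases "y \<in> ?S") (auto simp: \<nu>1_def algebra_simps indicator_def)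
    qed
   have "?I = - (\<integral>y. ?g y \<partial>lborel)"
    unfolding eq Bochner_Integration.integral_diff[OF Hnu(1) gi] Hnu(2) by simp
   then show ?thesis using gb by (simp add: mult_ac)
  qed
  show "?I = 0"
  proof (rule ccontr)
   assume "?I \<noteq> 0"
   \<comment> \<open>With \<open>\<epsilon>\<close> equal to the norm of the integral divided by
     \<open>2 k\<close>, the bound is at most half of that norm. The added one keeps
     \<open>k\<close> positive even when \<open>m = 0\<close>.\<close>
   define k where "k = norm m * X + 1"
   have k: "0 < k" using X by (simp add: k_def add_nonneg_pos)
   have "norm ?I \<le> norm m * X * (norm ?I / (2 * k))" using \<open>?I \<noteq> 0\<close> k by (intro small) simp
   also have "\<dots> \<le> k * (norm ?I / (2 * k))" using k by (intro mult_right_mono divide_nonneg_nonneg) (simp_all add: k_def[symmetric], simp add: k_def)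
   also have "\<dots> = norm ?I / 2" using k by simp
   finally show False using \<open>?I \<noteq> 0\<close> by simp
  qed
 qed
 then show ?thesis
  by eventually_elim (use A_nz in \<open>auto simp: H_def h0_def field_simps\<close>)
qed

end

section \<open>Solutions with a single mode\<close>

text \<open>The exceptional set may fail to be measurable, so the quantifiers are exchanged for a
  null set covering it.\<close>

lemma (in pair_sigma_finite) AE_pair_swap:
 assumes "AE p in M1 \<Otimes>\<^sub>M M2. Q (fst p) (snd p)"
 shows "AE y in M2. AE x in M1. Q x y"
proof -
 obtain N where N: "N \<in> null_sets (M1 \<Otimes>\<^sub>M M2)" "{p \<in> space (M1 \<Otimes>\<^sub>M M2). \<not> Q (fst p) (snd p)} \<subseteq> N"
  using assms unfolding eventually_ae_filter by auto
 have ms: "{p \<in> space (M1 \<Otimes>\<^sub>M M2). (fst p, snd p) \<notin> N} \<in> sets (M1 \<Otimes>\<^sub>M M2)"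
 proof -
  have "{p \<in> space (M1 \<Otimes>\<^sub>M M2). (fst p, snd p) \<notin> N} = space (M1 \<Otimes>\<^sub>M M2) - N" by auto
  then show ?thesis using N(1) by auto
 qed
 have "AE p in M1 \<Otimes>\<^sub>M M2. (fst p, snd p) \<notin> N" using AE_not_in[OF N(1)] by simp
 then have "AE x in M1. AE y in M2. (x, y) \<notin> N" using AE_pair_iff[OF ms] by simp
 then have *: "AE y in M2. AE x in M1. (x, y) \<notin> N" using AE_commute[OF ms] by simp
 show ?thesis using * AE_space
 proof eventually_elim
  fix y assume y: "AE x in M1. (x, y) \<notin> N" "y \<in> space M2"
  from y(1) AE_space[of M1] show "AE x in M1. Q x y"
   by eventually_elim (use N(2) y(2) in \<open>auto simp: space_pair_measure\<close>)
 qed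
qed

definition rapid :: "(real => complex) => bool" where
 "rapid G \<longleftrightarrow> continuous_on UNIV G \<and> (\<forall>N. \<exists>C. \<forall>xi. (1 + \<bar>xi\<bar>) ^ N * norm (G xi) \<le> C)"

lemma rapid_mult:
 assumes G: "rapid G" and H: "continuous_on UNIV H" "\<And>xi. norm (H xi) \<le> L * (1 + \<bar>xi\<bar>) ^ K"
 shows "rapid (\<lambda>xi. H xi * G xi)"
 unfolding rapid_def
proof (intro conjI allI)
 show "continuous_on UNIV (\<lambda>xi. H xi * G xi)" using G H by (auto simp: rapid_def intro: continuous_on_mult)
 fix N
 obtain C where C: "\<And>xi. (1 + \<bar>xi\<bar>) ^ (N + K) * norm (G xi) \<le> C" using G unfolding rapid_def by blast
 have L: "0 \<le> L" using order_trans[OF norm_ge_zero H(2)[of 0]] by simp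
 have "(1 + \<bar>xi\<bar>) ^ N * norm (H xi * G xi) \<le> L * C" for xi
 proof -
  have "(1 + \<bar>xi\<bar>) ^ N * norm (H xi * G xi) \<le> (1 + \<bar>xi\<bar>) ^ N * ((L * (1 + \<bar>xi\<bar>) ^ K) * norm (G xi))"
   unfolding norm_mult by (intro mult_left_mono mult_right_mono H) auto
  also have "\<dots> = L * ((1 + \<bar>xi\<bar>) ^ (N + K) * norm (G xi))" by (simp only: power_add mult_ac)
  also have "\<dots> \<le> L * C" by (rule mult_left_mono[OF C L])
  finally show ?thesis .
 qed
 then show "\<exists>C. \<forall>xi. (1 + \<bar>xi\<bar>) ^ N * norm (H xi * G xi) \<le> C" by blast
qed

lemma rapid_integrable:
 assumes "rapid G"
 shows "integrable lborel G"
proof -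
 obtain C where C: "\<And>xi. (1 + \<bar>xi\<bar>) ^ 2 * norm (G xi) \<le> C" using assms unfolding rapid_def by blast
 have [measurable]: "G \<in> borel_measurable borel" using assms by (auto simp: rapid_def intro: borel_measurable_continuous_onI)
 have "norm (G xi) \<le> norm (C / (1 + xi\<^sup>2))" for xi
 proof -
  have p: "0 < 1 + xi\<^sup>2" by (simp add: add_pos_nonneg)
  have "(1 + xi\<^sup>2) * norm (G xi) \<le> (1 + \<bar>xi\<bar>) ^ 2 * norm (G xi)"
   by (intro mult_right_mono) (auto simp: power2_eq_square algebra_simps)
  also have "\<dots> \<le> C" by (rule C)
  finally have "norm (G xi) \<le> C / (1 + xi\<^sup>2)" using p by (simp add: pos_le_divide_eq mult.commute)
  then show ?thesis by (rule order_trans) (simp only: real_norm_def abs_ge_self)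
 qed
 then show ?thesis
  by (intro Bochner_Integration.integrable_bound[OF integrable_inverse_square[of C]]) auto
qed

lemma zroot_line_continuous: "0 < e ==> continuous_on UNIV (\<lambda>xi. zroot lam (Complex e xi))"
 unfolding zroot_def by (rule continuous_on_zsq_powr_line)

lemma norm_zroot_le:
 assumes "0 < e" "e \<le> 1" "0 \<le> lam"
 shows "norm (zroot lam (Complex e xi)) \<le> (1 + lam) * (1 + \<bar>xi\<bar>) ^ 1"
proof -
 let ?w = "Complex e xi"
 have nw: "norm ?w \<le> 1 + \<bar>xi\<bar>" using cmod_le[of ?w] assms by simp
 have "(norm (zroot lam ?w))\<^sup>2 = norm (zsq lam ?w)"
  using zroot_square[of ?w lam] assms by (simp flip: norm_power)
 also have "\<dots> \<le> lam\<^sup>2 + (1 + \<bar>xi\<bar>)\<^sup>2"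
  unfolding zsq_def using nw by (intro norm_triangle_le add_mono) (auto simp: norm_power intro: power_mono)
 also have "\<dots> \<le> (lam + (1 + \<bar>xi\<bar>))\<^sup>2" using assms by (simp add: power2_sum)
 finally have "norm (zroot lam ?w) \<le> lam + (1 + \<bar>xi\<bar>)" by (rule power2_le_imp_le) (use assms in simp)
 also have "\<dots> \<le> (1 + lam) * (1 + \<bar>xi\<bar>) ^ 1" using assms by (simp add: algebra_simps)
 finally show ?thesis .
qed

section \<open>Inverse Laplace integrals of the kernel\<close>

context symbol_setup
begin

abbreviation zl :: "real => real => complex" where "zl e xi \<equiv> zroot lam (Complex e xi)"

lemma Re_zl: "0 < e ==> e \<le> Re (zl e xi)"
 using Re_zroot_ge[of "Complex e xi" lam] by simp

lemma rapid_zl: "0 < e ==> e \<le> 1 ==> rapid G ==> rapid (\<lambda>xi. zl e xi * G xi)"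
 by (rule rapid_mult[OF _ zroot_line_continuous norm_zroot_le]) (use lam in auto)

text \<open>An inverse Laplace integral over \<open>Re w = e\<close>, with the constant
  \<open>1 / (2 pi)\<close> left to the profile \<open>G\<close>. Order and profile are both
  parameters because each application of \<open>(1/y) d/dy\<close> changes both: it lowers
  \<open>mu\<close> by one and multiplies \<open>G\<close> by the root.\<close>

definition Vint :: "real => real => (real => complex) => real => real => complex" where
 "Vint e mu G t y = (\<integral>xi. exp (Complex e xi * of_real t) * (G xi * bint mu (zl e xi) y) \<partial>lborel)"

lemma norm_exp_line: "norm (exp (Complex e xi * of_real t)) = exp (e * t)"
 by (simp add: norm_exp_eq_Re)

lemma bint_line_continuous:
 assumes "0 < e"
 shows "continuous_on (UNIV \<times> {0<..}) (\<lambda>(xi, y). bint mu (zl e xi) y)"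
proof -
 have "continuous (at p) (\<lambda>(xi, y). bint mu (zl e xi) y)" if p: "p \<in> UNIV \<times> {0<..}" for p
 proof -
  obtain xi y where py: "p = (xi, y)" by (cases p)
  have y: "0 < y" using p py by simp
  have "continuous_on (UNIV \<times> {y/2<..}) (\<lambda>q. (\<lambda>(z, y). bint mu z y) (zl e (fst q), snd q))"
  proof (rule continuous_on_compose2[OF continuous_on_bint[OF assms, of "y/2" mu]])
   show "continuous_on (UNIV \<times> {y/2<..}) (\<lambda>q. (zl e (fst q), snd q))"
    by (intro continuous_on_Pair continuous_on_compose2[OF zroot_line_continuous[OF assms]] continuous_intros) auto
  qed (use y Re_zl[OF assms] in auto)
  then have "continuous_on (UNIV \<times> {y/2<..}) (\<lambda>(xi, y). bint mu (zl e xi) y)" by (simp add: split_beta)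
  moreover have "open (UNIV \<times> {y/2<..} :: (real \<times> real) set)" by (intro open_Times) auto
  ultimately show ?thesis using y py by (simp add: continuous_on_eq_continuous_at)
 qed
 then show ?thesis by (intro continuous_at_imp_continuous_on) auto
qed

lemma bint_line_continuous1:
 assumes "0 < e" "0 < y"
 shows "continuous_on UNIV (\<lambda>xi. bint mu (zl e xi) y)"
proof -
 have "continuous_on UNIV (\<lambda>xi::real. (xi, y))" by (intro continuous_on_Pair continuous_on_id continuous_on_const)
 from continuous_on_compose2[OF bint_line_continuous[OF assms(1), of mu] this] show ?thesis using assms by auto
qed

lemma Vint_integrable:
 assumes e: "0 < e" and G: "rapid G" and y: "0 < y"
 shows "integrable lborel (\<lambda>xi. exp (Complex e xi * of_real t) * (G xi * bint mu (zl e xi) y))"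
proof -
 define K where "K = (\<integral>t. gdom mu e y t \<partial>lborel)"
 have K: "norm (bint mu (zl e xi) y) \<le> K" for xi
  unfolding K_def by (rule norm_bint_le[OF e Re_zl[OF e] y]) simp
 have cG: "continuous_on UNIV G" using G by (simp add: rapid_def)
 have "(\<lambda>xi. exp (Complex e xi * of_real t) * (G xi * bint mu (zl e xi) y)) \<in> borel_measurable borel"
  by (intro borel_measurable_continuous_onI continuous_on_mult continuous_on_exp continuous_on_Complex_line
    continuous_on_const cG bint_line_continuous1 e y)
 moreover have "norm (exp (Complex e xi * of_real t) * (G xi * bint mu (zl e xi) y)) \<le> norm (exp (e * t) * K * norm (G xi))" for xi
 proof -
  have "norm (exp (Complex e xi * of_real t) * (G xi * bint mu (zl e xi) y)) \<le> exp (e * t) * (norm (G xi) * K)"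
   unfolding norm_mult norm_exp_line by (intro mult_left_mono K) auto
  also have "\<dots> = exp (e * t) * K * norm (G xi)" by simp
  finally show ?thesis by (rule order_trans) (simp only: real_norm_def abs_ge_self)
 qed
 ultimately show ?thesis
  by (intro Bochner_Integration.integrable_bound[OF integrable_mult_right[OF integrable_norm[OF rapid_integrable[OF G]], of "exp (e * t) * K"]]) auto
qed

lemma Vint_vd:
 assumes e: "0 < e" "e \<le> 1" and G: "rapid G" and y: "0 < y"
 shows "((\<lambda>y. Vint e mu G t y) has_vector_derivative - of_real y * Vint e (mu - 1) (\<lambda>xi. zl e xi * G xi) t y) (at y)"
proof -
 define K where "K = (\<integral>t. gdom (mu - 1) e (y/2) t \<partial>lborel)"
 have K: "norm (bint (mu - 1) (zl e xi) x) \<le> K" if "y / 2 \<le> x" for x xi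
  unfolding K_def by (rule norm_bint_le[OF e(1) Re_zl[OF e(1)]]) (use y that in auto)
 have K0: "0 \<le> K" using order_trans[OF norm_ge_zero K[of "y/2"]] by simp
 have zG: "rapid (\<lambda>xi. zl e xi * G xi)" by (rule rapid_zl[OF e G])
 let ?f = "\<lambda>x xi. exp (Complex e xi * of_real t) * (G xi * bint mu (zl e xi) x)"
 let ?f' = "\<lambda>x xi. - of_real x * (exp (Complex e xi * of_real t) * (zl e xi * G xi * bint (mu - 1) (zl e xi) x))"
 have "((\<lambda>x. \<integral>xi. ?f x xi \<partial>lborel) has_vector_derivative (\<integral>xi. ?f' y xi \<partial>lborel)) (at y)"
 proof (rule has_vector_derivative_integral[where S = "{y/2<..<2*y}" and g = "\<lambda>xi. 2 * y * (exp (e * t) * K) * norm (zl e xi * G xi)"])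
  show "integrable lborel (?f x)" if "x \<in> {y/2<..<2*y}" for x
   by (rule Vint_integrable[OF e(1) G]) (use that y in auto)
  show "integrable lborel (\<lambda>xi. 2 * y * (exp (e * t) * K) * norm (zl e xi * G xi))"
   by (intro integrable_mult_right integrable_norm rapid_integrable zG)
  show "?f' y \<in> borel_measurable lborel"
   using borel_measurable_times[OF borel_measurable_const borel_measurable_integrable[OF Vint_integrable[OF e(1) zG y, of t "mu - 1"]]] .
  fix x xi assume x: "x \<in> {y/2<..<2*y}"
  have x0: "0 < x" using x y by simp
  have z: "0 < Re (zl e xi)" using Re_zl[OF e(1), of xi] e by simp
  from has_vector_derivative_mult_right[OF has_vector_derivative_mult_right[OF bint_deriv[OF z x0, of mu]], of "exp (Complex e xi * of_real t)" "G xi"]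
  show "((\<lambda>x. ?f x xi) has_vector_derivative ?f' x xi) (at x)" by (simp add: mult_ac)
  have "norm (?f' x xi) = x * (exp (e * t) * (norm (zl e xi * G xi) * norm (bint (mu - 1) (zl e xi) x)))"
   using x0 by (simp add: norm_mult norm_exp_line)
  also have "\<dots> \<le> (2 * y) * (exp (e * t) * (norm (zl e xi * G xi) * K))"
   using x x0 y K0 by (intro mult_mono mult_left_mono K) auto
  finally show "norm (?f' x xi) \<le> 2 * y * (exp (e * t) * K) * norm (zl e xi * G xi)" by (simp add: mult_ac)
 qed (use y in auto)
 then show ?thesis by (simp add: Vint_def)
qed

lemma Vint_Ck:
 assumes e: "0 < e" "e \<le> 1"
 shows "rapid G ==> Ck_on k (\<lambda>y. Vint e mu G t y) {0<..}"
proof (induction k arbitrary: G mu)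
 case 0
 then show ?case using Vint_vd[OF e]
  by (auto intro!: continuous_at_imp_continuous_on has_vector_derivative_continuous)
next
 case (Suc k)
 show ?case
 proof (rule Ck_on_vector_derivative[OF open_greaterThan])
  show "((\<lambda>y. Vint e mu G t y) has_vector_derivative - of_real y * Vint e (mu - 1) (\<lambda>xi. zl e xi * G xi) t y) (at y)"
   if "y \<in> {0<..}" for y by (rule Vint_vd[OF e Suc.prems]) (use that in simp)
  show "Ck_on k (\<lambda>y. - of_real y * Vint e (mu - 1) (\<lambda>xi. zl e xi * G xi) t y) {0<..}"
   by (rule Ck_on_bilinear[OF open_greaterThan bounded_bilinear_mult Ck_on_linear_outer[OF open_greaterThan bounded_linear_minus[OF bounded_linear_of_real]
     Ck_on_bounded_linear[OF open_greaterThan bounded_linear_ident]] Suc.IH[OF rapid_zl[OF e Suc.prems]]])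
 qed
qed

lemma Vint_iterate:
 assumes e: "0 < e" "e \<le> 1" and G: "rapid G"
 shows "0 < y ==> ((\<lambda>w z. (1 / z) *\<^sub>R ddt w z) ^^ k) (\<lambda>y. Vint e mu G t y) y
   = (-1) ^ k * Vint e (mu - real k) (\<lambda>xi. zl e xi ^ k * G xi) t y"
proof (induction k arbitrary: y)
 case 0
 then show ?case by simp
next
 case (Suc k)
 let ?D = "\<lambda>w z. (1 / z) *\<^sub>R ddt w z"
 have rk: "rapid (\<lambda>xi. zl e xi ^ k * G xi)"
 proof (induction k)
  case (Suc k)
  then show ?case using rapid_zl[OF e Suc] by (simp add: mult.assoc)
 qed (simp add: G)
 have "((\<lambda>y. (-1) ^ k * Vint e (mu - real k) (\<lambda>xi. zl e xi ^ k * G xi) t y) has_vector_derivative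
   (-1) ^ k * (- of_real y * Vint e (mu - real k - 1) (\<lambda>xi. zl e xi * (zl e xi ^ k * G xi)) t y)) (at y)"
  by (intro has_vector_derivative_mult_right Vint_vd[OF e rk Suc.prems])
 then have "((?D ^^ k) (\<lambda>y. Vint e mu G t y) has_vector_derivative
   (-1) ^ k * (- of_real y * Vint e (mu - real k - 1) (\<lambda>xi. zl e xi * (zl e xi ^ k * G xi)) t y)) (at y)"
  by (rule has_vector_derivative_transform_within_open[where S = "{0<..}"]) (use Suc in auto)
 then have "ddt ((?D ^^ k) (\<lambda>y. Vint e mu G t y)) y = (-1) ^ k * (- of_real y * Vint e (mu - real k - 1) (\<lambda>xi. zl e xi * (zl e xi ^ k * G xi)) t y)"
  by (rule vector_derivative_at)
 then have "(?D ^^ Suc k) (\<lambda>y. Vint e mu G t y) y = (1 / y) *\<^sub>R ((-1) ^ k * (- of_real y * Vint e (mu - real k - 1) (\<lambda>xi. zl e xi * (zl e xi ^ k * G xi)) t y))"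
  by simp
 also have "\<dots> = (-1) ^ Suc k * Vint e (mu - real (Suc k)) (\<lambda>xi. zl e xi ^ Suc k * G xi) t y"
  using Suc.prems by (simp add: scaleR_conv_of_real mult_ac diff_diff_eq add.commute)
 finally show ?case .
qed

lemma Vint_continuous:
 assumes e: "0 < e" "e \<le> 1" and G: "rapid G"
 shows "continuous_on (UNIV \<times> {0<..}) (\<lambda>(t, y). Vint e mu G t y)"
proof -
 have cG: "continuous_on UNIV G" using G by (simp add: rapid_def)
 have eq: "Vint e mu G t y = of_real (exp (e * t)) * (\<integral>xi. eix (xi * t) * (G xi * bint mu (zl e xi) y) \<partial>lborel)" for t y
 proof -
  have "exp (Complex e xi * of_real t) = of_real (exp (e * t)) * eix (xi * t)" for xi
   by (simp add: Complex_eq distrib_right exp_add mult.assoc flip: exp_of_real)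
  then show ?thesis by (simp add: Vint_def mult.assoc)
 qed
 have "continuous (at p) (\<lambda>(t, y). Vint e mu G t y)" if p: "p \<in> UNIV \<times> {0<..}" for p
 proof -
  obtain t y where py: "p = (t, y)" by (cases p)
  have y: "0 < y" using p py by simp
  define K where "K = (\<integral>t. gdom mu e (y/2) t \<partial>lborel)"
  have K: "norm (bint mu (zl e xi) x) \<le> K" if "y / 2 \<le> x" for x xi
   unfolding K_def by (rule norm_bint_le[OF e(1) Re_zl[OF e(1)]]) (use y that in auto)
  let ?g = "\<lambda>p xi. eix (xi * fst p) * (G xi * bint mu (zl e xi) (snd p))"
  have "continuous_on (UNIV \<times> {y/2<..}) (\<lambda>p. \<integral>xi. ?g p xi \<partial>lborel)"
  proof (rule continuous_on_integral_dominated[where g = "\<lambda>xi. norm (G xi) * K"])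
   fix p :: "real \<times> real" assume p: "p \<in> UNIV \<times> {y/2<..}"
   then have p0: "0 < snd p" using y by auto
   show "?g p \<in> borel_measurable lborel"
    using p0 by (simp, intro borel_measurable_continuous_onI continuous_on_mult continuous_on_exp continuous_on_const
      continuous_on_of_real continuous_on_id cG bint_line_continuous1[OF e(1) p0])
   show "norm (?g p xi) \<le> norm (G xi) * K" for xi
    using p by (auto simp: norm_mult intro!: mult_left_mono K)
  next
   fix xi :: real
   have "continuous_on (UNIV \<times> {y/2<..}) (\<lambda>p::real \<times> real. (\<lambda>(xi, y). bint mu (zl e xi) y) (xi, snd p))"
    by (rule continuous_on_compose2[OF bint_line_continuous[OF e(1)]]) (use y in \<open>auto intro!: continuous_intros\<close>)
   then show "continuous_on (UNIV \<times> {y/2<..}) (\<lambda>p. ?g p xi)"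
    by (intro continuous_on_mult continuous_on_exp continuous_on_const continuous_on_of_real continuous_on_fst continuous_on_id) simp
  qed (intro integrable_mult_left integrable_norm rapid_integrable G)
  then have "continuous_on (UNIV \<times> {y/2<..}) (\<lambda>p. of_real (exp (e * fst p)) * (\<integral>xi. ?g p xi \<partial>lborel))"
   by (intro continuous_on_mult continuous_on_of_real continuous_on_exp continuous_on_const continuous_on_fst continuous_on_id)
  then have "continuous_on (UNIV \<times> {y/2<..}) (\<lambda>(t, y). Vint e mu G t y)" by (simp add: eq split_beta)
  moreover have "open (UNIV \<times> {y/2<..} :: (real \<times> real) set)" by (intro open_Times) auto
  ultimately show ?thesis using y py by (simp add: continuous_on_eq_continuous_at)
 qed
 then show ?thesis by (intro continuous_at_imp_continuous_on) auto
qed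

lemma Vint_tendsto:
 assumes e: "0 < e" "e \<le> 1" and G: "rapid G" and mu: "0 < mu"
 shows "((\<lambda>y. Vint e mu G t y) \<longlongrightarrow> (\<integral>xi. exp (Complex e xi * of_real t) * (G xi * bint mu (zl e xi) 0) \<partial>lborel)) (at_right 0)"
 unfolding tendsto_at_iff_sequentially comp_def
proof safe
 fix Y :: "nat => real" assume Y: "\<forall>n. Y n \<in> {0<..} - {0}" "Y \<longlonglongrightarrow> 0"
 have Yr: "filterlim Y (at_right 0) sequentially"
  unfolding filterlim_at using Y by (auto intro!: always_eventually simp: less_imp_neq[symmetric])
 have zp: "0 < Re (zl e xi)" for xi using Re_zl[OF e(1), of xi] e by simp
 define L where "L = (e / 2) powr (- mu) * Gamma mu"
 have L: "norm (bint mu (zl e xi) y) \<le> L" for xi y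
 proof -
  have "norm (bint mu (zl e xi) y) \<le> (Re (zl e xi) / 2) powr (- mu) * Gamma mu" by (rule norm_bint_le_Gamma[OF mu zp])
  also have "\<dots> \<le> L" unfolding L_def
   using Re_zl[OF e(1), of xi] e mu Gamma_real_pos[OF mu] by (intro mult_right_mono powr_mono2') auto
  finally show ?thesis .
 qed
 have lim: "(\<lambda>n. bint mu (zl e xi) (Y n)) \<longlonglongrightarrow> bint mu (zl e xi) 0" for xi
  by (rule filterlim_compose[OF bint_tendsto_0[OF mu zp] Yr])
 have Yp: "0 < Y n" for n using Y by auto
 \<comment> \<open>\<open>bint_line_continuous1\<close> covers \<open>y > 0\<close>; at the boundary
   measurability is inherited from the limit along \<open>Y n\<close>.\<close>
 have [measurable]: "(\<lambda>xi. bint mu (zl e xi) 0) \<in> borel_measurable borel"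
  by (rule borel_measurable_LIMSEQ_metric[OF _ lim]) (intro borel_measurable_continuous_onI bint_line_continuous1 e Yp)
 have [measurable]: "G \<in> borel_measurable borel" using G by (auto simp: rapid_def intro: borel_measurable_continuous_onI)
 have [measurable]: "(\<lambda>xi. exp (Complex e xi * of_real t)) \<in> borel_measurable borel"
  by (intro borel_measurable_continuous_onI continuous_on_mult continuous_on_exp continuous_on_Complex_line continuous_on_const)
 show "(\<lambda>n. Vint e mu G t (Y n)) \<longlonglongrightarrow> (\<integral>xi. exp (Complex e xi * of_real t) * (G xi * bint mu (zl e xi) 0) \<partial>lborel)"
  unfolding Vint_def
 proof (rule integral_dominated_convergence[where w = "\<lambda>xi. exp (e * t) * L * norm (G xi)"])
  show "(\<lambda>xi. exp (Complex e xi * of_real t) * (G xi * bint mu (zl e xi) 0)) \<in> borel_measurable lborel" by measurable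
  show "(\<lambda>xi. exp (Complex e xi * of_real t) * (G xi * bint mu (zl e xi) (Y n))) \<in> borel_measurable lborel" for n
   by (rule borel_measurable_integrable[OF Vint_integrable[OF e(1) G Yp]])
  show "integrable lborel (\<lambda>xi. exp (e * t) * L * norm (G xi))"
   by (intro integrable_mult_right integrable_norm rapid_integrable G)
  show "AE xi in lborel. (\<lambda>n. exp (Complex e xi * of_real t) * (G xi * bint mu (zl e xi) (Y n))) \<longlonglongrightarrow> exp (Complex e xi * of_real t) * (G xi * bint mu (zl e xi) 0)"
   by (intro AE_I2 tendsto_mult tendsto_const lim)
  show "AE xi in lborel. norm (exp (Complex e xi * of_real t) * (G xi * bint mu (zl e xi) (Y n))) \<le> exp (e * t) * L * norm (G xi)" for n
  proof (rule AE_I2)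
   fix xi
   have "norm (exp (Complex e xi * of_real t) * (G xi * bint mu (zl e xi) (Y n))) \<le> exp (e * t) * (norm (G xi) * L)"
    unfolding norm_mult norm_exp_line by (intro mult_left_mono L) auto
   then show "norm (exp (Complex e xi * of_real t) * (G xi * bint mu (zl e xi) (Y n))) \<le> exp (e * t) * L * norm (G xi)" by (simp add: mult_ac)
  qed
 qed
qed

text \<open>By \<open>bint_0\<close> the first factors are the reciprocal of the boundary value of
  the kernel, so that the product with the kernel of order \<open>\<alpha>\<close> starts from the
  transform of the boundary datum; \<open>2 pi\<close> belongs to Fourier inversion.\<close>

definition Gprof :: "real => real => complex" where
 "Gprof e xi = (zl e xi / 2) powr of_real \<alpha> / of_real (Gamma \<alpha>) / of_real (2 * pi) * lap (F 0) (Complex e xi)"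

lemma rapid_lap:
 assumes "0 < e" "e \<le> 1"
 shows "rapid (\<lambda>xi. lap (F 0) (Complex e xi))"
 unfolding rapid_def
proof (intro conjI allI)
 fix N
 obtain C where "\<And>w. 0 \<le> Re w ==> Re w \<le> 1 ==> (1 + \<bar>Im w\<bar>) ^ N * norm (lap (F 0) w) \<le> C"
  using lap_rapid[OF F] by blast
 from this[of "Complex e _"] show "\<exists>C. \<forall>xi. (1 + \<bar>xi\<bar>) ^ N * norm (lap (F 0) (Complex e xi)) \<le> C"
  using assms by (intro exI[of _ C]) auto
qed (rule continuous_on_lap_line[OF F])

lemma half_powr: "0 < Re z ==> (z / 2) powr of_real p = of_real (2 powr (- p)) * z powr of_real p"
proof -
 assume z: "0 < Re z"
 have z0: "z \<noteq> 0" using z by auto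
 have L: "Ln (z / 2) = Ln z - of_real (ln 2)"
 proof (rule Ln_unique)
  show "exp (Ln z - of_real (ln 2)) = z / 2" using z0 by (simp add: exp_diff exp_of_real)
 qed (use mpi_less_Im_Ln[OF z0] Im_Ln_le_pi[OF z0] in auto)
 show ?thesis using z
  by (auto simp: powr_def L exp_of_real[symmetric] exp_add[symmetric] algebra_simps)
qed

lemma rapid_Gprof:
 assumes e: "0 < e" "e \<le> 1"
 shows "rapid (Gprof e)"
proof -
 have zp: "0 < Re (zl e xi)" for xi using Re_zl[OF e(1), of xi] e by simp
 define N where "N = nat \<lceil>\<alpha>\<rceil>"
 define c where "c = 2 powr (- \<alpha>) / Gamma \<alpha> / (2 * pi)"
 have c: "0 \<le> c" using \<alpha> Gamma_real_pos[OF \<alpha>] by (simp add: c_def)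
 have eq: "Gprof e = (\<lambda>xi. (of_real c * zl e xi powr of_real \<alpha>) * lap (F 0) (Complex e xi))"
  unfolding Gprof_def[abs_def] half_powr[OF zp] by (auto simp: c_def)
 show ?thesis unfolding eq
 proof (rule rapid_mult[OF rapid_lap[OF e], where K = N and L = "c * (1 + lam) ^ N"])
  show "continuous_on UNIV (\<lambda>xi. of_real c * zl e xi powr of_real \<alpha>)"
   using e by (simp add: zroot_powr) (intro continuous_on_mult continuous_on_const continuous_on_zsq_powr_line[where p = "\<alpha> / 2", simplified])
  fix xi
  have n: "norm (zl e xi) \<le> (1 + lam) * (1 + \<bar>xi\<bar>)" using norm_zroot_le[OF e lam, of xi] by simp
  have g1: "1 \<le> (1 + lam) * (1 + \<bar>xi\<bar>)" using lam by (simp add: algebra_simps add_increasing)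
  have "norm (zl e xi) powr \<alpha> \<le> ((1 + lam) * (1 + \<bar>xi\<bar>)) powr \<alpha>" using n \<alpha> by (intro powr_mono2) auto
  also have "\<dots> \<le> ((1 + lam) * (1 + \<bar>xi\<bar>)) powr real N" using g1 by (intro powr_mono) (auto simp: N_def, linarith)
  also have "\<dots> = (1 + lam) ^ N * (1 + \<bar>xi\<bar>) ^ N" using g1 by (subst powr_realpow) (auto simp: power_mult_distrib)
  finally show "norm (of_real c * zl e xi powr of_real \<alpha>) \<le> c * (1 + lam) ^ N * (1 + \<bar>xi\<bar>) ^ N"
   using c by (simp add: norm_mult norm_powr_real_powr' mult_left_mono mult.assoc)
 qed
qed

end

text \<open>The interface between the manifold and the analysis of one mode: \<open>h\<close> is a
  coefficient of the solution and \<open>F 0\<close> that of the boundary datum. The terms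
  \<open>C y^\<alpha>\<close> come from the energy bound, while \<open>R\<close> dominates the even
  expansion, of whose coefficients only integrability in time is known. Test functions are products
  \<open>\<rho>(t) \<theta>(y)\<close>.\<close>

locale mode_problem = cutoff chi + symbol_setup F T \<alpha> lam
 for chi :: "real => real" and F T \<alpha> lam +
 fixes h :: "real => real => complex" and R :: "real => real" and C :: real
 assumes hm [measurable]: "case_prod h \<in> borel_measurable (borel \<Otimes>\<^sub>M borel)"
  and C0: "0 \<le> C" and Rint: "integrable lborel R" and R0: "\<And>t. 0 \<le> R t"
  and h0: "AE p in lborel2. fst p < - T --> 0 < snd p --> h (fst p) (snd p) = 0"
  and hb: "AE p in lborel2. 0 < snd p --> norm (h (fst p) (snd p)) \<le> C * snd p powr \<alpha> + R (fst p)"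
  and hf: "AE p in lborel2. 0 < snd p \<and> snd p < 1 -->
   norm (h (fst p) (snd p) - F 0 (fst p)) \<le> C * snd p powr \<alpha> + (snd p)\<^sup>2 * R (fst p)"
  and hweak: "\<And>\<rho> \<rho>1 \<rho>2 S \<theta> \<theta>1 \<theta>2 a b. smooth_on \<rho> UNIV ==> (\<And>t. S < \<bar>t\<bar> ==> \<rho> t = 0) ==>
   (\<And>t. (\<rho> has_vector_derivative \<rho>1 t) (at t)) ==> (\<And>t. (\<rho>1 has_vector_derivative \<rho>2 t) (at t)) ==>
   smooth_on \<theta> {0<..} ==> 0 < a ==> (\<And>y. y \<notin> {a..b} ==> \<theta> y = 0) ==>
   (\<And>y. 0 < y ==> (\<theta> has_vector_derivative \<theta>1 y) (at y)) ==>
   (\<And>y. 0 < y ==> (\<theta>1 has_vector_derivative \<theta>2 y) (at y)) ==>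
   (\<integral>p. indicator {0<..} (snd p) *\<^sub>R (h (fst p) (snd p) * of_real (snd p powr (1 - 2 * \<alpha>)) *
     (\<rho>2 (fst p) * \<theta> (snd p) + \<rho> (fst p) * ((of_real lam)\<^sup>2 * \<theta> (snd p) - \<theta>2 (snd p) - of_real ((1 - 2 * \<alpha>) / snd p) * \<theta>1 (snd p))))
    \<partial>(lborel2)) = 0"
begin

lemma T0: "0 < T" using F by (simp add: test_seq_def)

lemma F0_zero: "T < \<bar>t\<bar> ==> F 0 t = 0" using F by (simp add: test_seq_def)

text \<open>For \<open>t \<ge> - T\<close> and \<open>Re w \<le> 1\<close> one has
  \<open>- Re w t \<le> 2 T - Re w |t|\<close>, which is where the constant \<open>exp (2 T)\<close>
  comes from.\<close>

definition E1 :: "complex => real => real" where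
 "E1 w t = exp (2 * T) * exp (- (Re w * \<bar>t\<bar>))"

lemma E1_int: "0 < Re w ==> integrable lborel (E1 w)"
 unfolding E1_def by (intro integrable_mult_right integrable_exp_abs)

lemma exp_le_E1:
 assumes "0 < Re w" "Re w \<le> 1" "- T \<le> t"
 shows "norm (exp (- (w * of_real t))) \<le> E1 w t" "norm (exp (- (w * of_real t))) \<le> exp T"
proof -
 have a: "- (Re w * t) \<le> T"
 proof (cases "0 \<le> t")
  case False
  have "Re w * (- t) \<le> 1 * T" using assms False T0 by (intro mult_mono) auto
  then show ?thesis by simp
 qed (use assms T0 in \<open>smt (verit) mult_nonneg_nonneg\<close>)
 then show "norm (exp (- (w * of_real t))) \<le> exp T" by simp
 have "- (Re w * t) \<le> 2 * T + - (Re w * \<bar>t\<bar>)" using a T0 by (cases "0 \<le> t") (simp_all add: algebra_simps)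
 then show "norm (exp (- (w * of_real t))) \<le> E1 w t" unfolding E1_def exp_add[symmetric] by simp
qed

definition gd :: "complex => real => real => real" where
 "gd w y t = C * y powr \<alpha> * E1 w t + exp T * R t"

lemma gd_int: "0 < Re w ==> integrable lborel (gd w y)"
 unfolding gd_def by (intro Bochner_Integration.integrable_add integrable_mult_right E1_int Rint)

lemma gd_nonneg: "0 \<le> gd w y t" using C0 R0 by (simp add: gd_def E1_def)

lemma exp_h_le:
 assumes w: "0 < Re w" "Re w \<le> 1" and "t < - T --> x = 0" "norm x \<le> C * y powr \<alpha> + R t"
 shows "norm (exp (- (w * of_real t)) * x) \<le> gd w y t"
proof (cases "t < - T")
 case False
 have "norm (exp (- (w * of_real t)) * x) \<le> norm (exp (- (w * of_real t))) * (C * y powr \<alpha> + R t)"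
  unfolding norm_mult using assms by (intro mult_left_mono) auto
 also have "\<dots> = C * y powr \<alpha> * norm (exp (- (w * of_real t))) + norm (exp (- (w * of_real t))) * R t"
  by (simp only: distrib_left mult_ac)
 also have "\<dots> \<le> gd w y t"
  unfolding gd_def using False exp_le_E1[OF w, of t] C0 R0 by (intro add_mono mult_left_mono mult_right_mono) auto
 finally show ?thesis .
qed (use assms gd_nonneg in auto)

lemma hb_AE: "AE y in lborel. AE t in lborel. 0 < y --> (t < - T --> h t y = 0) \<and> norm (h t y) \<le> C * y powr \<alpha> + R t"
proof (rule lborel_pair.AE_pair_swap)
 show "AE p in lborel2. 0 < snd p --> (fst p < - T --> h (fst p) (snd p) = 0) \<and> norm (h (fst p) (snd p)) \<le> C * snd p powr \<alpha> + R (fst p)"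
  using h0 hb by eventually_elim auto
qed

definition Wt :: "complex => real => complex" where
 "Wt w y = lap (\<lambda>t. h t y) w"

lemma h_slice_int:
 assumes w: "0 < Re w" "Re w \<le> 1"
 shows "AE y in lborel. 0 < y --> integrable lborel (\<lambda>t. exp (- (w * of_real t)) * h t y)"
 using hb_AE
proof eventually_elim
 fix y assume ae: "AE t in lborel. 0 < y --> (t < - T --> h t y = 0) \<and> norm (h t y) \<le> C * y powr \<alpha> + R t"
 show "0 < y --> integrable lborel (\<lambda>t. exp (- (w * of_real t)) * h t y)"
 proof
  assume y: "0 < y"
  show "integrable lborel (\<lambda>t. exp (- (w * of_real t)) * h t y)"
  proof (rule Bochner_Integration.integrable_bound[OF gd_int[OF w(1), of y]])
   show "AE t in lborel. norm (exp (- (w * of_real t)) * h t y) \<le> norm (gd w y t)"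
    using ae by eventually_elim (use y exp_h_le[OF w] gd_nonneg in auto)
  qed measurable
 qed
qed

lemma Wt_measurable [measurable]: "Wt w \<in> borel_measurable borel"
 unfolding Wt_def[abs_def] lap_def by measurable

text \<open>Testing in time with \<open>exp (- w t)\<close> replaces two time derivatives by
  \<open>w^2\<close>, so the transform is a weak solution of the Bessel equation with parameter
  \<open>zroot lam w\<close>. Its growth and boundary rate are the bounds on \<open>h\<close>
  integrated against the exponential; uniqueness does the rest.\<close>

lemma Wt_eq:
 assumes w: "0 < Re w" "Re w \<le> 1"
 shows "AE y in lborel. 0 < y --> Wt w y = lap (F 0) w / bint \<alpha> (zroot lam w) 0 * bint \<alpha> (zroot lam w) y"
proof -
 define I1 where "I1 = (\<integral>t. E1 w t \<partial>lborel)"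
 define In where "In = (\<integral>t. R t \<partial>lborel)"
 have I: "0 \<le> I1" "0 \<le> In" unfolding I1_def In_def using R0 by (auto simp: E1_def)
 define K where "K = C * I1 + exp T * In"
 have K: "C * I1 \<le> K" "exp T * In \<le> K" "0 \<le> K" using I C0 by (auto simp: K_def)
 have zp: "0 < Re (zroot lam w)" using Re_zroot_ge[OF w(1), of lam] w by simp
 have gdI: "(\<integral>t. gd w y t \<partial>lborel) = C * y powr \<alpha> * I1 + exp T * In" for y
  unfolding gd_def I1_def In_def using E1_int[OF w(1)] Rint by simp
 interpret B: weak_bessel chi \<alpha> K K "zroot lam w" "lap (F 0) w" "Wt w"
 proof
  show "0 < \<alpha>" by (rule \<alpha>)
  show "0 < Re (zroot lam w)" by (rule zp)
  show "Wt w \<in> borel_measurable borel" by measurable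
  show "AE y in lborel. 0 < y --> norm (Wt w y) \<le> K * (1 + y powr \<alpha>)"
   using hb_AE
  proof eventually_elim
   fix y assume ae: "AE t in lborel. 0 < y --> (t < - T --> h t y = 0) \<and> norm (h t y) \<le> C * y powr \<alpha> + R t"
   show "0 < y --> norm (Wt w y) \<le> K * (1 + y powr \<alpha>)"
   proof
    assume y: "0 < y"
    have "AE t in lborel. norm (exp (- (w * of_real t)) * h t y) \<le> gd w y t"
     using ae by eventually_elim (use y exp_h_le[OF w] in auto)
    then have "norm (Wt w y) \<le> C * y powr \<alpha> * I1 + exp T * In"
     unfolding Wt_def lap_def gdI[symmetric] by (rule integral_norm_bound_AE[OF gd_int[OF w(1)]])
    also have "\<dots> = (C * I1) * y powr \<alpha> + exp T * In" by simp
    also have "\<dots> \<le> K * y powr \<alpha> + K" using K by (intro add_mono mult_right_mono) auto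
    finally show "norm (Wt w y) \<le> K * (1 + y powr \<alpha>)" by (simp add: algebra_simps)
   qed
  qed
  have hf': "AE y in lborel. AE t in lborel. 0 < y \<and> y < 1 --> norm (h t y - F 0 t) \<le> C * y powr \<alpha> + y\<^sup>2 * R t"
   by (rule lborel_pair.AE_pair_swap[OF hf])
  show "AE y in lborel. 0 < y \<and> y < 1 --> norm (Wt w y - lap (F 0) w) \<le> K * (y powr \<alpha> + y\<^sup>2)"
   using hb_AE hf' h_slice_int[OF w]
  proof eventually_elim
   fix y assume ae: "AE t in lborel. 0 < y --> (t < - T --> h t y = 0) \<and> norm (h t y) \<le> C * y powr \<alpha> + R t"
    and ae2: "AE t in lborel. 0 < y \<and> y < 1 --> norm (h t y - F 0 t) \<le> C * y powr \<alpha> + y\<^sup>2 * R t"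
    and int: "0 < y --> integrable lborel (\<lambda>t. exp (- (w * of_real t)) * h t y)"
   show "0 < y \<and> y < 1 --> norm (Wt w y - lap (F 0) w) \<le> K * (y powr \<alpha> + y\<^sup>2)"
   proof
    assume y: "0 < y \<and> y < 1"
    let ?g = "\<lambda>t. C * y powr \<alpha> * E1 w t + y\<^sup>2 * exp T * R t"
    have gi: "integrable lborel ?g"
     by (intro Bochner_Integration.integrable_add integrable_mult_right E1_int Rint w)
    have "AE t in lborel. norm (exp (- (w * of_real t)) * h t y - exp (- (w * of_real t)) * F 0 t) \<le> ?g t"
     using ae ae2
    proof eventually_elim
     fix t assume 1: "0 < y --> (t < - T --> h t y = 0) \<and> norm (h t y) \<le> C * y powr \<alpha> + R t"
      and 2: "0 < y \<and> y < 1 --> norm (h t y - F 0 t) \<le> C * y powr \<alpha> + y\<^sup>2 * R t"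
     show "norm (exp (- (w * of_real t)) * h t y - exp (- (w * of_real t)) * F 0 t) \<le> ?g t"
     proof (cases "t < - T")
      case True
      then have "h t y = 0" "F 0 t = 0" using 1 y F0_zero by auto
      then show ?thesis using C0 R0 by (simp add: E1_def)
     next
      case False
      have "norm (exp (- (w * of_real t)) * h t y - exp (- (w * of_real t)) * F 0 t) = norm (exp (- (w * of_real t))) * norm (h t y - F 0 t)"
       by (simp add: right_diff_distrib[symmetric] norm_mult)
      also have "\<dots> \<le> norm (exp (- (w * of_real t))) * (C * y powr \<alpha> + y\<^sup>2 * R t)"
       using 2 y by (intro mult_left_mono) auto
      also have "\<dots> = C * y powr \<alpha> * norm (exp (- (w * of_real t))) + norm (exp (- (w * of_real t))) * (y\<^sup>2 * R t)"
       by (simp only: distrib_left mult_ac)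
      also have "\<dots> \<le> C * y powr \<alpha> * E1 w t + exp T * (y\<^sup>2 * R t)"
       using False exp_le_E1[OF w, of t] C0 R0 by (intro add_mono mult_left_mono mult_right_mono) auto
      finally show ?thesis by (simp add: mult_ac)
     qed
    qed
    then have "norm (\<integral>t. exp (- (w * of_real t)) * h t y - exp (- (w * of_real t)) * F 0 t \<partial>lborel) \<le> (\<integral>t. ?g t \<partial>lborel)"
     by (rule integral_norm_bound_AE[OF gi])
    also have "(\<integral>t. exp (- (w * of_real t)) * h t y - exp (- (w * of_real t)) * F 0 t \<partial>lborel) = Wt w y - lap (F 0) w"
     unfolding Wt_def lap_def using int y lap_integrable[OF F] by (intro Bochner_Integration.integral_diff) auto
    also have "(\<integral>t. ?g t \<partial>lborel) = (C * I1) * y powr \<alpha> + (exp T * In) * y\<^sup>2"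
     unfolding I1_def In_def using E1_int[OF w(1)] Rint by simp
    also have "\<dots> \<le> K * y powr \<alpha> + K * y\<^sup>2" using K by (intro add_mono mult_right_mono) auto
    finally show "norm (Wt w y - lap (F 0) w) \<le> K * (y powr \<alpha> + y\<^sup>2)" by (simp add: algebra_simps)
   qed
  qed
 next
  fix \<theta> \<theta>1 \<theta>2 :: "real => complex" and a b :: real
  assume th: "smooth_on \<theta> {0<..}" and a: "0 < a" and th0: "\<And>y. y \<notin> {a..b} ==> \<theta> y = 0"
   and th1: "\<And>y. 0 < y ==> (\<theta> has_vector_derivative \<theta>1 y) (at y)"
   and th2: "\<And>y. 0 < y ==> (\<theta>1 has_vector_derivative \<theta>2 y) (at y)"
  have out: "h1 = 0" if "y \<notin> {a..b}" "0 < y" "\<And>y. y \<notin> {a..b} ==> 0 < y ==> g y = 0" "(g has_vector_derivative h1) (at y)"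
   for g :: "real => complex" and h1 y
  proof -
   have "(g has_vector_derivative 0) (at y)"
    by (rule has_vector_derivative_transform_within_open[where f = "\<lambda>_. 0" and S = "- {a..b} \<inter> {0<..}"])
      (use that in \<open>auto intro!: open_Int open_Compl\<close>)
   then show ?thesis using that(4) vector_derivative_at by metis
  qed
  have th10: "\<theta>1 y = 0" if "y \<notin> {a..b}" "0 < y" for y by (rule out[OF that _ th1[OF that(2)]]) (rule th0)
  have th20: "\<theta>2 y = 0" if "y \<notin> {a..b}" "0 < y" for y by (rule out[OF that _ th2[OF that(2)]]) (rule th10)
  have th1_s: "smooth_on \<theta>1 {0<..}"
   by (rule smooth_on_cong[OF open_greaterThan _ smooth_on_vector_derivativeD(1)[OF open_greaterThan th]]) (use th1 vector_derivative_at in auto)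
  have th2_s: "smooth_on \<theta>2 {0<..}"
   by (rule smooth_on_cong[OF open_greaterThan _ smooth_on_vector_derivativeD(1)[OF open_greaterThan th1_s]]) (use th2 vector_derivative_at in auto)
  define P where "P = (\<lambda>y::real. complex_of_real (y powr (1 - 2 * \<alpha>)))"
  define Q where "Q = (\<lambda>y. (of_real lam)\<^sup>2 * \<theta> y - \<theta>2 y - of_real ((1 - 2 * \<alpha>) / y) * \<theta>1 y)"
  have Q0: "Q y = 0" if "y \<notin> {a..b}" "0 < y" for y using th0 th10 th20 that by (simp add: Q_def)
  have cP: "continuous_on {0<..} P" unfolding P_def by (rule smooth_on_continuous[OF smooth_on_powr])
  have cth: "continuous_on {0<..} \<theta>" by (rule smooth_on_continuous[OF th])
  have cQ: "continuous_on {0<..} Q" unfolding Q_def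
   using smooth_on_continuous[OF th] smooth_on_continuous[OF th1_s] smooth_on_continuous[OF th2_s]
   by (intro continuous_on_diff continuous_on_mult continuous_on_const continuous_on_of_real continuous_on_divide continuous_on_id) auto
  have bd: "\<exists>B. \<forall>y\<in>{a..b}. norm (g y) \<le> B" if "continuous_on {0<..} g" for g :: "real => complex"
  proof -
   have "bounded (g ` {a..b})"
    using a by (intro compact_imp_bounded compact_continuous_image continuous_on_subset[OF that]) auto
   then show ?thesis by (auto simp: bounded_iff)
  qed
  obtain B1 where B1: "\<forall>y\<in>{a..b}. norm (P y * \<theta> y) \<le> B1" using bd[OF continuous_on_mult[OF cP cth]] by blast
  obtain B2 where B2: "\<forall>y\<in>{a..b}. norm (P y * Q y) \<le> B2" using bd[OF continuous_on_mult[OF cP cQ]] by blast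
  obtain X where X: "1 \<le> X" "\<And>y. norm (cx y) \<le> X" "\<And>y. norm (cx1 y) \<le> X" "\<And>y. norm (cx2 y) \<le> X" using cx_bound by blast
  have Pm: "(\<lambda>y. indicator {0<..} y *\<^sub>R (P y * \<theta> y)) \<in> borel_measurable borel" "(\<lambda>y. indicator {0<..} y *\<^sub>R (P y * Q y)) \<in> borel_measurable borel"
   by (intro borel_measurable_continuous_on_indicator continuous_on_mult cP cth cQ; simp)+
  define PT where "PT = (\<lambda>y. indicator {0<..} y *\<^sub>R (P y * \<theta> y))"
  define PQ where "PQ = (\<lambda>y. indicator {0<..} y *\<^sub>R (P y * Q y))"
  have [measurable]: "PT \<in> borel_measurable borel" "PQ \<in> borel_measurable borel" using Pm by (auto simp: PT_def PQ_def)
  define ex where "ex = (\<lambda>t::real. exp (- (w * of_real t)))"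
  \<comment> \<open>The exponential is not an admissible test function. \<open>\<kappa>\<close> cuts
    it off on the left and equals one for \<open>t \<ge> - T\<close>, the only times at which
    \<open>h\<close> may be nonzero; the factors \<open>c0 n\<close> cut it off on the right and
    tend to one.\<close>
  define \<kappa> where "\<kappa> = (\<lambda>t. cx (t / (-1) + (1/2 - T)))"
  define \<kappa>1 where "\<kappa>1 = (\<lambda>t. cx1 (t / (-1) + (1/2 - T)) / of_real (-1))"
  define \<kappa>2 where "\<kappa>2 = (\<lambda>t. cx2 (t / (-1) + (1/2 - T)) / of_real (-1) / of_real (-1))"
  define c0 where "c0 = (\<lambda>n t. cx (t / real (Suc n) + 0))"
  define c1 where "c1 = (\<lambda>n t. cx1 (t / real (Suc n) + 0) / of_real (real (Suc n)))"
  define c2 where "c2 = (\<lambda>n t. cx2 (t / real (Suc n) + 0) / of_real (real (Suc n)) / of_real (real (Suc n)))"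
  have ex_vd: "(ex has_vector_derivative - w * ex t) (at t)" for t
   unfolding ex_def by (rule has_vector_derivative_real_field) (auto intro!: derivative_eq_intros)
  have k_vd: "(\<kappa> has_vector_derivative \<kappa>1 t) (at t)" "(\<kappa>1 has_vector_derivative \<kappa>2 t) (at t)" for t
   unfolding \<kappa>_def \<kappa>1_def \<kappa>2_def
   by (rule cx_affine_vd(1), simp, rule has_vector_derivative_divide, rule cx_affine_vd(2), simp)
  have c_vd: "(c0 n has_vector_derivative c1 n t) (at t)" "(c1 n has_vector_derivative c2 n t) (at t)" for n t
   unfolding c0_def c1_def c2_def
   by (rule cx_affine_vd(1), simp, rule has_vector_derivative_divide, rule cx_affine_vd(2), simp)
  define \<rho> where "\<rho> = (\<lambda>n t. ex t * (\<kappa> t * c0 n t))"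
  define \<rho>1 where "\<rho>1 = (\<lambda>n t. ex t * (\<kappa> t * c1 n t + \<kappa>1 t * c0 n t) + - w * ex t * (\<kappa> t * c0 n t))"
  define \<rho>2 where "\<rho>2 = (\<lambda>n t. (ex t * ((\<kappa> t * c2 n t + \<kappa>1 t * c1 n t) + (\<kappa>1 t * c1 n t + \<kappa>2 t * c0 n t)) + - w * ex t * (\<kappa> t * c1 n t + \<kappa>1 t * c0 n t)) +
    (- w * ex t * (\<kappa> t * c1 n t + \<kappa>1 t * c0 n t) + - w * (- w * ex t) * (\<kappa> t * c0 n t)))"
  let ?q = "\<lambda>y. of_real ((1 - 2 * \<alpha>) / y) :: complex"
  define I where "I = (\<lambda>n p. h (fst p) (snd p) * (\<rho>2 n (fst p) * PT (snd p) + \<rho> n (fst p) * PQ (snd p)))"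
  have I0: "(\<integral>p. I n p \<partial>(lborel2)) = 0" for n
  proof -
   have eq: "indicator {0<..} (snd p) *\<^sub>R (h (fst p) (snd p) * of_real (snd p powr (1 - 2 * \<alpha>)) *
     (\<rho>2 n (fst p) * \<theta> (snd p) + \<rho> n (fst p) * ((of_real lam)\<^sup>2 * \<theta> (snd p) - \<theta>2 (snd p) - ?q (snd p) * \<theta>1 (snd p)))) = I n p" for p
    unfolding I_def PT_def PQ_def P_def Q_def by (simp add: indicator_def distrib_left mult_ac)
   show ?thesis unfolding eq[symmetric]
   proof (rule hweak[OF _ _ _ _ th a th0 th1 th2])
    show "smooth_on (\<rho> n) UNIV" unfolding \<rho>_def ex_def \<kappa>_def c0_def
     using smooth_on_exp_of_real[of "- w"]
     by (intro smooth_on_mult open_UNIV cx_affine_smooth(1)) (auto simp del: of_nat_Suc)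
    show "\<rho> n t = 0" if "max (T + 2) (2 * real (Suc n)) < \<bar>t\<bar>" for t
    proof (cases "0 \<le> t")
     case True
     then have "2 < t / real (Suc n)" using that by (simp add: field_simps del: of_nat_Suc)
     then show ?thesis by (simp add: \<rho>_def c0_def cx_0 del: of_nat_Suc)
    next
     case False
     then have "2 < t / (-1) + (1/2 - T)" using that by simp
     then show ?thesis by (simp add: \<rho>_def \<kappa>_def cx_0)
    qed
    show "(\<rho> n has_vector_derivative \<rho>1 n t) (at t)" for t unfolding \<rho>_def \<rho>1_def
     by (intro has_vector_derivative_mult ex_vd k_vd c_vd)
    show "(\<rho>1 n has_vector_derivative \<rho>2 n t) (at t)" for t unfolding \<rho>1_def \<rho>2_def
     by (intro has_vector_derivative_add has_vector_derivative_mult has_vector_derivative_mult_right ex_vd k_vd c_vd)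
   qed
  qed
  define L where "L = (\<lambda>p. h (fst p) (snd p) * (ex (fst p) * (w\<^sup>2 * PT (snd p) + PQ (snd p))))"
  have [measurable]: "ex \<in> borel_measurable borel" unfolding ex_def by measurable
  have Im [measurable]: "I n \<in> borel_measurable (lborel2)" for n
   unfolding I_def \<rho>_def \<rho>2_def \<kappa>_def \<kappa>1_def \<kappa>2_def c0_def c1_def c2_def by measurable
  have Lm [measurable]: "L \<in> borel_measurable (lborel2)" unfolding L_def by measurable
  define M where "M = (X + 2 * norm w * X + (norm w)\<^sup>2 * X) * B1 + X * B2"
  \<comment> \<open>On the support of \<open>\<theta>\<close> the power \<open>y^\<alpha>\<close> is
    at most \<open>b^\<alpha>\<close>, so the single time profile \<open>gd w b\<close> dominates
    for all \<open>n\<close>.\<close>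
  define D where "D = (\<lambda>p. gd w b (fst p) * (\<bar>M\<bar> * indicator {a..b} (snd p)))"
  have Dint: "integrable (lborel2) D"
  proof (rule integrable_pair_bound[where f = "gd w b" and g = "\<lambda>y. \<bar>M\<bar> * indicator {a..b} y"])
   have [measurable]: "gd w b \<in> borel_measurable borel" using gd_int[OF w(1), of b] by auto
   show "D \<in> borel_measurable (lborel2)" unfolding D_def by measurable
   show "AE p in lborel2. norm (D p) \<le> gd w b (fst p) * (\<bar>M\<bar> * indicator {a..b} (snd p))"
    using gd_nonneg by (simp add: D_def abs_mult)
  qed (auto intro!: sigma_finite_lborel gd_int w simp: integrable_indicator_iff emeasure_lborel_Icc_eq)
  have rho_late: "\<rho> n t = ex t * c0 n t" "\<rho>2 n t = ex t * (c2 n t - 2 * w * c1 n t + w\<^sup>2 * c0 n t)" if "- T \<le> t" for n t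
  proof -
   have "t / (-1) + (1/2 - T) < 1" using that by simp
   then have k: "\<kappa> t = 1" "\<kappa>1 t = 0" "\<kappa>2 t = 0" by (simp_all add: \<kappa>_def \<kappa>1_def \<kappa>2_def cx_1 cx1_0 cx2_0)
   show "\<rho> n t = ex t * c0 n t" by (simp add: \<rho>_def k)
   show "\<rho>2 n t = ex t * (c2 n t - 2 * w * c1 n t + w\<^sup>2 * c0 n t)"
    by (simp add: \<rho>2_def k power2_eq_square algebra_simps)
  qed
  have dom: "AE p in lborel2. norm (I n p) \<le> D p" for n
   using h0 hb
  proof eventually_elim
   fix p assume 1: "fst p < - T --> 0 < snd p --> h (fst p) (snd p) = 0"
    and 2: "0 < snd p --> norm (h (fst p) (snd p)) \<le> C * snd p powr \<alpha> + R (fst p)"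
   obtain t y where p: "p = (t, y)" by (cases p)
   show "norm (I n p) \<le> D p"
   proof (cases "0 < y \<and> - T \<le> t \<and> y \<in> {a..b}")
    case True
    then have t: "- T \<le> t" and y: "0 < y" "y \<in> {a..b}" by auto
    have hE: "norm (ex t * h t y) \<le> gd w b t"
    proof -
     have "norm (ex t * h t y) \<le> gd w y t"
      unfolding ex_def by (rule exp_h_le[OF w]) (use 1 2 y p in auto)
     also have "\<dots> \<le> gd w b t"
      unfolding gd_def using y C0 \<alpha> by (intro add_right_mono mult_right_mono mult_left_mono powr_mono2) (auto simp: E1_def)
     finally show ?thesis .
    qed
    have n1: "1 \<le> real (Suc n)" by simp
    have sm: "norm (v / of_real (real (Suc n))) \<le> X" if "norm v \<le> X" for v :: complex
    proof -
     have "norm v / real (Suc n) \<le> norm v / 1" using n1 by (intro divide_left_mono) auto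
     then show ?thesis using that by (simp add: norm_divide del: of_nat_Suc)
    qed
    have c: "norm (c0 n t) \<le> X" "norm (c1 n t) \<le> X" "norm (c2 n t) \<le> X"
     unfolding c0_def c1_def c2_def by (intro X sm)+
    have "norm (c2 n t - 2 * w * c1 n t + w\<^sup>2 * c0 n t) \<le> X + 2 * norm w * X + (norm w)\<^sup>2 * X"
     using c by (intro norm_triangle_le add_mono norm_triangle_le_diff)
      (auto simp: norm_mult norm_power intro!: mult_left_mono)
    then have s1: "norm ((c2 n t - 2 * w * c1 n t + w\<^sup>2 * c0 n t) * PT y) \<le> (X + 2 * norm w * X + (norm w)\<^sup>2 * X) * B1"
     unfolding norm_mult using B1[rule_format, OF y(2)] y X(1) by (intro mult_mono) (auto simp: PT_def)
    have s2: "norm (c0 n t * PQ y) \<le> X * B2"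
     unfolding norm_mult using B2[rule_format, OF y(2)] y X(1) c by (intro mult_mono) (auto simp: PQ_def)
    have "I n p = (ex t * h t y) * ((c2 n t - 2 * w * c1 n t + w\<^sup>2 * c0 n t) * PT y + c0 n t * PQ y)"
     unfolding I_def p fst_conv snd_conv rho_late[OF t] by (simp only: distrib_left mult_ac)
    then have "norm (I n p) \<le> gd w b t * M"
     unfolding M_def using hE norm_triangle_mono[OF s1 s2] gd_nonneg by (simp only: norm_mult) (intro mult_mono; simp)
    also have "\<dots> \<le> D p" using y gd_nonneg by (auto simp: D_def p intro!: mult_left_mono)
    finally show ?thesis .
   next
    case False
    then have "I n p = 0" using 1 th0[of y] Q0[of y] by (auto simp: I_def p PT_def PQ_def indicator_def)
    then show ?thesis using gd_nonneg by (simp add: D_def)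
   qed
  qed
  have lim: "AE p in lborel2. (\<lambda>n. I n p) \<longlonglongrightarrow> L p"
   using h0
  proof eventually_elim
   fix p assume 1: "fst p < - T --> 0 < snd p --> h (fst p) (snd p) = 0"
   obtain t y where p: "p = (t, y)" by (cases p)
   show "(\<lambda>n. I n p) \<longlonglongrightarrow> L p"
   proof (cases "0 < y \<and> - T \<le> t")
    case True
    have "\<forall>\<^sub>F n in sequentially. nat \<lceil>\<bar>t\<bar>\<rceil> \<le> n" by (rule eventually_ge_at_top)
    then have "\<forall>\<^sub>F n in sequentially. I n p = L p"
    proof eventually_elim
     fix n assume "nat \<lceil>\<bar>t\<bar>\<rceil> \<le> n"
     then have "t < real (Suc n)" by linarith
     then have "t / real (Suc n) < 1" by (simp del: of_nat_Suc)
     then have c: "c0 n t = 1" "c1 n t = 0" "c2 n t = 0" by (simp_all add: c0_def c1_def c2_def cx_1 cx1_0 cx2_0 del: of_nat_Suc)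
     show "I n p = L p" unfolding I_def L_def p fst_conv snd_conv using rho_late[of t n] True by (simp add: c algebra_simps)
    qed
    then show ?thesis by (rule tendsto_eventually)
   next
    case False
    then have "I n p = 0" "L p = 0" for n using 1 by (auto simp: I_def L_def p PT_def PQ_def indicator_def)
    then show ?thesis by simp
   qed
  qed
  have Lint: "integrable (lborel2) L"
   by (rule integrable_dominated_convergence[OF Lm Im Dint lim dom])
  have "(\<lambda>n. \<integral>p. I n p \<partial>(lborel2)) \<longlonglongrightarrow> (\<integral>p. L p \<partial>(lborel2))"
   by (rule integral_dominated_convergence[OF Lm Im Dint lim dom])
  then have L0: "(\<integral>p. L p \<partial>(lborel2)) = 0" unfolding I0 by (simp add: LIMSEQ_const_iff)
  let ?L = "\<lambda>t y. L (t, y)"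
  have "integrable (lborel2) (case_prod ?L)" using Lint by (simp add: case_prod_beta')
  from lborel_pair.integral_snd[OF this] have "(\<integral>y. (\<integral>t. L (t, y) \<partial>lborel) \<partial>lborel) = 0"
   using L0 by (simp add: case_prod_beta')
  moreover have "(\<integral>t. L (t, y) \<partial>lborel) = indicator {0<..} y *\<^sub>R (Wt w y * of_real (y powr (1 - 2 * \<alpha>)) *
     ((zroot lam w)\<^sup>2 * \<theta> y - \<theta>2 y - ?q y * \<theta>1 y))" for y
  proof -
   have "(\<integral>t. L (t, y) \<partial>lborel) = (\<integral>t. ex t * h t y * (w\<^sup>2 * PT y + PQ y) \<partial>lborel)"
    by (rule Bochner_Integration.integral_cong) (auto simp: L_def mult_ac)
   also have "\<dots> = Wt w y * (w\<^sup>2 * PT y + PQ y)" by (simp add: Wt_def lap_def ex_def)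
   finally show ?thesis unfolding zroot_square[OF w(1)] zsq_def PT_def PQ_def P_def Q_def
    by (auto simp: indicator_def algebra_simps)
  qed
  ultimately show "(\<integral>y. indicator {0<..} y *\<^sub>R (Wt w y * of_real (y powr (1 - 2 * \<alpha>)) *
     ((zroot lam w)\<^sup>2 * \<theta> y - \<theta>2 y - ?q y * \<theta>1 y)) \<partial>lborel) = 0" by simp
 qed
 show ?thesis by (rule B.solution_unique)
qed

end

section \<open>The Dirichlet-to-Neumann limit of the inverse Laplace integral\<close>

lemma vector_derivative_cong_open:
 assumes "open S" "x \<in> S" "\<And>y. y \<in> S ==> f y = g y"
 shows "vector_derivative f (at x) = vector_derivative g (at x)"
proof -
 have "(f has_vector_derivative d) (at x) \<longleftrightarrow> (g has_vector_derivative d) (at x)" for d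
  using has_vector_derivative_transform_within_open[of f d x S g] has_vector_derivative_transform_within_open[of g d x S f] assms
  by auto
 then show ?thesis by (simp add: vector_derivative_def)
qed

lemma DN_iterate_cong:
 assumes "\<And>y. 0 < y ==> f y = g y" "0 < y"
 shows "((\<lambda>w z. (1 / z) *\<^sub>R ddt w z) ^^ k) f y = ((\<lambda>w z. (1 / z) *\<^sub>R ddt w z) ^^ k) g y"
 using assms(2)
proof (induction k arbitrary: y)
 case (Suc k)
 have "ddt (((\<lambda>w z. (1 / z) *\<^sub>R ddt w z) ^^ k) f) y = ddt (((\<lambda>w z. (1 / z) *\<^sub>R ddt w z) ^^ k) g) y"
  by (rule vector_derivative_cong_open[of "{0<..}"]) (use Suc in auto)
 then show ?case by simp
qed (use assms in simp)

context symbol_setup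
begin

lemma zl_pos: "0 < e ==> 0 < Re (zl e xi)"
 using Re_zl[of e xi] by simp

lemma Gprof_eq:
 assumes "0 < e"
 shows "lap (F 0) (Complex e xi) / bint \<alpha> (zl e xi) 0 * b = of_real (2 * pi) * (Gprof e xi * b)"
proof -
 have z: "zl e xi / 2 \<noteq> 0" using zl_pos[OF assms, of xi] by auto
 define X where "X = (zl e xi / 2) powr of_real \<alpha>"
 define g where "g = (of_real (Gamma \<alpha>) :: complex)"
 have nz: "X \<noteq> 0" "g \<noteq> 0" using z Gamma_real_pos[OF \<alpha>] by (auto simp: X_def g_def)
 have b: "bint \<alpha> (zl e xi) 0 = inverse X * g"
  by (subst bint_0[OF \<alpha> zl_pos[OF assms]]) (simp add: powr_minus X_def g_def)
 show ?thesis unfolding Gprof_def b X_def[symmetric] g_def[symmetric] using nz by (simp add: field_simps)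
qed

text \<open>This is where \<open>DN_const\<close> comes from. Its sign cancels the sign of
  \<open>m + 1\<close> differentiations, its Gamma values cancel those in the boundary values of
  orders \<open>\<alpha>\<close> and \<open>1 - a\<close>, and its power of two cancels those from
  \<open>z / 2\<close>. The exponents of \<open>z\<close> add up to
  \<open>(m + 1) + \<alpha> - (1 - a) = 2 \<alpha>\<close>.\<close>

lemma DN_symbol:
 assumes e: "0 < e"
 shows "of_real (DN_const \<alpha>) * ((-1) ^ (nat \<lfloor>\<alpha>\<rfloor> + 1) * (zl e xi ^ (nat \<lfloor>\<alpha>\<rfloor> + 1) * Gprof e xi * bint (1 - frac \<alpha>) (zl e xi) 0))
  = hsym0 \<alpha> lam F (Complex e xi) / of_real (2 * pi)"
proof -
 define m where "m = nat \<lfloor>\<alpha>\<rfloor>"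
 define a where "a = frac \<alpha>"
 have am: "\<alpha> = real m + a" using \<alpha> by (simp add: m_def a_def frac_def)
 have a1: "0 < 1 - a" using frac_lt_1[of \<alpha>] by (simp add: a_def)
 define z where "z = zl e xi"
 have zp: "0 < Re z" unfolding z_def by (rule zl_pos[OF e])
 have z0: "z \<noteq> 0" using zp by auto
 define g where "g = Gamma \<alpha>"
 define g1 where "g1 = Gamma (1 - a)"
 have g: "g \<noteq> 0" "g1 \<noteq> 0" using Gamma_real_pos[OF \<alpha>] Gamma_real_pos[OF a1] by (auto simp: g_def g1_def)
 have s: "((-1) ^ (m + 1) :: complex) * (-1) ^ (m + 1) = 1" by (simp flip: power_mult_distrib)
 have zz: "z ^ (m + 1) * z powr of_real \<alpha> * z powr of_real (- (1 - a)) = zsq lam (Complex e xi) powr of_real \<alpha>"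
 proof -
  have "z ^ (m + 1) = z powr of_real (real (m + 1))" using powr_complexpow[OF z0, of "m + 1"] by simp
  then have "z ^ (m + 1) * z powr of_real \<alpha> * z powr of_real (- (1 - a)) = z powr (of_real (real (m + 1)) + of_real \<alpha> + of_real (- (1 - a)))"
   by (simp only: powr_add)
  also have "of_real (real (m + 1)) + of_real \<alpha> + of_real (- (1 - a)) = (of_real (2 * \<alpha>) :: complex)"
   by (simp add: am)
  also have "z powr of_real (2 * \<alpha>) = zsq lam (Complex e xi) powr of_real \<alpha>"
   unfolding z_def using zroot_powr[of "Complex e xi" lam "2 * \<alpha>"] e by simp
  finally show ?thesis .
 qed
 have two: "(2::real) powr (\<alpha> + a - 1) * 2 powr (- \<alpha>) * 2 powr (1 - a) = 1" by (simp flip: powr_add)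
 have b: "bint (1 - a) z 0 = of_real (2 powr (1 - a)) * z powr of_real (- (1 - a)) * of_real g1"
  using half_powr[OF zp, of "- (1 - a)"] by (subst bint_0[OF a1 zp]) (simp add: g1_def)
 have G: "Gprof e xi = of_real (2 powr (- \<alpha>)) * z powr of_real \<alpha> / of_real g / of_real (2 * pi) * lap (F 0) (Complex e xi)"
  unfolding Gprof_def z_def[symmetric] half_powr[OF zp] g_def ..
 have D: "of_real (DN_const \<alpha>) = (-1) ^ (m + 1) * of_real (2 powr (\<alpha> + a - 1)) * of_real g / (of_real g1 :: complex)"
  by (simp add: DN_const_def m_def a_def g_def g1_def)
 let ?s = "(-1) ^ (m + 1) :: complex"
 have "of_real (DN_const \<alpha>) * (?s * (z ^ (m + 1) * Gprof e xi * bint (1 - a) z 0))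
   = (?s * ?s) * of_real (2 powr (\<alpha> + a - 1) * 2 powr (- \<alpha>) * 2 powr (1 - a)) * (z ^ (m + 1) * z powr of_real \<alpha> * z powr of_real (- (1 - a)))
    * lap (F 0) (Complex e xi) / of_real (2 * pi)"
  unfolding D G b of_real_mult using g by (simp add: field_simps del: power_Suc)
 also have "\<dots> = hsym0 \<alpha> lam F (Complex e xi) / of_real (2 * pi)"
  unfolding s two zz hsym0_def by simp
 finally show ?thesis by (simp only: m_def a_def z_def)
qed

lemma rapid_power: "0 < e ==> e \<le> 1 ==> rapid G ==> rapid (\<lambda>xi. zl e xi ^ k * G xi)"
proof (induction k)
 case (Suc k)
 then show ?case using rapid_zl[of e "\<lambda>xi. zl e xi ^ k * G xi"] by (simp add: mult.assoc)
qed simp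

text \<open>After \<open>m + 1\<close> applications of \<open>(1/y) d/dy\<close> the order is
  \<open>- (1 - frac \<alpha>)\<close>, negative, and the bounds uniform down to the boundary are
  lost. The weight \<open>y^(2 (1 - frac \<alpha>))\<close> is exactly what
  \<open>bint_reflect\<close> needs to pass to the positive order \<open>1 - frac \<alpha>\<close>,
  for which \<open>Vint_tendsto\<close> gives the limit.\<close>

lemma DN_quotient_Vint:
 assumes e: "0 < e" "e \<le> 1" and \<alpha>Z: "\<alpha> \<notin> \<int>"
 shows "(DN_quotient \<alpha> (Vint e \<alpha> (Gprof e) t) \<longlongrightarrow>
  (-1) ^ (nat \<lfloor>\<alpha>\<rfloor> + 1) * (\<integral>xi. exp (Complex e xi * of_real t) * (zl e xi ^ (nat \<lfloor>\<alpha>\<rfloor> + 1) * Gprof e xi * bint (1 - frac \<alpha>) (zl e xi) 0) \<partial>lborel)) (at_right 0)"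
proof -
 define m where "m = nat \<lfloor>\<alpha>\<rfloor>"
 define b where "b = 1 - frac \<alpha>"
 have b: "0 < b" using frac_lt_1[of \<alpha>] by (simp add: b_def)
 have am: "\<alpha> - real (m + 1) = - b" using \<alpha> by (simp add: m_def b_def frac_def)
 have q: "(-1) ^ (m + 1) * Vint e b (\<lambda>xi. zl e xi ^ (m + 1) * Gprof e xi) t y = DN_quotient \<alpha> (Vint e \<alpha> (Gprof e) t) y" if y: "0 < y" for y
 proof -
  have "of_real (y powr (2 * b)) * Vint e (- b) (\<lambda>xi. zl e xi ^ (m + 1) * Gprof e xi) t y = Vint e b (\<lambda>xi. zl e xi ^ (m + 1) * Gprof e xi) t y"
   unfolding Vint_def integral_mult_right_zero[symmetric] bint_reflect[OF y, symmetric, of b]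
   by (rule Bochner_Integration.integral_cong) (simp_all add: mult_ac)
  moreover have "DN_quotient \<alpha> (Vint e \<alpha> (Gprof e) t) y = (y powr (2 * b)) *\<^sub>R ((-1) ^ (m + 1) * Vint e (- b) (\<lambda>xi. zl e xi ^ (m + 1) * Gprof e xi) t y)"
   unfolding DN_quotient_def m_def[symmetric] b_def[symmetric] Vint_iterate[OF e rapid_Gprof[OF e] y] am ..
  ultimately show ?thesis by (simp add: scaleR_conv_of_real mult_ac del: power_Suc)
 qed
 have "((\<lambda>y. (-1) ^ (m + 1) * Vint e b (\<lambda>xi. zl e xi ^ (m + 1) * Gprof e xi) t y) \<longlongrightarrow>
   (-1) ^ (m + 1) * (\<integral>xi. exp (Complex e xi * of_real t) * (zl e xi ^ (m + 1) * Gprof e xi * bint b (zl e xi) 0) \<partial>lborel)) (at_right 0)"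
  by (intro tendsto_mult tendsto_const Vint_tendsto[OF e rapid_power[OF e rapid_Gprof[OF e]] b])
 then have "(DN_quotient \<alpha> (Vint e \<alpha> (Gprof e) t) \<longlongrightarrow>
   (-1) ^ (m + 1) * (\<integral>xi. exp (Complex e xi * of_real t) * (zl e xi ^ (m + 1) * Gprof e xi * bint b (zl e xi) 0) \<partial>lborel)) (at_right 0)"
  by (rule Lim_transform_eventually) (use q in \<open>auto simp: eventually_at_filter\<close>)
 then show ?thesis by (simp only: m_def b_def)
qed

end

section \<open>The mode as an inverse Laplace integral\<close>

context mode_problem
begin

lemma Wt_line_measurable: "(\<lambda>p. Wt (Complex e (fst p)) (snd p)) \<in> borel_measurable (lborel2)"
 unfolding Wt_def lap_def Complex_eq by measurable

lemma continuous_on_pair_measurable: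
 fixes g :: "real \<times> real => complex"
 assumes "continuous_on (UNIV \<times> {0<..}) g"
 shows "(\<lambda>p. indicator {0<..} (snd p) *\<^sub>R g p) \<in> borel_measurable (lborel2)"
proof -
 have "(\<lambda>p. indicator (UNIV \<times> {0<..}) p *\<^sub>R g p) \<in> borel_measurable borel"
  by (rule borel_measurable_continuous_on_indicator[OF _ assms]) (intro borel_open open_Times open_UNIV open_greaterThan)
 moreover have "indicator (UNIV \<times> {0<..}) p *\<^sub>R g p = indicator {0<..} (snd p) *\<^sub>R g p" for p
  by (cases p) (auto simp: indicator_def)
 ultimately show ?thesis by (simp add: lborel_prod)
qed

text \<open>For almost every fixed \<open>y\<close> the transform of \<open>h\<close> along the line
  is a rapidly decreasing multiple of the kernel, hence integrable. Fourier inversion of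
  \<open>exp (- e t) h\<close> then returns \<open>h\<close> itself.\<close>

lemma h_slice_eq:
 assumes e: "0 < e" "e \<le> 1"
 shows "AE y in lborel. AE t in lborel. 0 < y --> h t y = Vint e \<alpha> (Gprof e) t y"
proof -
 let ?K = "\<lambda>xi y. Gprof e xi * bint \<alpha> (zl e xi) y"
 have cG: "continuous_on UNIV (Gprof e)" using rapid_Gprof[OF e] by (simp add: rapid_def)
 have "continuous_on (UNIV \<times> {0<..}) (\<lambda>p. Gprof e (fst p) * (\<lambda>(xi, y). bint \<alpha> (zl e xi) y) p)"
  by (intro continuous_on_mult bint_line_continuous[OF e(1)] continuous_on_compose2[OF cG] continuous_on_fst continuous_on_id) auto
 then have "continuous_on (UNIV \<times> {0<..}) (\<lambda>p. ?K (fst p) (snd p))" by (simp add: split_beta)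
 from continuous_on_pair_measurable[OF this]
 have [measurable]: "(\<lambda>p. indicator {0<..} (snd p) *\<^sub>R ?K (fst p) (snd p)) \<in> borel_measurable (lborel2)" .
 note Wt_line_measurable[of e, measurable]
 \<comment> \<open>\<open>Wt_eq\<close> holds for each \<open>xi\<close> off a null set of
   \<open>y\<close> that depends on \<open>xi\<close>. As a jointly measurable function, which the
   indicators ensure, \<open>D\<close> allows the order of the two quantifiers to be
   exchanged.\<close>
 define D where "D = (\<lambda>p. indicator {0<..} (snd p) *\<^sub>R Wt (Complex e (fst p)) (snd p) - of_real (2 * pi) * (indicator {0<..} (snd p) *\<^sub>R ?K (fst p) (snd p)))"
 have [measurable]: "D \<in> borel_measurable (lborel2)" unfolding D_def by measurable
 have "AE y in lborel. D (xi, y) = 0" for xi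
  using Wt_eq[of "Complex e xi", unfolded complex.sel, OF e]
 proof eventually_elim
  case (elim y)
  then show ?case unfolding D_def Gprof_eq[OF e(1)] by (cases "0 < y") simp_all
 qed
 then have "AE xi in lborel. AE y in lborel. D (xi, y) = 0" by simp
 moreover have "{p \<in> space (lborel2). D (fst p, snd p) = 0} \<in> sets (lborel2)" by measurable
 ultimately have "AE y in lborel. AE xi in lborel. D (xi, y) = 0"
  using lborel_pair.AE_commute[of "\<lambda>xi y. D (xi, y) = 0"] by simp
 then show ?thesis
  using h_slice_int[of "of_real e", unfolded Re_complex_of_real, OF e]
 proof eventually_elim
  fix y assume ae: "AE xi in lborel. D (xi, y) = 0"
   and int: "0 < y --> integrable lborel (\<lambda>t. exp (- (of_real e * of_real t)) * h t y)"
  show "AE t in lborel. 0 < y --> h t y = Vint e \<alpha> (Gprof e) t y"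
  proof (cases "0 < y")
   case y: True
   let ?g = "\<lambda>t. exp (- (of_real e * of_real t)) * h t y"
   let ?gh = "\<lambda>xi. Wt (Complex e xi) y"
   have gi: "integrable lborel ?g" using int y by simp
   have ghm: "?gh \<in> borel_measurable borel" unfolding Wt_def lap_def Complex_eq by measurable
   have ae': "AE xi in lborel. ?gh xi = of_real (2 * pi) * ?K xi y"
    using ae by eventually_elim (use y in \<open>simp add: D_def\<close>)
   have Ki: "integrable lborel (\<lambda>xi. of_real (2 * pi) * ?K xi y)"
    using Vint_integrable[OF e(1) rapid_Gprof[OF e] y, of 0 \<alpha>] by (intro integrable_mult_right) simp
   have ghi: "integrable lborel ?gh"
    by (rule integrable_cong_AE_imp[OF Ki]) (use ghm ae' in \<open>auto elim: eventually_mono\<close>)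
   have ghd: "?gh xi = (\<integral>t. exp (- (\<i> * of_real (xi * t))) * ?g t \<partial>lborel)" for xi
    unfolding Wt_def lap_def
   proof (rule Bochner_Integration.integral_cong[OF refl])
    fix t
    have "exp (- (Complex e xi * of_real t)) = exp (- (\<i> * of_real (xi * t))) * exp (- (of_real e * of_real t))"
     unfolding exp_add[symmetric] by (rule arg_cong[where f = exp]) (simp add: Complex_eq algebra_simps)
    then show "exp (- (Complex e xi * of_real t)) * h t y = exp (- (\<i> * of_real (xi * t))) * ?g t" by simp
   qed
   have "AE t in lborel. ?g t = (\<integral>xi. eix (xi * t) * ?gh xi \<partial>lborel) / of_real (2 * pi)"
    by (rule fourier_inversion[OF gi ghi ghd])
   then show ?thesis
   proof eventually_elim
    fix t assume g: "?g t = (\<integral>xi. eix (xi * t) * ?gh xi \<partial>lborel) / of_real (2 * pi)"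
    have Km: "(\<lambda>xi. ?K xi y) \<in> borel_measurable borel"
     by (intro borel_measurable_continuous_onI continuous_on_mult cG bint_line_continuous1 e y)
    have "(\<integral>xi. eix (xi * t) * ?gh xi \<partial>lborel) = (\<integral>xi. of_real (2 * pi) * (eix (xi * t) * ?K xi y) \<partial>lborel)"
    proof (rule integral_cong_AE)
     show "AE xi in lborel. eix (xi * t) * ?gh xi = of_real (2 * pi) * (eix (xi * t) * ?K xi y)"
      using ae' by eventually_elim (simp add: mult_ac)
    qed (use ghm Km in measurable)
    then have 1: "?g t = (\<integral>xi. eix (xi * t) * ?K xi y \<partial>lborel)" using g by simp
    have "h t y = exp (of_real e * of_real t) * ?g t" by (simp add: mult.assoc[symmetric] flip: exp_add)
    also have "\<dots> = (\<integral>xi. exp (of_real e * of_real t) * (eix (xi * t) * ?K xi y) \<partial>lborel)" unfolding 1 by simp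
    also have "\<dots> = Vint e \<alpha> (Gprof e) t y"
     unfolding Vint_def
    proof (rule Bochner_Integration.integral_cong[OF refl])
     fix xi
     have "exp (Complex e xi * of_real t) = exp (of_real e * of_real t) * eix (xi * t)"
      unfolding exp_add[symmetric] by (rule arg_cong[where f = exp]) (simp add: Complex_eq algebra_simps)
     then show "exp (of_real e * of_real t) * (eix (xi * t) * ?K xi y) = exp (Complex e xi * of_real t) * ?K xi y" by (simp add: mult.assoc)
    qed
    finally show "0 < y --> h t y = Vint e \<alpha> (Gprof e) t y" by simp
   qed
  qed simp
 qed
qed

lemma h_eq_Vint:
 assumes e: "0 < e" "e \<le> 1"
 shows "AE p in lborel2. 0 < snd p --> h (fst p) (snd p) = Vint e \<alpha> (Gprof e) (fst p) (snd p)"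
proof -
 have "continuous_on (UNIV \<times> {0<..}) (\<lambda>p. Vint e \<alpha> (Gprof e) (fst p) (snd p))"
  using Vint_continuous[OF e rapid_Gprof[OF e], of \<alpha>] by (simp add: split_beta)
 from continuous_on_pair_measurable[OF this]
 have [measurable]: "(\<lambda>p. indicator {0<..} (snd p) *\<^sub>R Vint e \<alpha> (Gprof e) (fst p) (snd p)) \<in> borel_measurable (lborel2)" .
 define D where "D = (\<lambda>p. indicator {0<..} (snd p) *\<^sub>R h (fst p) (snd p) - indicator {0<..} (snd p) *\<^sub>R Vint e \<alpha> (Gprof e) (fst p) (snd p))"
 have [measurable]: "D \<in> borel_measurable (lborel2)" unfolding D_def by measurable
 have "AE y in lborel. AE t in lborel. D (t, y) = 0"
  using h_slice_eq[OF e] by (elim eventually_mono) (auto simp: D_def indicator_def elim: eventually_mono)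
 moreover have ms: "{p \<in> space (lborel2). D (fst p, snd p) = 0} \<in> sets (lborel2)" by measurable
 ultimately have "AE t in lborel. AE y in lborel. D (t, y) = 0"
  using lborel_pair.AE_commute[of "\<lambda>t y. D (t, y) = 0"] by simp
 moreover have "{p \<in> space (lborel2). D p = 0} \<in> sets (lborel2)" by measurable
 ultimately have "AE p in lborel2. D p = 0"
  by (intro lborel_pair.AE_pair_measure)
 then show ?thesis by eventually_elim (auto simp: D_def)
qed

text \<open>Both sides are continuous and agree with \<open>h\<close> almost everywhere. This
  replaces a shift of the contour.\<close>

lemma Vint_indep:
 assumes e: "0 < e" "e \<le> 1" and y: "0 < y"
 shows "Vint e \<alpha> (Gprof e) t y = Vint 1 \<alpha> (Gprof 1) t y"
proof -
 have op: "open (UNIV \<times> {0<..} :: (real \<times> real) set)" by (intro open_Times) auto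
 have "continuous_on (UNIV \<times> {0<..}) (\<lambda>p. Vint e \<alpha> (Gprof e) (fst p) (snd p) - Vint 1 \<alpha> (Gprof 1) (fst p) (snd p))"
  using Vint_continuous[OF e rapid_Gprof[OF e], of \<alpha>] Vint_continuous[of 1, OF _ _ rapid_Gprof[of 1], of \<alpha>]
  by (intro continuous_on_diff) (auto simp: split_beta)
 moreover have "AE p in lborel2. p \<in> UNIV \<times> {0<..} --> Vint e \<alpha> (Gprof e) (fst p) (snd p) - Vint 1 \<alpha> (Gprof 1) (fst p) (snd p) = 0"
  using h_eq_Vint[OF e] h_eq_Vint[OF zero_less_one order_refl] by eventually_elim auto
 ultimately show ?thesis using AE_zero_imp_zero[OF op, of _ "(t, y)"] y unfolding lborel_prod by fastforce
qed

lemma Vint_zero: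
 assumes t: "t < - T" and y: "0 < y"
 shows "Vint 1 \<alpha> (Gprof 1) t y = 0"
proof -
 have op: "open ({..<- T} \<times> {0<..} :: (real \<times> real) set)" by (intro open_Times) auto
 have "continuous_on ({..<- T} \<times> {0<..}) (\<lambda>p. Vint 1 \<alpha> (Gprof 1) (fst p) (snd p))"
  using continuous_on_subset[OF Vint_continuous[of 1, OF _ _ rapid_Gprof[of 1], of \<alpha>], of "{..<- T} \<times> {0<..}"]
  by (auto simp: split_beta)
 moreover have "AE p in lborel2. p \<in> {..<- T} \<times> {0<..} --> Vint 1 \<alpha> (Gprof 1) (fst p) (snd p) = 0"
  using h0 h_eq_Vint[OF zero_less_one order_refl] by eventually_elim auto
 ultimately show ?thesis using AE_zero_imp_zero[OF op, of _ "(t, y)"] t y unfolding lborel_prod by fastforce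
qed

text \<open>\<open>symbol_inverse\<close> needs one function represented on all lines
  \<open>0 < e \<le> 1\<close>. The line \<open>e = 1\<close> serves to define \<open>U\<close>; by
  \<open>Vint_indep\<close> the limit of its quotient can be computed on any other line.\<close>

theorem mode_solution:
 assumes \<alpha>Z: "\<alpha> \<notin> \<int>"
 shows "\<exists>U. continuous_on (UNIV \<times> {0<..}) (\<lambda>(t, y). U t y) \<and>
  (AE p in lborel2. 0 < snd p --> U (fst p) (snd p) = h (fst p) (snd p)) \<and>
  (\<forall>t k. Ck_on k (U t) {0<..}) \<and>
  (\<forall>t. \<exists>l. (DN_quotient \<alpha> (U t) \<longlongrightarrow> l) (at_right 0)) \<and>
  integrable lborel (\<lambda>t. DN_const \<alpha> *\<^sub>R Lim (at_right 0) (DN_quotient \<alpha> (U t))) \<and>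
  (\<forall>xi. fourier (\<lambda>t. DN_const \<alpha> *\<^sub>R Lim (at_right 0) (DN_quotient \<alpha> (U t))) xi = wave_symbol \<alpha> xi lam * fourier (F 0) xi)"
proof -
 define U where "U = Vint 1 \<alpha> (Gprof 1)"
 define m where "m = nat \<lfloor>\<alpha>\<rfloor> + 1"
 define l where "l = (\<lambda>e t. (-1) ^ m * (\<integral>xi. exp (Complex e xi * of_real t) * (zl e xi ^ m * Gprof e xi * bint (1 - frac \<alpha>) (zl e xi) 0) \<partial>lborel))"
 have lim: "(DN_quotient \<alpha> (U t) \<longlongrightarrow> l e t) (at_right 0)" if e: "0 < e" "e \<le> 1" for e t
 proof (rule Lim_transform_eventually)
  show "(DN_quotient \<alpha> (Vint e \<alpha> (Gprof e) t) \<longlongrightarrow> l e t) (at_right 0)"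
   using DN_quotient_Vint[OF e \<alpha>Z, of t] unfolding l_def m_def .
  have "DN_quotient \<alpha> (Vint e \<alpha> (Gprof e) t) y = DN_quotient \<alpha> (U t) y" if "0 < y" for y
   unfolding DN_quotient_def U_def by (subst DN_iterate_cong[OF Vint_indep[OF e] that]) auto
  then show "\<forall>\<^sub>F y in at_right 0. DN_quotient \<alpha> (Vint e \<alpha> (Gprof e) t) y = DN_quotient \<alpha> (U t) y"
   by (auto simp: eventually_at_filter)
 qed
 define G where "G = (\<lambda>t. DN_const \<alpha> *\<^sub>R Lim (at_right 0) (DN_quotient \<alpha> (U t)))"
 have Gl: "G t = of_real (DN_const \<alpha>) * l e t" if "0 < e" "e \<le> 1" for e t
  unfolding G_def using tendsto_Lim[OF trivial_limit_at_right_real lim[OF that]] by (simp add: scaleR_conv_of_real)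
 have Geq: "G t = (\<integral>xi. exp (Complex e xi * of_real t) * hsym0 \<alpha> lam F (Complex e xi) \<partial>lborel) / of_real (2 * pi)"
  if e: "0 < e" "e \<le> 1" for e t
 proof -
  have "G t = (\<integral>xi. of_real (DN_const \<alpha>) * ((-1) ^ m * (exp (Complex e xi * of_real t) * (zl e xi ^ m * Gprof e xi * bint (1 - frac \<alpha>) (zl e xi) 0))) \<partial>lborel)"
   unfolding Gl[OF e] l_def by simp
  also have "\<dots> = (\<integral>xi. exp (Complex e xi * of_real t) * (hsym0 \<alpha> lam F (Complex e xi) / of_real (2 * pi)) \<partial>lborel)"
  proof (rule Bochner_Integration.integral_cong[OF refl])
   fix xi
   show "of_real (DN_const \<alpha>) * ((-1) ^ m * (exp (Complex e xi * of_real t) * (zl e xi ^ m * Gprof e xi * bint (1 - frac \<alpha>) (zl e xi) 0)))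
    = exp (Complex e xi * of_real t) * (hsym0 \<alpha> lam F (Complex e xi) / of_real (2 * pi))"
    unfolding DN_symbol[OF e(1), symmetric] m_def by (simp only: mult_ac)
  qed
  finally show ?thesis by simp
 qed
 have G0: "G t = 0" if "t < - T" for t
 proof -
  have "DN_quotient \<alpha> (U t) y = DN_quotient \<alpha> (\<lambda>_. 0) y" if "0 < y" for y
   unfolding DN_quotient_def U_def by (subst DN_iterate_cong[OF Vint_zero[OF \<open>t < - T\<close>] that]) auto
  moreover have "((\<lambda>w z. (1 / z) *\<^sub>R ddt w z) ^^ k) (\<lambda>_. 0 :: complex) = (\<lambda>_. 0)" for k
   by (induction k) simp_all
  ultimately have "\<forall>\<^sub>F y in at_right 0. 0 = DN_quotient \<alpha> (U t) y"
   by (auto simp: eventually_at_filter DN_quotient_def)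
  then have "(DN_quotient \<alpha> (U t) \<longlongrightarrow> 0) (at_right 0)" by (rule Lim_transform_eventually[OF tendsto_const])
  then show ?thesis unfolding G_def using tendsto_Lim[OF trivial_limit_at_right_real] by force
 qed
 have "continuous_on (UNIV \<times> {0<..}) (\<lambda>(t, y). U t y)"
  unfolding U_def by (rule Vint_continuous) (auto intro: rapid_Gprof)
 moreover have "AE p in lborel2. 0 < snd p --> U (fst p) (snd p) = h (fst p) (snd p)"
  unfolding U_def using h_eq_Vint[of 1] by (auto elim: eventually_mono)
 moreover have "\<forall>t k. Ck_on k (U t) {0<..}"
  unfolding U_def using Vint_Ck[of 1, OF _ _ rapid_Gprof[of 1], of _ \<alpha>] by simp
 moreover have "\<forall>t. \<exists>l. (DN_quotient \<alpha> (U t) \<longlongrightarrow> l) (at_right 0)" using lim[of 1] by fastforce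
 moreover have "integrable lborel G" by (rule symbol_inverse(1)[OF Geq G0])
 moreover have "\<forall>xi. fourier G xi = wave_symbol \<alpha> xi lam * fourier (F 0) xi"
  using symbol_inverse(2)[OF Geq G0] by blast
 ultimately show ?thesis unfolding G_def by blast
qed

end

section \<open>Analysis on a compact Riemannian manifold\<close>

lemma smooth_on_frechet_derivative: "smooth_on f S ==> smooth_on (\<lambda>x. frechet_derivative f (at x) v) S"
 unfolding smooth_on_def using Ck_on.simps(2) by blast

lemma smooth_on_has_derivative: "smooth_on f S ==> x \<in> S ==> (f has_derivative frechet_derivative f (at x)) (at x)"
 unfolding smooth_on_def using Ck_on_SucD[of 0] by blast

lemma positive_definite_invertible:
 fixes G :: "real^'d::finite^'d"
 assumes "\<And>\<xi>. \<xi> \<noteq> 0 ==> 0 < \<xi> \<bullet> (G *v \<xi>)"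
 shows "invertible G"
 unfolding invertible_left_inverse matrix_left_invertible_ker using assms by force

lemma matrix_inv_right: "invertible G ==> G ** matrix_inv G = mat 1" for G :: "real^'d::finite^'d"
 unfolding invertible_def matrix_inv_def by (erule someI2_ex) blast

text \<open>Applied to \<open>xi = G eta\<close>, the inverse has the quadratic form
  \<open>(G eta) . eta\<close>. For complex entries the form splits into the forms of the real and
  imaginary parts, the cross terms being imaginary. It lets the tangential part of the energy be
  dropped.\<close>

lemma positive_definite_inverse_nonneg:
 fixes G :: "real^'d::finite^'d"
 assumes pos: "\<And>\<xi>. \<xi> \<noteq> 0 ==> 0 < \<xi> \<bullet> (G *v \<xi>)"
 shows "0 \<le> Re (\<Sum>a\<in>UNIV. \<Sum>b\<in>UNIV. (matrix_inv G $ a $ b) *\<^sub>R (x a * cnj (x b)))"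
proof -
 have q: "0 \<le> \<xi> \<bullet> (matrix_inv G *v \<xi>)" for \<xi>
 proof -
  have "G *v (matrix_inv G *v \<xi>) = \<xi>"
   using matrix_inv_right[OF positive_definite_invertible[OF pos]] by (simp add: matrix_vector_mul_assoc)
  then show ?thesis using pos[of "matrix_inv G *v \<xi>"] by (cases "matrix_inv G *v \<xi> = 0") (auto simp: inner_commute)
 qed
 have "Re (\<Sum>a\<in>UNIV. \<Sum>b\<in>UNIV. (matrix_inv G $ a $ b) *\<^sub>R (x a * cnj (x b)))
  = (\<chi> a. Re (x a)) \<bullet> (matrix_inv G *v (\<chi> a. Re (x a))) + (\<chi> a. Im (x a)) \<bullet> (matrix_inv G *v (\<chi> a. Im (x a)))"
  by (simp add: inner_vec_def matrix_vector_mult_def sum_distrib_left algebra_simps flip: sum.distrib)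
 then show ?thesis using q by simp
qed

locale riemann =
 fixes A :: "('m::{t2_space, second_countable_topology}, 'd::finite) chart set"
  and g :: "('m, 'd) metric" and V :: "'m measure"
 assumes mfd: "compact_riemannian_manifold A g" and vol: "riemannian_volume A g V"
begin

lemma sets_V [measurable_cong]: "sets V = sets borel" using vol by (simp add: riemannian_volume_def)

lemma space_V [simp]: "space V = UNIV" using sets_eq_imp_space_eq[OF sets_V] by simp

lemma chart_at: "chart_at A x \<in> A" "x \<in> cdom (chart_at A x)"
proof -
 have "(\<Union>k\<in>A. cdom k) = UNIV" using mfd by (simp add: compact_riemannian_manifold_def smooth_atlas_def)
 then have "\<exists>k. k \<in> A \<and> x \<in> cdom k" by auto
 from someI_ex[OF this] show "chart_at A x \<in> A" "x \<in> cdom (chart_at A x)" by (auto simp: chart_at_def)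
qed

lemma compact_M: "compact (UNIV :: 'm set)" using mfd by (simp add: compact_riemannian_manifold_def)

lemma chart:
 assumes "k \<in> A"
 shows "open (cdom k)" "open (coord k ` cdom k)" "continuous_on (cdom k) (coord k)"
  "x \<in> cdom k ==> param k (coord k x) = x"
 using mfd assms by (auto simp: compact_riemannian_manifold_def smooth_atlas_def homeomorphism_def)

lemma UN_chart: "(\<Union>k\<in>A. S \<times> cdom k) = S \<times> UNIV"
 using chart_at by auto

lemma metric_smooth: "k \<in> A ==> smooth_on (\<lambda>p. g k p $ a $ b) (coord k ` cdom k)"
 using mfd by (simp add: compact_riemannian_manifold_def riemannian_metric_def)

lemma metric_pos: "k \<in> A ==> p \<in> coord k ` cdom k ==> \<xi> \<noteq> 0 ==> 0 < \<xi> \<bullet> (g k p *v \<xi>)"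
 using mfd unfolding compact_riemannian_manifold_def riemannian_metric_def by blast

text \<open>The density \<open>sqrt (det g)\<close> is bounded on a closed coordinate ball around
  each point, so small neighbourhoods have finite volume, and compactness leaves finitely many of
  them.\<close>

lemma finite_volume: "emeasure V UNIV < \<infinity>"
proof -
 have "\<exists>B. open B \<and> x \<in> B \<and> emeasure V B < \<infinity>" for x
 proof -
  define k where "k = chart_at A x"
  have k: "k \<in> A" "x \<in> cdom k" using chart_at unfolding k_def by auto
  obtain r where r: "0 < r" "cball (coord k x) r \<subseteq> coord k ` cdom k"
   using chart(2)[OF k(1)] k(2) by (meson imageI open_contains_cball)
  define B where "B = coord k -` ball (coord k x) r \<inter> cdom k"
  have oB: "open B" unfolding B_def
   using continuous_on_open_vimage[OF chart(1)[OF k(1)]] chart(3)[OF k(1)] by blast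
  have "continuous_on (coord k ` cdom k) (\<lambda>p. g k p $ a $ b)" for a b
   using smooth_on_continuous[OF metric_smooth[OF k(1)]] .
  then have gc: "continuous_on (cball (coord k x) r) (\<lambda>p. g k p $ a $ b)" for a b
   using r(2) continuous_on_subset by blast
  have "continuous_on (cball (coord k x) r) (\<lambda>p. sqrt (det (g k p)))"
   unfolding det_def
   by (intro continuous_on_real_sqrt continuous_on_sum continuous_on_prod continuous_on_mult continuous_on_const gc)
  then have "compact ((\<lambda>p. sqrt (det (g k p))) ` cball (coord k x) r)"
   by (intro compact_continuous_image compact_cball)
  from compact_imp_bounded[OF this] obtain D where D0: "\<forall>z\<in>(\<lambda>p. sqrt (det (g k p))) ` cball (coord k x) r. norm z \<le> D"
   unfolding bounded_iff by blast
  then have D: "\<bar>sqrt (det (g k p))\<bar> \<le> D" if "p \<in> cball (coord k x) r" for p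
   using bspec[OF D0 imageI[OF that]] by simp
  have "B \<in> sets borel" "B \<subseteq> cdom k" using oB by (auto simp: B_def)
  then have "emeasure V B = (\<integral>\<^sup>+p. ennreal (sqrt (det (g k p))) * indicator (coord k ` B) p \<partial>lborel)"
   using vol k(1) unfolding riemannian_volume_def by blast
  also have "\<dots> \<le> (\<integral>\<^sup>+p. ennreal D * indicator (ball (coord k x) r) p \<partial>lborel)"
  proof (rule nn_integral_mono)
   fix p
   show "ennreal (sqrt (det (g k p))) * indicator (coord k ` B) p \<le> ennreal D * indicator (ball (coord k x) r) p"
   proof (cases "p \<in> coord k ` B")
    case True
    then have "p \<in> ball (coord k x) r" by (auto simp: B_def)
    then show ?thesis using True D[of p] by (auto intro!: ennreal_leI)
   qed simp
  qed
  also have "\<dots> = ennreal D * emeasure lborel (ball (coord k x) r)" by (rule nn_integral_cmult_indicator) simp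
  also have "\<dots> < \<infinity>" using emeasure_lborel_ball_finite[of "coord k x" r] by (simp add: ennreal_mult_less_top)
  finally show ?thesis using oB k r(1) by (intro exI[of _ B]) (auto simp: B_def)
 qed
 then obtain B where B: "\<And>x. open (B x)" "\<And>x. x \<in> B x" "\<And>x. emeasure V (B x) < \<infinity>" by metis
 obtain I where I: "finite I" "UNIV \<subseteq> (\<Union>x\<in>I. B x)"
 proof (rule compactE_image[OF compact_M])
  show "open (B x)" if "x \<in> UNIV" for x using B by blast
  show "UNIV \<subseteq> \<Union>(range B)" using B by auto
 qed blast
 have "emeasure V UNIV \<le> emeasure V (\<Union>x\<in>I. B x)" using I B by (intro emeasure_mono) (auto simp: sets_V)
 also have "\<dots> \<le> (\<Sum>x\<in>I. emeasure V (B x))" using I B by (intro emeasure_subadditive_finite) (auto simp: sets_V)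
 also have "\<dots> < \<infinity>" using I(1) B(3) by (simp add: ennreal_sum_less_top less_top[symmetric])
 finally show ?thesis .
qed

sublocale V: finite_measure V
 using finite_volume by (intro finite_measureI) auto

sublocale LV: pair_sigma_finite lborel V ..

lemma sets_lborel_V: "sets (lborel \<Otimes>\<^sub>M V) = sets borel"
proof -
 have "sets (lborel \<Otimes>\<^sub>M V) = sets (borel \<Otimes>\<^sub>M borel)" by (rule sets_pair_measure_cong) (auto simp: sets_V)
 then show ?thesis by (simp only: borel_prod)
qed

lemma continuous_on_M:
 assumes "\<And>k. k \<in> A ==> continuous_on (coord k ` cdom k) (h \<circ> param k)"
 shows "continuous_on UNIV h"
proof -
 have "continuous_on (\<Union>k\<in>A. cdom k) h"
 proof (rule continuous_on_open_UN)
  fix k assume k: "k \<in> A"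
  have "continuous_on (cdom k) (\<lambda>x. (h \<circ> param k) (coord k x))"
   by (rule continuous_on_compose2[OF assms[OF k] chart(3)[OF k]]) auto
  then show "continuous_on (cdom k) h" by (rule continuous_on_eq) (simp add: chart(4)[OF k])
 qed (rule chart(1))
 moreover have "(\<Union>k\<in>A. cdom k) = UNIV" using chart_at by auto
 ultimately show ?thesis by simp
qed

lemma continuous_bounded:
 fixes h :: "'m => 'b::real_normed_vector"
 assumes "continuous_on UNIV h"
 obtains B where "0 \<le> B" "\<And>x. norm (h x) \<le> B"
proof -
 have "bounded (range h)" using compact_imp_bounded[OF compact_continuous_image[OF assms compact_M]] .
 then obtain B where "\<And>x. norm (h x) \<le> B" unfolding bounded_iff by auto
 then show ?thesis using that[of "max B 0"] by (meson le_max_iff_disj max.cobounded2)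
qed

lemma smooth_mfd_continuous:
 assumes S: "open S" and F: "smooth_mfd A S F"
 shows "continuous_on (S \<times> UNIV) (\<lambda>(p, x). F p x)"
proof -
 have "continuous_on (\<Union>k\<in>A. S \<times> cdom k) (\<lambda>(p, x). F p x)"
 proof (rule continuous_on_open_UN)
  fix k assume k: "k \<in> A"
  show "open (S \<times> cdom k)" using S chart(1)[OF k] by (rule open_Times)
  have c: "continuous_on (S \<times> coord k ` cdom k) (\<lambda>(p, q). F p (param k q))"
   using F k by (auto simp: smooth_mfd_def intro: smooth_on_continuous)
  have "continuous_on (S \<times> cdom k) (\<lambda>z. (fst z, coord k (snd z)))"
   by (intro continuous_on_Pair continuous_on_fst continuous_on_id continuous_on_compose2[OF chart(3)[OF k] continuous_on_snd]) auto
  from continuous_on_compose2[OF c this]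
  have "continuous_on (S \<times> cdom k) (\<lambda>z. F (fst z) (param k (coord k (snd z))))" by (force simp: split_beta)
  then show "continuous_on (S \<times> cdom k) (\<lambda>(p, x). F p x)" by (rule continuous_on_eq) (auto simp: chart(4)[OF k])
 qed
 then show ?thesis by (simp only: UN_chart)
qed

text \<open>In a chart the derivative in the scalar variable is the Frechet derivative in the
  direction \<open>(1, 0)\<close>, which is again jointly smooth.\<close>

lemma smooth_mfd_line:
 fixes F :: "real => 'm => complex"
 assumes S: "open S" and F: "smooth_mfd A S F"
 shows "smooth_mfd A S (\<lambda>s x. ddt (\<lambda>r. F r x) s)"
  and "s \<in> S ==> ((\<lambda>r. F r x) has_vector_derivative ddt (\<lambda>r. F r x) s) (at s)"
proof -
 have d: "((\<lambda>r. F r (param k q)) has_vector_derivative frechet_derivative (\<lambda>(p, q). F p (param k q)) (at (s, q)) (1, 0)) (at s)"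
  if k: "k \<in> A" and s: "s \<in> S" and q: "q \<in> coord k ` cdom k" for k s q
 proof -
  let ?G = "\<lambda>(p, q). F p (param k q)"
  have "smooth_on ?G (S \<times> coord k ` cdom k)" using F k by (auto simp: smooth_mfd_def)
  from smooth_on_has_derivative[OF this, of "(s, q)"] s q
  have G: "(?G has_derivative frechet_derivative ?G (at (s, q))) (at (s, q))" by auto
  have "((\<lambda>r. (r, q)) has_derivative (\<lambda>h. (h, 0))) (at s)" by (auto intro!: derivative_eq_intros)
  from has_derivative_compose[OF this G] have "((\<lambda>r. F r (param k q)) has_derivative (\<lambda>h. frechet_derivative ?G (at (s, q)) (h, 0))) (at s)" by simp
  moreover have "(\<lambda>h. frechet_derivative ?G (at (s, q)) (h, 0)) = (\<lambda>h. h *\<^sub>R frechet_derivative ?G (at (s, q)) (1, 0))"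
  proof
   show "frechet_derivative ?G (at (s, q)) (h, 0) = h *\<^sub>R frechet_derivative ?G (at (s, q)) (1, 0)" for h
    using linear_scale[OF has_derivative_linear[OF G], of h "(1, 0)"] by simp
  qed
  ultimately show ?thesis unfolding has_vector_derivative_def by (simp only:)
 qed
 show "smooth_mfd A S (\<lambda>s x. ddt (\<lambda>r. F r x) s)"
  unfolding smooth_mfd_def
 proof
  fix k assume k: "k \<in> A"
  have "smooth_on (\<lambda>z. frechet_derivative (\<lambda>(p, q). F p (param k q)) (at z) (1, 0)) (S \<times> coord k ` cdom k)"
   by (rule smooth_on_frechet_derivative) (use F k in \<open>auto simp: smooth_mfd_def\<close>)
  then show "smooth_on (\<lambda>(s, q). ddt (\<lambda>r. F r (param k q)) s) (S \<times> coord k ` cdom k)"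
   by (rule smooth_on_cong[rotated 2]) (auto simp: vector_derivative_at[OF d[OF k]] intro!: open_Times S chart(2)[OF k])
 qed
 assume s: "s \<in> S"
 let ?k = "chart_at A x"
 have "((\<lambda>r. F r (param ?k (coord ?k x))) has_vector_derivative frechet_derivative (\<lambda>(p, q). F p (param ?k q)) (at (s, coord ?k x)) (1, 0)) (at s)"
  by (rule d[OF chart_at(1) s imageI[OF chart_at(2)]])
 then have "((\<lambda>r. F r x) has_vector_derivative frechet_derivative (\<lambda>(p, q). F p (param ?k q)) (at (s, coord ?k x)) (1, 0)) (at s)"
  by (simp only: chart(4)[OF chart_at(1) chart_at(2)])
 with vector_derivative_at[OF this] show "((\<lambda>r. F r x) has_vector_derivative ddt (\<lambda>r. F r x) s) (at s)" by simp
qed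

lemma grad_sq_nonneg: "0 \<le> grad_sq A g h x"
 unfolding grad_sq_def Let_def
 by (rule positive_definite_inverse_nonneg) (rule metric_pos[OF chart_at(1) imageI[OF chart_at(2)]])

lemma test_time_support:
 fixes f :: "real => 'm => complex"
 assumes "test_mfd A UNIV f"
 obtains T where "0 < T" "\<And>t x. T < \<bar>t\<bar> ==> f t x = 0"
proof -
 obtain K where K: "compact K" "\<And>p x. (p, x) \<notin> K ==> f p x = 0" using assms unfolding test_mfd_def by blast
 have "bounded (fst ` K)" by (intro compact_imp_bounded compact_continuous_image K continuous_on_fst continuous_on_id)
 then obtain T where T: "\<And>t. t \<in> fst ` K ==> \<bar>t\<bar> \<le> T" unfolding bounded_iff by auto
 have "f t x = 0" if "max T 1 < \<bar>t\<bar>" for t x using T[of t] K(2)[of t x] that by force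
 then show ?thesis using that[of "max T 1"] by auto
qed

lemma zero_ddt:
 fixes f :: "real => 'b::real_normed_vector"
 assumes "open S" "t \<in> S" "\<And>s. s \<in> S ==> f s = 0"
 shows "ddt f t = 0"
 using vector_derivative_cong_open[of S t f "\<lambda>_. 0"] assms by simp

lemma smooth_mfd_time_bounded:
 fixes f :: "real => 'm => complex"
 assumes f: "smooth_mfd A UNIV f" and T: "\<And>t x. T < \<bar>t\<bar> ==> f t x = 0"
 obtains B where "0 \<le> B" "\<And>t x. norm (f t x) \<le> B"
proof -
 have "compact ((\<lambda>(p, x). f p x) ` ({-T..T} \<times> UNIV))"
  by (intro compact_continuous_image compact_Times compact_M compact_Icc
    continuous_on_subset[OF smooth_mfd_continuous[OF open_UNIV f]]) auto
 from compact_imp_bounded[OF this] obtain B where B: "\<forall>z\<in>(\<lambda>(p, x). f p x) ` ({-T..T} \<times> UNIV). norm z \<le> B"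
  unfolding bounded_iff by blast
 have "norm (f t x) \<le> max B 0" for t x
 proof (cases "T < \<bar>t\<bar>")
  case False
  then have "f t x \<in> (\<lambda>(p, x). f p x) ` ({-T..T} \<times> UNIV)" by (intro image_eqI[of _ _ "(t, x)"]) auto
  with B have "norm (f t x) \<le> B" by (rule bspec)
  then show ?thesis by simp
 qed (use T in auto)
 then show ?thesis using that[of "max B 0"] by auto
qed

text \<open>Compactness of the manifold and of the time support bounds every time derivative, so
  constants dominate the differentiation under the integral over \<open>V\<close>.\<close>

lemma mode_test_seq:
 fixes f :: "real => 'm => complex"
 assumes f: "test_mfd A UNIV f" and T: "0 < T" "\<And>t x. T < \<bar>t\<bar> ==> f t x = 0"
  and Y: "continuous_on UNIV (Y j)"
 shows "test_seq (\<lambda>k t. mode_coeff V Y j (((\<lambda>f s x. ddt (\<lambda>r. f r x) s) ^^ k) f t)) T"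
proof -
 define D where "D = (\<lambda>(f :: real => 'm => complex) s x. ddt (\<lambda>r. f r x) s)"
 have D: "smooth_mfd A UNIV ((D ^^ k) f) \<and> (\<forall>t x. T < \<bar>t\<bar> --> (D ^^ k) f t x = 0)" for k
 proof (induction k)
  case (Suc k)
  have "smooth_mfd A UNIV ((D ^^ Suc k) f)" using smooth_mfd_line(1)[OF open_UNIV] Suc by (simp add: D_def)
  moreover have "(D ^^ Suc k) f t x = 0" if "T < \<bar>t\<bar>" for t x
  proof -
   have o: "open {s :: real. T < \<bar>s\<bar>}" by (intro open_Collect_less continuous_intros)
   have "ddt (\<lambda>r. (D ^^ k) f r x) t = 0"
    by (rule zero_ddt[OF o]) (use Suc that in auto)
   then show ?thesis by (simp add: D_def)
  qed
  ultimately show ?case by blast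
 qed (use f T in \<open>simp add: test_mfd_def\<close>)
 obtain BY where BY: "0 \<le> BY" "\<And>x. norm (Y j x) \<le> BY" using continuous_bounded[OF Y] by blast
 have cont: "continuous_on UNIV ((D ^^ k) f t)" for k t
 proof -
  have c: "continuous_on (UNIV \<times> UNIV) (\<lambda>(p, x). (D ^^ k) f p x)" using smooth_mfd_continuous[OF open_UNIV] D by blast
  have "continuous_on UNIV (\<lambda>x. (t, x :: 'm))" by (intro continuous_intros)
  from continuous_on_compose2[OF c this] show ?thesis by auto
 qed
 have meas: "(\<lambda>x. (D ^^ k) f t x * cnj (Y j x)) \<in> borel_measurable V" for k t
  by (subst measurable_cong_sets[OF sets_V refl], intro borel_measurable_continuous_onI continuous_intros cont Y)
 have der: "((\<lambda>t. mode_coeff V Y j ((D ^^ k) f t)) has_vector_derivative mode_coeff V Y j ((D ^^ Suc k) f t)) (at t)" for k t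
 proof -
  obtain B0 where B0: "0 \<le> B0" "\<And>t x. norm ((D ^^ k) f t x) \<le> B0" using smooth_mfd_time_bounded[of "(D ^^ k) f" T] D by blast
  obtain B1 where B1: "0 \<le> B1" "\<And>t x. norm ((D ^^ Suc k) f t x) \<le> B1" using smooth_mfd_time_bounded[of "(D ^^ Suc k) f" T] D by blast
  show ?thesis
   unfolding mode_coeff_def
  proof (rule has_vector_derivative_integral[where S = UNIV and g = "\<lambda>_. B1 * BY"])
   show "integrable V (\<lambda>x. (D ^^ k) f t x * cnj (Y j x))" for t
    by (rule V.integrable_const_bound[of _ "B0 * BY"]) (use B0 BY meas in \<open>auto simp: norm_mult intro!: mult_mono\<close>)
   show "((\<lambda>t. (D ^^ k) f t x * cnj (Y j x)) has_vector_derivative (D ^^ Suc k) f t x * cnj (Y j x)) (at t)" for t x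
    using smooth_mfd_line(2)[OF open_UNIV, of "(D ^^ k) f" t x] D
    by (intro has_vector_derivative_mult_left) (auto simp: D_def)
   show "norm ((D ^^ Suc k) f t x * cnj (Y j x)) \<le> B1 * BY" for t x
    using B1 BY by (auto simp: norm_mult simp del: funpow.simps intro!: mult_mono)
  qed (auto intro: meas simp del: funpow.simps)
 qed
 show ?thesis
  unfolding test_seq_def D_def[symmetric]
 proof (intro conjI allI impI)
  show "mode_coeff V Y j ((D ^^ k) f t) = 0" if "T < \<bar>t\<bar>" for k t using D that by (simp add: mode_coeff_def)
 qed (rule T(1) der)+
qed

text \<open>The set \<open>T < |t|\<close> is open, so time derivatives vanish on it as well, and
  there the Laplacian is applied to the zero function.\<close>

lemma wave_iterate_zero:
 assumes T: "\<And>t x. T < \<bar>t\<bar> ==> f t x = 0" and t: "T < \<bar>t\<bar>"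
 shows "(wave_op A g ^^ i) f t x = 0"
 using t
proof (induction i arbitrary: t x)
 case (Suc i)
 let ?W = "(wave_op A g ^^ i) f"
 have o: "open {s :: real. T < \<bar>s\<bar>}" by (intro open_Collect_less continuous_intros)
 have "ddt (\<lambda>s. ?W s x) r = 0" if "T < \<bar>r\<bar>" for r by (rule zero_ddt[OF o]) (use Suc that in auto)
 then have "ddt (ddt (\<lambda>s. ?W s x)) t = 0" by (rule zero_ddt[OF o, rotated]) (use Suc.prems in auto)
 moreover have "laplace A g (?W t) x = 0"
 proof -
  have "?W t = (\<lambda>_. 0)" using Suc by auto
  then show ?thesis by (simp add: laplace_def laplace_coord_def pd_def o_def Let_def)
 qed
 ultimately show ?case using wave_op_def[of A g ?W t x] by simp
qed (use T in simp)

end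

section \<open>Energy bounds on slices of fixed height\<close>

lemma weighted_am_gm:
 fixes n z c :: real
 assumes "0 < z" "0 < c"
 shows "n \<le> c / 2 * (z powr (1 - 2 * \<alpha>) * n\<^sup>2) + 1 / (2 * c) * z powr (2 * \<alpha> - 1)"
proof -
 define q where "q = z powr (1 - 2 * \<alpha>)"
 have q: "0 < q" using assms by (simp add: q_def)
 have "z powr (2 * \<alpha> - 1) = z powr - (1 - 2 * \<alpha>)" by simp
 then have e: "z powr (2 * \<alpha> - 1) = 1 / q" unfolding q_def by (simp only: powr_minus_divide)
 have "0 \<le> (c * q * n - 1)\<^sup>2 / (2 * c * q)" using assms q by simp
 also have "\<dots> = c / 2 * (q * n\<^sup>2) + 1 / (2 * c) * (1 / q) - n" using assms q by (simp add: field_simps power2_eq_square)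
 finally show ?thesis unfolding e q_def[symmetric] by simp
qed

lemma ennreal_mult_plus_mult:
 assumes "0 \<le> a" "0 \<le> b" "0 \<le> c" "0 \<le> d"
 shows "ennreal (a * b + c * d) = ennreal a * ennreal b + ennreal c * ennreal d"
 by (simp only: ennreal_plus ennreal_mult mult_nonneg_nonneg assms)

text \<open>Compares first and second powers with an adjustable constant. It is used once with
  \<open>c\<close> tending to infinity, to pass an approximation in mean square to the first power,
  and once with \<open>c\<close> adapted to a given lower bound.\<close>

lemma ennreal_am_gm:
 assumes "0 < c"
 shows "ennreal n \<le> ennreal (c / 2) * ennreal (n\<^sup>2) + ennreal (1 / (2 * c))"
proof -
 have "0 \<le> (c * n - 1)\<^sup>2 / (2 * c)" using assms by simp
 also have "\<dots> = c / 2 * n\<^sup>2 + 1 / (2 * c) - n" using assms by (simp add: field_simps power2_eq_square)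
 finally have "ennreal n \<le> ennreal (c / 2 * n\<^sup>2 + 1 / (2 * c) * 1)" by (intro ennreal_leI) simp
 then show ?thesis using assms by (subst (asm) ennreal_mult_plus_mult) auto
qed

lemma nn_integral_powr_Icc:
 fixes \<alpha> y :: real
 assumes "0 < \<alpha>" "0 \<le> y"
 shows "(\<integral>\<^sup>+z. ennreal (z powr (2 * \<alpha> - 1)) * indicator {0..y} z \<partial>lborel) = ennreal (y powr (2 * \<alpha>) / (2 * \<alpha>))"
proof -
 have "((\<lambda>z. z powr (2 * \<alpha> - 1)) has_integral (y powr (2 * \<alpha>) / (2 * \<alpha>))) {0..y}"
  using has_integral_powr_from_0[of "2 * \<alpha> - 1" y] assms by simp
 from nn_integral_has_integral_lebesgue'[OF _ this] show ?thesis by simp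
qed

context riemann
begin

lemma test_half_line_support:
 fixes w :: "real => 'm => complex"
 assumes "test_mfd A {0<..} w"
 obtains a where "0 < a" "\<And>z x. z < a ==> w z x = 0"
proof -
 obtain K where K: "compact K" "K \<subseteq> {0<..} \<times> UNIV" "\<And>p x. (p, x) \<notin> K ==> w p x = 0" using assms unfolding test_mfd_def by blast
 have c: "compact (fst ` K)" by (intro compact_continuous_image K continuous_on_fst continuous_on_id)
 show ?thesis
 proof (cases "K = {}")
  case True
  then show ?thesis using that[of 1] K(3) by auto
 next
  case False
  then obtain a where a: "a \<in> fst ` K" "\<And>z. z \<in> fst ` K ==> a \<le> z" using compact_attains_inf[OF c] by blast
  have "w z x = 0" if "z < a" for z x
   using a(2)[of z] that K(3)[of z x] by force
  moreover have "0 < a" using a(1) K(2) by auto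
  ultimately show ?thesis using that by blast
 qed
qed

lemma test_half_line_derivative:
 fixes w :: "real => 'm => complex"
 assumes w: "test_mfd A {0<..} w"
 shows "((\<lambda>r. w r x) has_vector_derivative ddt (\<lambda>r. w r x) z) (at z)"
  and "continuous_on UNIV (\<lambda>(z, x). ddt (\<lambda>r. w r x) z)"
  and "continuous_on UNIV (\<lambda>(z, x). w z x)"
proof -
 have s: "smooth_mfd A {0<..} w" using w by (simp add: test_mfd_def)
 obtain a where a: "0 < a" "\<And>z x. z < a ==> w z x = 0" using test_half_line_support[OF w] by blast
 have z: "((\<lambda>r. w r x) has_vector_derivative 0) (at z)" if "z < a" for z x
  by (rule has_vector_derivative_transform_within_open[of "\<lambda>_. 0" _ _ "{..<a}"]) (use a that in auto)
 show "((\<lambda>r. w r x) has_vector_derivative ddt (\<lambda>r. w r x) z) (at z)"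
 proof (cases "z < a")
  case True
  from z[OF this] show ?thesis using vector_derivative_at[OF z[OF True, of x]] by simp
 next
  case False
  then show ?thesis using smooth_mfd_line(2)[OF open_greaterThan s, of z x] a by simp
 qed
 have op: "open ({..<a} \<times> (UNIV :: 'm set))" "open ({0 :: real<..} \<times> (UNIV :: 'm set))" for a :: real
  by (intro open_Times open_lessThan open_greaterThan open_UNIV)+
 have un: "{..<a} \<times> (UNIV :: 'm set) \<union> {0<..} \<times> UNIV = UNIV" using a(1) by auto
 have "continuous_on ({..<a} \<times> UNIV) (\<lambda>(z, x). ddt (\<lambda>r. w r x) z)"
  by (rule continuous_on_eq[of _ "\<lambda>_. 0"]) (auto simp: vector_derivative_at[OF z])
 moreover have "continuous_on ({0<..} \<times> UNIV) (\<lambda>(z, x). ddt (\<lambda>r. w r x) z)"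
  by (rule smooth_mfd_continuous[OF open_greaterThan smooth_mfd_line(1)[OF open_greaterThan s]])
 ultimately show "continuous_on UNIV (\<lambda>(z, x). ddt (\<lambda>r. w r x) z)"
  using continuous_on_open_Un[OF op] un by metis
 have "continuous_on ({..<a} \<times> UNIV) (\<lambda>(z, x). w z x)"
  by (rule continuous_on_eq[of _ "\<lambda>_. 0"]) (auto simp: a)
 then show "continuous_on UNIV (\<lambda>(z, x). w z x)"
  using continuous_on_open_Un[OF op] un smooth_mfd_continuous[OF open_greaterThan s] by metis
qed

text \<open>\<open>w\<close> vanishes at zero, so it is the integral of its derivative. The
  Cauchy-Schwarz inequality is used in the additive form \<open>weighted_am_gm\<close> with
  \<open>c = y^\<alpha>\<close>, which is linear in the energy density and hence can be integrated
  over the manifold. The second term is the integral of \<open>z^(2 \<alpha> - 1)\<close> over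
  \<open>[0, y]\<close> divided by \<open>2 y^\<alpha>\<close>.\<close>

lemma energy_pointwise:
 fixes w :: "real => 'm => complex"
 assumes w: "test_mfd A {0<..} w" and \<alpha>: "0 < \<alpha>" and y: "0 < y"
 shows "ennreal (norm (w y x)) \<le> ennreal (y powr \<alpha> / 2) *
   (\<integral>\<^sup>+z. ennreal (z powr (1 - 2 * \<alpha>)) * indicator {0<..} z * ennreal ((norm (ddt (\<lambda>r. w r x) z))\<^sup>2) \<partial>lborel)
   + ennreal (y powr \<alpha> / (4 * \<alpha>))"
proof -
 define D where "D = (\<lambda>z. ddt (\<lambda>r. w r x) z)"
 have Dv: "((\<lambda>r. w r x) has_vector_derivative D z) (at z)" for z
  unfolding D_def by (rule test_half_line_derivative(1)[OF w])
 have "continuous_on UNIV (\<lambda>z. (z, x))" by (intro continuous_intros)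
 from continuous_on_compose2[OF test_half_line_derivative(2)[OF w] this]
 have Dc: "continuous_on UNIV D" by (simp add: D_def)
 then have [measurable]: "D \<in> borel_measurable borel" by (rule borel_measurable_continuous_onI)
 have w0: "w 0 x = 0" using test_half_line_support[OF w] by metis
 have int: "integrable lborel (\<lambda>z. indicator {0..y} z *\<^sub>R D z)"
  using borel_integrable_atLeastAtMost'[OF continuous_on_subset[OF Dc], of 0 y] by (simp add: set_integrable_def)
 have "(\<integral>z. indicator {0..y} z *\<^sub>R D z \<partial>lborel) = w y x - w 0 x"
  by (rule integral_FTC_Icc) (use y Dv Dc in \<open>auto intro: has_vector_derivative_at_within continuous_on_subset\<close>)
 then have "ennreal (norm (w y x)) = ennreal (norm (\<integral>z. indicator {0..y} z *\<^sub>R D z \<partial>lborel))" by (simp add: w0)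
 also have "\<dots> \<le> (\<integral>\<^sup>+z. ennreal (norm (indicator {0..y} z *\<^sub>R D z)) \<partial>lborel)"
  by (rule integral_norm_bound_ennreal[OF int])
 also have "\<dots> \<le> (\<integral>\<^sup>+z. ennreal (y powr \<alpha> / 2) * (ennreal (z powr (1 - 2 * \<alpha>)) * indicator {0<..} z * ennreal ((norm (D z))\<^sup>2))
   + ennreal (1 / (2 * y powr \<alpha>)) * (ennreal (z powr (2 * \<alpha> - 1)) * indicator {0..y} z) \<partial>lborel)"
 proof (rule nn_integral_mono_AE)
  have "AE z in lborel. z \<noteq> (0::real)" by (rule AE_lborel_singleton)
  then show "AE z in lborel. ennreal (norm (indicator {0..y} z *\<^sub>R D z)) \<le> ennreal (y powr \<alpha> / 2) * (ennreal (z powr (1 - 2 * \<alpha>)) * indicator {0<..} z * ennreal ((norm (D z))\<^sup>2))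
   + ennreal (1 / (2 * y powr \<alpha>)) * (ennreal (z powr (2 * \<alpha> - 1)) * indicator {0..y} z)"
  proof eventually_elim
   fix z :: real assume z: "z \<noteq> 0"
   show "ennreal (norm (indicator {0..y} z *\<^sub>R D z)) \<le> ennreal (y powr \<alpha> / 2) * (ennreal (z powr (1 - 2 * \<alpha>)) * indicator {0<..} z * ennreal ((norm (D z))\<^sup>2))
   + ennreal (1 / (2 * y powr \<alpha>)) * (ennreal (z powr (2 * \<alpha> - 1)) * indicator {0..y} z)"
   proof (cases "z \<in> {0..y}")
    case True
    then have z: "0 < z" using z by auto
    have "norm (D z) \<le> y powr \<alpha> / 2 * (z powr (1 - 2 * \<alpha>) * (norm (D z))\<^sup>2) + 1 / (2 * y powr \<alpha>) * z powr (2 * \<alpha> - 1)"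
     by (rule weighted_am_gm) (use z y in auto)
    then have "ennreal (norm (D z)) \<le> ennreal (y powr \<alpha> / 2 * (z powr (1 - 2 * \<alpha>) * (norm (D z))\<^sup>2) + 1 / (2 * y powr \<alpha>) * z powr (2 * \<alpha> - 1))"
     by (rule ennreal_leI)
    also have "\<dots> = ennreal (y powr \<alpha> / 2) * (ennreal (z powr (1 - 2 * \<alpha>)) * ennreal ((norm (D z))\<^sup>2)) + ennreal (1 / (2 * y powr \<alpha>)) * ennreal (z powr (2 * \<alpha> - 1))"
     by (subst ennreal_mult_plus_mult) (simp_all add: ennreal_mult)
    finally show ?thesis using True z by simp
   qed simp
  qed
 qed
 also have "\<dots> = ennreal (y powr \<alpha> / 2) * (\<integral>\<^sup>+z. ennreal (z powr (1 - 2 * \<alpha>)) * indicator {0<..} z * ennreal ((norm (D z))\<^sup>2) \<partial>lborel)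
   + ennreal (1 / (2 * y powr \<alpha>)) * (\<integral>\<^sup>+z. ennreal (z powr (2 * \<alpha> - 1)) * indicator {0..y} z \<partial>lborel)"
  by (simp add: nn_integral_add nn_integral_cmult)
 also have "ennreal (1 / (2 * y powr \<alpha>)) * (\<integral>\<^sup>+z. ennreal (z powr (2 * \<alpha> - 1)) * indicator {0..y} z \<partial>lborel) = ennreal (y powr \<alpha> / (4 * \<alpha>))"
 proof -
  have "y powr (2 * \<alpha>) = y powr \<alpha> * y powr \<alpha>" by (simp flip: powr_add)
  then have "1 / (2 * y powr \<alpha>) * (y powr (2 * \<alpha>) / (2 * \<alpha>)) = y powr \<alpha> / (4 * \<alpha>)" using y \<alpha> by simp
  then show ?thesis using y \<alpha> by (simp add: nn_integral_powr_Icc flip: ennreal_mult)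
 qed
 finally show ?thesis by (simp only: D_def)
qed

text \<open>The pointwise bound integrated over the manifold; dropping the nonnegative tangential
  part leaves at most the energy, and the constant term contributes the volume.\<close>

lemma energy_slice:
 fixes w :: "real => 'm => complex"
 assumes w: "test_mfd A {0<..} w" and \<alpha>: "0 < \<alpha>" and y: "0 < y" and C: "energy A g V \<alpha> w \<le> ennreal C" "0 \<le> C"
 shows "(\<integral>\<^sup>+x. ennreal (norm (w y x)) \<partial>V) \<le> ennreal ((C / 2 + measure V UNIV / (4 * \<alpha>)) * y powr \<alpha>)"
proof -
 have Dm [measurable]: "(\<lambda>(z, x). ddt (\<lambda>r. w r x) z) \<in> borel_measurable (lborel \<Otimes>\<^sub>M V)"
  unfolding measurable_cong_sets[OF sets_lborel_V refl] by (rule borel_measurable_continuous_onI[OF test_half_line_derivative(2)[OF w]])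
 let ?e = "\<lambda>(z, x). ennreal (z powr (1 - 2 * \<alpha>)) * indicator {0<..} z * ennreal ((norm (ddt (\<lambda>r. w r x) z))\<^sup>2)"
 have em: "?e \<in> borel_measurable (lborel \<Otimes>\<^sub>M V)"
  using Dm unfolding split_beta by measurable
 have "(\<integral>\<^sup>+x. (\<integral>\<^sup>+z. ?e (z, x) \<partial>lborel) \<partial>V) = integral\<^sup>N (lborel \<Otimes>\<^sub>M V) ?e"
  by (rule LV.nn_integral_snd[OF em])
 also have "\<dots> = (\<integral>\<^sup>+p. ennreal ((norm (ddt (\<lambda>r. w r (snd p)) (fst p)))\<^sup>2) \<partial>cyl_measure \<alpha> V)"
  unfolding cyl_measure_def
  by (subst nn_integral_density) (use Dm in \<open>auto simp: case_prod_unfold\<close>)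
 also have "\<dots> \<le> energy A g V \<alpha> w"
  unfolding energy_def split_beta by (intro nn_integral_mono ennreal_leI) (use grad_sq_nonneg in simp)
 also have "\<dots> \<le> ennreal C" by (rule C)
 finally have E: "(\<integral>\<^sup>+x. (\<integral>\<^sup>+z. ?e (z, x) \<partial>lborel) \<partial>V) \<le> ennreal C" .
 have em': "(\<lambda>x. \<integral>\<^sup>+z. ?e (z, x) \<partial>lborel) \<in> borel_measurable V"
  by (rule LV.M1.borel_measurable_nn_integral) (use em in measurable)
 have "(\<integral>\<^sup>+x. ennreal (norm (w y x)) \<partial>V) \<le> (\<integral>\<^sup>+x. ennreal (y powr \<alpha> / 2) * (\<integral>\<^sup>+z. ?e (z, x) \<partial>lborel) + ennreal (y powr \<alpha> / (4 * \<alpha>)) \<partial>V)"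
  using energy_pointwise[OF w \<alpha> y] by (intro nn_integral_mono) simp
 also have "\<dots> = ennreal (y powr \<alpha> / 2) * (\<integral>\<^sup>+x. (\<integral>\<^sup>+z. ?e (z, x) \<partial>lborel) \<partial>V) + ennreal (y powr \<alpha> / (4 * \<alpha>)) * emeasure V UNIV"
  using em' by (simp add: nn_integral_add nn_integral_cmult)
 also have "\<dots> \<le> ennreal (y powr \<alpha> / 2) * ennreal C + ennreal (y powr \<alpha> / (4 * \<alpha>)) * ennreal (measure V UNIV)"
  by (intro add_mono mult_left_mono E) (simp_all add: V.emeasure_eq_measure)
 also have "\<dots> = ennreal ((C / 2 + measure V UNIV / (4 * \<alpha>)) * y powr \<alpha>)"
  using C \<alpha> by (simp add: field_simps flip: ennreal_mult ennreal_plus)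
 finally show ?thesis .
qed

text \<open>The approximating functions converge only in local mean square, not slice by slice. The
  excess of the slice norm over the bound, a truncated difference in \<open>ennreal\<close>, is
  integrated over \<open>[a, b]\<close>; it is at most \<open>c / 2\<close> times the squared
  distance plus a multiple of \<open>1 / c\<close>. Letting first \<open>i\<close> and then
  \<open>c\<close> tend to infinity makes it zero.\<close>

lemma Hdot_slice_bound:
 fixes w :: "real => 'm => complex"
 assumes \<alpha>: "0 < \<alpha>" and ap: "Hdot_approx A g V \<alpha> ws w" and C: "\<And>i. energy A g V \<alpha> (ws i) \<le> ennreal C" "0 \<le> C"
  and wm: "(\<lambda>p. indicator {0<..} (fst p) *\<^sub>R w (fst p) (snd p)) \<in> borel_measurable (lborel \<Otimes>\<^sub>M V)"
 shows "AE y in lborel. 0 < y --> (\<integral>\<^sup>+x. ennreal (norm (w y x)) \<partial>V) \<le> ennreal ((C / 2 + measure V UNIV / (4 * \<alpha>)) * y powr \<alpha>)"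
proof -
 define B where "B = C / 2 + measure V UNIV / (4 * \<alpha>)"
 have B: "0 \<le> B" using C \<alpha> by (simp add: B_def)
 define w' where "w' = (\<lambda>y x. indicator {0<..} y *\<^sub>R w y x)"
 have w'm [measurable]: "(\<lambda>p. w' (fst p) (snd p)) \<in> borel_measurable (lborel \<Otimes>\<^sub>M V)" using wm by (simp add: w'_def)
 have test: "test_mfd A {0<..} (ws i)" for i using ap by (simp add: Hdot_approx_def)
 have wsm [measurable]: "(\<lambda>p. ws i (fst p) (snd p)) \<in> borel_measurable (lborel \<Otimes>\<^sub>M V)" for i
  unfolding measurable_cong_sets[OF sets_lborel_V refl]
  using borel_measurable_continuous_onI[OF test_half_line_derivative(3)[OF test[of i]]] by (simp add: case_prod_unfold)
 have ab: "AE y in lborel. y \<in> {a..b} --> (\<integral>\<^sup>+x. ennreal (norm (w' y x)) \<partial>V) \<le> ennreal (B * y powr \<alpha>)" if a: "0 < a" for a b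
 proof -
  let ?N = "\<lambda>y. \<integral>\<^sup>+x. ennreal (norm (w' y x)) \<partial>V"
  let ?sq = "\<lambda>i. \<integral>\<^sup>+p. ennreal ((norm (ws i (fst p) (snd p) - w' (fst p) (snd p)))\<^sup>2) * indicator {a..b} (fst p) \<partial>(lborel \<Otimes>\<^sub>M V)"
  have Nm [measurable]: "?N \<in> borel_measurable lborel" by measurable
  have sq: "?sq \<longlonglongrightarrow> 0"
  proof -
   have "(\<lambda>i. \<integral>\<^sup>+(y, x). ennreal ((cmod (ws i y x - w y x))\<^sup>2) * indicator {a..b} y \<partial>(lborel \<Otimes>\<^sub>M V)) \<longlonglongrightarrow> 0"
    using ap a unfolding Hdot_approx_def by blast
   moreover have "(\<integral>\<^sup>+(y, x). ennreal ((cmod (ws i y x - w y x))\<^sup>2) * indicator {a..b} y \<partial>(lborel \<Otimes>\<^sub>M V)) = ?sq i" for i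
    by (rule nn_integral_cong) (use a in \<open>auto simp: w'_def indicator_def\<close>)
   ultimately show ?thesis by simp
  qed
  have le: "(\<integral>\<^sup>+y. (?N y - ennreal (B * y powr \<alpha>)) * indicator {a..b} y \<partial>lborel) \<le> ennreal (c / 2) * ?sq i + ennreal (1 / (2 * c)) * (ennreal (b - a) * emeasure V UNIV)"
   if c: "0 < c" for c i
  proof -
   let ?d = "\<lambda>p. ennreal (c / 2) * (ennreal ((norm (ws i (fst p) (snd p) - w' (fst p) (snd p)))\<^sup>2) * indicator {a..b} (fst p)) + ennreal (1 / (2 * c)) * indicator {a..b} (fst p)"
   have "(?N y - ennreal (B * y powr \<alpha>)) * indicator {a..b} y \<le> (\<integral>\<^sup>+x. ?d (y, x) \<partial>V)" for y
   proof (cases "y \<in> {a..b}")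
    case y: True
    have "?N y \<le> (\<integral>\<^sup>+x. ennreal (norm (ws i y x)) + ennreal (norm (ws i y x - w' y x)) \<partial>V)"
     by (intro nn_integral_mono) (simp flip: ennreal_plus, metis norm_minus_commute norm_triangle_sub)
    also have "\<dots> = (\<integral>\<^sup>+x. ennreal (norm (ws i y x)) \<partial>V) + (\<integral>\<^sup>+x. ennreal (norm (ws i y x - w' y x)) \<partial>V)"
    proof (rule nn_integral_add)
     have [measurable]: "(\<lambda>x. ws i y x) \<in> borel_measurable V" "(\<lambda>x. w' y x) \<in> borel_measurable V"
      using measurable_Pair2[OF wsm, of y i] measurable_Pair2[OF w'm, of y] by simp_all
     show "(\<lambda>x. ennreal (norm (ws i y x))) \<in> borel_measurable V" "(\<lambda>x. ennreal (norm (ws i y x - w' y x))) \<in> borel_measurable V"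
      by measurable
    qed
    also have "\<dots> \<le> ennreal (B * y powr \<alpha>) + (\<integral>\<^sup>+x. ?d (y, x) \<partial>V)"
    proof (intro add_mono nn_integral_mono)
     show "(\<integral>\<^sup>+x. ennreal (norm (ws i y x)) \<partial>V) \<le> ennreal (B * y powr \<alpha>)"
      using energy_slice[OF test \<alpha> _ C, of y i] y a unfolding B_def by auto
     fix x
     show "ennreal (norm (ws i y x - w' y x)) \<le> ?d (y, x)" using ennreal_am_gm[OF c] y by simp
    qed
    finally have "?N y \<le> ennreal (B * y powr \<alpha>) + (\<integral>\<^sup>+x. ?d (y, x) \<partial>V)" .
    then show ?thesis using y by (simp add: ennreal_minus_le_iff)
   qed simp
   then have "(\<integral>\<^sup>+y. (?N y - ennreal (B * y powr \<alpha>)) * indicator {a..b} y \<partial>lborel) \<le> (\<integral>\<^sup>+y. (\<integral>\<^sup>+x. ?d (y, x) \<partial>V) \<partial>lborel)"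
    by (intro nn_integral_mono)
   also have "\<dots> = integral\<^sup>N (lborel \<Otimes>\<^sub>M V) ?d" by (rule V.nn_integral_fst) measurable
   also have "\<dots> = ennreal (c / 2) * ?sq i + ennreal (1 / (2 * c)) * (\<integral>\<^sup>+p. indicator {a..b} (fst p) \<partial>(lborel \<Otimes>\<^sub>M V))"
    by (subst nn_integral_add) (auto simp: nn_integral_cmult)
   also have "(\<integral>\<^sup>+p. indicator {a..b} (fst p) \<partial>(lborel \<Otimes>\<^sub>M V)) = (\<integral>\<^sup>+y. (\<integral>\<^sup>+x. indicator {a..b} y \<partial>V) \<partial>lborel)"
    by (subst V.nn_integral_fst[symmetric]) auto
   also have "\<dots> \<le> ennreal (b - a) * emeasure V UNIV"
    by (cases "a \<le> b") (simp_all add: nn_integral_cmult_indicator mult.commute)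
   finally show ?thesis by (simp add: add_left_mono mult_left_mono)
  qed
  have le': "(\<integral>\<^sup>+y. (?N y - ennreal (B * y powr \<alpha>)) * indicator {a..b} y \<partial>lborel) \<le> ennreal (1 / (2 * c)) * (ennreal (b - a) * emeasure V UNIV)" if c: "0 < c" for c
  proof (rule tendsto_lowerbound[OF _ _ sequentially_bot])
   have "(\<lambda>i. ennreal (c / 2) * ?sq i + ennreal (1 / (2 * c)) * (ennreal (b - a) * emeasure V UNIV)) \<longlonglongrightarrow> ennreal (c / 2) * 0 + ennreal (1 / (2 * c)) * (ennreal (b - a) * emeasure V UNIV)"
    by (intro tendsto_add tendsto_const ennreal_tendsto_cmult sq) simp
   then show "(\<lambda>i. ennreal (c / 2) * ?sq i + ennreal (1 / (2 * c)) * (ennreal (b - a) * emeasure V UNIV)) \<longlonglongrightarrow> ennreal (1 / (2 * c)) * (ennreal (b - a) * emeasure V UNIV)" by simp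
  qed (use le[OF c] in simp)
  have "(\<integral>\<^sup>+y. (?N y - ennreal (B * y powr \<alpha>)) * indicator {a..b} y \<partial>lborel) \<le> 0"
  proof (rule tendsto_lowerbound[OF _ _ sequentially_bot])
   define D where "D = (b - a) * measure V UNIV"
   have "(\<lambda>n. ennreal (1 / real (Suc n) * \<bar>D\<bar>)) \<longlonglongrightarrow> ennreal (0 * \<bar>D\<bar>)"
    by (intro tendsto_ennrealI tendsto_mult tendsto_const LIMSEQ_Suc[OF lim_1_over_n])
   then show "(\<lambda>n. ennreal (1 / real (Suc n) * \<bar>D\<bar>)) \<longlonglongrightarrow> 0" by simp
   have "(\<integral>\<^sup>+y. (?N y - ennreal (B * y powr \<alpha>)) * indicator {a..b} y \<partial>lborel) \<le> ennreal (1 / real (Suc n) * \<bar>D\<bar>)" for n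
   proof -
    have "ennreal (1 / (2 * (real (Suc n) / 2))) * (ennreal (b - a) * emeasure V UNIV) \<le> ennreal (1 / real (Suc n) * \<bar>D\<bar>)"
     by (cases "a \<le> b") (auto simp: D_def V.emeasure_eq_measure abs_mult ennreal_neg simp flip: ennreal_mult simp del: of_nat_Suc)
    then show ?thesis using le'[of "real (Suc n) / 2"] by (auto intro: order_trans)
   qed
   then show "\<forall>\<^sub>F n in sequentially. (\<integral>\<^sup>+y. (?N y - ennreal (B * y powr \<alpha>)) * indicator {a..b} y \<partial>lborel) \<le> ennreal (1 / real (Suc n) * \<bar>D\<bar>)"
    by simp
  qed
  then have "(\<integral>\<^sup>+y. (?N y - ennreal (B * y powr \<alpha>)) * indicator {a..b} y \<partial>lborel) = 0" by simp
  then have "AE y in lborel. (?N y - ennreal (B * y powr \<alpha>)) * indicator {a..b} y = 0"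
   by (subst (asm) nn_integral_0_iff_AE) auto
  then show ?thesis by eventually_elim (auto dest: ennreal_minus_eq_0 split: split_indicator_asm)
 qed
 have "AE y in lborel. 0 < y --> (\<integral>\<^sup>+x. ennreal (norm (w' y x)) \<partial>V) \<le> ennreal (B * y powr \<alpha>)"
  by (rule AE_pos_exhaust[OF ab])
 then show ?thesis by eventually_elim (auto simp: w'_def B_def)
qed

end

section \<open>The mode equation\<close>

lemma AE_half:
 assumes "AE y in lborel. Q (y::real)"
 shows "AE y in lborel. Q (y / 2)"
proof -
 obtain N where N: "N \<in> null_sets lborel" "{y \<in> space lborel. \<not> Q y} \<subseteq> N"
  using assms unfolding eventually_ae_filter by auto
 have [measurable]: "N \<in> sets borel" using N(1) by (auto dest: null_setsD2)
 have "AE y in lborel. 0 + 1 / 2 * y \<notin> N"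
  by (rule AE_borel_affine) (use AE_not_in[OF N(1)] in auto)
 then show ?thesis by eventually_elim (use N(2) in auto)
qed

lemma AE_unit_interval_obtain:
 assumes "AE y in lborel. 0 < y \<and> y < 1 --> Q (y::real)"
 obtains y where "0 < y" "y < 1" "Q y"
proof -
 have "\<exists>y. 0 < y \<and> y < 1 \<and> Q y"
 proof (rule ccontr)
  assume "\<not> ?thesis"
  then have "AE y in lborel. \<not> (y \<in> {0<..<1::real})" using assms by (auto elim: eventually_mono)
  from emeasure_eq_0_AE[OF this] have "emeasure lborel {y \<in> space lborel. y \<in> {0<..<1::real}} = 0" .
  moreover have "{y \<in> space lborel. y \<in> {0<..<1::real}} = {0<..<1}" by auto
  ultimately have "emeasure lborel {0<..<1::real} = 0" by (simp only:)
  then show False by simp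
 qed
 then show ?thesis using that by blast
qed

text \<open>Comparing \<open>y\<close> with \<open>y / 2\<close> removes the leading coefficient.\<close>

lemma even_polynomial_elimination:
 fixes W :: "nat => 'a => complex"
 assumes add: "\<And>p q. P p ==> P q ==> P (\<lambda>x. p x + q x)"
  and scale: "\<And>(c::real) p. P p ==> P (\<lambda>x. c *\<^sub>R p x)"
  and ae: "AE y in lborel. 0 < y \<and> y < 1 --> P (\<lambda>x. \<Sum>i<k. y ^ (2 * i) *\<^sub>R W i x)"
  and i: "i < k"
 shows "P (W i)"
 using ae i
proof (induction k arbitrary: W i)
 case (Suc k)
 \<comment> \<open>The factors left when \<open>4^(-k)\<close> times the sum at \<open>y\<close> is
   subtracted from the sum at \<open>y / 2\<close>: zero at \<open>k\<close>, nonzero below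
   \<open>k\<close>.\<close>
 define c :: "nat => real" where "c = (\<lambda>i. (1 / 4) ^ i - (1 / 4) ^ k)"
 have sum_half: "(\<Sum>i<Suc k. (y / 2) ^ (2 * i) *\<^sub>R W i x) + (- ((1 / 4) ^ k)) *\<^sub>R (\<Sum>i<Suc k. y ^ (2 * i) *\<^sub>R W i x)
   = (\<Sum>i<k. y ^ (2 * i) *\<^sub>R (c i *\<^sub>R W i x))" for y x
 proof -
  have p: "(y / 2) ^ (2 * i) = (1 / 4) ^ i * y ^ (2 * i)" for i
   by (simp add: power_mult power_divide)
  have "(\<Sum>i<Suc k. (y / 2) ^ (2 * i) *\<^sub>R W i x) + (- ((1 / 4) ^ k)) *\<^sub>R (\<Sum>i<Suc k. y ^ (2 * i) *\<^sub>R W i x)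
   = (\<Sum>i<Suc k. y ^ (2 * i) *\<^sub>R (c i *\<^sub>R W i x))"
   unfolding scaleR_sum_right sum.distrib[symmetric] p c_def
   by (rule sum.cong) (simp_all add: scaleR_left_diff_distrib scaleR_right_diff_distrib left_diff_distrib right_diff_distrib mult.commute)
  then show ?thesis by (simp add: c_def)
 qed
 have "AE y in lborel. 0 < y \<and> y < 1 --> P (\<lambda>x. \<Sum>i<k. y ^ (2 * i) *\<^sub>R (c i *\<^sub>R W i x))"
  using Suc.prems(1) AE_half[OF Suc.prems(1)]
 proof eventually_elim
  case (elim y)
  show ?case
  proof
   assume y: "0 < y \<and> y < 1"
   then have "P (\<lambda>x. \<Sum>i<Suc k. (y / 2) ^ (2 * i) *\<^sub>R W i x)" "P (\<lambda>x. \<Sum>i<Suc k. y ^ (2 * i) *\<^sub>R W i x)" using elim by auto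
   from add[OF this(1) scale[OF this(2), of "- ((1 / 4) ^ k)"]]
   show "P (\<lambda>x. \<Sum>i<k. y ^ (2 * i) *\<^sub>R (c i *\<^sub>R W i x))" unfolding sum_half .
  qed
 qed
 note IH = Suc.IH[OF this]
 have W: "P (W i)" if "i < k" for i
 proof -
  have "((1 / 4 :: real) ^ k) < (1 / 4) ^ i" using that by (intro power_strict_decreasing) auto
  then have "c i \<noteq> 0" unfolding c_def by linarith
  then show ?thesis using scale[OF IH[OF that], of "1 / c i"] by simp
 qed
 show ?case
 proof (cases "i < k")
  case False
  then have ik: "i = k" using Suc.prems(2) by simp
  \<comment> \<open>The top coefficient is what remains of the full sum at a single good
    \<open>y\<close> after the lower terms are removed.\<close>
  obtain y where y: "0 < y" "y < 1" "P (\<lambda>x. \<Sum>i<Suc k. y ^ (2 * i) *\<^sub>R W i x)"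
   using AE_unit_interval_obtain[OF Suc.prems(1)] by blast
  have "P (\<lambda>x. \<Sum>i<m. d i *\<^sub>R W i x)" if "m \<le> k" for m and d :: "nat => real"
   using that
  proof (induction m)
   case 0
   then show ?case using scale[OF y(3), of 0] by simp
  next
   case (Suc m)
   then show ?case using add[OF Suc.IH scale[OF W, of m "d m"]] by simp
  qed
  from add[OF y(3) this[of k "\<lambda>i. - (y ^ (2 * i))"]]
  have "P (\<lambda>x. y ^ (2 * k) *\<^sub>R W k x)" by (simp add: sum_negf)
  from scale[OF this, of "1 / y ^ (2 * k)"] show ?thesis using y(1) by (simp add: ik)
 qed (rule W)
qed simp

lemma AE_fst:
 assumes "AE t in lborel. Q (t::real)"
 shows "AE p in lborel \<Otimes>\<^sub>M (lborel :: real measure). Q (fst p)"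
proof -
 obtain N where N: "N \<in> null_sets lborel" "{t \<in> space lborel. \<not> Q t} \<subseteq> N"
  using assms unfolding eventually_ae_filter by auto
 have [measurable]: "N \<in> sets lborel" using N(1) by (auto dest: null_setsD2)
 have "{p \<in> space (lborel \<Otimes>\<^sub>M (lborel :: real measure)). fst p \<notin> N} \<in> sets (lborel2)" by measurable
 moreover have "AE t in lborel. AE y in (lborel :: real measure). fst (t, y) \<notin> N"
  using AE_not_in[OF N(1)] by eventually_elim simp
 ultimately have "AE p in lborel \<Otimes>\<^sub>M (lborel :: real measure). fst p \<notin> N" by (rule lborel_pair.AE_pair_measure)
 then show ?thesis by eventually_elim (use N(2) in auto)
qed

section \<open>Coefficients of the solution in the eigenbasis\<close>

locale kg_problem = riemann A g V
 for A :: "('m::{t2_space, second_countable_topology}, 'd::finite) chart set"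
  and g :: "('m, 'd) metric" and V :: "'m measure" +
 fixes n :: nat and \<alpha> :: real and chi :: "real => real"
  and Y :: "nat => 'm => complex" and lam :: "nat => real"
  and f :: "real => 'm => complex"
  and \<phi> u :: "real => real => 'm => complex"
 assumes \<alpha>0: "0 < \<alpha>"
  and eigen: "laplace_eigenbasis A g V Y lam"
  and test: "test_mfd A UNIV f"
  and cutoff: "smooth_cutoff chi"
  and KG: "KG_solution A g V n \<alpha> \<phi>"
  and u_def: "u = (\<lambda>t y x. (y powr (\<alpha> - real n / 2)) *\<^sub>R \<phi> t y x)"
  and form: "solution_form A g V \<alpha> chi f u"
  and initial: "trivial_initial_data V f u"
  and boundary: "boundary_value V f u"
begin

sublocale L3: pair_sigma_finite lborel "lborel \<Otimes>\<^sub>M V" ..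

abbreviation M3 :: "(real \<times> real \<times> 'm) measure" where "M3 \<equiv> lborel \<Otimes>\<^sub>M (lborel \<Otimes>\<^sub>M V)"

lemma Y_smooth: "k \<in> A ==> smooth_on (Y j \<circ> param k) (coord k ` cdom k)"
 using eigen by (simp add: laplace_eigenbasis_def)

lemma Y_continuous: "continuous_on UNIV (Y j)"
 by (rule continuous_on_M) (rule smooth_on_continuous[OF Y_smooth])

lemma Y_measurable [measurable]: "Y j \<in> borel_measurable V"
 unfolding measurable_cong_sets[OF sets_V refl] by (rule borel_measurable_continuous_onI[OF Y_continuous])

lemma lam_nonneg: "0 \<le> lam j" using eigen by (simp add: laplace_eigenbasis_def)

definition BY :: "nat => real" where "BY j = (SOME B. 1 \<le> B \<and> (\<forall>x. norm (Y j x) \<le> B))"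

lemma BY: "1 \<le> BY j" "norm (Y j x) \<le> BY j"
proof -
 obtain B where "0 \<le> B" "\<And>x. norm (Y j x) \<le> B" using continuous_bounded[OF Y_continuous[of j]] by blast
 then have "1 \<le> B + 1 \<and> (\<forall>x. norm (Y j x) \<le> B + 1)" by (auto intro: add_increasing2)
 from someI[of "\<lambda>B. 1 \<le> B \<and> (\<forall>x. norm (Y j x) \<le> B)", OF this]
 show "1 \<le> BY j" "norm (Y j x) \<le> BY j" unfolding BY_def by auto
qed

lemma integrable_times_Y: "integrable V q ==> integrable V (\<lambda>x. q x * cnj (Y j x))"
 by (rule Bochner_Integration.integrable_bound[of V "\<lambda>x. BY j *\<^sub>R q x"])
   (use BY[of j] in \<open>auto simp: norm_mult mult.commute[of "BY j"] intro!: mult_left_mono measurable_cnj\<close>)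

lemma norm_mode_le:
 assumes q: "integrable V q" and B: "(\<integral>\<^sup>+x. ennreal (norm (q x)) \<partial>V) \<le> ennreal B" "0 \<le> B"
 shows "norm (mode_coeff V Y j q) \<le> BY j * B"
proof -
 have "ennreal (norm (mode_coeff V Y j q)) \<le> (\<integral>\<^sup>+x. ennreal (norm (q x * cnj (Y j x))) \<partial>V)"
  unfolding mode_coeff_def by (rule integral_norm_bound_ennreal[OF integrable_times_Y[OF q]])
 also have "\<dots> \<le> (\<integral>\<^sup>+x. ennreal (BY j) * ennreal (norm (q x)) \<partial>V)"
  by (intro nn_integral_mono) (use BY[of j] in \<open>auto simp: norm_mult mult.commute[of "BY j"] simp flip: ennreal_mult intro!: ennreal_leI mult_left_mono\<close>)
 also have "\<dots> = ennreal (BY j) * (\<integral>\<^sup>+x. ennreal (norm (q x)) \<partial>V)" using q by (intro nn_integral_cmult) auto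
 also have "\<dots> \<le> ennreal (BY j) * ennreal B" by (intro mult_left_mono B) simp
 also have "\<dots> = ennreal (BY j * B)" using BY(1)[of j] B by (simp add: ennreal_mult)
 finally show ?thesis using BY(1)[of j] B by (simp add: ennreal_le_iff)
qed

lemma reassoc_measurable:
 "(\<lambda>z. (fst (fst z), snd (fst z), snd z)) \<in> measurable ((lborel2) \<Otimes>\<^sub>M V) M3"
 by measurable

lemma phi_box: "0 < a ==> integrable M3 (\<lambda>p. indicator ({-T..T} \<times> {a..b} \<times> UNIV) p *\<^sub>R \<phi> (fst p) (fst (snd p)) (snd (snd p)))"
 using KG unfolding KG_solution_def set_integrable_def by (simp add: case_prod_unfold)

text \<open>The equation supplies integrability of \<open>\<phi>\<close> only on boxes away from
  \<open>y = 0\<close>. These exhaust the half-space, and the truncated functions converge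
  pointwise.\<close>

lemma u_measurable: "(\<lambda>p. indicator {0<..} (fst (snd p)) *\<^sub>R u (fst p) (fst (snd p)) (snd (snd p))) \<in> borel_measurable M3"
proof -
 let ?phi = "\<lambda>p. indicator {0<..} (fst (snd p)) *\<^sub>R \<phi> (fst p) (fst (snd p)) (snd (snd p))"
 let ?F = "\<lambda>n p. indicator ({-real n..real n} \<times> {1 / real (Suc n)..real n} \<times> UNIV) p *\<^sub>R \<phi> (fst p) (fst (snd p)) (snd (snd p))"
 have "?phi \<in> borel_measurable M3"
 proof (rule borel_measurable_LIMSEQ_metric)
  show "?F n \<in> borel_measurable M3" for n by (rule borel_measurable_integrable[OF phi_box]) simp
  fix p :: "real \<times> real \<times> 'm"
  obtain t y x where p: "p = (t, y, x)" by (cases p) auto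
  have "\<forall>\<^sub>F n in sequentially. ?phi p = ?F n p"
  proof (cases "0 < y")
   case y: True
   show ?thesis unfolding eventually_sequentially
   proof (intro exI allI impI)
    fix n assume "nat \<lceil>max (max \<bar>t\<bar> y) (1 / y)\<rceil> \<le> n"
    then have "max (max \<bar>t\<bar> y) (1 / y) \<le> real n" by linarith
    then have "\<bar>t\<bar> \<le> real n" "y \<le> real n" "1 / y \<le> real (Suc n)" by auto
    moreover from this(3) have "1 / real (Suc n) \<le> y" using y by (simp add: field_simps)
    ultimately show "?phi p = ?F n p" using y by (auto simp: p indicator_def abs_le_iff)
   qed
  next
   case False
   have "\<not> 1 / real (Suc n) \<le> y" for n using False by (smt (verit) of_nat_0_less_iff zero_less_Suc zero_less_divide_1_iff)
   then show ?thesis using False by (simp add: p)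
  qed
  then show "(\<lambda>n. ?F n p) \<longlonglongrightarrow> ?phi p" by (rule Lim_transform_eventually[OF tendsto_const])
 qed
 then have "(\<lambda>p. (fst (snd p) powr (\<alpha> - real n / 2)) *\<^sub>R ?phi p) \<in> borel_measurable M3" by measurable
 then show ?thesis by (rule measurable_cong[THEN iffD1, rotated]) (simp add: u_def)
qed

lemma u_box:
 assumes a: "0 < a"
 shows "integrable M3 (\<lambda>p. indicator {-T..T} (fst p) *\<^sub>R indicator {a..b} (fst (snd p)) *\<^sub>R u (fst p) (fst (snd p)) (snd (snd p)))"
proof (rule Bochner_Integration.integrable_bound)
 let ?s = "\<alpha> - real n / 2"
 show "integrable M3 (\<lambda>p. (a powr ?s + b powr ?s) *\<^sub>R (indicator ({-T..T} \<times> {a..b} \<times> UNIV) p *\<^sub>R \<phi> (fst p) (fst (snd p)) (snd (snd p))))"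
  by (intro integrable_scaleR_right phi_box a)
 have "(\<lambda>p. indicator {-T..T} (fst p) *\<^sub>R indicator {a..b} (fst (snd p)) *\<^sub>R (indicator {0<..} (fst (snd p)) *\<^sub>R u (fst p) (fst (snd p)) (snd (snd p)))) \<in> borel_measurable M3"
  using u_measurable by measurable
 then show "(\<lambda>p. indicator {-T..T} (fst p) *\<^sub>R indicator {a..b} (fst (snd p)) *\<^sub>R u (fst p) (fst (snd p)) (snd (snd p))) \<in> borel_measurable M3"
  by (rule measurable_cong[THEN iffD1, rotated]) (use a in \<open>auto simp: indicator_def\<close>)
 have le: "y powr ?s \<le> a powr ?s + b powr ?s" if "a \<le> y" "y \<le> b" for y
 proof (cases "0 \<le> ?s")
  case True
  have "y powr ?s \<le> b powr ?s" by (rule powr_mono2) (use a that True in auto)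
  then show ?thesis by (simp add: add_increasing)
 next
  case False
  have "y powr ?s \<le> a powr ?s" by (rule powr_mono2') (use a that False in auto)
  then show ?thesis by (simp add: add_increasing2)
 qed
 show "AE p in M3. norm (indicator {-T..T} (fst p) *\<^sub>R indicator {a..b} (fst (snd p)) *\<^sub>R u (fst p) (fst (snd p)) (snd (snd p)))
   \<le> norm ((a powr ?s + b powr ?s) *\<^sub>R (indicator ({-T..T} \<times> {a..b} \<times> UNIV) p *\<^sub>R \<phi> (fst p) (fst (snd p)) (snd (snd p))))"
  using le by (intro AE_I2) (auto simp: indicator_def u_def intro!: mult_right_mono)
qed

text \<open>Values of \<open>u\<close> at \<open>y \<le> 0\<close> are unspecified; the indicator
  makes the coefficient measurable on the whole plane.\<close>

definition hmode :: "nat => real => real => complex" where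
 "hmode j t y = mode_coeff V Y j (\<lambda>x. indicator {0<..} y *\<^sub>R u t y x)"

lemma hmode_pos: "0 < y ==> hmode j t y = mode_coeff V Y j (u t y)"
 by (simp add: hmode_def)

lemma mode_measurable:
 assumes "q \<in> borel_measurable M3"
 shows "(\<lambda>p. mode_coeff V Y j (\<lambda>x. q (fst p, snd p, x))) \<in> borel_measurable (lborel2)"
proof -
 have "(\<lambda>z. q (fst (fst z), snd (fst z), snd z)) \<in> borel_measurable ((lborel2) \<Otimes>\<^sub>M V)"
  by (rule measurable_compose[OF reassoc_measurable assms])
 then have "(\<lambda>z. q (fst (fst z), snd (fst z), snd z) * cnj (Y j (snd z))) \<in> borel_measurable ((lborel2) \<Otimes>\<^sub>M V)"
  by (rule borel_measurable_times[OF _ measurable_compose[OF measurable_compose[OF measurable_snd Y_measurable] measurable_cnj]])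
 then show ?thesis unfolding mode_coeff_def
  by (intro V.borel_measurable_lebesgue_integral) (simp add: case_prod_unfold)
qed

lemma slice_measurable:
 assumes "q \<in> borel_measurable M3"
 shows "(\<lambda>p. \<integral>\<^sup>+x. ennreal (norm (q (fst p, snd p, x))) \<partial>V) \<in> borel_measurable (lborel2)"
proof -
 have "(\<lambda>z. ennreal (norm (q (fst (fst z), snd (fst z), snd z)))) \<in> borel_measurable ((lborel2) \<Otimes>\<^sub>M V)"
  using measurable_compose[OF reassoc_measurable assms] by measurable
 then show ?thesis by (intro V.borel_measurable_nn_integral) (simp add: case_prod_unfold)
qed

lemma hmode_measurable: "case_prod (hmode j) \<in> borel_measurable (borel \<Otimes>\<^sub>M borel)"
 using mode_measurable[OF u_measurable, of j] by (simp add: hmode_def[abs_def] case_prod_unfold)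

lemma slice_meas:
 fixes w :: "real => real => 'm => complex"
 assumes "(\<lambda>p. indicator {0<..} (fst (snd p)) *\<^sub>R w (fst p) (fst (snd p)) (snd (snd p))) \<in> borel_measurable M3"
  and "0 < y"
 shows "w t y \<in> borel_measurable V"
proof -
 have "(\<lambda>x. (t, y, x)) \<in> measurable V M3" by measurable
 from measurable_compose[OF this assms(1)] show ?thesis using assms(2) by simp
qed

lemma u_slice_integrable: "AE p in lborel2. 0 < snd p --> integrable V (u (fst p) (snd p))"
proof -
 let ?N = "\<lambda>p. \<integral>\<^sup>+x. ennreal (norm (indicator {0<..} (snd p) *\<^sub>R u (fst p) (snd p) x)) \<partial>V"
 have [measurable]: "?N \<in> borel_measurable (lborel2)" using slice_measurable[OF u_measurable] by simp
 have "AE t in lborel. AE y in lborel. ?N (t, y) < \<infinity>"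
 proof -
  have "AE t in lborel. \<forall>n. AE y in lborel. integrable V (\<lambda>x. indicator {-real n..real n} t *\<^sub>R indicator {1 / real (Suc n)..real n} y *\<^sub>R u t y x)"
   unfolding AE_all_countable
  proof
   fix n
   have i: "integrable M3 (\<lambda>p. indicator {-real n..real n} (fst p) *\<^sub>R indicator {1 / real (Suc n)..real n} (fst (snd p)) *\<^sub>R u (fst p) (fst (snd p)) (snd (snd p)))"
    by (rule u_box) simp
   have "AE t in lborel. integrable (lborel \<Otimes>\<^sub>M V) (\<lambda>q. indicator {-real n..real n} t *\<^sub>R indicator {1 / real (Suc n)..real n} (fst q) *\<^sub>R u t (fst q) (snd q))"
    using L3.AE_integrable_fst'[OF i] by simp
   then show "AE t in lborel. AE y in lborel. integrable V (\<lambda>x. indicator {-real n..real n} t *\<^sub>R indicator {1 / real (Suc n)..real n} y *\<^sub>R u t y x)"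
   proof eventually_elim
    case (elim t)
    from LV.AE_integrable_fst'[OF elim] show ?case by simp
   qed
  qed
  then show ?thesis
  proof eventually_elim
   case (elim t)
   then have "AE y in lborel. \<forall>n. integrable V (\<lambda>x. indicator {-real n..real n} t *\<^sub>R indicator {1 / real (Suc n)..real n} y *\<^sub>R u t y x)"
    unfolding AE_all_countable .
   then show ?case
   proof eventually_elim
    case (elim y)
    show ?case
    proof (cases "0 < y")
     case y: True
     define n where "n = nat \<lceil>max (max \<bar>t\<bar> y) (1 / y)\<rceil>"
     have "max (max \<bar>t\<bar> y) (1 / y) \<le> real n" unfolding n_def by linarith
     then have nn: "\<bar>t\<bar> \<le> real n" "y \<le> real n" "1 / y \<le> real (Suc n)" by auto
     moreover from this(3) have "1 / real (Suc n) \<le> y" using y by (simp add: field_simps)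
     ultimately have "integrable V (u t y)" using elim[rule_format, of n] by (simp add: abs_le_iff)
     then show ?thesis using y by (simp add: integrable_iff_bounded)
    qed simp
   qed
  qed
 qed
 moreover have "{p \<in> space (lborel2). ?N p < \<infinity>} \<in> sets (lborel2)" by measurable
 ultimately have "AE p in lborel2. ?N p < \<infinity>" by (intro lborel_pair.AE_pair_measure)
 then show ?thesis
  by eventually_elim (auto simp: integrable_iff_bounded intro: slice_meas[OF u_measurable])
qed

text \<open>\<open>M3\<close> is nested to the right, whereas a coefficient integrates over the
  manifold first. The integral is unfolded into iterated integrals and folded the other way,
  beginning with norms to secure integrability.\<close>

lemma integral_reassoc:
 fixes q :: "real \<times> real \<times> 'm => complex"
 assumes q: "integrable M3 q"
 shows "integrable (lborel2) (\<lambda>p. \<integral>x. q (fst p, snd p, x) \<partial>V)"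
  and "(\<integral>p. (\<integral>x. q (fst p, snd p, x) \<partial>V) \<partial>(lborel2)) = integral\<^sup>L M3 q"
proof -
 have qm [measurable]: "q \<in> borel_measurable M3" using q by auto
 have qz [measurable]: "(\<lambda>z. q (fst (fst z), snd (fst z), snd z)) \<in> borel_measurable ((lborel2) \<Otimes>\<^sub>M V)"
  by (rule measurable_compose[OF reassoc_measurable qm])
 let ?G = "\<lambda>p. \<integral>x. q (fst p, snd p, x) \<partial>V"
 have Gm [measurable]: "?G \<in> borel_measurable (lborel2)"
  by (intro V.borel_measurable_lebesgue_integral) (use qz in \<open>simp add: case_prod_unfold\<close>)
 have Nm [measurable]: "(\<lambda>p. \<integral>\<^sup>+x. ennreal (norm (q (fst p, snd p, x))) \<partial>V) \<in> borel_measurable (lborel2)"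
  by (rule slice_measurable[OF qm])
 have t_slice: "AE t in lborel. integrable (lborel \<Otimes>\<^sub>M V) (\<lambda>r. q (t, r))" by (rule L3.AE_integrable_fst'[OF q])
 have "(\<integral>\<^sup>+p. ennreal (norm (?G p)) \<partial>(lborel2)) \<le> (\<integral>\<^sup>+p. (\<integral>\<^sup>+x. ennreal (norm (q (fst p, snd p, x))) \<partial>V) \<partial>(lborel2))"
 proof (rule nn_integral_mono)
  fix p
  show "ennreal (norm (?G p)) \<le> (\<integral>\<^sup>+x. ennreal (norm (q (fst p, snd p, x))) \<partial>V)"
  proof (cases "integrable V (\<lambda>x. q (fst p, snd p, x))")
   case True
   then show ?thesis by (rule integral_norm_bound_ennreal)
  qed (simp add: not_integrable_integral_eq)
 qed
 also have "\<dots> = (\<integral>\<^sup>+t. \<integral>\<^sup>+y. (\<integral>\<^sup>+x. ennreal (norm (q (t, y, x))) \<partial>V) \<partial>lborel \<partial>lborel)"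
  using lborel.nn_integral_fst[OF Nm] by simp
 also have "\<dots> = (\<integral>\<^sup>+t. \<integral>\<^sup>+r. ennreal (norm (q (t, r))) \<partial>(lborel \<Otimes>\<^sub>M V) \<partial>lborel)"
  by (rule nn_integral_cong, rule V.nn_integral_fst) measurable
 also have "\<dots> = (\<integral>\<^sup>+z. ennreal (norm (q z)) \<partial>M3)" by (rule LV.P.nn_integral_fst) measurable
 also have "\<dots> < \<infinity>" using q by (simp add: integrable_iff_bounded)
 finally show Gi: "integrable (lborel2) ?G" by (simp add: integrable_iff_bounded Gm)
 have "integral\<^sup>L (lborel2) ?G = (\<integral>t. \<integral>y. ?G (t, y) \<partial>lborel \<partial>lborel)"
  by (rule lborel_pair.integral_fst'[OF Gi, symmetric])
 also have "\<dots> = (\<integral>t. (\<integral>r. q (t, r) \<partial>(lborel \<Otimes>\<^sub>M V)) \<partial>lborel)"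
 proof (rule integral_cong_AE)
  show "(\<lambda>t. \<integral>y. ?G (t, y) \<partial>lborel) \<in> borel_measurable lborel"
   using Gm by (intro lborel.borel_measurable_lebesgue_integral) (simp add: case_prod_unfold)
  show "(\<lambda>t. \<integral>r. q (t, r) \<partial>(lborel \<Otimes>\<^sub>M V)) \<in> borel_measurable lborel"
   using qm by (intro LV.P.borel_measurable_lebesgue_integral) (simp add: case_prod_unfold)
  show "AE t in lborel. (\<integral>y. ?G (t, y) \<partial>lborel) = (\<integral>r. q (t, r) \<partial>(lborel \<Otimes>\<^sub>M V))"
   using t_slice by eventually_elim (use LV.integral_fst' in simp)
 qed
 also have "\<dots> = integral\<^sup>L M3 q" by (rule L3.integral_fst'[OF q])
 finally show "integral\<^sup>L (lborel2) ?G = integral\<^sup>L M3 q" .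
qed

lemma integrable_M3_times:
 assumes "integrable M3 q" and [measurable]: "r \<in> borel_measurable M3" and "\<And>z. norm (r z) \<le> B"
 shows "integrable M3 (\<lambda>z. q z * r z :: complex)"
proof (rule Bochner_Integration.integrable_bound)
 show "integrable M3 (\<lambda>z. B *\<^sub>R q z)" using assms by simp
 show "AE z in M3. norm (q z * r z) \<le> norm (B *\<^sub>R q z)"
 proof (rule AE_I2)
  fix z
  have "norm (q z * r z) \<le> norm (q z) * B" unfolding norm_mult by (intro mult_left_mono assms) simp
  also have "\<dots> \<le> norm (B *\<^sub>R q z)" by (simp add: mult.commute mult_right_mono)
  finally show "norm (q z * r z) \<le> norm (B *\<^sub>R q z)" .
 qed
qed (use assms in measurable)

lemma Y_M3 [measurable]: "(\<lambda>z. cnj (Y j (snd (snd z)))) \<in> borel_measurable M3"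
 by (rule measurable_compose[OF measurable_compose[OF measurable_compose[OF measurable_snd measurable_snd] Y_measurable] measurable_cnj])

lemma mode_add: "integrable V p ==> integrable V q ==> mode_coeff V Y j (\<lambda>x. p x + q x) = mode_coeff V Y j p + mode_coeff V Y j q"
 using integrable_times_Y by (simp add: mode_coeff_def distrib_right)

lemma mode_sum:
 assumes "\<And>i. i < k ==> integrable V (q i)"
 shows "mode_coeff V Y j (\<lambda>x. \<Sum>i<(k::nat). d i *\<^sub>R q i x) = (\<Sum>i<k. d i *\<^sub>R mode_coeff V Y j (q i))"
proof -
 have "mode_coeff V Y j (\<lambda>x. \<Sum>i<k. d i *\<^sub>R q i x) = (\<integral>x. (\<Sum>i<k. d i *\<^sub>R (q i x * cnj (Y j x))) \<partial>V)"
  by (simp add: mode_coeff_def sum_distrib_right)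
 also have "\<dots> = (\<Sum>i<k. d i *\<^sub>R mode_coeff V Y j (q i))"
  unfolding mode_coeff_def
  by (subst Bochner_Integration.integral_sum) (use assms integrable_times_Y in auto)
 finally show ?thesis .
qed

lemma hmode_box: "AE y in lborel. 0 < y --> integrable lborel (\<lambda>t. indicator {-T..T} t *\<^sub>R hmode j t y)"
proof -
 have *: "AE y in lborel. y \<in> {a..b} --> integrable lborel (\<lambda>t. indicator {-T..T} t *\<^sub>R hmode j t y)" if a: "0 < a" for a b
 proof -
  let ?q = "\<lambda>p. (indicator {-T..T} (fst p) *\<^sub>R indicator {a..b} (fst (snd p)) *\<^sub>R u (fst p) (fst (snd p)) (snd (snd p))) * cnj (Y j (snd (snd p)))"
  have "integrable M3 ?q" by (rule integrable_M3_times[OF u_box[OF a] Y_M3, of _ "BY j"]) (use BY in auto)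
  from integral_reassoc(1)[OF this]
  have "integrable (lborel2) (\<lambda>(t, y). indicator {-T..T} t *\<^sub>R indicator {a..b} y *\<^sub>R mode_coeff V Y j (u t y))"
   by (simp add: case_prod_unfold mode_coeff_def)
  from lborel_pair.AE_integrable_snd[OF this]
  show ?thesis by eventually_elim (use a in \<open>auto simp: hmode_pos\<close>)
 qed
 show ?thesis by (rule AE_pos_exhaust[OF *])
qed

text \<open>\<open>Hdot_slice_bound\<close> turns the uniform energy bound on the approximations of
  \<open>v\<close> into the rate \<open>y^\<alpha>\<close> for slices. Positivity of
  \<open>k\<close> guarantees the term \<open>i = 0\<close>, which will carry the boundary
  value.\<close>

lemma form_obtain:
 obtains c :: "nat => real" and v k C where "0 < (k::nat)" "0 \<le> C"
  "\<And>t y x. 0 < y ==> u t y x = (\<Sum>i<k. (c i * y ^ (2 * i) * chi y) *\<^sub>R (wave_op A g ^^ i) f t x) + v t y x"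
  "(\<lambda>p. indicator {0<..} (fst (snd p)) *\<^sub>R v (fst p) (fst (snd p)) (snd (snd p))) \<in> borel_measurable M3"
  "AE p in lborel2. 0 < snd p --> (\<integral>\<^sup>+x. ennreal (norm (v (fst p) (snd p) x)) \<partial>V) \<le> ennreal (C * snd p powr \<alpha>)"
proof -
 define k where "k = (LEAST k::nat. (1 + \<alpha>) / 2 < real k)"
 have "(1 + \<alpha>) / 2 < real k" unfolding k_def by (rule LeastI_ex) (rule reals_Archimedean2)
 then have k: "0 < k" using \<alpha>0 by (cases k) auto
 obtain c v where v: "Linf_Hdot A g V \<alpha> v"
  and eq: "\<And>t y x. 0 < y ==> u t y x = (\<Sum>i<k. (c i * y ^ (2 * i) * chi y) *\<^sub>R (wave_op A g ^^ i) f t x) + v t y x"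
  using form unfolding solution_form_def k_def by blast
 have vm: "(\<lambda>p. indicator {0<..} (fst (snd p)) *\<^sub>R v (fst p) (fst (snd p)) (snd (snd p))) \<in> borel_measurable M3"
  using v by (simp add: Linf_Hdot_def set_borel_measurable_def case_prod_unfold indicator_times)
 obtain C0 where C0: "AE t in lborel. \<exists>ws. Hdot_approx A g V \<alpha> ws (v t) \<and> (\<forall>i. energy A g V \<alpha> (ws i) \<le> ennreal C0)"
  using v unfolding Linf_Hdot_def by blast
 define C1 where "C1 = max C0 0"
 define C where "C = C1 / 2 + measure V UNIV / (4 * \<alpha>)"
 have C: "0 \<le> C" using \<alpha>0 by (simp add: C_def C1_def)
 have "AE t in lborel. AE y in lborel. 0 < y --> (\<integral>\<^sup>+x. ennreal (norm (v t y x)) \<partial>V) \<le> ennreal (C * y powr \<alpha>)"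
  using C0
 proof eventually_elim
  case (elim t)
  then obtain ws where ws: "Hdot_approx A g V \<alpha> ws (v t)" "\<And>i. energy A g V \<alpha> (ws i) \<le> ennreal C0" by blast
  have le: "ennreal C0 \<le> ennreal C1" by (simp add: C1_def ennreal_leI)
  have en: "energy A g V \<alpha> (ws i) \<le> ennreal C1" for i by (rule order_trans[OF ws(2) le])
  have "(\<lambda>r. (t, r)) \<in> measurable (lborel \<Otimes>\<^sub>M V) M3" by measurable
  from measurable_compose[OF this vm]
  have "(\<lambda>p. indicator {0<..} (fst p) *\<^sub>R v t (fst p) (snd p)) \<in> borel_measurable (lborel \<Otimes>\<^sub>M V)" by simp
  from Hdot_slice_bound[OF \<alpha>0 ws(1) en _ this] show ?case by (simp add: C_def C1_def)
 qed
 moreover have "AE p in lborel2. 0 < snd p --> (\<integral>\<^sup>+x. ennreal (norm (v (fst p) (snd p) x)) \<partial>V) \<le> ennreal (C * snd p powr \<alpha>)"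
  if ae: "AE t in lborel. AE y in lborel. 0 < y --> (\<integral>\<^sup>+x. ennreal (norm (v t y x)) \<partial>V) \<le> ennreal (C * y powr \<alpha>)"
 proof -
  let ?N = "\<lambda>p. \<integral>\<^sup>+x. ennreal (norm (indicator {0<..} (snd p) *\<^sub>R v (fst p) (snd p) x)) \<partial>V"
  have [measurable]: "?N \<in> borel_measurable (lborel2)" using slice_measurable[OF vm] by simp
  have "AE t in lborel. AE y in lborel. 0 < snd (t, y) --> ?N (t, y) \<le> ennreal (C * snd (t, y) powr \<alpha>)"
   using ae by (elim eventually_mono) simp
  moreover have "{p \<in> space (lborel2). 0 < snd p --> ?N p \<le> ennreal (C * snd p powr \<alpha>)} \<in> sets (lborel2)" by measurable
  ultimately have "AE p in lborel2. 0 < snd p --> ?N p \<le> ennreal (C * snd p powr \<alpha>)" by (intro lborel_pair.AE_pair_measure)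
  then show ?thesis by eventually_elim simp
 qed
 ultimately show ?thesis using that[OF k C eq vm] by blast
qed

end

context kg_problem
begin

text \<open>No regularity of the iterates of \<open>wave_op\<close> is established. For almost every
  \<open>y < 1\<close>, however, \<open>u - v\<close> is well behaved and is an even polynomial in
  \<open>y\<close> with these iterates as coefficients. \<open>even_polynomial_elimination\<close>
  hands good behaviour on to each coefficient, first over the manifold and then in time.\<close>

lemma mode_structure:
 obtains k C gs where "0 < (k::nat)" "0 \<le> C" "\<And>i. i < k ==> integrable lborel (gs i :: real => complex)"
  "AE p in lborel2. 0 < snd p -->
    norm (hmode j (fst p) (snd p) - (\<Sum>i<k. (snd p ^ (2 * i) * chi (snd p)) *\<^sub>R gs i (fst p))) \<le> C * snd p powr \<alpha>"
proof (rule form_obtain)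
 fix c :: "nat => real" and v k C
 assume k: "0 < (k::nat)" and C: "0 \<le> C"
  and u: "\<And>t y x. 0 < y ==> u t y x = (\<Sum>i<k. (c i * y ^ (2 * i) * chi y) *\<^sub>R (wave_op A g ^^ i) f t x) + v t y x"
  and vm: "(\<lambda>p. indicator {0<..} (fst (snd p)) *\<^sub>R v (fst p) (fst (snd p)) (snd (snd p))) \<in> borel_measurable M3"
  and vb: "AE p in lborel2. 0 < snd p --> (\<integral>\<^sup>+x. ennreal (norm (v (fst p) (snd p) x)) \<partial>V) \<le> ennreal (C * snd p powr \<alpha>)"
 obtain T where T: "0 < T" "\<And>t x. T < \<bar>t\<bar> ==> f t x = 0" using test_time_support[OF test] by blast
 define W where "W = (\<lambda>i t x. c i *\<^sub>R (wave_op A g ^^ i) f t x)"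
 define w where "w = (\<lambda>i t. mode_coeff V Y j (W i t))"
 have uW: "u t y = (\<lambda>x. (\<Sum>i<k. (y ^ (2 * i) * chi y) *\<^sub>R W i t x) + v t y x)" if "0 < y" for t y
  unfolding u[OF that] W_def by (simp add: mult_ac)
 have good: "AE p in lborel2. 0 < snd p --> integrable V (u (fst p) (snd p)) \<and> integrable V (v (fst p) (snd p)) \<and>
   (\<integral>\<^sup>+x. ennreal (norm (v (fst p) (snd p) x)) \<partial>V) \<le> ennreal (C * snd p powr \<alpha>)"
  using u_slice_integrable vb
 proof eventually_elim
  case (elim p)
  then show ?case using slice_meas[OF vm, of "snd p" "fst p"]
   by (auto simp: integrable_iff_bounded intro: le_less_trans)
 qed
 \<comment> \<open>First elimination, at a fixed time: the property is integrability over the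
   manifold.\<close>
 have Wint: "AE t in lborel. \<forall>i<k. integrable V (W i t)"
  using lborel_pair.AE_pair[OF good]
 proof eventually_elim
  case (elim t)
  have "AE y in lborel. 0 < y \<and> y < 1 --> integrable V (\<lambda>x. \<Sum>i<k. y ^ (2 * i) *\<^sub>R W i t x)"
   using elim
  proof eventually_elim
   case (elim y)
   show ?case
   proof
    assume y: "0 < y \<and> y < 1"
    then have "integrable V (\<lambda>x. u t y x - v t y x)" using elim by auto
    moreover have "chi y = 1" using cutoff y by (simp add: smooth_cutoff_def)
    ultimately show "integrable V (\<lambda>x. \<Sum>i<k. y ^ (2 * i) *\<^sub>R W i t x)" using uW[of y t] y by simp
   qed
  qed
  then have "integrable V (W i t)" if "i < k" for i
   by (rule even_polynomial_elimination[where P = "integrable V", rotated 2]) (use that in auto)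
  then show ?case by blast
 qed
 have split: "AE p in lborel2. 0 < snd p -->
   hmode j (fst p) (snd p) = (\<Sum>i<k. (snd p ^ (2 * i) * chi (snd p)) *\<^sub>R w i (fst p)) + mode_coeff V Y j (v (fst p) (snd p)) \<and>
   norm (mode_coeff V Y j (v (fst p) (snd p))) \<le> BY j * C * snd p powr \<alpha>"
  using good AE_fst[OF Wint]
 proof eventually_elim
  case (elim p)
  show ?case
  proof
   assume y: "0 < snd p"
   have i: "integrable V (v (fst p) (snd p))" using elim y by blast
   have "hmode j (fst p) (snd p) = mode_coeff V Y j (\<lambda>x. (\<Sum>i<k. (snd p ^ (2 * i) * chi (snd p)) *\<^sub>R W i (fst p) x) + v (fst p) (snd p) x)"
    by (simp only: hmode_pos[OF y] uW[OF y])
   also have "\<dots> = mode_coeff V Y j (\<lambda>x. \<Sum>i<k. (snd p ^ (2 * i) * chi (snd p)) *\<^sub>R W i (fst p) x) + mode_coeff V Y j (v (fst p) (snd p))"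
    by (rule mode_add) (use elim i in auto)
   also have "mode_coeff V Y j (\<lambda>x. \<Sum>i<k. (snd p ^ (2 * i) * chi (snd p)) *\<^sub>R W i (fst p) x) = (\<Sum>i<k. (snd p ^ (2 * i) * chi (snd p)) *\<^sub>R w i (fst p))"
    unfolding w_def by (rule mode_sum) (use elim in blast)
   finally have 1: "hmode j (fst p) (snd p) = (\<Sum>i<k. (snd p ^ (2 * i) * chi (snd p)) *\<^sub>R w i (fst p)) + mode_coeff V Y j (v (fst p) (snd p))" .
   have "norm (mode_coeff V Y j (v (fst p) (snd p))) \<le> BY j * (C * snd p powr \<alpha>)"
    by (rule norm_mode_le[OF i]) (use elim y C in auto)
   with 1 show "hmode j (fst p) (snd p) = (\<Sum>i<k. (snd p ^ (2 * i) * chi (snd p)) *\<^sub>R w i (fst p)) + mode_coeff V Y j (v (fst p) (snd p)) \<and>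
     norm (mode_coeff V Y j (v (fst p) (snd p))) \<le> BY j * C * snd p powr \<alpha>" by (simp add: mult.assoc)
  qed
 qed
 define vj where "vj = (\<lambda>p. mode_coeff V Y j (\<lambda>x. indicator {0<..} (snd p) *\<^sub>R v (fst p) (snd p) x))"
 have vjm: "vj \<in> borel_measurable (lborel2)" using mode_measurable[OF vm, of j] by (simp add: vj_def)
 have w0: "w i t = 0" if "T < \<bar>t\<bar>" for i t
  using wave_iterate_zero[OF T(2) that] by (simp add: w_def W_def mode_coeff_def)
 \<comment> \<open>Second elimination, now for the modes as functions of time: the property is
   agreement almost everywhere with an integrable function. The mode of \<open>v\<close> is bounded
   and all \<open>w i\<close> vanish outside \<open>[- T, T]\<close>, so restricting to this
   interval suffices.\<close>
 have "AE y in lborel. 0 < y \<and> y < 1 --> (\<exists>q'. integrable lborel q' \<and> (AE t in lborel. (\<Sum>i<k. y ^ (2 * i) *\<^sub>R w i t) = q' t))"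
  using lborel_pair.AE_pair_swap[OF split] hmode_box[of T j]
 proof eventually_elim
  case (elim y)
  show ?case
  proof
   assume y: "0 < y \<and> y < 1"
   have chi: "chi y = 1" using cutoff y by (simp add: smooth_cutoff_def)
   define q' where "q' = (\<lambda>t. indicator {-T..T} t *\<^sub>R hmode j t y - indicator {-T..T} t *\<^sub>R vj (t, y))"
   have vjy: "vj (t, y) = mode_coeff V Y j (v t y)" for t using y by (simp add: vj_def)
   have [measurable]: "(\<lambda>t. vj (t, y)) \<in> borel_measurable lborel"
   proof -
    have "(\<lambda>t. (t, y)) \<in> measurable lborel (lborel2)" by measurable
    from measurable_compose[OF this vjm] show ?thesis .
   qed
   have "integrable lborel (\<lambda>t. indicator {-T..T} t *\<^sub>R vj (t, y))"
   proof (rule Bochner_Integration.integrable_bound)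
    show "integrable lborel (\<lambda>t. (BY j * C * y powr \<alpha>) *\<^sub>R (indicator {-T..T} t :: real))"
     by (intro integrable_scaleR_right integrable_real_indicator) (auto simp: emeasure_lborel_Icc_eq)
    have e: "AE t in lborel. norm (vj (t, y)) \<le> BY j * C * y powr \<alpha>" using elim(1) y by (auto simp: vjy)
    show "AE t in lborel. norm (indicator {-T..T} t *\<^sub>R vj (t, y)) \<le> norm ((BY j * C * y powr \<alpha>) *\<^sub>R (indicator {-T..T} t :: real))"
     using e by eventually_elim (auto simp: indicator_def)
   qed measurable
   then have "integrable lborel q'" unfolding q'_def using elim(2) y by (intro Bochner_Integration.integrable_diff) auto
   moreover have "AE t in lborel. (\<Sum>i<k. y ^ (2 * i) *\<^sub>R w i t) = q' t"
    using elim(1)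
   proof eventually_elim
    case (elim t)
    show ?case
    proof (cases "T < \<bar>t\<bar>")
     case True
     then have "q' t = 0" by (auto simp: q'_def indicator_def)
     then show ?thesis using w0[OF True] by simp
    next
     case False
     then have "q' t = hmode j t y - vj (t, y)" by (auto simp: q'_def indicator_def abs_le_iff not_less)
     then show ?thesis using elim y chi by (simp add: vjy)
    qed
   qed
   ultimately show "\<exists>q'. integrable lborel q' \<and> (AE t in lborel. (\<Sum>i<k. y ^ (2 * i) *\<^sub>R w i t) = q' t)" by blast
  qed
 qed
 then have "\<exists>q'. integrable lborel q' \<and> (AE t in lborel. w i t = q' t)" if "i < k" for i
 proof (rule even_polynomial_elimination[where P = "\<lambda>q. \<exists>q'. integrable lborel q' \<and> (AE t in lborel. q t = q' t)", rotated 2])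
  fix p q :: "real => complex"
  assume "\<exists>q'. integrable lborel q' \<and> (AE t in lborel. p t = q' t)" "\<exists>q'. integrable lborel q' \<and> (AE t in lborel. q t = q' t)"
  then obtain p' q' where a: "integrable lborel p'" "AE t in lborel. p t = p' t" "integrable lborel q'" "AE t in lborel. q t = q' t" by blast
  have "AE t in lborel. p t + q t = p' t + q' t" using a(2,4) by eventually_elim simp
  then show "\<exists>q'. integrable lborel q' \<and> (AE t in lborel. p t + q t = q' t)"
   using a by (intro exI[of _ "\<lambda>t. p' t + q' t"]) auto
 next
  fix c :: real and p :: "real => complex"
  assume "\<exists>q'. integrable lborel q' \<and> (AE t in lborel. p t = q' t)"
  then obtain p' where a: "integrable lborel p'" "AE t in lborel. p t = p' t" by blast
  have "AE t in lborel. c *\<^sub>R p t = c *\<^sub>R p' t" using a(2) by eventually_elim simp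
  then show "\<exists>q'. integrable lborel q' \<and> (AE t in lborel. c *\<^sub>R p t = q' t)"
   using a by (intro exI[of _ "\<lambda>t. c *\<^sub>R p' t"]) auto
 qed (rule that)
 then obtain gs where gs: "\<And>i. i < k ==> integrable lborel (gs i)" "\<And>i. i < k ==> AE t in lborel. w i t = gs i t" by metis
 have "AE t in lborel. \<forall>i\<in>{..<k}. w i t = gs i t" by (rule AE_finite_allI) (use gs(2) in auto)
 from AE_fst[OF this] have wg: "AE p in lborel \<Otimes>\<^sub>M (lborel :: real measure). \<forall>i\<in>{..<k}. w i (fst p) = gs i (fst p)" .
 have "AE p in lborel2. 0 < snd p -->
    norm (hmode j (fst p) (snd p) - (\<Sum>i<k. (snd p ^ (2 * i) * chi (snd p)) *\<^sub>R gs i (fst p))) \<le> BY j * C * snd p powr \<alpha>"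
  using split wg
 proof eventually_elim
  case (elim p)
  have "(\<Sum>i<k. (snd p ^ (2 * i) * chi (snd p)) *\<^sub>R gs i (fst p)) = (\<Sum>i<k. (snd p ^ (2 * i) * chi (snd p)) *\<^sub>R w i (fst p))"
   by (rule sum.cong) (use elim(2) in auto)
  then show ?case using elim(1) by simp
 qed
 moreover have "0 \<le> BY j * C" using C BY(1)[of j] by simp
 ultimately show ?thesis using that[of k "BY j * C" gs] k gs(1) by blast
qed

text \<open>On a space of finite volume a lower bound on the integral of the norm forces one on the
  integral of its square. It prepares a contradiction with the averaged trace, which is formulated
  with squares.\<close>

lemma slice_lower_bound:
 assumes q: "q \<in> borel_measurable V" and e: "0 < e" "ennreal e \<le> (\<integral>\<^sup>+x. ennreal (norm (q x)) \<partial>V)"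
 shows "ennreal (e / (2 * (measure V UNIV / e + 1))) \<le> (\<integral>\<^sup>+x. ennreal ((norm (q x :: complex))\<^sup>2) \<partial>V)"
proof -
 \<comment> \<open>Chosen so that the constant term \<open>measure V UNIV / (2 c)\<close> takes at
   most half of \<open>e\<close>.\<close>
 define c where "c = measure V UNIV / e + 1"
 have c: "0 < c" using e by (simp add: c_def add_nonneg_pos)
 define I where "I = (\<integral>\<^sup>+x. ennreal ((norm (q x))\<^sup>2) \<partial>V)"
 have le: "measure V UNIV / (2 * c) \<le> e / 2"
 proof -
  have "measure V UNIV \<le> e * c" using e by (simp add: c_def field_simps)
  then show ?thesis using c by (simp add: field_simps)
 qed
 have "ennreal e \<le> (\<integral>\<^sup>+x. ennreal (norm (q x)) \<partial>V)" by (rule e)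
 also have "\<dots> \<le> (\<integral>\<^sup>+x. ennreal (c / 2) * ennreal ((norm (q x))\<^sup>2) + ennreal (1 / (2 * c)) \<partial>V)"
  by (intro nn_integral_mono ennreal_am_gm c)
 also have "\<dots> = ennreal (c / 2) * I + ennreal (1 / (2 * c)) * emeasure V UNIV"
  unfolding I_def using q by (simp add: nn_integral_add nn_integral_cmult)
 finally have m: "ennreal e \<le> ennreal (c / 2) * I + ennreal (1 / (2 * c)) * ennreal (measure V UNIV)" by (simp add: V.emeasure_eq_measure)
 show ?thesis
 proof (cases I)
  case (real r)
  have "ennreal e \<le> ennreal (c / 2 * r + 1 / (2 * c) * measure V UNIV)"
   using m real c by (subst ennreal_mult_plus_mult) auto
  then have "e \<le> c / 2 * r + 1 / (2 * c) * measure V UNIV" using real c by (subst (asm) ennreal_le_iff) auto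
  then have "e / 2 \<le> c / 2 * r" using le by simp
  then have "e / (2 * c) \<le> r" using c e by (simp add: field_simps)
  then show ?thesis using real by (simp add: I_def[symmetric] c_def[symmetric] ennreal_leI)
 qed (simp add: I_def[symmetric])
qed

text \<open>If \<open>gs 0\<close> and the mode of \<open>f\<close> differed at a time
  \<open>t\<close> by \<open>d > 0\<close>, the remaining terms of the expansion would be below
  \<open>d / 2\<close> for small \<open>y\<close>. The slices of \<open>u - f\<close> would then
  have squared norm at least a fixed \<open>e'\<close>, contradicting the averaged trace.\<close>

lemma boundary_mode:
 assumes k: "0 < (k::nat)" and C: "0 \<le> C"
  and ae: "AE p in lborel2. 0 < snd p -->
    norm (hmode j (fst p) (snd p) - (\<Sum>i<k. (snd p ^ (2 * i) * chi (snd p)) *\<^sub>R gs i (fst p))) \<le> C * snd p powr \<alpha>"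
 shows "AE t in lborel. gs 0 t = mode_coeff V Y j (f t)"
proof -
 have fc: "continuous_on UNIV (f t)" for t
 proof -
  have c: "continuous_on (UNIV \<times> UNIV) (\<lambda>(p, x). f p x)"
   using smooth_mfd_continuous[OF open_UNIV] test by (auto simp: test_mfd_def)
  have "continuous_on UNIV (\<lambda>x. (t, x :: 'm))" by (intro continuous_intros)
  from continuous_on_compose2[OF c this] show ?thesis by auto
 qed
 have fm [measurable]: "f t \<in> borel_measurable V" for t
  unfolding measurable_cong_sets[OF sets_V refl] by (rule borel_measurable_continuous_onI[OF fc])
 have fi: "integrable V (f t)" for t
 proof -
  obtain B where "\<And>x. norm (f t x) \<le> B" using continuous_bounded[OF fc] by blast
  then show ?thesis by (intro V.integrable_const_bound[of _ B]) auto
 qed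
 have "AE t in lborel. ((\<lambda>\<delta>. ennreal (1 / \<delta>) *
      (\<integral>\<^sup>+(y, x). ennreal ((cmod (u t y x - f t x))\<^sup>2) * indicator {0<..<\<delta>} y \<partial>(lborel \<Otimes>\<^sub>M V)))
     \<longlongrightarrow> 0) (at_right 0)"
  using boundary by (simp add: boundary_value_def)
 then show ?thesis
  using lborel_pair.AE_pair[OF ae] lborel_pair.AE_pair[OF u_slice_integrable]
 proof eventually_elim
  case (elim t)
  note lim = elim(1)
  show "gs 0 t = mode_coeff V Y j (f t)"
  proof (rule ccontr)
   assume ne: "gs 0 t \<noteq> mode_coeff V Y j (f t)"
   define d where "d = norm (gs 0 t - mode_coeff V Y j (f t))"
   have d: "0 < d" using ne by (simp add: d_def)
   let ?r = "\<lambda>y. (\<Sum>i\<in>{1..<k}. y ^ (2 * i) * norm (gs i t)) + C * y powr \<alpha>"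
   have "(?r \<longlongrightarrow> (\<Sum>i\<in>{1..<k}. 0 ^ (2 * i) * norm (gs i t)) + C * 0) (at_right 0)"
    by (intro tendsto_intros tendsto_zero_powrI \<alpha>0) (auto simp: \<alpha>0 eventually_at_filter)
   moreover have "(\<Sum>i\<in>{1..<k}. 0 ^ (2 * i) * norm (gs i t)) + C * 0 = 0" by (simp add: zero_power)
   ultimately have "(?r \<longlongrightarrow> 0) (at_right 0)" by simp
   then have "\<forall>\<^sub>F y in at_right 0. ?r y < d / 2" by (rule order_tendstoD) (use d in simp)
   then obtain b where b: "0 < b" "\<And>y. 0 < y ==> y < b ==> ?r y < d / 2"
    unfolding eventually_at_right_field by auto
   define \<delta>0 where "\<delta>0 = min b 1"
   \<comment> \<open>A mode of size at least \<open>d / 2\<close> forces the slice to have norm at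
     least \<open>d / (2 BY j)\<close>, because the eigenfunction is bounded by
     \<open>BY j\<close>.\<close>
   define e where "e = d / (2 * BY j)"
   have e: "0 < e" using d BY(1)[of j] by (simp add: e_def)
   define e' where "e' = e / (2 * (measure V UNIV / e + 1))"
   have "0 < measure V UNIV / e + 1" using e by (simp add: add_nonneg_pos)
   then have e': "0 < e'" using e by (simp add: e'_def)
   have low: "AE y in lborel. 0 < y \<and> y < \<delta>0 --> ennreal e' \<le> (\<integral>\<^sup>+x. ennreal ((norm (u t y x - f t x))\<^sup>2) \<partial>V)"
    using elim(2,3)
   proof eventually_elim
    case (elim y)
    show ?case
    proof
     assume y: "0 < y \<and> y < \<delta>0"
     then have y1: "y < 1" "y < b" "0 < y" by (auto simp: \<delta>0_def)
     have chi: "chi y = 1" using cutoff y1 by (simp add: smooth_cutoff_def)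
     have ui: "integrable V (u t y)" using elim y by simp
     have S: "(\<Sum>i<k. (y ^ (2 * i) * chi y) *\<^sub>R gs i t) = gs 0 t + (\<Sum>i\<in>{1..<k}. y ^ (2 * i) *\<^sub>R gs i t)"
     proof -
      have "{..<k} = insert 0 {1..<k}" using k by auto
      then show ?thesis by (simp add: chi)
     qed
     have "norm (hmode j t y - gs 0 t) \<le> norm (hmode j t y - (\<Sum>i<k. (y ^ (2 * i) * chi y) *\<^sub>R gs i t)) + norm (\<Sum>i\<in>{1..<k}. y ^ (2 * i) *\<^sub>R gs i t)"
      unfolding S using norm_triangle_ineq[of "hmode j t y - (gs 0 t + (\<Sum>i\<in>{1..<k}. y ^ (2 * i) *\<^sub>R gs i t))" "\<Sum>i\<in>{1..<k}. y ^ (2 * i) *\<^sub>R gs i t"] by simp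
     also have "\<dots> \<le> C * y powr \<alpha> + (\<Sum>i\<in>{1..<k}. y ^ (2 * i) * norm (gs i t))"
      using elim y by (intro add_mono sum_norm_le) auto
     also have "\<dots> < d / 2" using b(2)[of y] y1 by simp
     finally have "d / 2 \<le> norm (hmode j t y - mode_coeff V Y j (f t))"
      using norm_triangle_ineq[of "gs 0 t - hmode j t y" "hmode j t y - mode_coeff V Y j (f t)"]
      by (simp add: d_def norm_minus_commute)
     also have "hmode j t y - mode_coeff V Y j (f t) = mode_coeff V Y j (\<lambda>x. u t y x - f t x)"
      using mode_add[OF ui integrable_minus[OF fi[of t]], of j] y1 by (simp add: hmode_pos) (simp add: mode_coeff_def)
     finally have d2: "d / 2 \<le> norm (mode_coeff V Y j (\<lambda>x. u t y x - f t x))" .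
     have "ennreal e \<le> (\<integral>\<^sup>+x. ennreal (norm (u t y x - f t x)) \<partial>V)"
     proof (rule ccontr)
      assume "\<not> ?thesis"
      then have "(\<integral>\<^sup>+x. ennreal (norm (u t y x - f t x)) \<partial>V) < ennreal e" by simp
      then obtain e2 where e2: "0 \<le> e2" "(\<integral>\<^sup>+x. ennreal (norm (u t y x - f t x)) \<partial>V) = ennreal e2" "e2 < e"
       by (cases "\<integral>\<^sup>+x. ennreal (norm (u t y x - f t x)) \<partial>V") (auto simp: ennreal_less_iff)
      have "norm (mode_coeff V Y j (\<lambda>x. u t y x - f t x)) \<le> BY j * e2"
       by (rule norm_mode_le) (use ui fi e2 in auto)
      also have "\<dots> < BY j * e" using e2 BY(1)[of j] by (intro mult_strict_left_mono) auto
      also have "\<dots> = d / 2" using BY(1)[of j] by (simp add: e_def)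
      finally show False using d2 by simp
     qed
     then show "ennreal e' \<le> (\<integral>\<^sup>+x. ennreal ((norm (u t y x - f t x))\<^sup>2) \<partial>V)"
      unfolding e'_def by (intro slice_lower_bound e) (use ui in auto)
    qed
   qed
   have "ennreal e' \<le> ennreal (1 / \<delta>) * (\<integral>\<^sup>+(y, x). ennreal ((cmod (u t y x - f t x))\<^sup>2) * indicator {0<..<\<delta>} y \<partial>(lborel \<Otimes>\<^sub>M V))"
    if \<delta>: "0 < \<delta>" "\<delta> < \<delta>0" for \<delta>
   proof -
    have "(\<lambda>r. (t, r)) \<in> measurable (lborel \<Otimes>\<^sub>M V) M3" by measurable
    from measurable_compose[OF this u_measurable]
    have [measurable]: "(\<lambda>p. indicator {0<..} (fst p) *\<^sub>R u t (fst p) (snd p)) \<in> borel_measurable (lborel \<Otimes>\<^sub>M V)" by simp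
    let ?s = "\<lambda>p. ennreal ((norm (indicator {0<..} (fst p) *\<^sub>R u t (fst p) (snd p) - f t (snd p)))\<^sup>2) * indicator {0<..<\<delta>} (fst p)"
    have sm: "?s \<in> borel_measurable (lborel \<Otimes>\<^sub>M V)" by measurable
    have "ennreal e' * ennreal \<delta> = (\<integral>\<^sup>+y. ennreal e' * indicator {0<..<\<delta>} y \<partial>lborel)"
     using \<delta> by (subst nn_integral_cmult_indicator) auto
    also have "\<dots> \<le> (\<integral>\<^sup>+y. (\<integral>\<^sup>+x. ?s (y, x) \<partial>V) \<partial>lborel)"
    proof (rule nn_integral_mono_AE)
     show "AE y in lborel. ennreal e' * indicator {0<..<\<delta>} y \<le> (\<integral>\<^sup>+x. ?s (y, x) \<partial>V)"
      using low by eventually_elim (use \<delta> in \<open>auto simp: indicator_def\<close>)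
    qed
    also have "\<dots> = integral\<^sup>N (lborel \<Otimes>\<^sub>M V) ?s" by (rule V.nn_integral_fst[OF sm])
    also have "\<dots> = (\<integral>\<^sup>+(y, x). ennreal ((cmod (u t y x - f t x))\<^sup>2) * indicator {0<..<\<delta>} y \<partial>(lborel \<Otimes>\<^sub>M V))"
     by (rule nn_integral_cong) (auto simp: indicator_def)
    finally have "ennreal (1 / \<delta>) * (ennreal e' * ennreal \<delta>) \<le> ennreal (1 / \<delta>) * (\<integral>\<^sup>+(y, x). ennreal ((cmod (u t y x - f t x))\<^sup>2) * indicator {0<..<\<delta>} y \<partial>(lborel \<Otimes>\<^sub>M V))"
     by (rule mult_left_mono) simp
    moreover have "ennreal (1 / \<delta>) * (ennreal e' * ennreal \<delta>) = ennreal e'"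
     using \<delta> e' by (simp flip: ennreal_mult)
    ultimately show ?thesis by simp
   qed
   then have "\<forall>\<^sub>F \<delta> in at_right 0. ennreal e' \<le> ennreal (1 / \<delta>) * (\<integral>\<^sup>+(y, x). ennreal ((cmod (u t y x - f t x))\<^sup>2) * indicator {0<..<\<delta>} y \<partial>(lborel \<Otimes>\<^sub>M V))"
    unfolding eventually_at_right_field using b by (intro exI[of _ \<delta>0]) (auto simp: \<delta>0_def)
   from tendsto_lowerbound[OF lim this trivial_limit_at_right_real] show False using e' by simp
  qed
 qed
qed

end

section \<open>Separated test functions in the Klein-Gordon equation\<close>

lemma pd_linear:
 assumes "bounded_linear L" "H differentiable (at p)"
 shows "pd a (\<lambda>q. L (H q)) p = L (pd a H p)"
proof -
 have "(H has_derivative frechet_derivative H (at p)) (at p)" using assms(2) frechet_derivative_works by blast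
 from bounded_linear.has_derivative[OF assms(1) this]
 have "((\<lambda>q. L (H q)) has_derivative (\<lambda>v. L (frechet_derivative H (at p) v))) (at p)" .
 from frechet_derivative_at[OF this] show ?thesis unfolding pd_def by metis
qed

lemma pd_cong_open:
 assumes "open S" "p \<in> S" "\<And>q. q \<in> S ==> H q = H' q"
 shows "pd a H p = pd a H' p"
proof -
 have "(H has_derivative D) (at p) \<longleftrightarrow> (H' has_derivative D) (at p)" for D
  using has_derivative_transform_within_open[of H D p UNIV S H'] has_derivative_transform_within_open[of H' D p UNIV S H] assms
  by auto
 then show ?thesis by (simp add: pd_def frechet_derivative_def)
qed

lemma det_differentiable:
 fixes M :: "real^'d::finite => real^'d^'d"
 assumes "\<And>i j. (\<lambda>q. M q $ i $ j) differentiable (at p)"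
 shows "(\<lambda>q. det (M q)) differentiable (at p)"
proof -
 have pr: "(\<lambda>q. \<Prod>i\<in>I. M q $ i $ s i) differentiable (at p)" if "finite I" for s and I :: "'d set"
  using that by induction (auto intro!: differentiable_mult assms)
 have "(\<lambda>q. \<Sum>s\<in>{s. s permutes (UNIV :: 'd set)}. of_int (sign s) * (\<Prod>i\<in>UNIV. M q $ i $ s i)) differentiable (at p)"
  by (intro differentiable_sum ballI differentiable_mult differentiable_const pr finite_permutations) auto
 then show ?thesis by (simp add: det_def)
qed

text \<open>Cramer's rule, which reduces differentiability of the inverse metric to that of
  determinants.\<close>

lemma matrix_inv_component:
 fixes G :: "real^'d::finite^'d"
 assumes "det G \<noteq> 0"
 shows "matrix_inv G $ a $ b = det (\<chi> i j. if j = a then axis b 1 $ i else G $ i $ j) / det G"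
proof -
 have "G *v (matrix_inv G *v axis b 1) = axis b 1"
  using matrix_inv_right[of G] assms by (simp add: invertible_det_nz matrix_vector_mul_assoc)
 then have "matrix_inv G *v axis b 1 = (\<chi> k. det (\<chi> i j. if j = k then axis b 1 $ i else G $ i $ j) / det G)"
  using cramer[OF assms] by blast
 from arg_cong[OF this, of "\<lambda>v. v $ a"]
 show ?thesis by (simp add: matrix_vector_mult_basis column_def)
qed

context riemann
begin

text \<open>Differentiability of these coefficients makes the flux inside the Laplacian
  differentiable, so that a linear map can be moved through the outer derivative.\<close>

lemma metric_differentiable:
 assumes k: "k \<in> A" and p: "p \<in> coord k ` cdom k"
 shows "(\<lambda>q. sqrt (det (g k q)) * matrix_inv (g k q) $ a $ b) differentiable (at p)"
proof -
 have nz: "det (g k q) \<noteq> 0" if "q \<in> coord k ` cdom k" for q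
  using positive_definite_invertible[of "g k q"] metric_pos[OF k that] by (simp add: invertible_det_nz)
 have G: "(\<lambda>q. g k q $ i $ j) differentiable (at p)" for i j
  using smooth_on_has_derivative[OF metric_smooth[OF k] p] differentiableI by blast
 then have d: "(\<lambda>q. det (g k q)) differentiable (at p)" by (rule det_differentiable)
 have s: "(\<lambda>q. sqrt (det (g k q))) differentiable (at p)"
 proof -
  obtain D where D: "((\<lambda>q. det (g k q)) has_derivative D) (at p)" using d unfolding differentiable_def by blast
  have "(sqrt has_derivative (\<lambda>x. (inverse (sqrt (det (g k p))) / 2 * (if 0 < det (g k p) then 1 else -1)) * x)) (at (det (g k p)))"
   unfolding has_field_derivative_def[symmetric] by (rule DERIV_real_sqrt_generic[OF nz[OF p]]) (use nz[OF p] in \<open>auto simp: divide_simps\<close>)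
  from has_derivative_compose[OF D this] show ?thesis by (auto intro: differentiableI)
 qed
 have "(\<lambda>q. det (\<chi> i j. if j = a then axis b 1 $ i else g k q $ i $ j)) differentiable (at p)"
 proof (rule det_differentiable)
  fix i j
  show "(\<lambda>q. (\<chi> i j. if j = a then axis b 1 $ i else g k q $ i $ j) $ i $ j) differentiable (at p)"
   using G by (cases "j = a") simp_all
 qed
 then have "(\<lambda>q. det (\<chi> i j. if j = a then axis b 1 $ i else g k q $ i $ j) / det (g k q)) differentiable (at p)"
  using d nz[OF p] by (intro differentiable_divide)
 from differentiable_mult[OF s this]
 obtain D where D: "((\<lambda>q. sqrt (det (g k q)) * (det (\<chi> i j. if j = a then axis b 1 $ i else g k q $ i $ j) / det (g k q))) has_derivative D) (at p)"
  unfolding differentiable_def by blast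
 have "((\<lambda>q. sqrt (det (g k q)) * matrix_inv (g k q) $ a $ b) has_derivative D) (at p)"
  by (rule has_derivative_transform_within_open[OF D chart(2)[OF k] p]) (simp add: matrix_inv_component[OF nz])
 then show ?thesis by (rule differentiableI)
qed

text \<open>\<open>L\<close> is linear over the reals only, which is enough because the metric has
  real coefficients. It is applied to conjugation followed by a complex factor, since the test
  functions contain \<open>cnj (Y j x)\<close>.\<close>

lemma laplace_linear:
 assumes L: "bounded_linear L" and h: "\<And>k. k \<in> A ==> smooth_on (h \<circ> param k) (coord k ` cdom k)"
 shows "laplace A g (\<lambda>x. L (h x)) x = L (laplace A g h x)"
proof -
 interpret L: bounded_linear L by (rule L)
 define k where "k = chart_at A x"
 have k: "k \<in> A" and x: "x \<in> cdom k" using chart_at unfolding k_def by auto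
 define S where "S = coord k ` cdom k"
 define p where "p = coord k x"
 have p: "p \<in> S" using x by (simp add: p_def S_def)
 have S: "open S" unfolding S_def by (rule chart(2)[OF k])
 define H where "H = h \<circ> param k"
 have H: "smooth_on H S" unfolding H_def S_def by (rule h[OF k])
 let ?r = "\<lambda>a b q. sqrt (det (g k q)) * matrix_inv (g k q) $ a $ b"
 let ?I = "\<lambda>a q. \<Sum>b\<in>UNIV. ?r a b q *\<^sub>R pd b H q"
 have inner: "(\<Sum>b\<in>UNIV. ?r a b q *\<^sub>R pd b (\<lambda>q. L (H q)) q) = L (?I a q)" if "q \<in> S" for a q
 proof -
  have "H differentiable (at q)" using smooth_on_has_derivative[OF H that] differentiableI by blast
  then show ?thesis by (simp add: pd_linear[OF L] L.sum L.scaleR)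
 qed
 have Id: "?I a differentiable (at p)" for a
 proof (intro differentiable_sum ballI differentiable_scaleR finite)
  fix b
  show "?r a b differentiable (at p)" using metric_differentiable[OF k] p by (simp add: S_def)
  have "smooth_on (pd b H) S" unfolding pd_def[abs_def] by (rule smooth_on_frechet_derivative[OF H])
  from smooth_on_has_derivative[OF this p] show "pd b H differentiable (at p)" by (rule differentiableI)
 qed
 have outer: "pd a (\<lambda>q. \<Sum>b\<in>UNIV. ?r a b q *\<^sub>R pd b (\<lambda>q. L (H q)) q) p = L (pd a (?I a) p)" for a
  by (subst pd_cong_open[OF S p inner]) (auto intro: pd_linear[OF L Id])
 have "laplace_coord (g k) (\<lambda>q. L (H q)) p = L (laplace_coord (g k) H p)"
  unfolding laplace_coord_def outer L.scaleR L.sum ..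
 then show ?thesis
  unfolding laplace_def Let_def k_def[symmetric] p_def[symmetric] by (simp add: H_def o_def)
qed

end

lemma has_vector_derivative_powr:
 "0 < z ==> ((\<lambda>y. complex_of_real (y powr b)) has_vector_derivative of_real b * of_real (z powr (b - 1))) (at z)"
 using has_vector_derivative_of_real[of "\<lambda>y. y powr b" "b * z powr (b - 1)" "at z"]
  has_real_derivative_powr[of z b]
 by (auto simp: has_real_derivative_iff_has_vector_derivative)

context kg_problem
begin

lemma laplace_cnj_Y: "laplace A g (\<lambda>x. c * cnj (Y j x)) x = - (c * (of_real (lam j))\<^sup>2 * cnj (Y j x))"
proof -
 have L: "bounded_linear (\<lambda>z. c * cnj z)"
  using bounded_linear_compose[OF bounded_linear_mult_right bounded_linear_cnj] .
 have "- laplace A g (Y j) x = of_real ((lam j)\<^sup>2) * Y j x" using eigen by (simp add: laplace_eigenbasis_def)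
 then have "laplace A g (Y j) x = - (of_real ((lam j)\<^sup>2) * Y j x)" by (metis minus_minus)
 then show ?thesis using laplace_linear[OF L Y_smooth, of j x] by (simp add: mult.assoc)
qed

text \<open>The power \<open>y^(n / 2 - \<alpha>)\<close> in the test function inverts the one in
  \<open>u_def\<close>. Conjugation by it cancels the potential and changes the first-order
  coefficient from \<open>1 - n\<close> to \<open>1 - 2 \<alpha>\<close>.\<close>

lemma KG_op_product:
 fixes \<rho> \<rho>1 \<rho>2 \<theta> \<theta>1 \<theta>2 :: "real => complex"
 assumes \<rho>: "\<And>t. (\<rho> has_vector_derivative \<rho>1 t) (at t)" "\<And>t. (\<rho>1 has_vector_derivative \<rho>2 t) (at t)"
  and \<theta>: "\<And>y. 0 < y ==> (\<theta> has_vector_derivative \<theta>1 y) (at y)" "\<And>y. 0 < y ==> (\<theta>1 has_vector_derivative \<theta>2 y) (at y)"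
  and y: "0 < y"
 shows "(y powr (1 - real n)) *\<^sub>R (\<phi> t y x * KG_op A g n \<alpha> (\<lambda>t y x. of_real (y powr (real n / 2 - \<alpha>)) * \<theta> y * \<rho> t * cnj (Y j x)) t y x)
  = u t y x * cnj (Y j x) * (of_real (y powr (1 - 2 * \<alpha>)) *
     (\<rho>2 t * \<theta> y + \<rho> t * ((of_real (lam j))\<^sup>2 * \<theta> y - \<theta>2 y - of_real ((1 - 2 * \<alpha>) / y) * \<theta>1 y)))"
proof -
 define s where "s = real n / 2 - \<alpha>"
 let ?\<psi> = "\<lambda>t y x. of_real (y powr s) * \<theta> y * \<rho> t * cnj (Y j x)"
 let ?c = "cnj (Y j x)"
 define P where "P = complex_of_real (y powr s)"
 define w where "w = complex_of_real y"
 have w: "w \<noteq> 0" using y by (simp add: w_def)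
 have P1: "complex_of_real (y powr (s - 1)) = P / w" using y by (simp add: P_def w_def powr_diff)
 have P2: "complex_of_real (y powr (s - 1 - 1)) = P / w\<^sup>2" using y by (simp add: P_def w_def powr_diff power2_eq_square)
 have d1: "ddt (\<lambda>r. ?\<psi> r y x) = (\<lambda>r. P * \<theta> y * \<rho>1 r * ?c)"
 proof
  fix r
  show "ddt (\<lambda>r. ?\<psi> r y x) r = P * \<theta> y * \<rho>1 r * ?c" unfolding P_def
   by (rule vector_derivative_at) (intro has_vector_derivative_mult_left has_vector_derivative_mult_right \<rho>)
 qed
 have tt: "ddt (ddt (\<lambda>r. ?\<psi> r y x)) t = P * \<theta> y * \<rho>2 t * ?c"
  unfolding d1 by (rule vector_derivative_at) (intro has_vector_derivative_mult_left has_vector_derivative_mult_right \<rho>)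
 define e1 where "e1 = (\<lambda>z. of_real (z powr s) * \<theta>1 z + of_real s * of_real (z powr (s - 1)) * \<theta> z)"
 have e1: "((\<lambda>z. ?\<psi> t z x) has_vector_derivative e1 z * \<rho> t * ?c) (at z)" if z: "0 < z" for z
  unfolding e1_def
  by (intro has_vector_derivative_mult_left) (rule has_vector_derivative_mult[OF has_vector_derivative_powr[OF z] \<theta>(1)[OF z]])
 define e2 where "e2 = (of_real (y powr s) * \<theta>2 y + of_real s * of_real (y powr (s - 1)) * \<theta>1 y) +
   (of_real s * of_real (y powr (s - 1)) * \<theta>1 y + of_real s * (of_real (s - 1) * of_real (y powr (s - 1 - 1))) * \<theta> y)"
 have e2: "(e1 has_vector_derivative e2) (at y)"
  unfolding e1_def e2_def
  by (intro has_vector_derivative_add has_vector_derivative_mult has_vector_derivative_mult_right has_vector_derivative_powr \<theta> y)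
 have yy: "ddt (ddt (\<lambda>z. ?\<psi> t z x)) y = e2 * \<rho> t * ?c"
 proof -
  have "ddt (ddt (\<lambda>z. ?\<psi> t z x)) y = ddt (\<lambda>z. e1 z * \<rho> t * ?c) y"
   by (rule vector_derivative_cong_open[of "{0<..}"]) (use y vector_derivative_at[OF e1] in auto)
  also have "\<dots> = e2 * \<rho> t * ?c" by (rule vector_derivative_at) (intro has_vector_derivative_mult_left e2)
  finally show ?thesis .
 qed
 have lp: "laplace A g (?\<psi> t y) x = - (P * \<theta> y * \<rho> t * (of_real (lam j))\<^sup>2 * ?c)"
  unfolding P_def by (rule laplace_cnj_Y)
 define a where "a = complex_of_real \<alpha>"
 define N where "N = complex_of_real (real n)"
 have sN: "complex_of_real s = N / 2 - a" by (simp add: s_def N_def a_def)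
 have "KG_op A g n \<alpha> ?\<psi> t y x = P * \<theta> y * \<rho>2 t * ?c + P * \<theta> y * \<rho> t * (of_real (lam j))\<^sup>2 * ?c - e2 * \<rho> t * ?c
   - (1 - N) / w * (e1 y * \<rho> t * ?c) + (4 * a\<^sup>2 - N\<^sup>2) / (4 * w\<^sup>2) * (P * \<theta> y * \<rho> t * ?c)"
  unfolding KG_op_def tt yy lp vector_derivative_at[OF e1[OF y]]
  by (simp add: scaleR_conv_of_real N_def w_def a_def P_def)
 also have "\<dots> = P * ?c * (\<rho>2 t * \<theta> y + \<rho> t * ((of_real (lam j))\<^sup>2 * \<theta> y - \<theta>2 y - (1 - 2 * a) / w * \<theta>1 y))"
 proof -
  have e1': "e1 y = P * \<theta>1 y + (N / 2 - a) * (P / w) * \<theta> y" unfolding e1_def P1 P_def[symmetric] sN ..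
  have e2': "e2 = (P * \<theta>2 y + (N / 2 - a) * (P / w) * \<theta>1 y) + ((N / 2 - a) * (P / w) * \<theta>1 y + (N / 2 - a) * ((N / 2 - a - 1) * (P / w\<^sup>2)) * \<theta> y)"
   unfolding e2_def P1 P2 P_def[symmetric] of_real_diff of_real_1 sN ..
  show ?thesis unfolding e1' e2' using w by (simp add: divide_simps) (simp add: algebra_simps power2_eq_square)
 qed
 finally have KG: "KG_op A g n \<alpha> ?\<psi> t y x = P * ?c * (\<rho>2 t * \<theta> y + \<rho> t * ((of_real (lam j))\<^sup>2 * \<theta> y - \<theta>2 y - (1 - 2 * a) / w * \<theta>1 y))" .
 have u: "\<phi> t y x = P * u t y x"
 proof -
  have "y powr s * y powr (\<alpha> - real n / 2) = 1" using y by (simp add: s_def flip: powr_add)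
  then have "P * of_real (y powr (\<alpha> - real n / 2)) = 1" unfolding P_def by (metis of_real_1 of_real_mult)
  then show ?thesis by (simp add: u_def scaleR_conv_of_real mult.assoc[symmetric])
 qed
 \<comment> \<open>Two powers \<open>y^s\<close> meet the weight, one from the test function and one
   from \<open>\<phi> = y^s u\<close>; the exponents add up to
   \<open>1 - 2 \<alpha>\<close>.\<close>
 have "y powr (1 - real n) * (y powr s * y powr s) = y powr (1 - 2 * \<alpha>)" using y by (simp add: s_def flip: powr_add)
 then have pw: "of_real (y powr (1 - real n)) * (P * P) = complex_of_real (y powr (1 - 2 * \<alpha>))"
  unfolding P_def by (metis of_real_mult)
 have aw: "complex_of_real ((1 - 2 * \<alpha>) / y) = (1 - 2 * a) / w" by (simp add: a_def w_def)
 show ?thesis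
  unfolding s_def[symmetric] KG u aw pw[symmetric] scaleR_conv_of_real by (simp only: mult_ac)
qed

lemma product_test_mfd:
 fixes \<rho> \<theta> :: "real => complex"
 assumes \<rho>: "smooth_on \<rho> UNIV" "\<And>t. S < \<bar>t\<bar> ==> \<rho> t = 0"
  and \<theta>: "smooth_on \<theta> {0<..}" "0 < a" "\<And>y. y \<notin> {a..b} ==> \<theta> y = 0"
 shows "test_mfd A (UNIV \<times> {0<..}) (\<lambda>(t, y) x. of_real (y powr s) * \<theta> y * \<rho> t * cnj (Y j x))"
 unfolding test_mfd_def
proof
 show "smooth_mfd A (UNIV \<times> {0<..}) (\<lambda>(t, y) x. of_real (y powr s) * \<theta> y * \<rho> t * cnj (Y j x))"
  unfolding smooth_mfd_def
 proof
  fix k assume k: "k \<in> A"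
  let ?D = "(UNIV \<times> {0<..}) \<times> coord k ` cdom k :: ((real \<times> real) \<times> (real^'d)) set"
  have D: "open ?D" by (intro open_Times open_UNIV open_greaterThan chart(2)[OF k])
  have "smooth_on (\<lambda>z. of_real ((snd (fst z) + 0) powr s) * \<theta> (snd (fst z) + 0)) ?D"
   by (rule smooth_on_affine_inner[OF D _ _ smooth_on_mult[OF open_greaterThan smooth_on_powr \<theta>(1)]])
     (auto intro: bounded_linear_compose[OF bounded_linear_snd bounded_linear_fst])
  moreover have "smooth_on (\<lambda>z. \<rho> (fst (fst z) + 0)) ?D"
   by (rule smooth_on_affine_inner[OF D _ _ \<rho>(1)])
     (auto intro: bounded_linear_compose[OF bounded_linear_fst bounded_linear_fst])
  moreover have "smooth_on (\<lambda>z. cnj ((Y j \<circ> param k) (snd z + 0))) ?D"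
   by (rule smooth_on_linear_outer[OF D bounded_linear_cnj smooth_on_affine_inner[OF D bounded_linear_snd _ Y_smooth[OF k]]]) auto
  ultimately have "smooth_on (\<lambda>z. of_real ((snd (fst z) + 0) powr s) * \<theta> (snd (fst z) + 0) * \<rho> (fst (fst z) + 0) * cnj ((Y j \<circ> param k) (snd z + 0))) ?D"
   using smooth_on_mult[OF D] by blast
  then show "smooth_on (\<lambda>(p, q). (case p of (t, y) => \<lambda>x. of_real (y powr s) * \<theta> y * \<rho> t * cnj (Y j x)) (param k q)) ?D"
   by (simp add: case_prod_unfold)
 qed
 show "\<exists>K. compact K \<and> K \<subseteq> (UNIV \<times> {0<..}) \<times> UNIV \<and>
   (\<forall>p x. (p, x) \<notin> K --> (case p of (t, y) => \<lambda>x. of_real (y powr s) * \<theta> y * \<rho> t * cnj (Y j x)) x = 0)"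
 proof (intro exI conjI allI impI)
  show "compact (({-S..S} \<times> {a..b}) \<times> (UNIV :: 'm set))" by (intro compact_Times compact_Icc compact_M)
  show "({-S..S} \<times> {a..b}) \<times> (UNIV :: 'm set) \<subseteq> (UNIV \<times> {0<..}) \<times> UNIV" using \<theta>(2) by auto
  fix p x assume p: "(p, x :: 'm) \<notin> ({-S..S} \<times> {a..b}) \<times> UNIV"
  obtain t y where ty: "p = (t, y)" by (cases p)
  have "\<rho> t = 0 \<or> \<theta> y = 0" using p \<rho>(2)[of t] \<theta>(3)[of y] by (auto simp: ty)
  then show "(case p of (t, y) => \<lambda>x. of_real (y powr s) * \<theta> y * \<rho> t * cnj (Y j x)) x = 0" by (auto simp: ty)
 qed
qed

text \<open>The distributional equation tested with a product containing \<open>cnj (Y j x)\<close>: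
  integrating over the manifold first turns \<open>u\<close> into its coefficient and the Laplacian
  into a factor \<open>(lam j)^2\<close>.\<close>

lemma mode_weak:
 fixes \<rho> \<rho>1 \<rho>2 \<theta> \<theta>1 \<theta>2 :: "real => complex"
 assumes \<rho>: "smooth_on \<rho> UNIV" "\<And>t. S < \<bar>t\<bar> ==> \<rho> t = 0"
   "\<And>t. (\<rho> has_vector_derivative \<rho>1 t) (at t)" "\<And>t. (\<rho>1 has_vector_derivative \<rho>2 t) (at t)"
  and \<theta>: "smooth_on \<theta> {0<..}" "0 < a" "\<And>y. y \<notin> {a..b} ==> \<theta> y = 0"
   "\<And>y. 0 < y ==> (\<theta> has_vector_derivative \<theta>1 y) (at y)" "\<And>y. 0 < y ==> (\<theta>1 has_vector_derivative \<theta>2 y) (at y)"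
 shows "(\<integral>p. indicator {0<..} (snd p) *\<^sub>R (hmode j (fst p) (snd p) * of_real (snd p powr (1 - 2 * \<alpha>)) *
     (\<rho>2 (fst p) * \<theta> (snd p) + \<rho> (fst p) * ((of_real (lam j))\<^sup>2 * \<theta> (snd p) - \<theta>2 (snd p) - of_real ((1 - 2 * \<alpha>) / snd p) * \<theta>1 (snd p))))
    \<partial>(lborel2)) = 0"
proof -
 define K where "K = (\<lambda>p. of_real (snd p powr (1 - 2 * \<alpha>)) *
     (\<rho>2 (fst p) * \<theta> (snd p) + \<rho> (fst p) * ((of_real (lam j))\<^sup>2 * \<theta> (snd p) - \<theta>2 (snd p) - of_real ((1 - 2 * \<alpha>) / snd p) * \<theta>1 (snd p))))"
 let ?\<psi> = "\<lambda>t y x. of_real (y powr (real n / 2 - \<alpha>)) * \<theta> y * \<rho> t * cnj (Y j x)"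
 define q where "q = (\<lambda>z. indicator {0<..} (fst (snd z)) *\<^sub>R (u (fst z) (fst (snd z)) (snd (snd z)) * cnj (Y j (snd (snd z))) * K (fst z, fst (snd z))))"
 have "smooth_on \<rho>1 UNIV" using smooth_on_vector_derivativeD(1)[OF open_UNIV \<rho>(1)] by (simp add: vector_derivative_at[OF \<rho>(3)])
 then have "smooth_on \<rho>2 UNIV" using smooth_on_vector_derivativeD(1)[OF open_UNIV, of \<rho>1] by (simp add: vector_derivative_at[OF \<rho>(4)])
 then have \<rho>c: "continuous_on UNIV \<rho>" "continuous_on UNIV \<rho>2" using \<rho>(1) smooth_on_continuous by blast+
 have \<theta>1s: "smooth_on \<theta>1 {0<..}"
  by (rule smooth_on_cong[OF open_greaterThan _ smooth_on_vector_derivativeD(1)[OF open_greaterThan \<theta>(1)]]) (simp add: vector_derivative_at[OF \<theta>(4)])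
 have "smooth_on \<theta>2 {0<..}"
  by (rule smooth_on_cong[OF open_greaterThan _ smooth_on_vector_derivativeD(1)[OF open_greaterThan \<theta>1s]]) (simp add: vector_derivative_at[OF \<theta>(5)])
 then have \<theta>c: "continuous_on {0<..} \<theta>" "continuous_on {0<..} \<theta>1" "continuous_on {0<..} \<theta>2"
  using \<theta>(1) \<theta>1s smooth_on_continuous by blast+
 have cf: "continuous_on (UNIV \<times> {0<..}) (\<lambda>p. r (fst p))" if "continuous_on UNIV r" for r :: "real => complex"
  by (rule continuous_on_compose2[OF that continuous_on_fst[OF continuous_on_id]]) auto
 have cs: "continuous_on (UNIV \<times> {0<..}) (\<lambda>p. r (snd p))" if "continuous_on {0<..} r" for r :: "real => complex"
  by (rule continuous_on_compose2[OF that continuous_on_snd[OF continuous_on_id]]) auto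
 have Kc: "continuous_on (UNIV \<times> {0<..}) K"
  unfolding K_def
  by (intro continuous_on_mult continuous_on_add continuous_on_diff cf cs \<rho>c \<theta>c continuous_on_const
    smooth_on_continuous[OF smooth_on_powr] continuous_on_of_real continuous_on_divide continuous_on_snd continuous_on_id) auto
 have out: "open (- {a..b})" by auto
 have z1: "\<theta>1 y = 0" if "0 < y" "y \<notin> {a..b}" for y
  using zero_ddt[of "- {a..b}" y \<theta>] that \<theta>(3) vector_derivative_at[OF \<theta>(4)[OF that(1)]] by auto
 have o2: "open ({0<..} - {a..b})" by (intro open_Diff) auto
 have z2: "\<theta>2 y = 0" if "0 < y" "y \<notin> {a..b}" for y
  using zero_ddt[OF o2, of y \<theta>1] that z1 vector_derivative_at[OF \<theta>(5)[OF that(1)]] by auto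
 have zr1: "\<rho>1 t = 0" if "S < \<bar>t\<bar>" for t
 proof -
  have o: "open {s :: real. S < \<bar>s\<bar>}" by (intro open_Collect_less continuous_intros)
  show ?thesis using zero_ddt[OF o, of t \<rho>] that \<rho>(2) vector_derivative_at[OF \<rho>(3)] by auto
 qed
 have zr2: "\<rho>2 t = 0" if "S < \<bar>t\<bar>" for t
 proof -
  have o: "open {s :: real. S < \<bar>s\<bar>}" by (intro open_Collect_less continuous_intros)
  show ?thesis using zero_ddt[OF o, of t \<rho>1] that zr1 vector_derivative_at[OF \<rho>(4)] by auto
 qed
 \<comment> \<open>The factor vanishes outside a box away from \<open>y = 0\<close>. On such boxes
   \<open>u\<close> is integrable, which Fubini's theorem requires.\<close>
 have K0: "K (t, y) = 0" if "0 < y" "t \<notin> {-S..S} \<or> y \<notin> {a..b}" for t y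
  using that \<rho>(2)[of t] zr2[of t] \<theta>(3)[of y] z1[of y] z2[of y] by (auto simp: K_def)
 obtain B where B: "\<And>t y. 0 < y ==> norm (K (t, y)) \<le> B" "0 \<le> B"
 proof -
  have "compact (K ` ({-S..S} \<times> {a..b}))"
   by (intro compact_continuous_image compact_Times compact_Icc continuous_on_subset[OF Kc]) (use \<theta>(2) in auto)
  from compact_imp_bounded[OF this] obtain B where B: "\<forall>z\<in>K ` ({-S..S} \<times> {a..b}). norm z \<le> B" unfolding bounded_iff by blast
  have "norm (K (t, y)) \<le> max B 0" if "0 < y" for t y
  proof (cases "(t, y) \<in> {-S..S} \<times> {a..b}")
   case True
   from bspec[OF B imageI[OF this]] show ?thesis by simp
  qed (use K0[OF that, of t] in auto)
  then show thesis using that[of "max B 0"] by simp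
 qed
 let ?r = "\<lambda>z. cnj (Y j (snd (snd z))) * (indicator {0<..} (fst (snd z)) *\<^sub>R K (fst z, fst (snd z)))"
 have Km: "(\<lambda>p. indicator {0<..} (snd p) *\<^sub>R K p) \<in> borel_measurable (lborel2)"
 proof -
  have "(\<lambda>p. indicator (UNIV \<times> {0<..}) p *\<^sub>R K p) \<in> borel_measurable borel"
   by (rule borel_measurable_continuous_on_indicator[OF _ Kc]) (intro borel_open open_Times open_UNIV open_greaterThan)
  moreover have "indicator (UNIV \<times> {0<..}) p *\<^sub>R K p = indicator {0<..} (snd p) *\<^sub>R K p" for p
   by (cases p) (auto simp: indicator_def)
  ultimately show ?thesis by (simp add: lborel_prod)
 qed
 have "(\<lambda>z. (fst z, fst (snd z))) \<in> measurable M3 (lborel2)" by measurable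
 from measurable_compose[OF this Km]
 have "(\<lambda>z. indicator {0<..} (fst (snd z)) *\<^sub>R K (fst z, fst (snd z))) \<in> borel_measurable M3" by simp
 then have rm: "?r \<in> borel_measurable M3" by (rule borel_measurable_times[OF Y_M3])
 have "norm (?r z) \<le> BY j * B" for z
  unfolding norm_mult using BY[of j] B by (intro mult_mono) (auto simp: indicator_def)
 from integrable_M3_times[OF u_box[OF \<theta>(2), of S b] rm this]
 have qi: "integrable M3 q"
 proof (rule Bochner_Integration.integrable_cong[THEN iffD1, rotated 2])
  fix z :: "real \<times> real \<times> 'm"
  obtain t y x where z: "z = (t, y, x)" by (cases z) auto
  show "(indicator {-S..S} (fst z) *\<^sub>R indicator {a..b} (fst (snd z)) *\<^sub>R u (fst z) (fst (snd z)) (snd (snd z))) * ?r z = q z"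
  proof (cases "0 < y \<and> (t \<notin> {-S..S} \<or> y \<notin> {a..b})")
   case True
   then show ?thesis using K0[of y t] by (simp add: z q_def)
  next
   case False
   then show ?thesis using \<theta>(2) by (auto simp: z q_def indicator_def)
  qed
 qed simp
 have "(LINT (t, y, x) : UNIV \<times> {0<..} \<times> UNIV | M3. (y powr (1 - real n)) *\<^sub>R (\<phi> t y x * KG_op A g n \<alpha> ?\<psi> t y x)) = 0"
 proof (rule KG[unfolded KG_solution_def, THEN conjunct2, rule_format])
  show "test_mfd A (UNIV \<times> {0<..}) (\<lambda>(t, y). ?\<psi> t y)"
   by (rule product_test_mfd) (fact \<rho> \<theta>)+
 qed
 then have "(\<integral>z. indicator (UNIV \<times> {0<..} \<times> UNIV) z *\<^sub>R ((fst (snd z) powr (1 - real n)) *\<^sub>R (\<phi> (fst z) (fst (snd z)) (snd (snd z)) * KG_op A g n \<alpha> ?\<psi> (fst z) (fst (snd z)) (snd (snd z)))) \<partial>M3) = 0"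
  by (simp add: set_lebesgue_integral_def case_prod_unfold)
 also have "(\<integral>z. indicator (UNIV \<times> {0<..} \<times> UNIV) z *\<^sub>R ((fst (snd z) powr (1 - real n)) *\<^sub>R (\<phi> (fst z) (fst (snd z)) (snd (snd z)) * KG_op A g n \<alpha> ?\<psi> (fst z) (fst (snd z)) (snd (snd z)))) \<partial>M3) = integral\<^sup>L M3 q"
 proof (rule Bochner_Integration.integral_cong[OF refl])
  fix z :: "real \<times> real \<times> 'm"
  obtain t y x where z: "z = (t, y, x)" by (cases z) auto
  show "indicator (UNIV \<times> {0<..} \<times> UNIV) z *\<^sub>R ((fst (snd z) powr (1 - real n)) *\<^sub>R (\<phi> (fst z) (fst (snd z)) (snd (snd z)) * KG_op A g n \<alpha> ?\<psi> (fst z) (fst (snd z)) (snd (snd z)))) = q z"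
  proof (cases "0 < y")
   case True
   show ?thesis
    using KG_op_product[where \<rho> = \<rho> and \<theta> = \<theta> and t = t and x = x and j = j, OF \<rho>(3,4) \<theta>(4,5) True] True
    by (simp add: z q_def K_def)
  qed (simp add: z q_def)
 qed
 finally have "integral\<^sup>L M3 q = 0" .
 moreover have "(\<integral>x. q (fst p, snd p, x) \<partial>V) = indicator {0<..} (snd p) *\<^sub>R (hmode j (fst p) (snd p) * of_real (snd p powr (1 - 2 * \<alpha>)) *
     (\<rho>2 (fst p) * \<theta> (snd p) + \<rho> (fst p) * ((of_real (lam j))\<^sup>2 * \<theta> (snd p) - \<theta>2 (snd p) - of_real ((1 - 2 * \<alpha>) / snd p) * \<theta>1 (snd p))))" for p
  unfolding mult.assoc[of "hmode j (fst p) (snd p)"]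
  by (cases "0 < snd p") (simp_all add: q_def hmode_pos mode_coeff_def K_def)
 ultimately show ?thesis using integral_reassoc(2)[OF qi] by simp
qed

end

section \<open>Every coefficient solves a mode problem\<close>

context kg_problem
begin

text \<open>Every \<open>t < - T\<close> precedes the support of \<open>f\<close>, so the initial
  condition applies at almost every such time and the whole slice of \<open>u\<close> vanishes, and
  with it the coefficient.\<close>

lemma hmode_initial:
 assumes T: "\<And>t x. T < \<bar>t\<bar> ==> f t x = 0" and "0 < T"
 shows "AE p in lborel2. fst p < - T --> 0 < snd p --> hmode j (fst p) (snd p) = 0"
proof -
 obtain u' :: "real => real => 'm => complex" where "AE t in lborel. (\<forall>s<t. \<forall>x. f s x = 0) --> (AE (y, x) in lborel \<Otimes>\<^sub>M V. 0 < y --> u t y x = 0 \<and> u' t y x = 0)"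
  using initial unfolding trivial_initial_data_def by blast
 then have "AE t in lborel. AE y in lborel. fst (t, y) < - T --> 0 < snd (t, y) --> hmode j (fst (t, y)) (snd (t, y)) = 0"
 proof eventually_elim
  case (elim t)
  show ?case
  proof (cases "t < - T")
   case True
   then have "\<forall>s<t. \<forall>x. f s x = 0" using T by auto
   with elim have "AE p in lborel \<Otimes>\<^sub>M V. 0 < fst p --> u t (fst p) (snd p) = 0" by (auto simp: case_prod_unfold elim: eventually_mono)
   from LV.AE_pair[OF this] show ?thesis
   proof eventually_elim
    case (elim y)
    have "hmode j t y = 0" if y: "0 < y"
    proof -
     have "AE x in V. u t y x * cnj (Y j x) = 0" using elim y by (auto elim: eventually_mono)
     then show ?thesis unfolding hmode_pos[OF y] mode_coeff_def by (rule integral_eq_zero_AE)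
    qed
    then show ?case by simp
   qed
  qed simp
 qed
 moreover have "{p \<in> space (lborel2). fst p < - T --> 0 < snd p --> hmode j (fst p) (snd p) = 0} \<in> sets (lborel2)"
 proof -
  have [measurable]: "(\<lambda>p. hmode j (fst p) (snd p)) \<in> borel_measurable (lborel2)"
   using hmode_measurable[of j] by (simp add: case_prod_unfold)
  show ?thesis by measurable
 qed
 ultimately show ?thesis by (intro lborel_pair.AE_pair_measure)
qed

text \<open>\<open>mode_structure\<close> gives both growth bounds, \<open>boundary_mode\<close>
  identifies the term \<open>i = 0\<close> with the boundary datum, and for \<open>y < 1\<close> all
  further terms carry at least the factor \<open>y^2\<close>.\<close>

lemma mode_problem_hmode:
 obtains F T C R where "mode_problem chi F T \<alpha> (lam j) (hmode j) R C" "F 0 = (\<lambda>t. mode_coeff V Y j (f t))"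
proof -
 obtain T where T: "0 < T" "\<And>t x. T < \<bar>t\<bar> ==> f t x = 0" using test_time_support[OF test] by blast
 define F where "F = (\<lambda>k t. mode_coeff V Y j (((\<lambda>f s x. ddt (\<lambda>r. f r x) s) ^^ k) f t))"
 have F: "test_seq F T" unfolding F_def by (rule mode_test_seq[OF test T Y_continuous])
 have F0: "F 0 = (\<lambda>t. mode_coeff V Y j (f t))" by (simp add: F_def)
 obtain k C and gs :: "nat => real => complex" where k: "0 < (k::nat)" and C: "0 \<le> C"
  and gs: "\<And>i. i < k ==> integrable lborel (gs i)"
  and bd: "AE p in lborel2. 0 < snd p -->
    norm (hmode j (fst p) (snd p) - (\<Sum>i<k. (snd p ^ (2 * i) * chi (snd p)) *\<^sub>R gs i (fst p))) \<le> C * snd p powr \<alpha>"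
  using mode_structure[of j] by blast
 have g0: "AE p in lborel \<Otimes>\<^sub>M (lborel :: real measure). gs 0 (fst p) = F 0 (fst p)"
  unfolding F0 by (rule AE_fst) (rule boundary_mode[OF k C bd])
 interpret c: cutoff chi by unfold_locales (rule cutoff)
 obtain X where X: "1 \<le> X" "\<And>y. norm (c.cx y) \<le> X" using c.cx_bound by blast
 define S where "S = (\<lambda>t. \<Sum>i<k. norm (gs i t))"
 have S0: "0 \<le> S t" for t unfolding S_def by (intro sum_nonneg) simp
 \<comment> \<open>On the support of the cutoff \<open>y \<le> 2\<close>, so
   \<open>y^(2 i) \<le> 4^k\<close> for \<open>i < k\<close>, and \<open>X\<close> bounds the cutoff
   itself.\<close>
 define R where "R = (\<lambda>t. X * 4 ^ k * S t)"
 have XK: "1 \<le> X * 4 ^ k" using mult_mono[of 1 X 1 "4 ^ k"] X(1) by simp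
 have R0: "0 \<le> R t" for t unfolding R_def using S0 X(1) by (intro mult_nonneg_nonneg) auto
 have SR: "S t \<le> R t" for t unfolding R_def using mult_right_mono[OF XK S0[of t]] by simp
 have "mode_problem chi F T \<alpha> (lam j) (hmode j) R C"
 proof unfold_locales
  show "integrable lborel R" unfolding R_def S_def using gs by (intro integrable_mult_right Bochner_Integration.integrable_sum integrable_norm) auto
  have coeff: "\<bar>y ^ (2 * i) * chi y\<bar> \<le> X * 4 ^ k" if "0 < y" "i < k" for y i
  proof (cases "2 < y")
   case True
   then have "chi y = 0" using cutoff by (simp add: smooth_cutoff_def)
   then show ?thesis using XK by simp
  next
   case False
   have "y ^ (2 * i) \<le> 2 ^ (2 * i)" using that False by (intro power_mono) auto
   also have "\<dots> = (4 :: real) ^ i" by (simp add: power_mult)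
   also have "\<dots> \<le> 4 ^ k" using that by (intro power_increasing) auto
   finally have "y ^ (2 * i) * \<bar>chi y\<bar> \<le> 4 ^ k * X" using X(2)[of y] that by (intro mult_mono) (auto simp: c.cx_def)
   then show ?thesis using that by (simp add: abs_mult mult.commute)
  qed
  show "AE p in lborel2. 0 < snd p --> norm (hmode j (fst p) (snd p)) \<le> C * snd p powr \<alpha> + R (fst p)"
   using bd
  proof eventually_elim
   case (elim p)
   show ?case
   proof
    assume y: "0 < snd p"
    let ?S = "\<Sum>i<k. (snd p ^ (2 * i) * chi (snd p)) *\<^sub>R gs i (fst p)"
    have "norm ?S \<le> (\<Sum>i<k. X * 4 ^ k * norm (gs i (fst p)))"
     by (intro sum_norm_le) (use coeff[OF y] in \<open>auto intro!: mult_right_mono\<close>)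
    also have "\<dots> = R (fst p)" by (simp add: R_def S_def sum_distrib_left)
    finally show "norm (hmode j (fst p) (snd p)) \<le> C * snd p powr \<alpha> + R (fst p)"
     using elim y norm_triangle_ineq[of "hmode j (fst p) (snd p) - ?S" ?S] by simp
   qed
  qed
  show "AE p in lborel2. 0 < snd p \<and> snd p < 1 -->
   norm (hmode j (fst p) (snd p) - F 0 (fst p)) \<le> C * snd p powr \<alpha> + (snd p)\<^sup>2 * R (fst p)"
   using bd g0
  proof eventually_elim
   case (elim p)
   show ?case
   proof
    assume y: "0 < snd p \<and> snd p < 1"
    have chi: "chi (snd p) = 1" using cutoff y by (simp add: smooth_cutoff_def)
    let ?S = "\<Sum>i<k. (snd p ^ (2 * i) * chi (snd p)) *\<^sub>R gs i (fst p)"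
    let ?S1 = "\<Sum>i\<in>{1..<k}. (snd p ^ (2 * i)) *\<^sub>R gs i (fst p)"
    have eq: "?S = F 0 (fst p) + ?S1"
    proof -
     have "{..<k} = insert 0 {1..<k}" using k by auto
     then show ?thesis using elim(2) by (simp add: chi)
    qed
    have "norm ?S1 \<le> (\<Sum>i\<in>{1..<k}. (snd p)\<^sup>2 * norm (gs i (fst p)))"
    proof (intro sum_norm_le)
     fix i assume "i \<in> {1..<k}"
     then have "snd p ^ (2 * i) \<le> (snd p)\<^sup>2" using y by (intro power_decreasing) auto
     then show "norm ((snd p ^ (2 * i)) *\<^sub>R gs i (fst p)) \<le> (snd p)\<^sup>2 * norm (gs i (fst p))"
      by (auto intro: mult_right_mono)
    qed
    also have "\<dots> \<le> (snd p)\<^sup>2 * S (fst p)"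
     unfolding S_def sum_distrib_left[symmetric] by (intro mult_left_mono sum_mono2) auto
    also have "\<dots> \<le> (snd p)\<^sup>2 * R (fst p)" by (intro mult_left_mono SR) simp
    finally have "norm ?S1 \<le> (snd p)\<^sup>2 * R (fst p)" .
    then show "norm (hmode j (fst p) (snd p) - F 0 (fst p)) \<le> C * snd p powr \<alpha> + (snd p)\<^sup>2 * R (fst p)"
     using elim(1) y norm_triangle_ineq[of "hmode j (fst p) (snd p) - ?S" ?S1] by (simp add: eq)
   qed
  qed
  show "AE p in lborel2. fst p < - T --> 0 < snd p --> hmode j (fst p) (snd p) = 0"
   by (rule hmode_initial[OF T(2) T(1)])
 qed (fact F \<alpha>0 lam_nonneg hmode_measurable C R0 | rule mode_weak; assumption)+
 then show ?thesis using that F0 by blast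
qed

end

theorem mainTheorem4:
  fixes A :: "('m::{t2_space, second_countable_topology}, 'd::finite) chart set"
    and g :: "('m, 'd) metric"
    and V :: "'m measure"
    and n :: nat and \<alpha> :: real and chi :: "real \<Rightarrow> real"
    and Y :: "nat \<Rightarrow> 'm \<Rightarrow> complex" and lam :: "nat \<Rightarrow> real"
    and f :: "real \<Rightarrow> 'm \<Rightarrow> complex"
    and \<phi> u :: "real \<Rightarrow> real \<Rightarrow> 'm \<Rightarrow> complex"
  assumes "compact_riemannian_manifold A g"
    and "riemannian_volume A g V"
    and "n = CARD('d) + 1"
    and "0 < \<alpha>" and "\<alpha> \<notin> \<int>"
    and "laplace_eigenbasis A g V Y lam"
    and "test_mfd A UNIV f"
    and "smooth_cutoff chi"
    and "KG_solution A g V n \<alpha> \<phi>"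
    and "u = (\<lambda>t y x. (y powr (\<alpha> - real n / 2)) *\<^sub>R \<phi> t y x)"
    and "solution_form A g V \<alpha> chi f u"
    and "trivial_initial_data V f u"
    and "boundary_value V f u"
  shows "\<exists>U. (\<forall>j. continuous_version (U j) (\<lambda>t y. mode_coeff V Y j (u t y))) \<and>
             (\<forall>j t. Ck_on (nat \<lfloor>\<alpha>\<rfloor> + 1) (U j t) {0<..}) \<and>
             (\<forall>j t. \<exists>l. (DN_quotient \<alpha> (U j t) \<longlongrightarrow> l) (at_right 0)) \<and>
             is_wave_power \<alpha> lam (\<lambda>j t. mode_coeff V Y j (f t)) (DN_map \<alpha> U)"
proof -
  interpret kg_problem A g V n \<alpha> chi Y lam f \<phi> u by unfold_locales (fact assms)+
  \<comment> \<open>Each \<open>j\<close> is treated independently, with its own mode problem; the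
    versions are collected into one family by choice afterwards.\<close>
  have "\<exists>W. continuous_version W (\<lambda>t y. mode_coeff V Y j (u t y)) \<and>
      (\<forall>t. Ck_on (nat \<lfloor>\<alpha>\<rfloor> + 1) (W t) {0<..}) \<and>
      (\<forall>t. \<exists>l. (DN_quotient \<alpha> (W t) \<longlongrightarrow> l) (at_right 0)) \<and>
      integrable lborel (\<lambda>t. mode_coeff V Y j (f t)) \<and>
      integrable lborel (\<lambda>t. DN_const \<alpha> *\<^sub>R Lim (at_right 0) (DN_quotient \<alpha> (W t))) \<and>
      (\<forall>\<tau>. fourier (\<lambda>t. DN_const \<alpha> *\<^sub>R Lim (at_right 0) (DN_quotient \<alpha> (W t))) \<tau>
        = wave_symbol \<alpha> \<tau> (lam j) * fourier (\<lambda>t. mode_coeff V Y j (f t)) \<tau>)" for j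
  proof (rule mode_problem_hmode[of j])
    fix F T C R
    assume "mode_problem chi F T \<alpha> (lam j) (hmode j) R C" and F0: "F 0 = (\<lambda>t. mode_coeff V Y j (f t))"
    then interpret m: mode_problem chi F T \<alpha> "lam j" "hmode j" R C by simp
    obtain W where W: "continuous_on (UNIV \<times> {0<..}) (\<lambda>(t, y). W t y)"
      "AE p in lborel \<Otimes>\<^sub>M lborel. 0 < snd p \<longrightarrow> W (fst p) (snd p) = hmode j (fst p) (snd p)"
      "\<forall>t k. Ck_on k (W t) {0<..}" "\<forall>t. \<exists>l. (DN_quotient \<alpha> (W t) \<longlongrightarrow> l) (at_right 0)"
      "integrable lborel (\<lambda>t. DN_const \<alpha> *\<^sub>R Lim (at_right 0) (DN_quotient \<alpha> (W t)))"
      "\<forall>\<tau>. fourier (\<lambda>t. DN_const \<alpha> *\<^sub>R Lim (at_right 0) (DN_quotient \<alpha> (W t))) \<tau> = wave_symbol \<alpha> \<tau> (lam j) * fourier (F 0) \<tau>"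
      using m.mode_solution[OF \<open>\<alpha> \<notin> \<int>\<close>] by blast
    have "AE p in lborel \<Otimes>\<^sub>M lborel. 0 < snd p \<longrightarrow> W (fst p) (snd p) = mode_coeff V Y j (u (fst p) (snd p))"
      using W(2) by eventually_elim (simp add: hmode_pos)
    then have "continuous_version W (\<lambda>t y. mode_coeff V Y j (u t y))"
      using W(1) by (simp add: continuous_version_def case_prod_unfold)
    moreover have "integrable lborel (\<lambda>t. mode_coeff V Y j (f t))" using test_seq_integrable[OF m.F, of 0] by (simp add: F0)
    ultimately show ?thesis using W(3-6) unfolding F0 by blast
  qed
  then obtain W where "\<And>j. continuous_version (W j) (\<lambda>t y. mode_coeff V Y j (u t y)) \<and>
      (\<forall>t. Ck_on (nat \<lfloor>\<alpha>\<rfloor> + 1) (W j t) {0<..}) \<and>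
      (\<forall>t. \<exists>l. (DN_quotient \<alpha> (W j t) \<longlongrightarrow> l) (at_right 0)) \<and>
      integrable lborel (\<lambda>t. mode_coeff V Y j (f t)) \<and>
      integrable lborel (\<lambda>t. DN_const \<alpha> *\<^sub>R Lim (at_right 0) (DN_quotient \<alpha> (W j t))) \<and>
      (\<forall>\<tau>. fourier (\<lambda>t. DN_const \<alpha> *\<^sub>R Lim (at_right 0) (DN_quotient \<alpha> (W j t))) \<tau>
        = wave_symbol \<alpha> \<tau> (lam j) * fourier (\<lambda>t. mode_coeff V Y j (f t)) \<tau>)" by metis
  then show ?thesis unfolding is_wave_power_def DN_map_def by (intro exI[of _ W]) blast
qed

end
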